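(* Let $c_1,c_2$ be real constants and let $L(a)=c_1|\det(a)|^2+c_2|P(\bar a,\bar a,{}^ta)|^2$ for $a\in M_{3\times3}(\mathbb{C})$. Write $a^i_{\bar\jmath\bar k}=-a^i_{\bar k\bar\jmath}$ for the components of $a$ (with $a_{i1}=a^i_{\bar2\bar3}$, $a_{i2}=a^i_{\bar3\bar1}$, $a_{i3}=a^i_{\bar1\bar2}$), and let $L^{\bar\jmath\bar k}_i(a)=-L^{\bar k\bar\jmath}_i(a)$ be the polynomial functions on $M_{3\times 3}(\mathbb{C})$ such that $dL=\mathrm{Re}\bigl(L^{\bar\jmath\bar k}_i\,da^i_{\bar\jmath\bar k}\bigr)$ (summation over all $i,j,k$). Then an almost complex structure $J$ on a $6$-manifold $M$ is a critical point of the functional $F_c(J)=\int_M c_1\,\Phi(J)+c_2\,\tfrac{i}{8}\psi(J)\wedge\overline{\psi(J)}$ if and only if, for any local $J$-linear coframing $\alpha:TU\to\mathbb{C}^3$ and any $(0,2)$-connection $\kappa=(\kappa^i_j)$, i.e. $\mathfrak{gl}(3,\mathbb{C})$-valued $1$-form on $U$, satisfying $$d\alpha=-\kappa\wedge\alpha+N(\alpha)\begin{pmatrix}\overline{\alpha^2\wedge\alpha^3}\\ \overline{\alpha^3\wedge\alpha^1}\\ \overline{\alpha^1\wedge\alpha^2}\end{pmatrix},$$ the following identities hold for all $i,j$ (summation over repeated $k,\ell$): $$d\bigl(L^{\bar\jmath\bar k}_i(N(\alpha))\,\alpha_{[\bar k]}\bigr)+L^{\bar\jmath\bar k}_\ell(N(\alpha))\,\kappa^\ell_i\wedge\alpha_{[\bar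 k]}-L^{\bar\ell\bar k}_i(N(\alpha))\,\overline{\kappa^j_\ell}\wedge\alpha_{[\bar k]}=0.$$
   Context: For an almost complex structure $J$ on a $6$-manifold $M$, $\mathcal{A}^{p,q}(M)$ is the space of smooth complex-valued forms of type $(p,q)$, where a $1$-form $\alpha$ is of type $(1,0)$ iff $\alpha(Jv)=i\,\alpha(v)$ for all tangent vectors $v$. The exterior derivative decomposes as $d=d^{2,-1}+\partial+\bar\partial+d^{-1,2}$, with $\partial=d^{1,0}$, $\bar\partial=d^{0,1}$ and $d^{r,s}:\mathcal{A}^{p,q}\to\mathcal{A}^{p+r,q+s}$. A $J$-linear local coframing on an open set $U\subset M$ is a column $\alpha=(\alpha^1,\alpha^2,\alpha^3)$ of pointwise linearly independent $(1,0)$-forms on $U$. The function $N(\alpha):U\to M_{3\times3}(\mathbb{C})$ is defined by $$d^{-1,2}\alpha=N(\alpha)\begin{pmatrix}\overline{\alpha^2\wedge\alpha^3}\\ \overline{\alpha^3\wedge\alpha^1}\\ \overline{\alpha^1\wedge\alpha^2}\end{pmatrix}.$$ $P$ is the symmetric trilinear form on $M_{3\times 3}(\mathbb{C})$ with $P(a,a,a)=\det a$. On $U$, $$\Phi(J)=\tfrac{i}{8}|\det N(\alpha)|^2\,\alpha^1\wedge\alpha^2\wedge\alpha^3\wedge\overline{\alpha^1}\wedge\overline{\alpha^2}\wedge\overline{\alpha^3},\qquad \psi(J)=P\bigl(\overline{N(\alpha)},\overline{N(\alpha)},{}^tN(\alpha)\bigr)\,\alpha^1\wedge\alpha^2\wedge\alpha^3;$$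 these are independent of $\alpha$ and globally defined on $M$. With $\Omega=\tfrac{i}{8}\,\alpha^1\wedge\alpha^2\wedge\alpha^3\wedge\overline{\alpha^1\wedge\alpha^2\wedge\alpha^3}$, the $5$-forms $\alpha_{[\bar k]}$ are defined by $\overline{\alpha^j}\wedge\alpha_{[\bar k]}=\delta^j_k\,\Omega$ and $\alpha^j\wedge\alpha_{[\bar k]}=0$ for all $j,k$. The functional $F_c$, $c=(c_1,c_2)$, is defined for $M$ compact and oriented, on the space of almost complex structures on $M$ inducing the given orientation; $J$ is a critical point of $F_c$ if the first variation of $F_c$ at $J$ vanishes.
   Formalization: The two connection terms carry opposite signs: minus for κ^ℓ_i∧α_[k] and plus for the conjugate κ^j_ℓ term; with the printed signs the identity is not invariant under change of coframing and fails for the nearly Kähler S^6, which is critical. *)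

theory Defs
  imports "HOL-Analysis.Analysis"
begin

section \<open>Smooth maps\<close>

primrec Ck_on :: "nat \<Rightarrow> 'a::real_normed_vector set \<Rightarrow> ('a \<Rightarrow> 'b::real_normed_vector) \<Rightarrow> bool" where
  "Ck_on 0 S f \<longleftrightarrow> continuous_on S f"
| "Ck_on (Suc n) S f \<longleftrightarrow> (\<forall>x\<in>S. f differentiable (at x)) \<and>
     (\<forall>v. Ck_on n S (\<lambda>x. frechet_derivative f (at x) v))"

text \<open>Only used for open sets in finite-dimensional spaces, where it is the usual notion.\<close>
definition smooth_on :: "'a::real_normed_vector set \<Rightarrow> ('a \<Rightarrow> 'b::real_normed_vector) \<Rightarrow> bool" where
  "smooth_on S f \<longleftrightarrow> (\<forall>n. Ck_on n S f)"

section \<open>Oriented 6-manifolds\<close>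

text \<open>A chart is a pair of its domain and its coordinate map. The underlying topological
  manifold is the whole type, which carries the Hausdorff and second countability conditions
  as sort constraints.\<close>

type_synonym 'a chart = "'a set \<times> ('a \<Rightarrow> real^6)"

definition coord_set :: "'a chart \<Rightarrow> 'a set \<Rightarrow> (real^6) set" where
  "coord_set c U = snd c ` (U \<inter> fst c)"

definition chart_inv :: "'a chart \<Rightarrow> real^6 \<Rightarrow> 'a" where
  "chart_inv c = inv_into (fst c) (snd c)"

definition transition :: "'a chart \<Rightarrow> 'a chart \<Rightarrow> real^6 \<Rightarrow> real^6" where
  "transition c c' = snd c' \<circ> chart_inv c"

definition transition_deriv :: "'a chart \<Rightarrow> 'a chart \<Rightarrow> real^6 \<Rightarrow> real^6 \<Rightarrow> real^6" where
  "transition_deriv c c' x = frechet_derivative (transition c c') (at x)"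

definition oriented_atlas :: "'a::{t2_space,second_countable_topology} chart set \<Rightarrow> bool" where
  "oriented_atlas A \<longleftrightarrow>
     (\<Union>c\<in>A. fst c) = UNIV \<and>
     (\<forall>c\<in>A. open (fst c) \<and> open (coord_set c UNIV) \<and>
        homeomorphism (fst c) (coord_set c UNIV) (snd c) (chart_inv c)) \<and>
     (\<forall>c\<in>A. \<forall>c'\<in>A. smooth_on (coord_set c (fst c')) (transition c c') \<and>
        (\<forall>x\<in>coord_set c (fst c'). det (matrix (transition_deriv c c' x)) > 0))"

section \<open>Exterior algebra\<close>

text \<open>An element of the complexified exterior algebra of the dual of \<open>\<real>\<^sup>6\<close> is a function on
  lists of vectors. A \<open>k\<close>-form vanishes on lists of length other than \<open>k\<close>, so that the wedge
  product needs no degree arguments and forms can be compared as functions.\<close>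

type_synonym cform = "(real^6) list \<Rightarrow> complex"

definition alt_form :: "nat \<Rightarrow> cform \<Rightarrow> bool" where
  "alt_form k \<omega> \<longleftrightarrow>
     (\<forall>vs. length vs \<noteq> k \<longrightarrow> \<omega> vs = 0) \<and>
     (\<forall>vs i. length vs = k \<and> i < k \<longrightarrow> linear (\<lambda>v. \<omega> (vs[i := v]))) \<and>
     (\<forall>vs i j. length vs = k \<and> i < j \<and> j < k \<and> vs ! i = vs ! j \<longrightarrow> \<omega> vs = 0)"

text \<open>The wedge product as a sum over shuffles: \<open>I\<close> is the set of positions of the vectors
  handed to the first factor and the exponent counts the inversions of the shuffle. In this
  normalization \<open>(\<alpha> \<and>\<^sub>e \<beta>) [u, v] = \<alpha> [u] * \<beta> [v] - \<alpha> [v] * \<beta> [u]\<close> for 1-forms.\<close>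
definition wedge :: "cform \<Rightarrow> cform \<Rightarrow> cform" (infixr "\<and>\<^sub>e" 72) where
  "(\<omega> \<and>\<^sub>e \<eta>) = (\<lambda>vs. \<Sum>I\<in>Pow {..<length vs}.
     (-1) ^ card {(i, j). i \<in> I \<and> j \<in> {..<length vs} - I \<and> j < i} *
     \<omega> (nths vs I) * \<eta> (nths vs (- I)))"

definition cnj_form :: "cform \<Rightarrow> cform" where
  "cnj_form \<omega> = (\<lambda>vs. cnj (\<omega> vs))"

definition unit_form :: cform where
  "unit_form = (\<lambda>vs. if vs = [] then 1 else 0)"

definition wedge_list :: "cform list \<Rightarrow> cform" where
  "wedge_list \<theta>s = foldr wedge \<theta>s unit_form"

text \<open>The exterior derivative of a form on an open subset of \<open>\<real>\<^sup>6\<close>: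
  \<open>d\<omega>(v\<^sub>0,\<dots>,v\<^sub>k) = \<Sum>\<^sub>i (-1)\<^sup>i D\<omega>(v\<^sub>i)(v\<^sub>0,\<dots>,v\<^sub>k without v\<^sub>i)\<close> for constant vectors.\<close>
definition ext_d :: "(real^6 \<Rightarrow> cform) \<Rightarrow> real^6 \<Rightarrow> cform" where
  "ext_d \<omega> x = (\<lambda>vs. \<Sum>i<length vs.
     (-1) ^ i * frechet_derivative (\<lambda>y. \<omega> y (nths vs (- {i}))) (at x) (vs ! i))"

section \<open>Differential forms on a manifold\<close>

text \<open>A form is given by its coordinate expressions in all charts of the atlas; these have to
  agree under the transition maps. Operations on forms such as \<open>ext_d\<close> and \<open>\<and>\<^sub>e\<close> are applied
  chart by chart. Values at points outside the chart images are irrelevant.\<close>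

type_synonym 'a form_field = "'a chart \<Rightarrow> real^6 \<Rightarrow> cform"

definition form_on :: "'a chart set \<Rightarrow> 'a set \<Rightarrow> nat \<Rightarrow> 'a form_field \<Rightarrow> bool" where
  "form_on A U k \<omega> \<longleftrightarrow>
     (\<forall>c\<in>A. (\<forall>x\<in>coord_set c U. alt_form k (\<omega> c x)) \<and>
            (\<forall>vs. smooth_on (coord_set c U) (\<lambda>x. \<omega> c x vs))) \<and>
     (\<forall>c\<in>A. \<forall>c'\<in>A. \<forall>x\<in>coord_set c (U \<inter> fst c'). \<forall>vs.
        \<omega> c' (transition c c' x) (map (transition_deriv c c' x) vs) = \<omega> c x vs)"

definition smooth_function :: "'a chart set \<Rightarrow> ('a \<Rightarrow> real) \<Rightarrow> bool" where
  "smooth_function A f \<longleftrightarrow> (\<forall>c\<in>A. smooth_on (coord_set c UNIV) (f \<circ> chart_inv c))"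

definition partition_of_unity ::
    "'a::topological_space chart set \<Rightarrow> 'a chart set \<Rightarrow> ('a chart \<Rightarrow> 'a \<Rightarrow> real) \<Rightarrow> bool" where
  "partition_of_unity A F \<rho> \<longleftrightarrow> finite F \<and> F \<subseteq> A \<and>
     (\<forall>c\<in>F. smooth_function A (\<rho> c) \<and> (\<forall>p. 0 \<le> \<rho> c p) \<and>
            closure {p. \<rho> c p \<noteq> 0} \<subseteq> fst c) \<and>
     (\<forall>p. (\<Sum>c\<in>F. \<rho> c p) = 1)"

definition std_basis :: "(real^6) list" where
  "std_basis = [axis 1 1, axis 2 1, axis 3 1, axis 4 1, axis 5 1, axis 6 1]"

text \<open>Integration of 6-forms over a compact oriented manifold, where finite partitions of unity
  exist and the result is independent of the one chosen.\<close>
definition integral_form :: "'a::topological_space chart set \<Rightarrow> 'a form_field \<Rightarrow> complex" where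
  "integral_form A \<omega> =
     (let (F, \<rho>) = (SOME (F, \<rho>). partition_of_unity A F \<rho>) in
      \<Sum>c\<in>F. integral (coord_set c UNIV)
        (\<lambda>x. complex_of_real (\<rho> c (chart_inv c x)) * \<omega> c x std_basis))"

section \<open>Almost complex structures\<close>

type_synonym 'a endo_field = "'a chart \<Rightarrow> real^6 \<Rightarrow> real^6 \<Rightarrow> real^6"

definition almost_complex :: "'a chart set \<Rightarrow> 'a endo_field \<Rightarrow> bool" where
  "almost_complex A J \<longleftrightarrow>
     (\<forall>c\<in>A. (\<forall>x\<in>coord_set c UNIV. linear (J c x) \<and> (\<forall>v. J c x (J c x v) = - v)) \<and>
            (\<forall>v. smooth_on (coord_set c UNIV) (\<lambda>x. J c x v))) \<and>
     (\<forall>c\<in>A. \<forall>c'\<in>A. \<forall>x\<in>coord_set c (fst c'). \<forall>v.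
        J c' (transition c c' x) (transition_deriv c c' x v) = transition_deriv c c' x (J c x v))"

text \<open>Every basis of the form \<open>v\<^sub>1, Jv\<^sub>1, v\<^sub>2, Jv\<^sub>2, v\<^sub>3, Jv\<^sub>3\<close> is positively oriented.\<close>
definition induces_orientation :: "'a chart set \<Rightarrow> 'a endo_field \<Rightarrow> bool" where
  "induces_orientation A J \<longleftrightarrow>
     (\<forall>c\<in>A. \<forall>x\<in>coord_set c UNIV. \<forall>v1 v2 v3.
        let D = det (vector [v1, J c x v1, v2, J c x v2, v3, J c x v3] :: real^6^6)
        in D \<noteq> 0 \<longrightarrow> D > 0)"

text \<open>Below, \<open>j\<close> is an endomorphism of \<open>\<real>\<^sup>6\<close> with \<open>j\<^sup>2 = -1\<close>.\<close>

definition type10 :: "(real^6 \<Rightarrow> real^6) \<Rightarrow> cform \<Rightarrow> bool" where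
  "type10 j \<theta> \<longleftrightarrow> alt_form 1 \<theta> \<and> (\<forall>v. \<theta> [j v] = \<i> * \<theta> [v])"

text \<open>The complex span of the products of \<open>p\<close> forms of type (1,0) and \<open>q\<close> conjugates of such.\<close>
definition forms_pq :: "(real^6 \<Rightarrow> real^6) \<Rightarrow> nat \<Rightarrow> nat \<Rightarrow> cform set" where
  "forms_pq j p q = {\<omega>. \<exists>n (z :: nat \<Rightarrow> complex) \<theta>s \<eta>s.
     (\<forall>m<n. length (\<theta>s m) = p \<and> length (\<eta>s m) = q \<and>
            (\<forall>\<theta>\<in>set (\<theta>s m) \<union> set (\<eta>s m). type10 j \<theta>)) \<and>
     \<omega> = (\<lambda>vs. \<Sum>m<n. z m * wedge_list (\<theta>s m @ map cnj_form (\<eta>s m)) vs)}"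

definition part_pq :: "(real^6 \<Rightarrow> real^6) \<Rightarrow> nat \<Rightarrow> nat \<Rightarrow> cform \<Rightarrow> cform" where
  "part_pq j p q \<omega> = (THE \<beta>. \<exists>\<gamma>. (\<forall>r\<le>p + q. \<gamma> r \<in> forms_pq j r (p + q - r)) \<and>
     \<omega> = (\<lambda>vs. \<Sum>r\<le>p + q. \<gamma> r vs) \<and> \<beta> = \<gamma> p)"

section \<open>Coframings and the Nijenhuis tensor\<close>

definition coframing ::
    "'a::topological_space chart set \<Rightarrow> 'a endo_field \<Rightarrow> 'a set \<Rightarrow> (3 \<Rightarrow> 'a form_field) \<Rightarrow> bool" where
  "coframing A J U \<alpha> \<longleftrightarrow> open U \<and> (\<forall>i. form_on A U 1 (\<alpha> i)) \<and>
     (\<forall>c\<in>A. \<forall>x\<in>coord_set c U. (\<forall>i. type10 (J c x) (\<alpha> i c x)) \<and>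
        (\<forall>z :: 3 \<Rightarrow> complex. (\<forall>vs. (\<Sum>i\<in>UNIV. z i * \<alpha> i c x vs) = 0) \<longrightarrow> (\<forall>i. z i = 0)))"

text \<open>The entries of the column of conjugate 2-forms multiplied by \<open>N(\<alpha>)\<close>.\<close>
definition cnj2 :: "(3 \<Rightarrow> cform) \<Rightarrow> 3 \<Rightarrow> cform" where
  "cnj2 \<theta> m = (if m = 1 then cnj_form (\<theta> 2 \<and>\<^sub>e \<theta> 3)
               else if m = 2 then cnj_form (\<theta> 3 \<and>\<^sub>e \<theta> 1)
               else cnj_form (\<theta> 1 \<and>\<^sub>e \<theta> 2))"

definition Nmat :: "'a endo_field \<Rightarrow> (3 \<Rightarrow> 'a form_field) \<Rightarrow> 'a chart \<Rightarrow> real^6 \<Rightarrow> complex^3^3" where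
  "Nmat J \<alpha> c x = (THE N. \<forall>i. part_pq (J c x) 0 2 (ext_d (\<alpha> i c) x) =
     (\<lambda>vs. \<Sum>m\<in>UNIV. N $ i $ m * cnj2 (\<lambda>i. \<alpha> i c x) m vs))"

definition vol3 :: "(3 \<Rightarrow> cform) \<Rightarrow> cform" where
  "vol3 \<theta> = \<theta> 1 \<and>\<^sub>e \<theta> 2 \<and>\<^sub>e \<theta> 3"

definition Omega :: "(3 \<Rightarrow> cform) \<Rightarrow> cform" where
  "Omega \<theta> = (\<lambda>vs. \<i> / 8 * (vol3 \<theta> \<and>\<^sub>e cnj_form (vol3 \<theta>)) vs)"

text \<open>The 5-forms dual to the conjugates of a coframe.\<close>
definition dual5 :: "(3 \<Rightarrow> cform) \<Rightarrow> 3 \<Rightarrow> cform" where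
  "dual5 \<theta> k = (THE \<eta>. alt_form 5 \<eta> \<and>
     (\<forall>j. (cnj_form (\<theta> j) \<and>\<^sub>e \<eta>) = (if j = k then Omega \<theta> else (\<lambda>_. 0))) \<and>
     (\<forall>j. (\<theta> j \<and>\<^sub>e \<eta>) = (\<lambda>_. 0)))"

text \<open>For \<open>d\<alpha> = -\<kappa> \<and> \<alpha> + \<dots>\<close>, a change of coframing \<open>\<alpha>' = g\<alpha>\<close> goes with
  \<open>\<kappa>' = g\<kappa>g\<^bsup>-1\<^esup> - dg g\<^bsup>-1\<^esup>\<close>. Hence in the covariant exterior derivative of a quantity with
  index structure \<open>L\<^sup>j\<^sub>i\<close> (\<open>j\<close> barred) the lower index contributes \<open>-\<kappa>\<^sup>l\<^sub>i\<close> and the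
  barred upper index \<open>+cnj \<kappa>\<^sup>j\<^sub>l\<close>.\<close>
definition connection02 ::
    "'a chart set \<Rightarrow> 'a endo_field \<Rightarrow> 'a set \<Rightarrow> (3 \<Rightarrow> 'a form_field) \<Rightarrow> (3 \<Rightarrow> 3 \<Rightarrow> 'a form_field) \<Rightarrow> bool" where
  "connection02 A J U \<alpha> \<kappa> \<longleftrightarrow> (\<forall>i j. form_on A U 1 (\<kappa> i j)) \<and>
     (\<forall>c\<in>A. \<forall>x\<in>coord_set c U. \<forall>i vs. ext_d (\<alpha> i c) x vs =
        - (\<Sum>j\<in>UNIV. (\<kappa> i j c x \<and>\<^sub>e \<alpha> j c x) vs)
        + (\<Sum>m\<in>UNIV. Nmat J \<alpha> c x $ i $ m * cnj2 (\<lambda>i. \<alpha> i c x) m vs))"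

section \<open>The functional\<close>

definition cnj_mat :: "complex^3^3 \<Rightarrow> complex^3^3" where
  "cnj_mat a = (\<chi> i j. cnj (a $ i $ j))"

definition Ptri :: "complex^3^3 \<Rightarrow> complex^3^3 \<Rightarrow> complex^3^3 \<Rightarrow> complex" where
  "Ptri = (THE P.
     (\<forall>a a' b c. P (a + a') b c = P a b c + P a' b c) \<and>
     (\<forall>z a b c. P (\<chi> i j. z * a $ i $ j) b c = z * P a b c) \<and>
     (\<forall>a b c. P a b c = P b a c \<and> P a b c = P a c b) \<and>
     (\<forall>a. P a a a = det a))"

definition Lfun :: "real \<Rightarrow> real \<Rightarrow> complex^3^3 \<Rightarrow> real" where
  "Lfun c1 c2 a = c1 * (cmod (det a))\<^sup>2 + c2 * (cmod (Ptri (cnj_mat a) (cnj_mat a) (transpose a)))\<^sup>2"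

text \<open>The components \<open>a\<^sup>i\<^sub>j\<^sub>k\<close>, skew in \<open>j\<close> and \<open>k\<close>, of a matrix.\<close>
definition mat_comp :: "complex^3^3 \<Rightarrow> 3 \<Rightarrow> 3 \<Rightarrow> 3 \<Rightarrow> complex" where
  "mat_comp a i j k =
     (if (j, k) = (2, 3) then a $ i $ 1 else if (j, k) = (3, 2) then - a $ i $ 1
      else if (j, k) = (3, 1) then a $ i $ 2 else if (j, k) = (1, 3) then - a $ i $ 2
      else if (j, k) = (1, 2) then a $ i $ 3 else if (j, k) = (2, 1) then - a $ i $ 3
      else 0)"

text \<open>The functions \<open>L\<^sup>j\<^sup>k\<^sub>i(a)\<close>, written \<open>L' a i j k\<close>. Skew symmetry and the
  formula for the differential determine them; they are then automatically polynomial.\<close>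
definition L_partials :: "real \<Rightarrow> real \<Rightarrow> (complex^3^3 \<Rightarrow> 3 \<Rightarrow> 3 \<Rightarrow> 3 \<Rightarrow> complex) \<Rightarrow> bool" where
  "L_partials c1 c2 L' \<longleftrightarrow> (\<forall>a i j k. L' a i j k = - L' a i k j) \<and>
     (\<forall>a. (Lfun c1 c2 has_derivative
        (\<lambda>h. Re (\<Sum>i\<in>UNIV. \<Sum>j\<in>UNIV. \<Sum>k\<in>UNIV. L' a i j k * mat_comp h i j k))) (at a))"

text \<open>\<open>\<Phi>(J)\<close> and \<open>\<psi>(J)\<close> are the global forms that have the stated expression
  in every coframing.\<close>

definition Phi :: "'a::topological_space chart set \<Rightarrow> 'a endo_field \<Rightarrow> 'a form_field" where
  "Phi A J c x = (THE \<omega>. \<forall>U \<alpha>. coframing A J U \<alpha> \<and> x \<in> coord_set c U \<longrightarrow>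
     (let \<theta> = (\<lambda>i. \<alpha> i c x) in
      \<omega> = (\<lambda>vs. \<i> / 8 * complex_of_real ((cmod (det (Nmat J \<alpha> c x)))\<^sup>2) *
        (\<theta> 1 \<and>\<^sub>e \<theta> 2 \<and>\<^sub>e \<theta> 3 \<and>\<^sub>e cnj_form (\<theta> 1) \<and>\<^sub>e cnj_form (\<theta> 2) \<and>\<^sub>e cnj_form (\<theta> 3)) vs)))"

definition psi :: "'a::topological_space chart set \<Rightarrow> 'a endo_field \<Rightarrow> 'a form_field" where
  "psi A J c x = (THE \<omega>. \<forall>U \<alpha>. coframing A J U \<alpha> \<and> x \<in> coord_set c U \<longrightarrow>
     (let \<theta> = (\<lambda>i. \<alpha> i c x); N = Nmat J \<alpha> c x in
      \<omega> = (\<lambda>vs. Ptri (cnj_mat N) (cnj_mat N) (transpose N) * (\<theta> 1 \<and>\<^sub>e \<theta> 2 \<and>\<^sub>e \<theta> 3) vs)))"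

definition Ffun :: "'a::topological_space chart set \<Rightarrow> real \<Rightarrow> real \<Rightarrow> 'a endo_field \<Rightarrow> complex" where
  "Ffun A c1 c2 J = integral_form A (\<lambda>c x vs.
     complex_of_real c1 * Phi A J c x vs +
     complex_of_real c2 * (\<i> / 8 * (psi A J c x \<and>\<^sub>e cnj_form (psi A J c x)) vs))"

definition smooth_variation ::
    "'a chart set \<Rightarrow> 'a endo_field \<Rightarrow> real \<Rightarrow> (real \<Rightarrow> 'a endo_field) \<Rightarrow> bool" where
  "smooth_variation A J \<epsilon> Jt \<longleftrightarrow> \<epsilon> > 0 \<and> Jt 0 = J \<and>
     (\<forall>t\<in>{-\<epsilon><..<\<epsilon>}. almost_complex A (Jt t) \<and> induces_orientation A (Jt t)) \<and>
     (\<forall>c\<in>A. \<forall>v. smooth_on ({-\<epsilon><..<\<epsilon>} \<times> coord_set c UNIV) (\<lambda>(t, x). Jt t c x v))"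

definition critical_point ::
    "'a::topological_space chart set \<Rightarrow> real \<Rightarrow> real \<Rightarrow> 'a endo_field \<Rightarrow> bool" where
  "critical_point A c1 c2 J \<longleftrightarrow> (\<forall>\<epsilon> Jt. smooth_variation A J \<epsilon> Jt \<longrightarrow>
     ((\<lambda>t. Ffun A c1 c2 (Jt t)) has_vector_derivative 0) (at 0))"

end

theory Submission
  imports Defs
begin

text \<open>Along a variation \<open>J\<^sub>t\<close> the coframe may be taken to be the projection of \<open>\<alpha>\<close> to type (1,0), so that
  \<open>\<alpha>\<close> varies by \<open>\<phi>\<^sup>i\<^sub>k\<close> times the conjugate of \<open>\<alpha>\<^sup>k\<close>. Differentiating the (0,2)-part of \<open>d\<alpha>\<^sub>t\<close> with the
  structure equation gives the components of \<open>N'\<close> as the skew part of the (0,1)-part of the covariant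
  derivative of \<open>\<phi>\<close>, while the volume form is constant to first order. Hence the Lagrangian density varies by
  \<open>-2 Re (d\<chi> - \<phi>\<^sup>i\<^sub>j E\<^sup>j\<^sub>i)\<close>, where \<open>\<chi>\<close> is a 5-form linear in \<open>\<phi>\<close> and \<open>E\<close> is the left-hand side of the
  Euler-Lagrange equation, and Stokes' theorem removes \<open>d\<chi>\<close> for variations supported in a chart.
  An arbitrary variation has the same first variation as the sum of its localizations \<open>J\<^bsub>t \<rho>\<^esub>\<close> by a
  partition of unity. Conversely, \<open>J + t T\<close> is an almost complex structure whenever
  \<open>T J = - J T\<close> and \<open>T\<^sup>2 = 0\<close>; such \<open>T\<close> realize all \<open>\<phi>\<close> with \<open>\<phi>\<close> times its conjugate zero, and these suffice
  to test every component of \<open>E\<close>.\<close>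

section \<open>Calculus of smooth maps\<close>

lemma frechet_derivative_cong_open:
  assumes "open S" "x \<in> S" "\<And>y. y \<in> S \<Longrightarrow> f y = g y"
  shows "frechet_derivative f (at x) = frechet_derivative g (at x)"
proof -
  have "(f has_derivative f') (at x) \<longleftrightarrow> (g has_derivative f') (at x)" for f'
    using has_derivative_transform_within_open[where f=f and g=g, OF _ assms(1,2)]
      has_derivative_transform_within_open[where f=g and g=f, OF _ assms(1,2)] assms(3) by metis
  then show ?thesis by (simp add: frechet_derivative_def)
qed

lemma Ck_on_cong:
  assumes "open S" "\<And>x. x \<in> S \<Longrightarrow> f x = g x" "Ck_on n S f"
  shows "Ck_on n S g"
  using assms(2,3)
proof (induction n arbitrary: f g)
  case 0
  then show ?case using continuous_on_cong[of S S f g] by simp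
next
  case (Suc n)
  have "g differentiable (at x)" if "x \<in> S" for x
    using Suc.prems that has_derivative_transform_within_open[where f=f and g=g, OF _ assms(1) that]
    unfolding Ck_on.simps differentiable_def by blast
  moreover have "Ck_on n S (\<lambda>x. frechet_derivative g (at x) v)" for v
    using Suc.IH[of "\<lambda>x. frechet_derivative f (at x) v" "\<lambda>x. frechet_derivative g (at x) v"]
      frechet_derivative_cong_open[OF assms(1) _ Suc.prems(1)] Suc.prems(2) by simp
  ultimately show ?case by simp
qed

lemma Ck_on_SucI:
  assumes "open S" "\<And>x. x \<in> S \<Longrightarrow> (f has_derivative f' x) (at x)" "\<And>v. Ck_on n S (\<lambda>x. f' x v)"
  shows "Ck_on (Suc n) S f"
proof -
  have "f' x = frechet_derivative f (at x)" if "x \<in> S" for x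
    using frechet_derivative_at[OF assms(2)[OF that]] .
  then have "Ck_on n S (\<lambda>x. frechet_derivative f (at x) v)" for v
    using Ck_on_cong[OF assms(1) _ assms(3)[of v], of "\<lambda>x. frechet_derivative f (at x) v"] by simp
  then show ?thesis
    using assms(2) differentiableI by (simp, blast)
qed

lemma Ck_on_has_derivative:
  "Ck_on (Suc n) S f \<Longrightarrow> x \<in> S \<Longrightarrow> (f has_derivative frechet_derivative f (at x)) (at x)"
  by (simp add: frechet_derivative_works)

lemma Ck_on_Suc_imp: "Ck_on (Suc n) S f \<Longrightarrow> Ck_on n S f"
proof (induction n arbitrary: f)
  case 0
  then show ?case
    by (simp add: continuous_at_imp_continuous_on differentiable_imp_continuous_within)
next
  case (Suc n)
  then show ?case by simp
qed

lemma Ck_on_subset: "T \<subseteq> S \<Longrightarrow> Ck_on n S f \<Longrightarrow> Ck_on n T f"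
proof (induction n arbitrary: f)
  case 0
  then show ?case using continuous_on_subset by simp
next
  case (Suc n)
  then show ?case unfolding Ck_on.simps by blast
qed

lemma Ck_on_local:
  "(\<And>x. x \<in> S \<Longrightarrow> \<exists>T. open T \<and> x \<in> T \<and> Ck_on n T f) \<Longrightarrow> Ck_on n S f"
proof (induction n arbitrary: f)
  case 0
  then show ?case
    by (metis Ck_on.simps(1) continuous_at_imp_continuous_on continuous_on_eq_continuous_at)
next
  case (Suc n)
  have "f differentiable at x" if "x \<in> S" for x
    using Suc.prems[OF that] by auto
  moreover have "Ck_on n S (\<lambda>x. frechet_derivative f (at x) v)" for v
    by (rule Suc.IH) (use Suc.prems in \<open>metis Ck_on.simps(2)\<close>)
  ultimately show ?case by simp
qed

lemma Ck_on_const: "open S \<Longrightarrow> Ck_on n S (\<lambda>x. c)"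
proof (induction n arbitrary: c)
  case (Suc n)
  show ?case by (rule Ck_on_SucI[OF Suc.prems has_derivative_const Suc.IH[OF Suc.prems]])
qed auto

lemma Ck_on_bounded_linear:
  assumes "bounded_linear h" "open S" "Ck_on n S f"
  shows "Ck_on n S (\<lambda>x. h (f x))"
  using assms(3)
proof (induction n arbitrary: f)
  case 0
  then show ?case unfolding Ck_on.simps by (rule bounded_linear.continuous_on[OF assms(1)])
next
  case (Suc n)
  show ?case
    by (rule Ck_on_SucI[OF assms(2), where f' = "\<lambda>x v. h (frechet_derivative f (at x) v)"],
      rule bounded_linear.has_derivative[OF assms(1) Ck_on_has_derivative[OF Suc.prems]], assumption)
      (use Suc in simp)
qed

lemma Ck_on_add:
  assumes "open S" "Ck_on n S f" "Ck_on n S g"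
  shows "Ck_on n S (\<lambda>x. f x + g x)"
  using assms(2,3)
proof (induction n arbitrary: f g)
  case 0
  then show ?case by (auto intro: continuous_intros)
next
  case (Suc n)
  show ?case
    by (rule Ck_on_SucI[OF assms(1),
          where f' = "\<lambda>x v. frechet_derivative f (at x) v + frechet_derivative g (at x) v"],
      rule has_derivative_add[OF Ck_on_has_derivative[OF Suc.prems(1)] Ck_on_has_derivative[OF Suc.prems(2)]],
      assumption, assumption) (use Suc in simp)
qed

lemma Ck_on_bilinear:
  assumes "bounded_bilinear h" "open S" "Ck_on n S f" "Ck_on n S g"
  shows "Ck_on n S (\<lambda>x. h (f x) (g x))"
  using assms(3,4)
proof (induction n arbitrary: f g)
  case 0
  then show ?case unfolding Ck_on.simps by (rule bounded_bilinear.continuous_on[OF assms(1)])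
next
  case (Suc n)
  have C: "Ck_on n S (\<lambda>x. h (f x) (frechet_derivative g (at x) v) + h (frechet_derivative f (at x) v) (g x))" for v
    using Suc.prems by (intro Ck_on_add Suc.IH assms(2) Ck_on_Suc_imp[OF Suc.prems(1)] Ck_on_Suc_imp[OF Suc.prems(2)]) auto
  show ?case
    by (rule Ck_on_SucI[OF assms(2) bounded_bilinear.FDERIV[OF assms(1) Ck_on_has_derivative[OF Suc.prems(1)]
            Ck_on_has_derivative[OF Suc.prems(2)]] C])
qed

lemma Ck_on_sum:
  assumes "open S" "\<And>i. i \<in> I \<Longrightarrow> Ck_on n S (f i)"
  shows "Ck_on n S (\<lambda>x. \<Sum>i\<in>I. f i x)"
  using assms(2)
  by (induction I rule: infinite_finite_induct) (auto intro: Ck_on_const Ck_on_add assms(1))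

lemma Ck_on_compose:
  fixes f :: "'a::real_normed_vector \<Rightarrow> 'b::euclidean_space"
  assumes "open S" "open T" "Ck_on n S f" "Ck_on n T g" "f ` S \<subseteq> T"
  shows "Ck_on n S (\<lambda>x. g (f x))"
  using assms(3,4)
proof (induction n arbitrary: g)
  case 0
  then show ?case using assms(5) continuous_on_compose2 by auto
next
  case (Suc n)
  have deriv: "((\<lambda>x. g (f x)) has_derivative
      (\<lambda>v. frechet_derivative g (at (f x)) (frechet_derivative f (at x) v))) (at x)" if "x \<in> S" for x
    using has_derivative_compose[OF Ck_on_has_derivative[OF Suc.prems(1) that] Ck_on_has_derivative[OF Suc.prems(2)]]
      assms(5) that by blast
  have expand: "frechet_derivative g (at (f x)) (frechet_derivative f (at x) v) =
      (\<Sum>b\<in>Basis. (frechet_derivative f (at x) v \<bullet> b) *\<^sub>R frechet_derivative g (at (f x)) b)"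
    if "x \<in> S" for x v
  proof -
    have "linear (frechet_derivative g (at (f x)))"
      using Ck_on_has_derivative[OF Suc.prems(2)] assms(5) that has_derivative_linear by blast
    then show ?thesis
      using linear_sum[of "frechet_derivative g (at (f x))" "\<lambda>b. (frechet_derivative f (at x) v \<bullet> b) *\<^sub>R b" Basis]
      by (simp add: euclidean_representation linear_cmul)
  qed
  have "Ck_on n S (\<lambda>x. \<Sum>b\<in>Basis. (frechet_derivative f (at x) v \<bullet> b) *\<^sub>R frechet_derivative g (at (f x)) b)" for v
    using Suc assms(1)
    by (intro Ck_on_sum Ck_on_bilinear[OF bounded_bilinear_scaleR] Suc.IH Ck_on_bounded_linear[OF bounded_linear_inner_left])
       (auto intro: Ck_on_Suc_imp)
  then have C: "Ck_on n S (\<lambda>x. frechet_derivative g (at (f x)) (frechet_derivative f (at x) v))" for v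
    by (rule Ck_on_cong[OF assms(1), rotated]) (simp add: expand)
  show ?case by (rule Ck_on_SucI[OF assms(1) deriv C])
qed

lemma Ck_on_inverse:
  fixes f :: "'a::real_normed_vector \<Rightarrow> 'b::real_normed_field"
  assumes "open S" "Ck_on n S f" "\<And>x. x \<in> S \<Longrightarrow> f x \<noteq> 0"
  shows "Ck_on n S (\<lambda>x. inverse (f x))"
  using assms(2)
proof (induction n)
  case 0
  then show ?case using assms(3) by (auto intro: continuous_on_inverse)
next
  case (Suc n)
  have C: "Ck_on n S (\<lambda>x. - (inverse (f x) * frechet_derivative f (at x) v * inverse (f x)))" for v
    using Suc assms(1)
    by (intro Ck_on_bounded_linear[OF bounded_linear_minus[OF bounded_linear_ident]]
        Ck_on_bilinear[OF bounded_bilinear_mult] Suc.IH) (auto intro: Ck_on_Suc_imp)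
  show ?case
    by (rule Ck_on_SucI[OF assms(1) Deriv.has_derivative_inverse[OF assms(3) Ck_on_has_derivative[OF Suc.prems]] C])
qed

lemma smooth_on_cong: "open S \<Longrightarrow> (\<And>x. x \<in> S \<Longrightarrow> f x = g x) \<Longrightarrow> smooth_on S f \<Longrightarrow> smooth_on S g"
  unfolding smooth_on_def using Ck_on_cong by blast

lemma smooth_on_subset: "smooth_on S f \<Longrightarrow> T \<subseteq> S \<Longrightarrow> smooth_on T f"
  unfolding smooth_on_def using Ck_on_subset by blast

lemma smooth_on_local:
  "(\<And>x. x \<in> S \<Longrightarrow> \<exists>T. open T \<and> x \<in> T \<and> smooth_on T f) \<Longrightarrow> smooth_on S f"
  unfolding smooth_on_def by (meson Ck_on_local)

lemma smooth_on_const [intro]: "open S \<Longrightarrow> smooth_on S (\<lambda>x. c)"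
  by (simp add: smooth_on_def Ck_on_const)

lemma smooth_on_bounded_linear:
  "bounded_linear h \<Longrightarrow> open S \<Longrightarrow> smooth_on S f \<Longrightarrow> smooth_on S (\<lambda>x. h (f x))"
  by (simp add: smooth_on_def Ck_on_bounded_linear)

lemma smooth_on_bilinear:
  "bounded_bilinear h \<Longrightarrow> open S \<Longrightarrow> smooth_on S f \<Longrightarrow> smooth_on S g \<Longrightarrow> smooth_on S (\<lambda>x. h (f x) (g x))"
  by (simp add: smooth_on_def Ck_on_bilinear)

lemma smooth_on_add [intro]:
  "open S \<Longrightarrow> smooth_on S f \<Longrightarrow> smooth_on S g \<Longrightarrow> smooth_on S (\<lambda>x. f x + g x)"
  by (simp add: smooth_on_def Ck_on_add)

lemma smooth_on_minus [intro]: "open S \<Longrightarrow> smooth_on S f \<Longrightarrow> smooth_on S (\<lambda>x. - f x)"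
  by (rule smooth_on_bounded_linear[OF bounded_linear_minus[OF bounded_linear_ident]])

lemma smooth_on_diff [intro]:
  "open S \<Longrightarrow> smooth_on S f \<Longrightarrow> smooth_on S g \<Longrightarrow> smooth_on S (\<lambda>x. f x - g x)"
  using smooth_on_add[OF _ _ smooth_on_minus, of S f g] by simp

lemma smooth_on_mult [intro]:
  fixes f g :: "'a::real_normed_vector \<Rightarrow> 'b::real_normed_algebra"
  shows "open S \<Longrightarrow> smooth_on S f \<Longrightarrow> smooth_on S g \<Longrightarrow> smooth_on S (\<lambda>x. f x * g x)"
  by (rule smooth_on_bilinear[OF bounded_bilinear_mult])

lemma smooth_on_scaleR [intro]:
  "open S \<Longrightarrow> smooth_on S f \<Longrightarrow> smooth_on S g \<Longrightarrow> smooth_on S (\<lambda>x. f x *\<^sub>R g x)"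
  by (rule smooth_on_bilinear[OF bounded_bilinear_scaleR])

lemma smooth_on_sum [intro]:
  "open S \<Longrightarrow> (\<And>i. i \<in> I \<Longrightarrow> smooth_on S (f i)) \<Longrightarrow> smooth_on S (\<lambda>x. \<Sum>i\<in>I. f i x)"
  by (simp add: smooth_on_def Ck_on_sum)

lemma smooth_on_divide [intro]:
  fixes f g :: "'a::real_normed_vector \<Rightarrow> 'b::real_normed_field"
  shows "open S \<Longrightarrow> smooth_on S f \<Longrightarrow> smooth_on S g \<Longrightarrow> (\<And>x. x \<in> S \<Longrightarrow> g x \<noteq> 0) \<Longrightarrow>
    smooth_on S (\<lambda>x. f x / g x)"
  unfolding divide_inverse by (rule smooth_on_mult) (auto simp: smooth_on_def Ck_on_inverse)

lemma smooth_on_cnj [intro]: "open S \<Longrightarrow> smooth_on S f \<Longrightarrow> smooth_on S (\<lambda>x. cnj (f x))"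
  by (rule smooth_on_bounded_linear[OF bounded_linear_cnj])

lemma smooth_on_Re [intro]: "open S \<Longrightarrow> smooth_on S f \<Longrightarrow> smooth_on S (\<lambda>x. Re (f x))"
  by (rule smooth_on_bounded_linear[OF bounded_linear_Re])

lemma smooth_on_Im [intro]: "open S \<Longrightarrow> smooth_on S f \<Longrightarrow> smooth_on S (\<lambda>x. Im (f x))"
  by (rule smooth_on_bounded_linear[OF bounded_linear_Im])

lemma smooth_on_of_real [intro]:
  "open S \<Longrightarrow> smooth_on S f \<Longrightarrow> smooth_on S (\<lambda>x. complex_of_real (f x))"
  by (rule smooth_on_bounded_linear[OF bounded_linear_of_real])

lemma smooth_on_inner_left [intro]: "open S \<Longrightarrow> smooth_on S f \<Longrightarrow> smooth_on S (\<lambda>x. f x \<bullet> c)"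
  by (rule smooth_on_bounded_linear[OF bounded_linear_inner_left])

lemma smooth_on_id: "open S \<Longrightarrow> smooth_on S (\<lambda>x. x)"
proof -
  assume S: "open S"
  have "Ck_on n S (\<lambda>x. x)" for n
  proof (cases n)
    case (Suc m)
    show ?thesis unfolding Suc by (rule Ck_on_SucI[OF S has_derivative_ident Ck_on_const[OF S]])
  qed simp
  then show ?thesis by (simp add: smooth_on_def)
qed

lemma smooth_on_linear: "bounded_linear h \<Longrightarrow> open S \<Longrightarrow> smooth_on S h"
  using smooth_on_bounded_linear[OF _ _ smooth_on_id] by blast

lemma smooth_on_compose:
  fixes f :: "'a::real_normed_vector \<Rightarrow> 'b::euclidean_space"
  shows "open S \<Longrightarrow> open T \<Longrightarrow> smooth_on S f \<Longrightarrow> smooth_on T g \<Longrightarrow> f ` S \<subseteq> T \<Longrightarrow> smooth_on S (\<lambda>x. g (f x))"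
  unfolding smooth_on_def using Ck_on_compose by blast

lemma smooth_on_differentiable: "smooth_on S f \<Longrightarrow> x \<in> S \<Longrightarrow> f differentiable (at x)"
  unfolding smooth_on_def by (metis Ck_on.simps(2))

lemma smooth_on_has_derivative:
  "smooth_on S f \<Longrightarrow> x \<in> S \<Longrightarrow> (f has_derivative frechet_derivative f (at x)) (at x)"
  by (meson frechet_derivative_works smooth_on_differentiable)

lemma smooth_on_frechet: "smooth_on S f \<Longrightarrow> smooth_on S (\<lambda>x. frechet_derivative f (at x) v)"
  unfolding smooth_on_def by (metis Ck_on.simps(2))

lemma smooth_on_continuous_on: "smooth_on S f \<Longrightarrow> continuous_on S f"
  unfolding smooth_on_def by (metis Ck_on.simps(1))

lemma smooth_on_linear_family:
  fixes g :: "'b::real_normed_vector \<Rightarrow> 'a::euclidean_space"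
  assumes "open S" "\<And>v. smooth_on S (\<lambda>x. F x v)" "smooth_on S g" "\<And>x. x \<in> S \<Longrightarrow> linear (F x)"
  shows "smooth_on S (\<lambda>x. F x (g x))"
proof -
  have "F x (g x) = (\<Sum>b\<in>Basis. (g x \<bullet> b) *\<^sub>R F x b)" if "x \<in> S" for x
    using linear_sum[OF assms(4)[OF that], of "\<lambda>b. (g x \<bullet> b) *\<^sub>R b" Basis] assms(4)[OF that]
    by (simp add: euclidean_representation linear_cmul)
  moreover have "smooth_on S (\<lambda>x. (\<Sum>b\<in>Basis. (g x \<bullet> b) *\<^sub>R F x b))"
    using assms by (intro smooth_on_sum smooth_on_scaleR smooth_on_inner_left) auto
  ultimately show ?thesis
    using smooth_on_cong[OF assms(1), of "\<lambda>x. \<Sum>b\<in>Basis. (g x \<bullet> b) *\<^sub>R F x b" "\<lambda>x. F x (g x)"] by simp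
qed

lemma frechet_derivative_compose_at:
  assumes "g differentiable (at (f x))" "f differentiable (at x)"
  shows "frechet_derivative (\<lambda>y. g (f y)) (at x) v = frechet_derivative g (at (f x)) (frechet_derivative f (at x) v)"
  using has_derivative_compose[OF assms(2)[unfolded frechet_derivative_works] assms(1)[unfolded frechet_derivative_works]]
  by (simp add: frechet_derivative_at[symmetric])

lemma frechet_derivative_bounded_linear_at:
  assumes "bounded_linear h" "f differentiable (at x)"
  shows "frechet_derivative (\<lambda>y. h (f y)) (at x) v = h (frechet_derivative f (at x) v)"
  using bounded_linear.has_derivative[OF assms(1) assms(2)[unfolded frechet_derivative_works]]
  by (simp add: frechet_derivative_at[symmetric])

lemma frechet_derivative_linear:
  "f differentiable (at x) \<Longrightarrow> linear (frechet_derivative f (at x))"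
  using frechet_derivative_works has_derivative_linear by blast

subsection \<open>Symmetry of second derivatives\<close>

lemma second_difference:
  fixes f :: "'a::real_normed_vector \<Rightarrow> real"
  assumes S: "open S" "x \<in> S" and f: "Ck_on 2 S f" and e: "e > 0"
  shows "\<exists>d>0. \<forall>h. 0 < h \<and> h < d \<longrightarrow>
    \<bar>f (x + h *\<^sub>R u + h *\<^sub>R v) - f (x + h *\<^sub>R u) - f (x + h *\<^sub>R v) + f x
      - h * h * frechet_derivative (\<lambda>y. frechet_derivative f (at y) u) (at x) v\<bar> \<le> e * h * h"
proof -
  define Du where "Du y = frechet_derivative f (at y) u" for y
  define A where "A y = frechet_derivative Du (at y) v" for y
  have C1: "Ck_on 1 S Du" and fd: "\<And>y. y \<in> S \<Longrightarrow> (f has_derivative frechet_derivative f (at y)) (at y)"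
    using f by (auto simp: numeral_2_eq_2 Du_def[abs_def] frechet_derivative_works)
  have "continuous_on S A" and Dud: "\<And>y. y \<in> S \<Longrightarrow> (Du has_derivative frechet_derivative Du (at y)) (at y)"
    using C1 by (auto simp: A_def[abs_def] frechet_derivative_works)
  then have "isCont A x" using S continuous_on_eq_continuous_at by blast
  then obtain r1 where r1: "r1 > 0" "\<And>y. dist y x < r1 \<Longrightarrow> dist (A y) (A x) < e"
    using e continuous_at_eps_delta by metis
  obtain r2 where r2: "r2 > 0" "ball x r2 \<subseteq> S" using S open_contains_ball by blast
  define d where "d = min r1 r2 / (norm u + norm v + 1)"
  have pos: "norm u + norm v + 1 > 0" by (simp add: add_nonneg_pos)
  have near: "dist (x + s *\<^sub>R u + r *\<^sub>R v) x < min r1 r2" if "0 \<le> s" "s < d" "0 \<le> r" "r < d" for s r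
  proof -
    have "dist (x + s *\<^sub>R u + r *\<^sub>R v) x \<le> s * norm u + r * norm v"
      using norm_triangle_ineq[of "s *\<^sub>R u" "r *\<^sub>R v"] that by (simp add: dist_norm algebra_simps)
    also have "\<dots> \<le> d * norm u + d * norm v"
      using that by (intro add_mono mult_right_mono) auto
    also have "\<dots> < d * (norm u + norm v + 1)"
      using that by (simp add: algebra_simps)
    also have "\<dots> = min r1 r2" using pos by (simp add: d_def)
    finally show ?thesis .
  qed
  have inS: "x + s *\<^sub>R u + r *\<^sub>R v \<in> S" if "0 \<le> s" "s < d" "0 \<le> r" "r < d" for s r
    using near[OF that] r2 by (auto simp: dist_commute)
  have "d > 0" using r1 r2 pos by (simp add: d_def)
  moreover have "\<bar>f (x + h *\<^sub>R u + h *\<^sub>R v) - f (x + h *\<^sub>R u) - f (x + h *\<^sub>R v) + f x - h * h * A x\<bar> \<le> e * h * h"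
    if h: "0 < h" "h < d" for h
  proof -
    define p where "p s = f (x + s *\<^sub>R u + h *\<^sub>R v) - f (x + s *\<^sub>R u + 0 *\<^sub>R v)" for s
    have fline: "((\<lambda>s. f (x + s *\<^sub>R u + r *\<^sub>R v)) has_real_derivative Du (x + s *\<^sub>R u + r *\<^sub>R v)) (at s)"
      if "0 \<le> s" "s < d" "0 \<le> r" "r < d" for s r
    proof -
      have "((\<lambda>s. x + s *\<^sub>R u + r *\<^sub>R v) has_derivative (\<lambda>t. t *\<^sub>R u)) (at s)"
        by (auto intro!: derivative_eq_intros)
      from has_derivative_compose[OF this fd[OF inS[OF that]]]
      show ?thesis
        using linear_cmul[OF has_derivative_linear[OF fd[OF inS[OF that]]]]
        unfolding has_field_derivative_def Du_def by (elim has_derivative_eq_rhs) (simp add: fun_eq_iff)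
    qed
    have "\<exists>z>0. z < h \<and> p h - p 0 = (h - 0) * (Du (x + z *\<^sub>R u + h *\<^sub>R v) - Du (x + z *\<^sub>R u + 0 *\<^sub>R v))"
      unfolding p_def using h by (intro MVT2 DERIV_diff fline) auto
    then obtain z where z: "0 < z" "z < h" "p h - p 0 = h * (Du (x + z *\<^sub>R u + h *\<^sub>R v) - Du (x + z *\<^sub>R u + 0 *\<^sub>R v))"
      by auto
    have "\<exists>w>0. w < h \<and> Du (x + z *\<^sub>R u + h *\<^sub>R v) - Du (x + z *\<^sub>R u + 0 *\<^sub>R v) = (h - 0) * A (x + z *\<^sub>R u + w *\<^sub>R v)"
    proof (intro MVT2)
      fix r assume r: "0 \<le> r" "r \<le> h"
      have i: "x + z *\<^sub>R u + r *\<^sub>R v \<in> S" using inS z h r by auto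
      have "((\<lambda>r. x + z *\<^sub>R u + r *\<^sub>R v) has_derivative (\<lambda>t. t *\<^sub>R v)) (at r)"
        by (auto intro!: derivative_eq_intros)
      from has_derivative_compose[OF this Dud[OF i]]
      show "((\<lambda>r. Du (x + z *\<^sub>R u + r *\<^sub>R v)) has_real_derivative A (x + z *\<^sub>R u + r *\<^sub>R v)) (at r)"
        using linear_cmul[OF has_derivative_linear[OF Dud[OF i]]]
        unfolding has_field_derivative_def A_def by (elim has_derivative_eq_rhs) (simp add: fun_eq_iff)
    qed (use h in auto)
    then obtain w where w: "0 < w" "w < h"
      "Du (x + z *\<^sub>R u + h *\<^sub>R v) - Du (x + z *\<^sub>R u + 0 *\<^sub>R v) = h * A (x + z *\<^sub>R u + w *\<^sub>R v)"
      by auto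
    have "\<bar>A (x + z *\<^sub>R u + w *\<^sub>R v) - A x\<bar> < e"
      using r1(2)[of "x + z *\<^sub>R u + w *\<^sub>R v"] near[of z w] z w h by (auto simp: dist_real_def)
    moreover have "p h - p 0 = f (x + h *\<^sub>R u + h *\<^sub>R v) - f (x + h *\<^sub>R u) - f (x + h *\<^sub>R v) + f x"
      by (simp add: p_def)
    moreover have "p h - p 0 - h * h * A x = h * h * (A (x + z *\<^sub>R u + w *\<^sub>R v) - A x)"
      using z(3) w(3) by (simp add: algebra_simps)
    ultimately show ?thesis using h
      by (simp add: abs_mult mult.assoc mult.left_commute)
  qed
  ultimately show ?thesis unfolding A_def Du_def[abs_def] by blast
qed

lemma second_derivative_symmetric_real:
  fixes f :: "'a::real_normed_vector \<Rightarrow> real"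
  assumes "open S" "x \<in> S" "Ck_on 2 S f"
  shows "frechet_derivative (\<lambda>y. frechet_derivative f (at y) u) (at x) v =
         frechet_derivative (\<lambda>y. frechet_derivative f (at y) v) (at x) u" (is "?A = ?B")
proof (rule ccontr)
  assume "?A \<noteq> ?B"
  define e where "e = \<bar>?A - ?B\<bar> / 3"
  have e: "e > 0" using \<open>?A \<noteq> ?B\<close> by (simp add: e_def)
  obtain d where d: "d > 0" "\<And>h. 0 < h \<and> h < d \<Longrightarrow>
    \<bar>f (x + h *\<^sub>R u + h *\<^sub>R v) - f (x + h *\<^sub>R u) - f (x + h *\<^sub>R v) + f x - h * h * ?A\<bar> \<le> e * h * h"
    using second_difference[OF assms e, of u v] by blast
  obtain d' where d': "d' > 0" "\<And>h. 0 < h \<and> h < d' \<Longrightarrow>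
    \<bar>f (x + h *\<^sub>R v + h *\<^sub>R u) - f (x + h *\<^sub>R v) - f (x + h *\<^sub>R u) + f x - h * h * ?B\<bar> \<le> e * h * h"
    using second_difference[OF assms e, of v u] by blast
  define h where "h = min d d' / 2"
  have h: "0 < h" "h < d" "h < d'" using d d' by (auto simp: h_def)
  have "\<bar>h * h * ?A - h * h * ?B\<bar> \<le> 2 * (e * h * h)"
    using d(2)[of h] d'(2)[of h] h by (simp add: add.commute add.left_commute)
  also have "\<bar>h * h * ?A - h * h * ?B\<bar> = h * h * (3 * e)"
    using h by (simp add: e_def abs_mult right_diff_distrib[symmetric])
  finally show False using h e by (simp add: mult_le_0_iff)
qed

lemma second_derivative_symmetric:
  fixes f :: "'a::real_normed_vector \<Rightarrow> 'b::euclidean_space"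
  assumes S: "open S" "x \<in> S" and f: "smooth_on S f"
  shows "frechet_derivative (\<lambda>y. frechet_derivative f (at y) u) (at x) v =
         frechet_derivative (\<lambda>y. frechet_derivative f (at y) v) (at x) u"
proof (rule euclidean_eqI)
  fix b :: 'b
  have i: "frechet_derivative (\<lambda>y. f y \<bullet> b) (at y) w = frechet_derivative f (at y) w \<bullet> b" if "y \<in> S" for y w
    by (rule frechet_derivative_bounded_linear_at[OF bounded_linear_inner_left smooth_on_differentiable[OF f that]])
  have j: "frechet_derivative (\<lambda>y. frechet_derivative f (at y) p) (at x) q \<bullet> b =
      frechet_derivative (\<lambda>y. frechet_derivative (\<lambda>y. f y \<bullet> b) (at y) p) (at x) q" for p q
  proof -
    have "frechet_derivative (\<lambda>y. frechet_derivative (\<lambda>y. f y \<bullet> b) (at y) p) (at x) q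
       = frechet_derivative (\<lambda>y. frechet_derivative f (at y) p \<bullet> b) (at x) q"
      using frechet_derivative_cong_open[OF S] i by (metis (mono_tags, lifting))
    then show ?thesis
      using frechet_derivative_bounded_linear_at[OF bounded_linear_inner_left
          smooth_on_differentiable[OF smooth_on_frechet[OF f] S(2)]] by metis
  qed
  have "Ck_on 2 S (\<lambda>y. f y \<bullet> b)"
    using smooth_on_inner_left[OF S(1) f] by (simp add: smooth_on_def)
  then show "frechet_derivative (\<lambda>y. frechet_derivative f (at y) u) (at x) v \<bullet> b =
      frechet_derivative (\<lambda>y. frechet_derivative f (at y) v) (at x) u \<bullet> b"
    unfolding j using second_derivative_symmetric_real[OF S] by blast
qed

section \<open>Charts and partitions of unity\<close>

definition flat :: "nat \<Rightarrow> real \<Rightarrow> real" where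
  "flat k t = (if t > 0 then exp (- 1 / t) / t ^ k else 0)"

lemma flat_tendsto_0: "(flat k \<longlongrightarrow> 0) (at 0)"
proof -
  have "((\<lambda>t. inverse t ^ k / exp (inverse t)) \<longlongrightarrow> (0::real)) (at_right 0)"
    by (rule filterlim_compose[OF tendsto_power_div_exp_0 filterlim_inverse_at_top_right])
  then have "(flat k \<longlongrightarrow> 0) (at_right 0)"
  proof (rule Lim_transform_eventually)
    show "\<forall>\<^sub>F t in at_right 0. inverse t ^ k / exp (inverse t) = flat k t"
      by (auto simp: eventually_at_right[of 0 1] flat_def exp_minus field_simps intro!: exI[of _ 1])
  qed
  moreover have "(flat k \<longlongrightarrow> 0) (at_left 0)"
    by (rule Lim_transform_eventually[OF tendsto_const])
       (auto simp: eventually_at_left[of "-1" 0] flat_def intro!: exI[of _ "-1"])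
  ultimately show ?thesis by (simp add: filterlim_split_at)
qed

lemma flat_has_derivative:
  "(flat k has_real_derivative flat (k + 2) t - real k * flat (k + 1) t) (at t)"
proof (cases "t > 0" "t < 0" rule: bool.exhaust[case_product bool.exhaust])
  case True_True
  then show ?thesis by simp
next
  case True_False
  then have t: "t > 0" by simp
  have "((\<lambda>t. exp (- 1 / t) / t ^ k) has_real_derivative flat (k + 2) t - real k * flat (k + 1) t) (at t)"
  proof -
    have p: "real k * t ^ (k - 1) = real k * t ^ k / t" using t by (cases k) auto
    have "((\<lambda>t. exp (- 1 / t) / t ^ k) has_real_derivative
        (exp (- 1 / t) * (1 / t\<^sup>2) * t ^ k - exp (- 1 / t) * (real k * t ^ (k - 1))) / (t ^ k * t ^ k)) (at t)"
      using t by (auto intro!: derivative_eq_intros simp: power2_eq_square)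
    moreover have "(exp (- 1 / t) * (1 / t\<^sup>2) * t ^ k - exp (- 1 / t) * (real k * t ^ k / t)) / (t ^ k * t ^ k)
        = flat (k + 2) t - real k * flat (k + 1) t"
      using t by (simp add: flat_def field_simps power2_eq_square)
    ultimately show ?thesis unfolding p by simp
  qed
  then show ?thesis
    by (rule has_field_derivative_transform_within_open[of _ _ _ "{0<..}"]) (use t in \<open>auto simp: flat_def\<close>)
next
  case False_True
  then have t: "t < 0" by simp
  have "((\<lambda>t. 0) has_real_derivative flat (k + 2) t - real k * flat (k + 1) t) (at t)"
    using t by (auto simp: flat_def)
  then show ?thesis
    by (rule has_field_derivative_transform_within_open[of _ _ _ "{..<0}"]) (use t in \<open>auto simp: flat_def\<close>)
next
  case False_False
  then have t: "t = 0" by simp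
  have "((\<lambda>h. (flat k (0 + h) - flat k 0) / h) \<longlongrightarrow> 0) (at 0)"
    by (rule Lim_transform_eventually[OF flat_tendsto_0[of "Suc k"]])
       (auto simp: flat_def eventually_at_filter)
  then show ?thesis unfolding t DERIV_def by (simp add: flat_def)
qed

lemma Ck_on_flat: "Ck_on n UNIV (flat k)"
proof (induction n arbitrary: k)
  case 0
  then show ?case using DERIV_isCont[OF flat_has_derivative] by (simp add: continuous_at_imp_continuous_on)
next
  case (Suc n)
  have d: "(flat k has_derivative (\<lambda>v. v * (flat (k + 2) t - real k * flat (k + 1) t))) (at t)" for t
    using flat_has_derivative[of k t] unfolding has_field_derivative_def
    by (elim has_derivative_eq_rhs) auto
  have "Ck_on n UNIV (\<lambda>t. v * (flat (k + 2) t + (- real k) * flat (k + 1) t))" for v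
    by (intro Ck_on_bounded_linear[OF bounded_linear_mult_right] Ck_on_add Suc.IH) auto
  then have c: "Ck_on n UNIV (\<lambda>t. v * (flat (k + 2) t - real k * flat (k + 1) t))" for v
    by simp
  show ?case by (rule Ck_on_SucI[OF open_UNIV d c])
qed

definition bump :: "real^6 \<Rightarrow> real \<Rightarrow> real^6 \<Rightarrow> real" where
  "bump a r x = flat 0 (r\<^sup>2 - (x - a) \<bullet> (x - a))"

lemma smooth_bump: "smooth_on UNIV (bump a r)"
proof -
  have i: "smooth_on UNIV (\<lambda>x::real^6. x - a)"
    by (intro smooth_on_diff smooth_on_id smooth_on_const) auto
  have "smooth_on UNIV (\<lambda>x. r\<^sup>2 - (x - a) \<bullet> (x - a))"
    by (intro smooth_on_diff smooth_on_const smooth_on_bilinear[OF bounded_bilinear_inner] i) auto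
  then show ?thesis unfolding bump_def[abs_def]
    by (rule smooth_on_compose[OF open_UNIV open_UNIV _ _ subset_UNIV]) (simp add: smooth_on_def Ck_on_flat)
qed

lemma bump_nonneg: "0 \<le> bump a r x"
  by (simp add: bump_def flat_def)

lemma bump_pos_iff: "r > 0 \<Longrightarrow> 0 < bump a r x \<longleftrightarrow> x \<in> ball a r"
proof -
  assume r: "r > 0"
  have "r\<^sup>2 > (x - a) \<bullet> (x - a) \<longleftrightarrow> norm (x - a) < r"
    using r power2_less_imp_less[of "norm (x - a)" r] power_strict_mono[of "norm (x - a)" r 2]
    by (auto simp: dot_square_norm)
  then show ?thesis by (simp add: bump_def flat_def dist_norm norm_minus_commute)
qed

locale atlas =
  fixes A :: "'a::{t2_space,second_countable_topology} chart set"
  assumes atlas: "oriented_atlas A"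
begin

lemma chart_cover: obtains c where "c \<in> A" "p \<in> fst c"
  using atlas unfolding oriented_atlas_def by blast

lemma open_chart: "c \<in> A \<Longrightarrow> open (fst c)"
  using atlas by (auto simp: oriented_atlas_def)

lemma chart_homeomorphism: "c \<in> A \<Longrightarrow> homeomorphism (fst c) (coord_set c UNIV) (snd c) (chart_inv c)"
  using atlas by (auto simp: oriented_atlas_def)

lemma open_coord_set: "c \<in> A \<Longrightarrow> open U \<Longrightarrow> open (coord_set c U)"
proof -
  assume c: "c \<in> A" and U: "open U"
  have "openin (top_of_set (coord_set c UNIV)) (snd c ` (U \<inter> fst c))"
    by (rule homeomorphism_imp_open_map[OF chart_homeomorphism[OF c]]) (use U in \<open>auto simp: openin_open\<close>)
  moreover have "open (coord_set c UNIV)" using atlas c by (auto simp: oriented_atlas_def)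
  ultimately show ?thesis by (simp add: coord_set_def openin_open_eq)
qed

lemma chart_inv_left: "c \<in> A \<Longrightarrow> p \<in> fst c \<Longrightarrow> chart_inv c (snd c p) = p"
  using chart_homeomorphism by (simp add: homeomorphism_def)

lemma chart_inv_right: "c \<in> A \<Longrightarrow> x \<in> coord_set c U \<Longrightarrow> snd c (chart_inv c x) = x"
  using chart_inv_left[of c] by (auto simp: coord_set_def)

lemma chart_inv_in: "c \<in> A \<Longrightarrow> x \<in> coord_set c U \<Longrightarrow> chart_inv c x \<in> U \<inter> fst c"
  using chart_inv_left[of c] by (auto simp: coord_set_def)

lemma coord_set_iff: "c \<in> A \<Longrightarrow> x \<in> coord_set c U \<longleftrightarrow> x \<in> coord_set c UNIV \<and> chart_inv c x \<in> U"
  using chart_inv_left[of c] by (auto simp: coord_set_def)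

lemma coord_set_mono: "U \<subseteq> V \<Longrightarrow> coord_set c U \<subseteq> coord_set c V"
  by (auto simp: coord_set_def)

lemma coord_set_UNIV: "x \<in> coord_set c U \<Longrightarrow> x \<in> coord_set c UNIV"
  by (auto simp: coord_set_def)

lemma coord_set_Int_chart: "coord_set c (U \<inter> fst c) = coord_set c U"
  by (auto simp: coord_set_def)

lemma snd_in_coord_set: "p \<in> U \<Longrightarrow> p \<in> fst c \<Longrightarrow> snd c p \<in> coord_set c U"
  by (auto simp: coord_set_def)

lemma continuous_on_chart_inv: "c \<in> A \<Longrightarrow> continuous_on (coord_set c UNIV) (chart_inv c)"
  using chart_homeomorphism by (auto simp: homeomorphism_def)

lemma transition_in:
  assumes "c \<in> A" "c' \<in> A" "x \<in> coord_set c (U \<inter> fst c')"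
  shows "transition c c' x \<in> coord_set c' (U \<inter> fst c)"
  using chart_inv_in[OF assms(1,3)] by (auto simp: transition_def coord_set_def)

lemma chart_inv_transition:
  assumes "c \<in> A" "c' \<in> A" "x \<in> coord_set c (fst c')"
  shows "chart_inv c' (transition c c' x) = chart_inv c x"
  using chart_inv_in[OF assms(1,3)] chart_inv_left[OF assms(2)] by (auto simp: transition_def)

lemma transition_transition:
  assumes "c \<in> A" "c' \<in> A" "x \<in> coord_set c (fst c' \<inter> fst c'')"
  shows "transition c' c'' (transition c c' x) = transition c c'' x"
proof -
  have "x \<in> coord_set c (fst c')" using assms(3) by (auto simp: coord_set_def)
  then show ?thesis using chart_inv_transition[OF assms(1,2)] by (simp add: transition_def)
qed

lemma transition_self: "c \<in> A \<Longrightarrow> x \<in> coord_set c UNIV \<Longrightarrow> transition c c x = x"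
  using chart_inv_right by (auto simp: transition_def)

lemma smooth_transition: "c \<in> A \<Longrightarrow> c' \<in> A \<Longrightarrow> smooth_on (coord_set c (fst c')) (transition c c')"
  using atlas by (auto simp: oriented_atlas_def)

lemma transition_det_pos:
  "c \<in> A \<Longrightarrow> c' \<in> A \<Longrightarrow> x \<in> coord_set c (fst c') \<Longrightarrow> det (matrix (transition_deriv c c' x)) > 0"
  using atlas by (auto simp: oriented_atlas_def)

lemma transition_has_derivative:
  "c \<in> A \<Longrightarrow> c' \<in> A \<Longrightarrow> x \<in> coord_set c (fst c') \<Longrightarrow>
    (transition c c' has_derivative transition_deriv c c' x) (at x)"
  unfolding transition_deriv_def by (rule smooth_on_has_derivative[OF smooth_transition])

lemma linear_transition_deriv:
  "c \<in> A \<Longrightarrow> c' \<in> A \<Longrightarrow> x \<in> coord_set c (fst c') \<Longrightarrow> linear (transition_deriv c c' x)"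
  using transition_has_derivative has_derivative_linear by blast

lemma smooth_transition_deriv:
  "c \<in> A \<Longrightarrow> c' \<in> A \<Longrightarrow> smooth_on (coord_set c (fst c')) (\<lambda>x. transition_deriv c c' x v)"
  unfolding transition_deriv_def by (rule smooth_on_frechet[OF smooth_transition])

lemma transition_deriv_compose:
  assumes "c \<in> A" "c' \<in> A" "c'' \<in> A" "x \<in> coord_set c (fst c' \<inter> fst c'')"
  shows "transition_deriv c' c'' (transition c c' x) (transition_deriv c c' x v) = transition_deriv c c'' x v"
proof -
  have x: "x \<in> coord_set c (fst c')" "x \<in> coord_set c (fst c'')"
    using assms(4) by (auto simp: coord_set_def)
  have "transition c c' x \<in> coord_set c' (fst c'' \<inter> fst c)"
    using transition_in[OF assms(1,2), of x "fst c''"] assms(4) by (simp add: Int_commute)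
  then have y: "transition c c' x \<in> coord_set c' (fst c'')"
    by (auto simp: coord_set_def)
  have "((\<lambda>x. transition c' c'' (transition c c' x)) has_derivative
      (\<lambda>v. transition_deriv c' c'' (transition c c' x) (transition_deriv c c' x v))) (at x)"
    by (rule has_derivative_compose[OF transition_has_derivative[OF assms(1,2) x(1)]
          transition_has_derivative[OF assms(2,3) y]])
  then have "(transition c c'' has_derivative
      (\<lambda>v. transition_deriv c' c'' (transition c c' x) (transition_deriv c c' x v))) (at x)"
    by (rule has_derivative_transform_within_open[where s = "coord_set c (fst c' \<inter> fst c'')"])
      (use assms open_coord_set[OF assms(1) open_Int[OF open_chart[OF assms(2)] open_chart[OF assms(3)]]]
        transition_transition[OF assms(1,2)] in auto)
  from has_derivative_unique[OF this transition_has_derivative[OF assms(1,3) x(2)]] show ?thesis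
    by (rule fun_cong)
qed

lemma transition_deriv_self:
  assumes "c \<in> A" "x \<in> coord_set c UNIV"
  shows "transition_deriv c c x v = v"
proof -
  have "((\<lambda>x. x) has_derivative (\<lambda>v. v)) (at x)" by simp
  then have "(transition c c has_derivative (\<lambda>v. v)) (at x)"
    by (rule has_derivative_transform_within_open[where s = "coord_set c UNIV"])
      (use assms open_coord_set[OF assms(1)] transition_self[OF assms(1)] in auto)
  then show ?thesis unfolding transition_deriv_def using frechet_derivative_at by metis
qed

lemma transition_deriv_inverse:
  assumes "c \<in> A" "c' \<in> A" "x \<in> coord_set c (fst c')"
  shows "transition_deriv c' c (transition c c' x) (transition_deriv c c' x v) = v"
  using transition_deriv_compose[OF assms(1,2,1), of x v] transition_deriv_self[OF assms(1)] assms(3)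
    coord_set_UNIV by (metis coord_set_Int_chart)

lemma smooth_functionD: "smooth_function A f \<Longrightarrow> c \<in> A \<Longrightarrow> smooth_on (coord_set c UNIV) (\<lambda>x. f (chart_inv c x))"
  by (simp add: smooth_function_def o_def)

lemma smooth_function_sum:
  assumes "\<And>i. i \<in> I \<Longrightarrow> smooth_function A (f i)"
  shows "smooth_function A (\<lambda>p. \<Sum>i\<in>I. f i p)"
  unfolding smooth_function_def o_def
  by (intro ballI smooth_on_sum open_coord_set open_UNIV smooth_functionD[OF assms])

lemma smooth_function_divide:
  assumes "smooth_function A f" "smooth_function A g" "\<And>p. g p \<noteq> 0"
  shows "smooth_function A (\<lambda>p. f p / g p)"
  unfolding smooth_function_def o_def
  by (intro ballI smooth_on_divide open_coord_set open_UNIV smooth_functionD[OF assms(1)] smooth_functionD[OF assms(2)] assms(3))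

lemma smooth_function_from_chart:
  fixes b :: "real^6 \<Rightarrow> real"
  assumes c: "c \<in> A" and b: "smooth_on UNIV b" and K: "compact K" "K \<subseteq> coord_set c UNIV"
    and zero: "\<And>x. x \<notin> K \<Longrightarrow> b x = 0"
  defines "f \<equiv> \<lambda>p. if p \<in> fst c then b (snd c p) else 0"
  shows "smooth_function A f" "closure {p. f p \<noteq> 0} \<subseteq> chart_inv c ` K"
proof -
  have closed: "closed (chart_inv c ` K)"
    using compact_continuous_image[OF continuous_on_subset[OF continuous_on_chart_inv[OF c] K(2)] K(1)]
    by (rule compact_imp_closed)
  have supp: "{p. f p \<noteq> 0} \<subseteq> chart_inv c ` K"
  proof
    fix p assume "p \<in> {p. f p \<noteq> 0}"
    then have "p \<in> fst c" "snd c p \<in> K" using zero by (auto simp: f_def split: if_splits)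
    then show "p \<in> chart_inv c ` K" using chart_inv_left[OF c] by (metis imageI)
  qed
  then show "closure {p. f p \<noteq> 0} \<subseteq> chart_inv c ` K" using closed by (simp add: closure_minimal)
  show "smooth_function A f" unfolding smooth_function_def
  proof (intro ballI smooth_on_local)
    fix c' x assume c': "c' \<in> A" and x: "x \<in> coord_set c' UNIV"
    show "\<exists>T. open T \<and> x \<in> T \<and> smooth_on T (f \<circ> chart_inv c')"
    proof (cases "chart_inv c' x \<in> fst c")
      case True
      let ?T = "coord_set c' (fst c)"
      have o: "open ?T" using open_coord_set open_chart c c' by blast
      have "smooth_on ?T (\<lambda>y. b (transition c' c y))"
        by (rule smooth_on_compose[OF o open_UNIV smooth_transition[OF c' c] b]) auto
      then have "smooth_on ?T (f \<circ> chart_inv c')"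
        by (rule smooth_on_cong[OF o, rotated]) (use chart_inv_in[OF c'] in \<open>auto simp: f_def transition_def\<close>)
      moreover have "x \<in> ?T" using True x coord_set_iff[OF c', of x "fst c"] by simp
      ultimately show ?thesis using o by (intro exI[of _ ?T]) simp
    next
      case False
      let ?T = "coord_set c' (- (chart_inv c ` K))"
      have o: "open ?T" using open_coord_set c' closed by blast
      have "smooth_on ?T (\<lambda>y. 0 :: real)" using o by blast
      then have "smooth_on ?T (f \<circ> chart_inv c')"
      proof (rule smooth_on_cong[OF o, rotated])
        fix y assume "y \<in> ?T"
        then have "chart_inv c' y \<notin> chart_inv c ` K" using chart_inv_in[OF c', of y] by blast
        then show "0 = (f \<circ> chart_inv c') y" using supp by auto
      qed
      moreover have "chart_inv c ` K \<subseteq> fst c"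
        using chart_inv_in[OF c, of _ UNIV] K(2) by (intro image_subsetI) (simp add: subset_iff)
      then have "x \<in> ?T"
        using False x coord_set_iff[OF c', of x "- (chart_inv c ` K)"] by (simp add: subset_iff) metis
      ultimately show ?thesis using o by (intro exI[of _ ?T]) simp
    qed
  qed
qed

lemma exists_bump:
  assumes "c \<in> A" "x \<in> coord_set c W" "open W"
  obtains f r where "smooth_function A f" "\<And>q. 0 \<le> f q" "closure {q. f q \<noteq> 0} \<subseteq> W \<inter> fst c" "r > 0"
    "\<And>q. q \<in> fst c \<Longrightarrow> f q = bump x r (snd c q)" "\<And>q. q \<notin> fst c \<Longrightarrow> f q = 0"
    "cball x r \<subseteq> coord_set c W"
proof -
  obtain r where r: "r > 0" "cball x r \<subseteq> coord_set c W"
    using open_coord_set[OF assms(1,3)] assms(2) open_contains_cball by blast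
  let ?f = "\<lambda>p. if p \<in> fst c then bump x r (snd c p) else 0"
  have K: "cball x r \<subseteq> coord_set c UNIV" using r coord_set_UNIV by blast
  have z: "bump x r y = 0" if "y \<notin> cball x r" for y
    using that bump_pos_iff[OF r(1), of x y] bump_nonneg[of x r y] by (auto simp: less_eq_real_def)
  have "chart_inv c ` cball x r \<subseteq> W \<inter> fst c"
    using chart_inv_in[OF assms(1), of _ W] r(2) by (intro image_subsetI) (simp add: subset_iff)
  moreover note smooth_function_from_chart[OF assms(1) smooth_bump compact_cball K z]
  ultimately show thesis
    using that[of ?f r] r bump_nonneg[of x r] by (smt (verit, ccfv_threshold) order_trans)
qed

lemma exists_partition:
  assumes "compact (UNIV :: 'a set)" "\<And>p. ch p \<in> A" "\<And>p. p \<in> W p" "\<And>p. open (W p)" "\<And>p. p \<in> fst (ch p)"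
  obtains I and \<rho> :: "'a \<Rightarrow> 'a \<Rightarrow> real" where "finite I"
    "\<And>i. i \<in> I \<Longrightarrow> smooth_function A (\<rho> i)" "\<And>i p. i \<in> I \<Longrightarrow> 0 \<le> \<rho> i p"
    "\<And>i. i \<in> I \<Longrightarrow> closure {p. \<rho> i p \<noteq> 0} \<subseteq> W i \<inter> fst (ch i)" "\<And>p. (\<Sum>i\<in>I. \<rho> i p) = 1"
proof -
  have "\<exists>f. smooth_function A f \<and> (\<forall>q. 0 \<le> f q) \<and> closure {q. f q \<noteq> 0} \<subseteq> W p \<inter> fst (ch p) \<and>
      (\<exists>V. open V \<and> p \<in> V \<and> (\<forall>q\<in>V. 0 < f q))" for p
  proof -
    have x: "snd (ch p) p \<in> coord_set (ch p) (W p)" using assms(3,5) by (auto simp: coord_set_def)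
    obtain f r where f: "smooth_function A f" "\<And>q. 0 \<le> f q" "closure {q. f q \<noteq> 0} \<subseteq> W p \<inter> fst (ch p)" "r > 0"
      "\<And>q. q \<in> fst (ch p) \<Longrightarrow> f q = bump (snd (ch p) p) r (snd (ch p) q)" "\<And>q. q \<notin> fst (ch p) \<Longrightarrow> f q = 0"
      "cball (snd (ch p) p) r \<subseteq> coord_set (ch p) (W p)"
      using exists_bump[OF assms(2) x assms(4)] by blast
    have "continuous_on (fst (ch p)) (snd (ch p))"
      using chart_homeomorphism[OF assms(2)] by (auto simp: homeomorphism_def)
    then have "open (fst (ch p) \<inter> snd (ch p) -` ball (snd (ch p) p) r)"
      using continuous_open_preimage[OF _ open_chart[OF assms(2)] open_ball] by blast
    moreover have "\<forall>q\<in>fst (ch p) \<inter> snd (ch p) -` ball (snd (ch p) p) r. 0 < f q"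
      using f(5) bump_pos_iff[OF f(4)] by auto
    ultimately show ?thesis using f(1-4) assms(5) by (metis Int_iff centre_in_ball vimageI)
  qed
  then obtain f V where f: "\<And>p. smooth_function A (f p)" "\<And>p q. 0 \<le> f p q"
      "\<And>p. closure {q. f p q \<noteq> 0} \<subseteq> W p \<inter> fst (ch p)"
      "\<And>p. open (V p)" "\<And>p. p \<in> V p" "\<And>p q. q \<in> V p \<Longrightarrow> 0 < f p q" by metis
  obtain I where I: "finite I" "UNIV \<subseteq> (\<Union>i\<in>I. V i)"
    using compactE_image[OF assms(1), of UNIV V] f(4,5) by (metis UNIV_I UN_I subsetI)
  define s where "s q = (\<Sum>i\<in>I. f i q)" for q
  have spos: "s q > 0" for q
  proof -
    obtain i where "i \<in> I" "q \<in> V i" using I by blast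
    then show ?thesis unfolding s_def using f(2,6) I(1) by (meson sum_pos2)
  qed
  have ss: "smooth_function A s" unfolding s_def[abs_def] by (rule smooth_function_sum[OF f(1)])
  show thesis
  proof (rule that[of I "\<lambda>i q. f i q / s q"])
    show "smooth_function A (\<lambda>q. f i q / s q)" for i
      using smooth_function_divide[OF f(1) ss] spos by (metis less_irrefl)
    show "0 \<le> f i p / s p" for i p using f(2) spos by (simp add: less_imp_le)
    show "closure {p. f i p / s p \<noteq> 0} \<subseteq> W i \<inter> fst (ch i)" for i
    proof -
      have "{p. f i p / s p \<noteq> 0} = {p. f i p \<noteq> 0}" using spos by (auto, metis less_irrefl)
      then show ?thesis using f(3) by auto
    qed
    show "(\<Sum>i\<in>I. f i p / s p) = 1" for p
      using spos[of p] by (simp add: sum_divide_distrib[symmetric] s_def)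
  qed (rule I)
qed

lemma exists_partition_of_unity:
  assumes "compact (UNIV :: 'a set)"
  shows "\<exists>F \<rho>. partition_of_unity A F \<rho>"
proof -
  have "\<forall>p. \<exists>c. c \<in> A \<and> p \<in> fst c" using chart_cover by blast
  then obtain ch where ch: "\<And>p. ch p \<in> A" "\<And>p. p \<in> fst (ch p)" by metis
  obtain I and \<rho> :: "'a \<Rightarrow> 'a \<Rightarrow> real" where I: "finite I"
    "\<And>i. i \<in> I \<Longrightarrow> smooth_function A (\<rho> i)" "\<And>i p. i \<in> I \<Longrightarrow> 0 \<le> \<rho> i p"
    "\<And>i. i \<in> I \<Longrightarrow> closure {p. \<rho> i p \<noteq> 0} \<subseteq> UNIV \<inter> fst (ch i)" "\<And>p. (\<Sum>i\<in>I. \<rho> i p) = 1"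
    by (rule exists_partition[OF assms ch(1) UNIV_I open_UNIV ch(2)], rule that)
  let ?\<rho> = "\<lambda>c p. \<Sum>i | i \<in> I \<and> ch i = c. \<rho> i p"
  have "partition_of_unity A (ch ` I) ?\<rho>"
    unfolding partition_of_unity_def
  proof (intro conjI ballI allI)
    show "ch ` I \<subseteq> A" using ch(1) by blast
    show "finite (ch ` I)" using I(1) by simp
    fix c assume "c \<in> ch ` I"
    show "smooth_function A (?\<rho> c)" by (rule smooth_function_sum) (use I(2) in blast)
    show "0 \<le> ?\<rho> c p" for p by (rule sum_nonneg) (use I(3) in blast)
    have "{p. ?\<rho> c p \<noteq> 0} \<subseteq> (\<Union>i\<in>{i\<in>I. ch i = c}. closure {p. \<rho> i p \<noteq> 0})" (is "_ \<subseteq> ?C")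
    proof
      fix p assume "p \<in> {p. ?\<rho> c p \<noteq> 0}"
      then obtain i where "i \<in> I" "ch i = c" "\<rho> i p \<noteq> 0" by (auto elim: sum.not_neutral_contains_not_neutral)
      moreover have "p \<in> closure {p. \<rho> i p \<noteq> 0}" using \<open>\<rho> i p \<noteq> 0\<close> closure_subset[of "{p. \<rho> i p \<noteq> 0}"] by auto
      ultimately show "p \<in> ?C" by blast
    qed
    moreover have "closed ?C" using I(1) by (intro closed_UN) auto
    ultimately have "closure {p. ?\<rho> c p \<noteq> 0} \<subseteq> ?C" by (rule closure_minimal)
    also have "?C \<subseteq> fst c" using I(4) by blast
    finally show "closure {p. ?\<rho> c p \<noteq> 0} \<subseteq> fst c" .
  next
    fix p
    have "(\<Sum>c\<in>ch ` I. ?\<rho> c p) = (\<Sum>i\<in>I. \<rho> i p)"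
      using sum.image_gen[OF I(1), of "\<lambda>i. \<rho> i p" ch] by simp
    then show "(\<Sum>c\<in>ch ` I. ?\<rho> c p) = 1" using I(5) by simp
  qed
  then show ?thesis by blast
qed

end

section \<open>Exterior algebra\<close>

definition contract :: "real^6 \<Rightarrow> cform \<Rightarrow> cform" where
  "contract v \<omega> = (\<lambda>vs. \<omega> (v # vs))"

definition hat :: "cform \<Rightarrow> cform" where
  "hat \<omega> = (\<lambda>vs. (-1) ^ length vs * \<omega> vs)"

definition degree_form :: "nat \<Rightarrow> cform \<Rightarrow> bool" where
  "degree_form k \<omega> \<longleftrightarrow> (\<forall>vs. length vs \<noteq> k \<longrightarrow> \<omega> vs = 0)"

definition neg :: "cform \<Rightarrow> cform" where
  "neg \<omega> = (\<lambda>vs. - \<omega> vs)"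

lemma wedge_Nil: "(\<omega> \<and>\<^sub>e \<eta>) [] = \<omega> [] * \<eta> []"
  by (simp add: wedge_def)

text \<open>The contraction with a vector is an antiderivation. This recursion reduces all algebraic
  identities of the wedge product to inductions on the list of arguments.\<close>

lemma wedge_Cons:
  "(\<omega> \<and>\<^sub>e \<eta>) (v # vs) = (contract v \<omega> \<and>\<^sub>e \<eta>) vs + (hat \<omega> \<and>\<^sub>e contract v \<eta>) vs"
proof -
  define n where "n = length vs"
  define inv where "inv m I = {(i, j). i \<in> I \<and> j \<in> {..<m} - I \<and> j < i}" for m and I :: "nat set"
  define g where "g I = (-1) ^ card (inv (Suc n) I) * \<omega> (nths (v # vs) I) * \<eta> (nths (v # vs) (- I))" for I
  have fin: "finite (inv n I)" if "I \<in> Pow {..<n}" for I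
    by (rule finite_subset[of _ "{..<n} \<times> {..<n}"]) (use that in \<open>auto simp: inv_def\<close>)
  have Pow: "Pow {..<Suc n} = image Suc ` Pow {..<n} \<union> insert 0 ` image Suc ` Pow {..<n}"
    unfolding lessThan_Suc_eq_insert_0 Pow_insert using image_Pow_surj[of Suc "{..<n}" "Suc ` {..<n}"] by simp
  have inj: "inj_on (image Suc) (Pow {..<n})" by (rule inj_on_subset[OF inj_on_image]) auto
  have inj': "inj_on (insert 0 \<circ> image Suc) (Pow {..<n})"
    by (intro inj_onI) (auto simp: set_eq_iff)
  have "(\<omega> \<and>\<^sub>e \<eta>) (v # vs) = sum g (Pow {..<Suc n})"
    by (simp add: wedge_def g_def inv_def n_def)
  also have "\<dots> = sum g (image Suc ` Pow {..<n}) + sum g (insert 0 ` image Suc ` Pow {..<n})"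
    unfolding Pow by (rule sum.union_disjoint) auto
  also have "sum g (image Suc ` Pow {..<n}) = (\<Sum>I\<in>Pow {..<n}. g (Suc ` I))"
    using sum.reindex[OF inj, of g] by simp
  also have "sum g (insert 0 ` image Suc ` Pow {..<n}) = (\<Sum>I\<in>Pow {..<n}. g (insert 0 (Suc ` I)))"
    using sum.reindex[OF inj', of g] by (simp add: image_comp)
  also have "(\<Sum>I\<in>Pow {..<n}. g (Suc ` I)) = (hat \<omega> \<and>\<^sub>e contract v \<eta>) vs"
  proof -
    have "g (Suc ` I) = (-1) ^ card (inv n I) * hat \<omega> (nths vs I) * contract v \<eta> (nths vs (- I))"
      if I: "I \<in> Pow {..<n}" for I
    proof -
      have "inv (Suc n) (Suc ` I) = map_prod Suc Suc ` inv n I \<union> (\<lambda>i. (Suc i, 0)) ` I"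
        by (auto simp: inv_def image_iff less_Suc_eq_0_disj)
      moreover have "card (map_prod Suc Suc ` inv n I \<union> (\<lambda>i. (Suc i, 0)) ` I) = card (inv n I) + card I"
      proof (subst card_Un_disjoint)
        show "card (map_prod Suc Suc ` inv n I) + card ((\<lambda>i. (Suc i, 0)) ` I) = card (inv n I) + card I"
          by (intro arg_cong2[where f = "(+)"] card_image) (auto simp: inj_on_def)
      qed (use fin[OF I] I finite_subset[of I "{..<n}"] in auto)
      moreover have "length (nths vs I) = card I"
        using I by (simp add: length_nths n_def) (rule arg_cong[where f = card], auto)
      moreover have "{j. j \<notin> I} = - I" by auto
      ultimately show ?thesis
        by (simp add: g_def nths_Cons hat_def contract_def power_add image_iff)
    qed
    then show ?thesis by (simp add: wedge_def n_def inv_def)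
  qed
  also have "(\<Sum>I\<in>Pow {..<n}. g (insert 0 (Suc ` I))) = (contract v \<omega> \<and>\<^sub>e \<eta>) vs"
  proof -
    have "g (insert 0 (Suc ` I)) = (-1) ^ card (inv n I) * contract v \<omega> (nths vs I) * \<eta> (nths vs (- I))"
      if I: "I \<in> Pow {..<n}" for I
    proof -
      have "inv (Suc n) (insert 0 (Suc ` I)) = map_prod Suc Suc ` inv n I"
        by (auto simp: inv_def image_iff less_Suc_eq_0_disj)
      moreover have "card (map_prod Suc Suc ` inv n I) = card (inv n I)"
        by (rule card_image) (auto simp: inj_on_def)
      moreover have "{j. j \<notin> I} = - I" by auto
      ultimately show ?thesis
        by (simp add: g_def nths_Cons contract_def image_iff)
    qed
    then show ?thesis by (simp add: wedge_def n_def inv_def)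
  qed
  finally show ?thesis by simp
qed

lemma wedge_linear_left:
  "((\<lambda>vs. a * \<omega> vs + b * \<omega>' vs) \<and>\<^sub>e \<eta>) vs = a * (\<omega> \<and>\<^sub>e \<eta>) vs + b * (\<omega>' \<and>\<^sub>e \<eta>) vs"
  by (simp add: wedge_def sum_distrib_left sum.distrib algebra_simps)

lemma wedge_linear_right:
  "(\<eta> \<and>\<^sub>e (\<lambda>vs. a * \<omega> vs + b * \<omega>' vs)) vs = a * (\<eta> \<and>\<^sub>e \<omega>) vs + b * (\<eta> \<and>\<^sub>e \<omega>') vs"
  by (simp add: wedge_def sum_distrib_left sum.distrib algebra_simps)

lemma wedge_scale_left: "((\<lambda>vs. a * \<omega> vs) \<and>\<^sub>e \<eta>) = (\<lambda>vs. a * (\<omega> \<and>\<^sub>e \<eta>) vs)"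
  using wedge_linear_left[of a \<omega> 0 \<omega> \<eta>] by (simp add: fun_eq_iff)

lemma wedge_scale_right: "(\<eta> \<and>\<^sub>e (\<lambda>vs. a * \<omega> vs)) = (\<lambda>vs. a * (\<eta> \<and>\<^sub>e \<omega>) vs)"
  using wedge_linear_right[of \<eta> a \<omega> 0 \<omega>] by (simp add: fun_eq_iff)

lemma wedge_zero_left: "((\<lambda>vs. 0) \<and>\<^sub>e \<eta>) = (\<lambda>vs. 0)"
  by (simp add: wedge_def)

lemma wedge_zero_right: "(\<eta> \<and>\<^sub>e (\<lambda>vs. 0)) = (\<lambda>vs. 0)"
  by (simp add: wedge_def)

lemma wedge_sum_left: "((\<lambda>vs. \<Sum>i\<in>I. \<omega> i vs) \<and>\<^sub>e \<eta>) vs = (\<Sum>i\<in>I. (\<omega> i \<and>\<^sub>e \<eta>) vs)"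
  unfolding wedge_def sum_distrib_left sum_distrib_right by (rule sum.swap)

lemma wedge_sum_right: "(\<eta> \<and>\<^sub>e (\<lambda>vs. \<Sum>i\<in>I. \<omega> i vs)) vs = (\<Sum>i\<in>I. (\<eta> \<and>\<^sub>e \<omega> i) vs)"
  unfolding wedge_def sum_distrib_left sum_distrib_right by (rule sum.swap)

lemma wedge_neg_left: "(neg \<omega> \<and>\<^sub>e \<eta>) = neg (\<omega> \<and>\<^sub>e \<eta>)"
  using wedge_scale_left[of "-1" \<omega> \<eta>] by (simp add: neg_def)

lemma wedge_neg_right: "(\<eta> \<and>\<^sub>e neg \<omega>) = neg (\<eta> \<and>\<^sub>e \<omega>)"
  using wedge_scale_right[of \<eta> "-1" \<omega>] by (simp add: neg_def)

lemma neg_neg [simp]: "neg (neg \<omega>) = \<omega>"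
  by (simp add: neg_def)

lemma wedge_add_left: "((\<lambda>vs. \<omega> vs + \<omega>' vs) \<and>\<^sub>e \<eta>) vs = (\<omega> \<and>\<^sub>e \<eta>) vs + (\<omega>' \<and>\<^sub>e \<eta>) vs"
  using wedge_linear_left[of 1 \<omega> 1 \<omega>' \<eta>] by simp

lemma wedge_add_right: "(\<eta> \<and>\<^sub>e (\<lambda>vs. \<omega> vs + \<omega>' vs)) vs = (\<eta> \<and>\<^sub>e \<omega>) vs + (\<eta> \<and>\<^sub>e \<omega>') vs"
  using wedge_linear_right[of \<eta> 1 \<omega> 1 \<omega>'] by simp

lemma contract_wedge:
  "contract v (\<omega> \<and>\<^sub>e \<eta>) = (\<lambda>vs. (contract v \<omega> \<and>\<^sub>e \<eta>) vs + (hat \<omega> \<and>\<^sub>e contract v \<eta>) vs)"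
  by (simp add: contract_def[of v "\<omega> \<and>\<^sub>e \<eta>"] wedge_Cons)

lemma contract_hat: "contract v (hat \<omega>) = neg (hat (contract v \<omega>))"
  by (simp add: contract_def hat_def neg_def)

lemma hat_wedge: "hat (\<omega> \<and>\<^sub>e \<eta>) = (hat \<omega> \<and>\<^sub>e hat \<eta>)"
proof
  fix vs show "hat (\<omega> \<and>\<^sub>e \<eta>) vs = (hat \<omega> \<and>\<^sub>e hat \<eta>) vs"
  proof (induction vs arbitrary: \<omega> \<eta>)
    case Nil
    then show ?case by (simp add: hat_def wedge_Nil)
  next
    case (Cons v vs)
    have "(hat \<omega> \<and>\<^sub>e hat \<eta>) (v # vs) = - hat (contract v \<omega> \<and>\<^sub>e \<eta>) vs - hat (hat \<omega> \<and>\<^sub>e contract v \<eta>) vs"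
      by (simp add: wedge_Cons contract_hat wedge_neg_left wedge_neg_right Cons.IH) (simp add: neg_def Cons.IH)
    then show ?case by (simp add: hat_def wedge_Cons algebra_simps)
  qed
qed

lemma wedge_assoc: "((\<omega> \<and>\<^sub>e \<eta>) \<and>\<^sub>e \<zeta>) = (\<omega> \<and>\<^sub>e (\<eta> \<and>\<^sub>e \<zeta>))"
proof
  fix vs show "((\<omega> \<and>\<^sub>e \<eta>) \<and>\<^sub>e \<zeta>) vs = (\<omega> \<and>\<^sub>e (\<eta> \<and>\<^sub>e \<zeta>)) vs"
    by (induction vs arbitrary: \<omega> \<eta> \<zeta>)
      (simp_all add: wedge_Nil wedge_Cons contract_wedge hat_wedge wedge_add_left wedge_add_right)
qed

lemma degree_contract: "degree_form (Suc k) \<omega> \<Longrightarrow> degree_form k (contract v \<omega>)"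
  by (simp add: degree_form_def contract_def)

lemma contract_degree_0: "degree_form 0 \<omega> \<Longrightarrow> contract v \<omega> = (\<lambda>vs. 0)"
  by (simp add: degree_form_def contract_def)

lemma hat_degree: "degree_form k \<omega> \<Longrightarrow> hat \<omega> = (\<lambda>vs. (-1) ^ k * \<omega> vs)"
  by (auto simp: degree_form_def hat_def fun_eq_iff)

lemma degree_wedge:
  assumes "degree_form p \<omega>" "degree_form q \<eta>"
  shows "degree_form (p + q) (\<omega> \<and>\<^sub>e \<eta>)"
  unfolding degree_form_def
proof (intro allI impI)
  fix vs :: "(real^6) list" assume "length vs \<noteq> p + q"
  moreover have "length vs = length (nths vs I) + length (nths vs (- I))" for I
  proof -
    have "card {i. i < length vs} = card ({i. i < length vs \<and> i \<in> I} \<union> {i. i < length vs \<and> i \<in> - I})"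
      by (rule arg_cong[where f = card]) auto
    also have "\<dots> = card {i. i < length vs \<and> i \<in> I} + card {i. i < length vs \<and> i \<in> - I}"
      by (rule card_Un_disjoint) auto
    finally show ?thesis by (simp add: length_nths)
  qed
  ultimately have "\<omega> (nths vs I) = 0 \<or> \<eta> (nths vs (- I)) = 0" for I
    using assms unfolding degree_form_def by metis
  then show "(\<omega> \<and>\<^sub>e \<eta>) vs = 0" unfolding wedge_def by (intro sum.neutral ballI) (simp add: mult.assoc)
qed

lemma degree_cnj: "degree_form k \<omega> \<Longrightarrow> degree_form k (cnj_form \<omega>)"
  by (simp add: degree_form_def cnj_form_def)

lemma wedge_commute_degree:
  "degree_form p \<omega> \<Longrightarrow> degree_form q \<eta> \<Longrightarrow> (\<eta> \<and>\<^sub>e \<omega>) vs = (-1) ^ (p * q) * (\<omega> \<and>\<^sub>e \<eta>) vs"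
proof (induction vs arbitrary: p q \<omega> \<eta>)
  case Nil
  show ?case
  proof (cases "p = 0 \<or> q = 0")
    case False
    then show ?thesis using Nil by (simp add: wedge_Nil degree_form_def)
  qed (auto simp: wedge_Nil)
next
  case (Cons v vs)
  have a: "(contract v \<eta> \<and>\<^sub>e \<omega>) vs = (-1) ^ p * ((-1) ^ (p * q) * (\<omega> \<and>\<^sub>e contract v \<eta>) vs)"
  proof (cases q)
    case 0
    then show ?thesis using contract_degree_0 Cons.prems by (simp add: wedge_zero_left wedge_zero_right)
  next
    case (Suc q')
    then show ?thesis using Cons.IH[OF Cons.prems(1) degree_contract, of q' \<eta> v] Cons.prems
      by (simp add: power_add mult.assoc[symmetric] power_mult_distrib[symmetric])
  qed
  have b: "(-1) ^ q * (\<eta> \<and>\<^sub>e contract v \<omega>) vs = (-1) ^ (p * q) * (contract v \<omega> \<and>\<^sub>e \<eta>) vs"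
  proof (cases p)
    case 0
    then show ?thesis using contract_degree_0 Cons.prems by (simp add: wedge_zero_left wedge_zero_right)
  next
    case (Suc p')
    then show ?thesis using Cons.IH[OF degree_contract Cons.prems(2), of p' \<omega> v] Cons.prems
      by (simp add: power_add mult.assoc[symmetric])
  qed
  show ?case
    unfolding wedge_Cons hat_degree[OF Cons.prems(1)] hat_degree[OF Cons.prems(2)] wedge_scale_left
    using a b by (simp add: algebra_simps)
qed

lemma wedge_anticommute_1:
  "degree_form 1 a \<Longrightarrow> degree_form 1 b \<Longrightarrow> (a \<and>\<^sub>e b) = neg (b \<and>\<^sub>e a)"
  using wedge_commute_degree[of 1 b 1 a] by (simp add: neg_def fun_eq_iff)

lemma wedge_swap_1:
  "degree_form 1 a \<Longrightarrow> degree_form 1 b \<Longrightarrow> (a \<and>\<^sub>e b \<and>\<^sub>e \<omega>) = neg (b \<and>\<^sub>e a \<and>\<^sub>e \<omega>)"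
  using wedge_anticommute_1[of a b] by (metis wedge_assoc wedge_neg_left)

lemma wedge_self: "degree_form 1 a \<Longrightarrow> (a \<and>\<^sub>e a) = (\<lambda>vs. 0)"
  using wedge_anticommute_1[of a a] by (simp add: neg_def fun_eq_iff)

lemma wedge_self_left: "degree_form 1 a \<Longrightarrow> (a \<and>\<^sub>e a \<and>\<^sub>e \<omega>) = (\<lambda>vs. 0)"
  using wedge_self[of a] wedge_assoc[of a a \<omega>] by (simp add: wedge_zero_left)

lemma wedge_unit: "(\<omega> \<and>\<^sub>e unit_form) = \<omega>"
proof
  fix vs show "(\<omega> \<and>\<^sub>e unit_form) vs = \<omega> vs"
  proof (induction vs arbitrary: \<omega>)
    case Nil
    then show ?case by (simp add: wedge_Nil unit_form_def)
  next
    case (Cons v vs)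
    have "contract v unit_form = (\<lambda>vs. 0)" by (simp add: contract_def unit_form_def)
    then show ?case by (simp add: wedge_Cons Cons.IH wedge_zero_right) (simp add: contract_def)
  qed
qed

lemma wedge_1:
  "degree_form 1 \<theta> \<Longrightarrow> (\<theta> \<and>\<^sub>e \<eta>) vs = (\<Sum>i<length vs. (-1) ^ i * \<theta> [vs ! i] * \<eta> (nths vs (- {i})))"
proof (induction vs arbitrary: \<eta>)
  case Nil
  then show ?case by (simp add: wedge_Nil degree_form_def)
next
  case (Cons v vs)
  have "(contract v \<theta> \<and>\<^sub>e \<eta>) vs = \<theta> [v] * \<eta> vs"
  proof -
    have "contract v \<theta> = (\<lambda>ws. \<theta> [v] * unit_form ws)"
      using Cons.prems by (auto simp: contract_def unit_form_def degree_form_def fun_eq_iff)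
    moreover have "(unit_form \<and>\<^sub>e \<eta>) vs = \<eta> vs"
    proof -
      have "(unit_form \<and>\<^sub>e \<eta>) vs = \<eta> vs" for \<eta>
      proof (induction vs arbitrary: \<eta>)
        case (Cons v vs)
        have "contract v unit_form = (\<lambda>vs. 0)" "hat unit_form = unit_form"
          by (auto simp: contract_def unit_form_def hat_def)
        then show ?case by (simp add: wedge_Cons Cons.IH wedge_zero_left) (simp add: contract_def)
      qed (simp add: wedge_Nil unit_form_def)
      then show ?thesis .
    qed
    ultimately show ?thesis by (simp add: wedge_scale_left)
  qed
  moreover have "(hat \<theta> \<and>\<^sub>e contract v \<eta>) vs = - (\<Sum>i<length vs. (-1) ^ i * \<theta> [vs ! i] * \<eta> (v # nths vs (- {i})))"
  proof -
    have "hat \<theta> = neg \<theta>" using hat_degree[OF Cons.prems] by (simp add: neg_def)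
    then show ?thesis
      using Cons.IH[OF Cons.prems, of "contract v \<eta>"] by (simp add: wedge_neg_left) (simp add: neg_def contract_def)
  qed
  moreover have "{j. Suc j \<in> - {0}} = UNIV" "{j. Suc j \<in> - {Suc i}} = - {i}" for i by auto
  moreover have "nths vs UNIV = vs" by (rule nths_all) simp
  ultimately show ?case
    unfolding wedge_Cons length_Cons sum.lessThan_Suc_shift
    by (simp add: nths_Cons sum_negf)
qed

lemma wedge_1_1: "degree_form 1 \<theta> \<Longrightarrow> (\<theta> \<and>\<^sub>e \<eta>) [u, v] = \<theta> [u] * \<eta> [v] - \<theta> [v] * \<eta> [u]"
  by (simp add: wedge_1 nths_Cons numeral_2_eq_2)

lemma cnj_form_wedge: "cnj_form (\<omega> \<and>\<^sub>e \<eta>) = (cnj_form \<omega> \<and>\<^sub>e cnj_form \<eta>)"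
  by (simp add: cnj_form_def wedge_def)

lemma cnj_form_cnj_form [simp]: "cnj_form (cnj_form \<omega>) = \<omega>"
  by (simp add: cnj_form_def)

lemma smooth_on_wedge:
  "open S \<Longrightarrow> (\<And>ws. smooth_on S (\<lambda>x. \<omega> x ws)) \<Longrightarrow> (\<And>ws. smooth_on S (\<lambda>x. \<eta> x ws)) \<Longrightarrow>
    smooth_on S (\<lambda>x. (\<omega> x \<and>\<^sub>e \<eta> x) vs)"
  unfolding wedge_def by (intro smooth_on_sum smooth_on_mult smooth_on_const)

lemma smooth_on_cnj_form:
  "open S \<Longrightarrow> (\<And>ws. smooth_on S (\<lambda>x. \<omega> x ws)) \<Longrightarrow> smooth_on S (\<lambda>x. cnj_form (\<omega> x) vs)"
  unfolding cnj_form_def by (intro smooth_on_cnj)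

subsection \<open>Alternating forms\<close>

lemma alt_form_degree: "alt_form k \<omega> \<Longrightarrow> degree_form k \<omega>"
  by (simp add: alt_form_def degree_form_def)

lemma alt_form_linear:
  assumes "alt_form k \<omega>"
  shows "linear (\<lambda>v. \<omega> (us @ v # ws))"
proof (cases "length us + Suc (length ws) = k")
  case True
  then have "linear (\<lambda>v. \<omega> ((us @ undefined # ws)[length us := v]))"
    using assms by (simp only: alt_form_def) (metis add_Suc_right less_add_Suc1 length_append list.size(4) add_0_right add.commute add_Suc)
  then show ?thesis by simp
next
  case False
  then have "(\<lambda>v. \<omega> (us @ v # ws)) = (\<lambda>v. 0)" using assms by (auto simp: alt_form_def)
  then show ?thesis by (simp add: linear_iff)
qed

lemma alt_form_repeat:
  assumes "alt_form k \<omega>"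
  shows "\<omega> (us @ v # ms @ v # ws) = 0"
proof (cases "length (us @ v # ms @ v # ws) = k")
  case True
  let ?vs = "us @ v # ms @ v # ws"
  have "?vs ! length us = ?vs ! (length us + Suc (length ms))"
    by (simp add: nth_append)
  moreover have "length us < length us + Suc (length ms)" "length us + Suc (length ms) < k"
    using True by auto
  ultimately show ?thesis using assms True unfolding alt_form_def by blast
qed (use assms in \<open>auto simp: alt_form_def\<close>)

lemma alternating_swap:
  fixes \<omega> :: cform
  assumes lin: "\<And>us ws. linear (\<lambda>v. \<omega> (us @ v # ws))" and adj: "\<And>us v ws. \<omega> (us @ v # v # ws) = 0"
  shows "\<omega> (us @ v # w # ws) = - \<omega> (us @ w # v # ws)"
proof -
  have l1: "\<omega> (us @ (a + b) # ws) = \<omega> (us @ a # ws) + \<omega> (us @ b # ws)" for us a b ws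
    using linear_add[OF lin] .
  have l2: "\<omega> (us @ x # (a + b) # ws) = \<omega> (us @ x # a # ws) + \<omega> (us @ x # b # ws)" for x a b
    using l1[of "us @ [x]" a b ws] by simp
  have "0 = \<omega> (us @ (v + w) # (v + w) # ws)" using adj by simp
  also have "\<dots> = \<omega> (us @ v # w # ws) + \<omega> (us @ w # v # ws)"
    by (simp only: l1 l2) (simp add: adj)
  finally show ?thesis by (simp add: eq_neg_iff_add_eq_0)
qed

lemma alt_formI:
  fixes \<omega> :: cform
  assumes deg: "degree_form k \<omega>" and lin: "\<And>us ws. linear (\<lambda>v. \<omega> (us @ v # ws))"
    and adj: "\<And>us v ws. \<omega> (us @ v # v # ws) = 0"
  shows "alt_form k \<omega>"
proof -
  have rep: "\<omega> (us @ v # ms @ v # ws) = 0" for us v ms ws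
  proof (induction ms arbitrary: us)
    case Nil
    then show ?case using adj by simp
  next
    case (Cons m ms)
    show ?case
      using alternating_swap[OF lin adj, of us v m "ms @ v # ws"] Cons.IH[of "us @ [m]"] by simp
  qed
  show ?thesis unfolding alt_form_def
  proof (intro conjI allI impI)
    fix vs :: "(real^6) list" assume "length vs \<noteq> k"
    then show "\<omega> vs = 0" using deg by (simp add: degree_form_def)
  next
    fix vs :: "(real^6) list" and i assume "length vs = k \<and> i < k"
    then show "linear (\<lambda>v. \<omega> (vs[i := v]))" using lin by (simp add: upd_conv_take_nth_drop)
  next
    fix vs :: "(real^6) list" and i j assume *: "length vs = k \<and> i < j \<and> j < k \<and> vs ! i = vs ! j"
    have "vs = take i vs @ vs ! i # drop (Suc i) vs" using * by (intro id_take_nth_drop) simp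
    moreover have "drop (Suc i) vs = take (j - Suc i) (drop (Suc i) vs) @ vs ! j # drop (Suc j) vs"
      using id_take_nth_drop[of "j - Suc i" "drop (Suc i) vs"] * by (simp add: diff_less_mono)
    ultimately show "\<omega> vs = 0" using rep * by metis
  qed
qed

lemma alt_form_iff:
  "alt_form k \<omega> \<longleftrightarrow> degree_form k \<omega> \<and> (\<forall>us ws. linear (\<lambda>v. \<omega> (us @ v # ws))) \<and> (\<forall>us v ws. \<omega> (us @ v # v # ws) = 0)"
  using alt_formI[of k \<omega>] alt_form_degree[of k \<omega>] alt_form_linear[of k \<omega>] alt_form_repeat[of k \<omega> _ _ "[]"] by auto

lemma linear_complex_combination:
  "linear f \<Longrightarrow> linear g \<Longrightarrow> linear (\<lambda>v. a * f v + b * g v :: complex)"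
  by (simp add: linear_iff algebra_simps scaleR_conv_of_real)

lemma linear_complex_scale: "linear f \<Longrightarrow> linear (\<lambda>v. a * f v :: complex)"
  using linear_complex_combination[of f f a 0] by simp

lemma wedge_multilinear:
  assumes "\<And>us ws. linear (\<lambda>v. \<omega> (us @ v # ws))" "\<And>us ws. linear (\<lambda>v. \<eta> (us @ v # ws))"
  shows "linear (\<lambda>v. (\<omega> \<and>\<^sub>e \<eta>) (us @ v # ws))"
  using assms
proof (induction us arbitrary: \<omega> \<eta>)
  case Nil
  have "linear (\<lambda>v. (contract v \<omega> \<and>\<^sub>e \<eta>) ws)"
    unfolding wedge_def contract_def using Nil.prems(1)[of "[]"]
    by (intro linear_compose_sum ballI) (simp add: linear_iff algebra_simps scaleR_conv_of_real)
  moreover have "linear (\<lambda>v. (hat \<omega> \<and>\<^sub>e contract v \<eta>) ws)"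
    unfolding wedge_def contract_def using Nil.prems(2)[of "[]"]
    by (intro linear_compose_sum ballI) (simp add: linear_iff algebra_simps scaleR_conv_of_real)
  ultimately show ?case by (simp add: wedge_Cons linear_compose_add)
next
  case (Cons u us)
  have "linear (\<lambda>v. hat \<omega> (us @ v # ws))" for us ws
    using linear_complex_scale[OF Cons.prems(1)[of us ws], of "(-1) ^ length (us @ undefined # ws)"]
    by (simp add: hat_def)
  moreover have "linear (\<lambda>v. contract u \<omega> (us @ v # ws))" "linear (\<lambda>v. contract u \<eta> (us @ v # ws))" for us ws
    using Cons.prems(1)[of "u # us" ws] Cons.prems(2)[of "u # us" ws] by (simp_all add: contract_def)
  ultimately show ?case
    using Cons.IH[of "contract u \<omega>" \<eta>] Cons.IH[of "hat \<omega>" "contract u \<eta>"] Cons.prems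
    by (simp add: wedge_Cons linear_compose_add)
qed

lemma wedge_adjacent:
  fixes \<omega> \<eta> :: cform
  assumes "\<And>us v ws. \<omega> (us @ v # v # ws) = 0" "\<And>us v ws. \<eta> (us @ v # v # ws) = 0"
  shows "(\<omega> \<and>\<^sub>e \<eta>) (us @ v # v # ws) = 0"
  using assms
proof (induction us arbitrary: \<omega> \<eta>)
  case Nil
  have "contract v (contract v \<omega>) = (\<lambda>vs. 0)" "contract v (contract v \<eta>) = (\<lambda>vs. 0)"
    using Nil.prems(1)[of "[]"] Nil.prems(2)[of "[]"] by (simp_all add: contract_def)
  then show ?case
    by (simp add: wedge_Cons wedge_zero_left wedge_zero_right contract_hat wedge_neg_left) (simp add: neg_def)
next
  case (Cons u us)
  have "hat \<omega> (us @ v # v # ws) = 0" for us v ws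
    using Cons.prems(1) by (simp add: hat_def)
  moreover have "contract u \<omega> (us @ v # v # ws) = 0" "contract u \<eta> (us @ v # v # ws) = 0" for us v ws
    using Cons.prems(1)[of "u # us"] Cons.prems(2)[of "u # us"] by (simp_all add: contract_def)
  ultimately show ?case
    using Cons.IH[of "contract u \<omega>" \<eta>] Cons.IH[of "hat \<omega>" "contract u \<eta>"] Cons.prems
    by (simp add: wedge_Cons)
qed

lemma alt_form_wedge:
  assumes "alt_form p \<omega>" "alt_form q \<eta>"
  shows "alt_form (p + q) (\<omega> \<and>\<^sub>e \<eta>)"
proof (rule alt_formI)
  show "degree_form (p + q) (\<omega> \<and>\<^sub>e \<eta>)"
    using degree_wedge alt_form_degree assms by blast
  show "linear (\<lambda>v. (\<omega> \<and>\<^sub>e \<eta>) (us @ v # ws))" for us ws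
    by (rule wedge_multilinear) (use assms alt_form_linear in auto)
  show "(\<omega> \<and>\<^sub>e \<eta>) (us @ v # v # ws) = 0" for us v ws
    by (rule wedge_adjacent) (use assms alt_form_repeat[of _ _ _ _ "[]"] in auto)
qed

lemma alt_form_combination:
  assumes "alt_form k \<omega>" "alt_form k \<eta>"
  shows "alt_form k (\<lambda>vs. a * \<omega> vs + b * \<eta> vs)"
  using assms unfolding alt_form_iff degree_form_def by (auto intro: linear_complex_combination)

lemma alt_form_scale: "alt_form k \<omega> \<Longrightarrow> alt_form k (\<lambda>vs. a * \<omega> vs)"
  using alt_form_combination[of k \<omega> \<omega> a 0] by simp

lemma alt_form_cnj: "alt_form k \<omega> \<Longrightarrow> alt_form k (cnj_form \<omega>)"
  unfolding alt_form_iff degree_form_def cnj_form_def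
  using linear_compose[of _ cnj, unfolded o_def] linear_cnj by auto

lemma alt_form_1I: "(\<And>vs. length vs \<noteq> 1 \<Longrightarrow> \<theta> vs = 0) \<Longrightarrow> linear (\<lambda>v. \<theta> [v]) \<Longrightarrow> alt_form 1 \<theta>"
proof (rule alt_formI)
  assume *: "\<And>vs. length vs \<noteq> 1 \<Longrightarrow> \<theta> vs = 0" "linear (\<lambda>v. \<theta> [v])"
  show "linear (\<lambda>v. \<theta> (us @ v # ws))" for us ws
  proof (cases "us = [] \<and> ws = []")
    case False
    then have "(\<lambda>v. \<theta> (us @ v # ws)) = (\<lambda>v. 0)" using *(1) by (intro ext *(1)) auto
    then show ?thesis by (simp add: linear_iff)
  qed (use * in auto)
qed (auto simp: degree_form_def)

lemma alt_form_1_linear: "alt_form 1 \<theta> \<Longrightarrow> linear (\<lambda>v. \<theta> [v])"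
  using alt_form_linear[of 1 \<theta> "[]" "[]"] by simp

lemma alt_form_move:
  assumes "alt_form k \<omega>"
  shows "\<omega> (us @ ms @ v # ws) = \<omega> (us @ v # ms @ ws) \<or> \<omega> (us @ ms @ v # ws) = - \<omega> (us @ v # ms @ ws)"
proof (induction ms arbitrary: us)
  case (Cons m ms)
  have "\<omega> (us @ m # v # ms @ ws) = - \<omega> (us @ v # m # ms @ ws)"
    by (rule alternating_swap[OF alt_form_linear[OF assms] alt_form_repeat[OF assms, of _ _ "[]", simplified]])
  then show ?case using Cons[of "us @ [m]"] by auto
qed simp

lemma alt_form_permutation:
  assumes "alt_form k \<omega>" "mset xs = mset ys"
  shows "\<omega> (us @ xs) = \<omega> (us @ ys) \<or> \<omega> (us @ xs) = - \<omega> (us @ ys)"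
  using assms(2)
proof (induction xs arbitrary: us ys)
  case (Cons x xs)
  then have "x \<in> set ys" by (metis list.set_intros(1) set_mset_mset)
  then obtain ms ws where ys: "ys = ms @ x # ws" by (auto simp: in_set_conv_decomp)
  then have "mset xs = mset (ms @ ws)" using Cons.prems by simp
  from Cons.IH[OF this, of "us @ [x]"] alt_form_move[OF assms(1), of us ms x ws]
  show ?case unfolding ys by auto
qed simp

lemma exhaust_6:
  fixes x :: 6
  shows "x = 1 \<or> x = 2 \<or> x = 3 \<or> x = 4 \<or> x = 5 \<or> x = 6"
proof (induct x)
  case (of_int z)
  then have "z = 0 \<or> z = 1 \<or> z = 2 \<or> z = 3 \<or> z = 4 \<or> z = 5" by auto
  then show ?case by auto
qed

lemma set_std_basis: "set std_basis = Basis"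
proof -
  have "\<exists>i. b = axis i 1" if "b \<in> Basis" for b :: "real^6"
    using that by (auto simp: Basis_vec_def)
  then show ?thesis
    using exhaust_6 by (auto simp: std_basis_def axis_in_Basis_iff) metis
qed

lemma length_std_basis [simp]: "length std_basis = 6"
  by (simp add: std_basis_def)

lemma distinct_std_basis: "distinct std_basis"
  by (rule card_distinct) (simp add: set_std_basis)

lemma alt_form_6_eq_0:
  assumes "alt_form 6 \<omega>" "\<omega> std_basis = 0"
  shows "\<omega> vs = 0"
proof -
  have basis: "\<omega> vs = 0" if "set vs \<subseteq> Basis" "length vs = 6" for vs
  proof (cases "distinct vs")
    case True
    then have "card (set vs) = card (Basis :: (real^6) set)" using that by (simp add: distinct_card)
    then have "set vs = set std_basis" using that by (simp add: card_subset_eq set_std_basis)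
    then have "mset vs = mset std_basis" using True distinct_std_basis set_eq_iff_mset_eq_distinct by blast
    then show ?thesis using alt_form_permutation[OF assms(1), of vs std_basis "[]"] assms(2) by auto
  next
    case False
    then obtain xs ys zs y where "vs = xs @ [y] @ ys @ [y] @ zs" using not_distinct_decomp by blast
    then show ?thesis using alt_form_repeat[OF assms(1)] by simp
  qed
  have "\<omega> (us @ vs) = 0" if "set vs \<subseteq> Basis" "length us + length vs = 6" for us vs
    using that
  proof (induction us arbitrary: vs rule: rev_induct)
    case Nil
    then show ?case using basis by simp
  next
    case (snoc u us)
    have lin: "linear (\<lambda>v. \<omega> (us @ v # vs))" by (rule alt_form_linear[OF assms(1)])
    have "\<omega> (us @ u # vs) = (\<Sum>b\<in>Basis. (u \<bullet> b) *\<^sub>R \<omega> (us @ b # vs))"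
      using linear_sum[OF lin, of "\<lambda>b. (u \<bullet> b) *\<^sub>R b" Basis] linear_cmul[OF lin]
      by (simp add: euclidean_representation)
    also have "\<dots> = 0"
      by (intro sum.neutral ballI) (use snoc.IH snoc.prems in \<open>auto simp: subset_iff\<close>)
    finally show ?case by simp
  qed
  from this[of "[]" vs] this[of "vs" "[]"] show ?thesis
    using assms(1) by (cases "length vs = 6") (auto simp: alt_form_def)
qed

definition basis_pos :: "6 \<Rightarrow> nat" where
  "basis_pos i = (THE n. n < 6 \<and> std_basis ! n = axis i 1)"

lemma basis_pos: "basis_pos i < 6" "std_basis ! basis_pos i = axis i 1"
proof -
  have "axis i 1 \<in> set std_basis" by (simp add: set_std_basis axis_in_Basis_iff)
  then obtain n where "n < 6 \<and> std_basis ! n = axis i 1" by (auto simp: in_set_conv_nth)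
  moreover have "m = n" if "m < 6 \<and> std_basis ! m = axis i 1" "n < 6 \<and> std_basis ! n = axis i 1" for m n
    using that distinct_std_basis by (metis length_std_basis nth_eq_iff_index_eq)
  ultimately have "basis_pos i < 6 \<and> std_basis ! basis_pos i = axis i 1"
    unfolding basis_pos_def by (metis (mono_tags, lifting) theI)
  then show "basis_pos i < 6" "std_basis ! basis_pos i = axis i 1" by auto
qed

lemma inj_basis_pos: "basis_pos i = basis_pos j \<longleftrightarrow> i = j"
  using basis_pos(2) by (metis axis_eq_axis zero_neq_one)

lemma basis_pos_surj: "n < 6 \<Longrightarrow> \<exists>i. basis_pos i = n"
proof -
  assume n: "n < 6"
  have "card (range basis_pos) = 6"
    by (subst card_image) (auto simp: inj_on_def inj_basis_pos)
  then have "range basis_pos = {..<6}"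
    using basis_pos(1) by (intro card_subset_eq) auto
  then show ?thesis using n by (metis (no_types, lifting) imageE lessThan_iff)
qed

definition det_form :: cform where
  "det_form vs = (if length vs = 6 then complex_of_real (det (\<chi> i. vs ! basis_pos i)) else 0)"

lemma alt_form_det: "alt_form 6 det_form"
  unfolding alt_form_def
proof (intro conjI allI impI)
  fix vs :: "(real^6) list" and p :: nat assume p: "length vs = 6 \<and> p < 6"
  then obtain k where k: "basis_pos k = p" using basis_pos_surj by blast
  have e: "(\<chi> i. vs[p := v] ! basis_pos i) = (\<chi> i. if i = k then v else vs ! basis_pos i)" for v
    using p k inj_basis_pos basis_pos(1) by (auto simp: vec_eq_iff nth_list_update)
  show "linear (\<lambda>v. det_form (vs[p := v]))"
  proof (rule linearI)
    fix u v show "det_form (vs[p := u + v]) = det_form (vs[p := u]) + det_form (vs[p := v])"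
      using p det_row_add[of k "\<lambda>_. u" "\<lambda>_. v" "\<lambda>i. vs ! basis_pos i"] by (simp add: det_form_def e)
  next
    fix r v show "det_form (vs[p := r *\<^sub>R v]) = r *\<^sub>R det_form (vs[p := v])"
      using p det_row_mul[of k r "\<lambda>_. v" "\<lambda>i. vs ! basis_pos i"]
      by (simp add: det_form_def e scaleR_conv_of_real[of _ "complex_of_real _"] scalar_mult_eq_scaleR[symmetric])
  qed
next
  fix vs :: "(real^6) list" and p q :: nat assume pq: "length vs = 6 \<and> p < q \<and> q < 6 \<and> vs ! p = vs ! q"
  then obtain k l where "basis_pos k = p" "basis_pos l = q" using basis_pos_surj by (metis less_trans)
  then show "det_form vs = 0"
    using pq det_identical_rows[of k l "\<chi> i. vs ! basis_pos i"] by (auto simp: det_form_def row_def vec_eq_iff)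
qed (simp add: det_form_def)

lemma det_form_map:
  assumes "linear T"
  shows "det_form (map T std_basis) = complex_of_real (det (matrix T))"
proof -
  have "(\<chi> i. map T std_basis ! basis_pos i) = transpose (matrix T)"
    by (simp add: vec_eq_iff transpose_def matrix_def basis_pos)
  then show ?thesis by (simp add: det_form_def)
qed

lemma alt_form_6_det:
  assumes "alt_form 6 \<omega>"
  shows "\<omega> vs = det_form vs * \<omega> std_basis"
proof -
  have "det_form std_basis = 1"
    using det_form_map[of id] by (simp add: linear_id matrix_id_mat_1)
  then show ?thesis
    using alt_form_6_eq_0[OF alt_form_combination[OF assms alt_form_det, of 1 "- \<omega> std_basis"], of vs]
    by (simp add: algebra_simps)
qed

lemma alt_form_6_map:
  assumes "alt_form 6 \<omega>" "linear T"
  shows "\<omega> (map T std_basis) = complex_of_real (det (matrix T)) * \<omega> std_basis"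
  using alt_form_6_det[OF assms(1)] det_form_map[OF assms(2)] by metis

section \<open>Complex coframes at a point\<close>

lemmas scaleR_complex = scaleR_conv_of_real[where 'a = complex]

text \<open>A real vector space element is recovered from its complex coordinates: the pair
  \<open>f, j\<close> below plays the role of the complex frame \<open>e\<^sub>k = (f\<^sub>k - \<i> j f\<^sub>k)/2\<close> dual to \<open>\<theta>\<close>.\<close>

locale coframe =
  fixes j :: "real^6 \<Rightarrow> real^6" and \<theta> :: "3 \<Rightarrow> cform"
  assumes linear_j: "linear j" and j_j: "j (j v) = - v"
    and type10: "type10 j (\<theta> i)"
    and independent: "(\<And>vs. (\<Sum>i\<in>UNIV. z i * \<theta> i vs) = 0) \<Longrightarrow> z i = 0"
begin

lemma alt_\<theta>: "alt_form 1 (\<theta> i)"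
  using type10 by (simp add: type10_def)

lemma linear_\<theta>: "linear (\<lambda>v. \<theta> i [v])"
  by (rule alt_form_1_linear[OF alt_\<theta>])

lemma \<theta>_j: "\<theta> i [j v] = \<i> * \<theta> i [v]"
  using type10 by (simp add: type10_def)

lemma degree_\<theta>: "degree_form 1 (\<theta> i)"
  by (rule alt_form_degree[OF alt_\<theta>])

definition coords :: "real^6 \<Rightarrow> complex^3" where
  "coords v = (\<chi> i. \<theta> i [v])"

lemma linear_coords: "linear coords"
  using linear_\<theta> by (simp add: coords_def linear_iff vec_eq_iff)

lemma surj_coords: "surj coords"
proof (rule ccontr)
  assume "\<not> surj coords"
  then have "span (range coords) \<noteq> UNIV"
    using linear_subspace_image[OF linear_coords subspace_UNIV] by (metis span_eq_iff)
  then obtain w where w: "w \<noteq> 0" "\<And>u. u \<in> span (range coords) \<Longrightarrow> w \<bullet> u = 0"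
    using span_not_UNIV_orthogonal by blast
  have re: "Re (\<Sum>i\<in>UNIV. cnj (w $ i) * \<theta> i [v]) = 0" for v
    using w(2)[of "coords v"] span_base[of "coords v" "range coords"]
    by (simp add: inner_vec_def coords_def inner_complex_def sum_subtractf[symmetric] sum_negf[symmetric])
  have "(\<Sum>i\<in>UNIV. cnj (w $ i) * \<theta> i [j v]) = \<i> * (\<Sum>i\<in>UNIV. cnj (w $ i) * \<theta> i [v])" for v
    by (simp add: \<theta>_j sum_distrib_left algebra_simps)
  then have "Im (\<Sum>i\<in>UNIV. cnj (w $ i) * \<theta> i [v]) = 0" for v
    using re[of "j v"] by (simp del: Re_sum Im_sum)
  then have eq0: "(\<Sum>i\<in>UNIV. cnj (w $ i) * \<theta> i [v]) = 0" for v
    using re[of v] by (intro complex_eqI) (simp_all del: Re_sum Im_sum)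
  have "(\<Sum>i\<in>UNIV. cnj (w $ i) * \<theta> i vs) = 0" for vs
  proof (cases "length vs = 1")
    case True
    then show ?thesis using eq0 by (auto simp: length_Suc_conv)
  next
    case False
    then show ?thesis using degree_\<theta> by (simp add: degree_form_def)
  qed
  then have "cnj (w $ i) = 0" for i by (rule independent)
  then show False using w(1) by (simp add: vec_eq_iff)
qed

lemma inj_coords: "inj coords"
  by (rule linear_surjective_imp_injective[OF linear_coords surj_coords]) simp

definition f :: "3 \<Rightarrow> real^6" where
  "f k = (SOME v. coords v = axis k 1)"

lemma \<theta>_f: "\<theta> i [f k] = (if i = k then 1 else 0)"
proof -
  have "coords (f k) = axis k 1"
    unfolding f_def using surj_coords by (metis (mono_tags, lifting) someI_ex surjD)
  then have "coords (f k) $ i = axis k 1 $ i" by simp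
  then show ?thesis by (simp add: coords_def axis_def)
qed

lemma expand_vector: "v = (\<Sum>k\<in>UNIV. Re (\<theta> k [v]) *\<^sub>R f k + Im (\<theta> k [v]) *\<^sub>R j (f k))"
proof -
  let ?w = "\<Sum>k\<in>UNIV. Re (\<theta> k [v]) *\<^sub>R f k + Im (\<theta> k [v]) *\<^sub>R j (f k)"
  have "\<theta> i [?w] = \<theta> i [v]" for i
  proof -
    have "\<theta> i [?w] = (\<Sum>k\<in>UNIV. complex_of_real (Re (\<theta> k [v])) * \<theta> i [f k] + complex_of_real (Im (\<theta> k [v])) * (\<i> * \<theta> i [f k]))"
      by (simp add: linear_sum[OF linear_\<theta>] linear_add[OF linear_\<theta>] linear_cmul[OF linear_\<theta>] \<theta>_j scaleR_complex)
    also have "\<dots> = (\<Sum>k\<in>UNIV. if k = i then \<theta> k [v] else 0)"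
      by (intro sum.cong refl) (auto simp: \<theta>_f complex_eq_iff)
    finally show ?thesis by simp
  qed
  then have "coords v = coords ?w" by (simp add: coords_def)
  then show ?thesis using inj_coords by (simp add: inj_eq)
qed

lemma linear_expand:
  fixes g :: "real^6 \<Rightarrow> complex"
  assumes "linear g"
  shows "g v = (\<Sum>k\<in>UNIV. of_real (Re (\<theta> k [v])) * g (f k) + of_real (Im (\<theta> k [v])) * g (j (f k)))"
proof -
  have "g v = g (\<Sum>k\<in>UNIV. Re (\<theta> k [v]) *\<^sub>R f k + Im (\<theta> k [v]) *\<^sub>R j (f k))"
    using expand_vector[of v] by simp
  then show ?thesis
    by (simp only: linear_sum[OF assms] linear_add[OF assms] linear_cmul[OF assms] scaleR_complex)
qed

text \<open>The complex linear extension of a real linear map at \<open>e\<^sub>k\<close> and at its conjugate.\<close>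

definition ev :: "(real^6 \<Rightarrow> complex) \<Rightarrow> 3 \<Rightarrow> complex" where
  "ev g k = (g (f k) - \<i> * g (j (f k))) / 2"

definition evc :: "(real^6 \<Rightarrow> complex) \<Rightarrow> 3 \<Rightarrow> complex" where
  "evc g k = (g (f k) + \<i> * g (j (f k))) / 2"

lemma expand_ev:
  assumes "linear g"
  shows "g v = (\<Sum>k\<in>UNIV. \<theta> k [v] * ev g k + cnj (\<theta> k [v]) * evc g k)"
  unfolding linear_expand[OF assms, of v]
  by (intro sum.cong refl) (simp add: ev_def evc_def complex_eq_iff field_simps)

lemma expand_10:
  fixes g :: "real^6 \<Rightarrow> complex"
  assumes "linear g" "\<And>v. g (j v) = \<i> * g v"
  shows "g v = (\<Sum>k\<in>UNIV. \<theta> k [v] * g (f k))"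
  unfolding linear_expand[OF assms(1), of v]
  by (intro sum.cong refl) (simp add: assms(2) complex_eq_iff field_simps)

lemma expand_01:
  fixes g :: "real^6 \<Rightarrow> complex"
  assumes "linear g" "\<And>v. g (j v) = - \<i> * g v"
  shows "g v = (\<Sum>k\<in>UNIV. cnj (\<theta> k [v]) * g (f k))"
  unfolding linear_expand[OF assms(1), of v]
  by (intro sum.cong refl) (simp add: assms(2) complex_eq_iff field_simps)

lemma one_form_expand:
  assumes "alt_form 1 \<mu>"
  shows "\<mu> = (\<lambda>vs. \<Sum>k\<in>UNIV. ev (\<lambda>v. \<mu> [v]) k * \<theta> k vs + evc (\<lambda>v. \<mu> [v]) k * cnj_form (\<theta> k) vs)"
proof
  fix vs
  show "\<mu> vs = (\<Sum>k\<in>UNIV. ev (\<lambda>v. \<mu> [v]) k * \<theta> k vs + evc (\<lambda>v. \<mu> [v]) k * cnj_form (\<theta> k) vs)"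
  proof (cases "length vs = 1")
    case True
    then obtain v where "vs = [v]" by (auto simp: length_Suc_conv)
    then show ?thesis using expand_ev[OF alt_form_1_linear[OF assms], of v]
      by (simp add: cnj_form_def mult.commute)
  next
    case False
    then show ?thesis using degree_\<theta> alt_form_degree[OF assms] by (simp add: degree_form_def cnj_form_def)
  qed
qed

end

subsection \<open>Volume forms of a coframe\<close>

lemma vol3_swap:
  assumes "\<And>i. degree_form 1 (\<theta> i)"
  shows "(\<theta> k \<and>\<^sub>e vol3 \<theta>) = (\<lambda>_. 0)"
proof -
  note d = assms
  have "(\<theta> 2 \<and>\<^sub>e \<theta> 1 \<and>\<^sub>e \<theta> 2 \<and>\<^sub>e \<theta> 3) = (\<lambda>_. 0)"
    using wedge_swap_1[OF d[of 2] d[of 1], of "\<theta> 2 \<and>\<^sub>e \<theta> 3"] wedge_self_left[OF d[of 2]]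
    by (simp add: wedge_zero_right) (simp add: neg_def)
  moreover have "(\<theta> 3 \<and>\<^sub>e \<theta> 1 \<and>\<^sub>e \<theta> 2 \<and>\<^sub>e \<theta> 3) = (\<lambda>_. 0)"
    using wedge_swap_1[OF d[of 3] d[of 1], of "\<theta> 2 \<and>\<^sub>e \<theta> 3"] wedge_swap_1[OF d[of 3] d[of 2], of "\<theta> 3"]
      wedge_self[OF d[of 3]]
    by (simp add: wedge_zero_right wedge_neg_right) (simp add: neg_def)?
  ultimately show ?thesis
    using wedge_self_left[OF d[of 1]] exhaust_3[of k] by (auto simp: vol3_def)
qed

lemma cnj2_eq: "cnj2 \<theta> m = (if m = 1 then cnj_form (\<theta> 2) \<and>\<^sub>e cnj_form (\<theta> 3)
    else if m = 2 then cnj_form (\<theta> 3) \<and>\<^sub>e cnj_form (\<theta> 1) else cnj_form (\<theta> 1) \<and>\<^sub>e cnj_form (\<theta> 2))"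
  by (simp add: cnj2_def cnj_form_wedge)

lemma cnj_wedge_cnj2:
  assumes "\<And>i. degree_form 1 (\<theta> i)"
  shows "(cnj_form (\<theta> l) \<and>\<^sub>e cnj2 \<theta> m) = (if l = m then cnj_form (vol3 \<theta>) else (\<lambda>_. 0))"
proof -
  define \<beta> where "\<beta> i = cnj_form (\<theta> i)" for i
  have d: "degree_form 1 (\<beta> i)" for i using degree_cnj[OF assms] by (simp add: \<beta>_def)
  have s: "(\<beta> 2 \<and>\<^sub>e \<beta> 3 \<and>\<^sub>e \<beta> 1) = (\<beta> 1 \<and>\<^sub>e \<beta> 2 \<and>\<^sub>e \<beta> 3)" "(\<beta> 3 \<and>\<^sub>e \<beta> 1 \<and>\<^sub>e \<beta> 2) = (\<beta> 1 \<and>\<^sub>e \<beta> 2 \<and>\<^sub>e \<beta> 3)"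
    using wedge_anticommute_1[OF d[of 3] d[of 1]] wedge_swap_1[OF d[of 2] d[of 1], of "\<beta> 3"]
      wedge_anticommute_1[OF d[of 3] d[of 2]] wedge_swap_1[OF d[of 3] d[of 1], of "\<beta> 2"]
    by (simp_all add: wedge_neg_right)
  have t: "(\<beta> a \<and>\<^sub>e \<beta> b \<and>\<^sub>e \<beta> a) = (\<lambda>_. 0)" for a b
    using wedge_swap_1[OF d[of a] d[of b], of "\<beta> a"] wedge_self[OF d[of a]]
    by (simp add: wedge_zero_right) (simp add: neg_def)
  have u: "(\<beta> a \<and>\<^sub>e \<beta> a \<and>\<^sub>e \<beta> b) = (\<lambda>_. 0)" for a b
    by (rule wedge_self_left[OF d])
  show ?thesis
    using exhaust_3[of l] exhaust_3[of m] s t u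
    by (auto simp: cnj2_eq vol3_def cnj_form_wedge \<beta>_def[symmetric])
qed

lemma degree_vol3: "(\<And>i. degree_form 1 (\<theta> i)) \<Longrightarrow> degree_form 3 (vol3 \<theta>)"
  using degree_wedge[OF _ degree_wedge, of 1 "\<theta> 1" 1 "\<theta> 2" 1 "\<theta> 3"] by (simp add: vol3_def numeral_3_eq_3)

lemma alt_vol3: "(\<And>i. alt_form 1 (\<theta> i)) \<Longrightarrow> alt_form 3 (vol3 \<theta>)"
  using alt_form_wedge[OF _ alt_form_wedge, of 1 "\<theta> 1" 1 "\<theta> 2" 1 "\<theta> 3"] by (simp add: vol3_def numeral_3_eq_3)

lemma alt_cnj2: "(\<And>i. alt_form 1 (\<theta> i)) \<Longrightarrow> alt_form 2 (cnj2 \<theta> m)"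
  using alt_form_cnj[OF alt_form_wedge[of 1 _ 1]] by (simp add: cnj2_def numeral_2_eq_2)

lemma alt_Omega: "(\<And>i. alt_form 1 (\<theta> i)) \<Longrightarrow> alt_form 6 (Omega \<theta>)"
  using alt_form_scale[OF alt_form_wedge[OF alt_vol3 alt_form_cnj[OF alt_vol3]], of \<theta> \<theta> "\<i> / 8"]
  by (simp add: Omega_def)

lemma cnj_Omega:
  assumes "\<And>i. degree_form 1 (\<theta> i)"
  shows "cnj (Omega \<theta> vs) = Omega \<theta> vs"
proof -
  have "cnj ((vol3 \<theta> \<and>\<^sub>e cnj_form (vol3 \<theta>)) vs) = (cnj_form (vol3 \<theta>) \<and>\<^sub>e vol3 \<theta>) vs"
    using cnj_form_wedge[of "vol3 \<theta>" "cnj_form (vol3 \<theta>)"] by (simp add: cnj_form_def fun_eq_iff)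
  also have "\<dots> = - (vol3 \<theta> \<and>\<^sub>e cnj_form (vol3 \<theta>)) vs"
    using wedge_commute_degree[OF degree_vol3 degree_cnj[OF degree_vol3], of \<theta> \<theta> vs] assms by simp
  finally show ?thesis by (simp add: Omega_def)
qed

context coframe
begin

definition dual :: "3 \<Rightarrow> cform" where
  "dual k = (\<lambda>vs. - \<i> / 8 * (vol3 \<theta> \<and>\<^sub>e cnj2 \<theta> k) vs)"

lemma alt_dual: "alt_form 5 (dual k)"
  using alt_form_scale[OF alt_form_wedge[OF alt_vol3 alt_cnj2, of \<theta> \<theta> k], of "- \<i> / 8"] alt_\<theta>
  by (simp add: dual_def)

lemma \<theta>_dual: "(\<theta> l \<and>\<^sub>e dual k) = (\<lambda>_. 0)"
proof -
  have "(\<theta> l \<and>\<^sub>e vol3 \<theta> \<and>\<^sub>e cnj2 \<theta> k) = (\<lambda>_. 0)"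
    unfolding wedge_assoc[symmetric] vol3_swap[of \<theta> l, OF degree_\<theta>] by (rule wedge_zero_left)
  then show ?thesis unfolding dual_def wedge_scale_right by simp
qed

lemma cnj_\<theta>_dual: "(cnj_form (\<theta> l) \<and>\<^sub>e dual k) = (if l = k then Omega \<theta> else (\<lambda>_. 0))"
proof -
  have "(cnj_form (\<theta> l) \<and>\<^sub>e vol3 \<theta>) = neg (vol3 \<theta> \<and>\<^sub>e cnj_form (\<theta> l))"
    using wedge_commute_degree[OF degree_vol3[OF degree_\<theta>] degree_cnj[OF degree_\<theta>], of l]
    by (simp add: neg_def fun_eq_iff)
  then have E: "(cnj_form (\<theta> l) \<and>\<^sub>e vol3 \<theta> \<and>\<^sub>e cnj2 \<theta> k) =
      neg (vol3 \<theta> \<and>\<^sub>e (if l = k then cnj_form (vol3 \<theta>) else (\<lambda>_. 0)))"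
    by (simp only: cnj_wedge_cnj2[of \<theta> l k, OF degree_\<theta>, symmetric] wedge_assoc[symmetric] wedge_neg_left[symmetric])
  show ?thesis
    unfolding dual_def wedge_scale_right E
    by (simp add: wedge_zero_right Omega_def neg_def)
qed

lemma one_form_wedge:
  assumes "alt_form 1 \<mu>"
  shows "(\<mu> \<and>\<^sub>e \<eta>) vs = (\<Sum>k\<in>UNIV. ev (\<lambda>v. \<mu> [v]) k * (\<theta> k \<and>\<^sub>e \<eta>) vs + evc (\<lambda>v. \<mu> [v]) k * (cnj_form (\<theta> k) \<and>\<^sub>e \<eta>) vs)"
  by (subst one_form_expand[OF assms]) (simp only: wedge_sum_left wedge_linear_left)

lemma one_form_wedge_dual:
  assumes "alt_form 1 \<mu>"
  shows "(\<mu> \<and>\<^sub>e dual k) vs = evc (\<lambda>v. \<mu> [v]) k * Omega \<theta> vs"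
  unfolding one_form_wedge[OF assms] \<theta>_dual cnj_\<theta>_dual
  by (simp add: if_distrib[of "\<lambda>h. _ * h _"] if_distribR if_distrib[of "\<lambda>h. _ * h"] cong: if_cong)

text \<open>A 5-form is detected by wedging with the real covector orthogonal to its five arguments.\<close>

lemma five_form_eq_0:
  assumes \<delta>: "alt_form 5 \<delta>" and "\<And>l. (\<theta> l \<and>\<^sub>e \<delta>) = (\<lambda>_. 0)" "\<And>l. (cnj_form (\<theta> l) \<and>\<^sub>e \<delta>) = (\<lambda>_. 0)"
  shows "\<delta> vs = 0"
proof (cases "length vs = 5")
  case True
  have "dim (set vs) \<le> card (set vs)" by (rule dim_le_card') simp
  also have "\<dots> \<le> 5" using True card_length[of vs] by simp
  finally have "dim (set vs) < DIM(real^6)" by simp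
  then obtain w where w: "w \<noteq> 0" "\<And>v. v \<in> span (set vs) \<Longrightarrow> orthogonal w v"
    using orthogonal_to_subspace_exists by blast
  define W where "W us = (if length us = 1 then complex_of_real (w \<bullet> hd us) else 0)" for us
  have W: "alt_form 1 W"
    by (rule alt_form_1I) (auto simp: W_def linear_iff inner_add_right scaleR_complex)
  have "(W \<and>\<^sub>e \<delta>) (w # vs) = 0"
    unfolding one_form_wedge[OF W] assms(2,3) by simp
  moreover have "(W \<and>\<^sub>e \<delta>) (w # vs) = W [w] * \<delta> vs + (\<Sum>i<length vs. - ((-1) ^ i) * W [vs ! i] * \<delta> (nths (w # vs) (- {Suc i})))"
  proof -
    have "{j. Suc j \<in> - {0}} = UNIV" by auto
    moreover have "nths vs UNIV = vs" by (rule nths_all) simp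
    ultimately show ?thesis
      unfolding wedge_1[OF alt_form_degree[OF W]] length_Cons sum.lessThan_Suc_shift by (simp add: nths_Cons)
  qed
  moreover have "W [vs ! i] = 0" if "i < length vs" for i
    using w(2)[OF span_base, of "vs ! i"] that by (simp add: W_def orthogonal_def)
  ultimately show ?thesis using w(1) by (simp add: W_def)
next
  case False
  then show ?thesis using alt_form_degree[OF \<delta>] by (simp add: degree_form_def)
qed

lemma dual5_eq: "dual5 \<theta> k = dual k"
  unfolding dual5_def
proof (rule the_equality)
  show "alt_form 5 (dual k) \<and> (\<forall>l. (cnj_form (\<theta> l) \<and>\<^sub>e dual k) = (if l = k then Omega \<theta> else (\<lambda>_. 0))) \<and>
      (\<forall>l. (\<theta> l \<and>\<^sub>e dual k) = (\<lambda>_. 0))"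
    using alt_dual cnj_\<theta>_dual \<theta>_dual by blast
next
  fix \<eta> assume \<eta>: "alt_form 5 \<eta> \<and> (\<forall>l. (cnj_form (\<theta> l) \<and>\<^sub>e \<eta>) = (if l = k then Omega \<theta> else (\<lambda>_. 0))) \<and>
      (\<forall>l. (\<theta> l \<and>\<^sub>e \<eta>) = (\<lambda>_. 0))"
  have "1 * \<eta> vs + (- 1) * dual k vs = 0" for vs
  proof (rule five_form_eq_0)
    show "alt_form 5 (\<lambda>vs. 1 * \<eta> vs + (- 1) * dual k vs)"
      using \<eta> alt_dual by (intro alt_form_combination) auto
    show "(\<theta> l \<and>\<^sub>e (\<lambda>vs. 1 * \<eta> vs + (- 1) * dual k vs)) = (\<lambda>_. 0)" for l
      using \<eta> \<theta>_dual by (simp only: fun_eq_iff wedge_linear_right) simp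
    show "(cnj_form (\<theta> l) \<and>\<^sub>e (\<lambda>vs. 1 * \<eta> vs + (- 1) * dual k vs)) = (\<lambda>_. 0)" for l
      using \<eta> cnj_\<theta>_dual by (simp only: fun_eq_iff wedge_linear_right) simp
  qed
  then show "\<eta> = dual k" by (simp add: fun_eq_iff)
qed

end

subsection \<open>The part of type (0,2)\<close>

definition P02 :: "(real^6 \<Rightarrow> real^6) \<Rightarrow> (real^6 \<Rightarrow> real^6 \<Rightarrow> complex) \<Rightarrow> real^6 \<Rightarrow> real^6 \<Rightarrow> complex" where
  "P02 j b u v = (b u v + \<i> * b (j u) v + \<i> * b u (j v) - b (j u) (j v)) / 4"

lemma forms_pq_zero: "(\<lambda>_. 0) \<in> forms_pq j p q"
  unfolding forms_pq_def by (intro CollectI exI[of _ 0]) auto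

lemma forms_pq_generator:
  assumes "length \<theta>s = p" "length \<eta>s = q" "\<And>\<theta>. \<theta> \<in> set \<theta>s \<union> set \<eta>s \<Longrightarrow> type10 j \<theta>"
  shows "(\<lambda>vs. z * wedge_list (\<theta>s @ map cnj_form \<eta>s) vs) \<in> forms_pq j p q"
  unfolding forms_pq_def
  by (intro CollectI exI[of _ 1] exI[of _ "\<lambda>_. z"] exI[of _ "\<lambda>_. \<theta>s"] exI[of _ "\<lambda>_. \<eta>s"])
    (use assms in auto)

lemma forms_pq_add:
  assumes "\<omega> \<in> forms_pq j p q" "\<eta> \<in> forms_pq j p q"
  shows "(\<lambda>vs. \<omega> vs + \<eta> vs) \<in> forms_pq j p q"
proof -
  obtain n and z :: "nat \<Rightarrow> complex" and \<theta>s \<eta>s where 1: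
    "\<forall>m<n. length (\<theta>s m) = p \<and> length (\<eta>s m) = q \<and> (\<forall>\<theta>\<in>set (\<theta>s m) \<union> set (\<eta>s m). type10 j \<theta>)"
    "\<omega> = (\<lambda>vs. \<Sum>m<n. z m * wedge_list (\<theta>s m @ map cnj_form (\<eta>s m)) vs)"
    using assms(1) unfolding forms_pq_def by blast
  obtain n' and z' :: "nat \<Rightarrow> complex" and \<theta>s' \<eta>s' where 2:
    "\<forall>m<n'. length (\<theta>s' m) = p \<and> length (\<eta>s' m) = q \<and> (\<forall>\<theta>\<in>set (\<theta>s' m) \<union> set (\<eta>s' m). type10 j \<theta>)"
    "\<eta> = (\<lambda>vs. \<Sum>m<n'. z' m * wedge_list (\<theta>s' m @ map cnj_form (\<eta>s' m)) vs)"
    using assms(2) unfolding forms_pq_def by blast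
  define Z where "Z m = (if m < n then z m else z' (m - n))" for m
  define T where "T m = (if m < n then \<theta>s m else \<theta>s' (m - n))" for m
  define H where "H m = (if m < n then \<eta>s m else \<eta>s' (m - n))" for m
  have split: "sum g {..<n + n'} = sum g {..<n} + (\<Sum>m<n'. g (n + m))" for g :: "nat \<Rightarrow> complex"
    by (induction n') (auto simp: add.assoc)
  show ?thesis
    unfolding forms_pq_def
  proof (intro CollectI exI conjI)
    show "\<forall>m<n + n'. length (T m) = p \<and> length (H m) = q \<and> (\<forall>\<theta>\<in>set (T m) \<union> set (H m). type10 j \<theta>)"
    proof (intro allI impI)
      fix m assume "m < n + n'"
      then show "length (T m) = p \<and> length (H m) = q \<and> (\<forall>\<theta>\<in>set (T m) \<union> set (H m). type10 j \<theta>)"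
        using 1(1)[rule_format, of m] 2(1)[rule_format, of "m - n"] by (cases "m < n") (simp_all add: T_def H_def)
    qed
    show "(\<lambda>vs. \<omega> vs + \<eta> vs) = (\<lambda>vs. \<Sum>m<n + n'. Z m * wedge_list (T m @ map cnj_form (H m)) vs)"
      unfolding 1(2) 2(2) split by (simp add: Z_def T_def H_def)
  qed
qed

lemma forms_pq_sum:
  assumes "finite I" "\<And>i. i \<in> I \<Longrightarrow> \<omega> i \<in> forms_pq j p q"
  shows "(\<lambda>vs. \<Sum>i\<in>I. \<omega> i vs) \<in> forms_pq j p q"
  using assms
proof (induction I rule: finite_induct)
  case empty
  then show ?case by (simp add: forms_pq_zero)
next
  case (insert i I)
  have "(\<lambda>vs. \<omega> i vs + (\<Sum>i\<in>I. \<omega> i vs)) \<in> forms_pq j p q"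
    by (rule forms_pq_add) (use insert in auto)
  then show ?case using insert by simp
qed

lemma length_2E: "length xs = 2 \<Longrightarrow> \<exists>a b. xs = [a, b]"
  by (auto simp: length_Suc_conv numeral_2_eq_2)

lemma wedge_list_2: "wedge_list [a, b] = (a \<and>\<^sub>e b)"
  by (simp add: wedge_list_def wedge_unit)

lemma P02_sum: "P02 j (\<lambda>u v. \<Sum>r\<in>I. b r u v) u v = (\<Sum>r\<in>I. P02 j (b r) u v)"
  by (simp add: P02_def sum_distrib_left sum.distrib sum_subtractf flip: sum_divide_distrib)

lemma P02_scale: "P02 j (\<lambda>u v. z * b u v) u v = z * P02 j b u v"
  by (simp add: P02_def algebra_simps)

lemma P02_wedge:
  assumes "alt_form 1 a" "alt_form 1 b" "\<And>v. a [j v] = s * a [v]" "\<And>v. b [j v] = t * b [v]"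
  shows "P02 j (\<lambda>u v. (a \<and>\<^sub>e b) [u, v]) u v = (1 + \<i> * s) * (1 + \<i> * t) / 4 * (a \<and>\<^sub>e b) [u, v]"
  by (simp add: P02_def wedge_1_1[OF alt_form_degree[OF assms(1)]] assms(3,4) field_simps)

lemma type10_degree: "type10 j \<theta> \<Longrightarrow> degree_form 1 \<theta>"
  by (simp add: type10_def alt_form_degree del: One_nat_def)

lemma type10_cnj: "type10 j \<theta> \<Longrightarrow> cnj_form \<theta> [j v] = - \<i> * cnj_form \<theta> [v]"
  by (simp add: type10_def cnj_form_def)

lemma P02_forms_pq:
  assumes "\<omega> \<in> forms_pq j r (2 - r)" "r \<le> 2"
  shows "P02 j (\<lambda>u v. \<omega> [u, v]) u v = (if r = 0 then \<omega> [u, v] else 0)"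
proof -
  obtain n and z :: "nat \<Rightarrow> complex" and \<theta>s \<eta>s where g:
    "\<forall>m<n. length (\<theta>s m) = r \<and> length (\<eta>s m) = 2 - r \<and> (\<forall>\<theta>\<in>set (\<theta>s m) \<union> set (\<eta>s m). type10 j \<theta>)"
    and \<omega>: "\<omega> = (\<lambda>vs. \<Sum>m<n. z m * wedge_list (\<theta>s m @ map cnj_form (\<eta>s m)) vs)"
    using assms(1) unfolding forms_pq_def by blast
  have "P02 j (\<lambda>u v. wedge_list (\<theta>s m @ map cnj_form (\<eta>s m)) [u, v]) u v =
      (if r = 0 then wedge_list (\<theta>s m @ map cnj_form (\<eta>s m)) [u, v] else 0)" if m: "m < n" for m
  proof -
    have t: "\<And>\<theta>. \<theta> \<in> set (\<theta>s m) \<union> set (\<eta>s m) \<Longrightarrow> type10 j \<theta>" and l: "length (\<theta>s m) = r" "length (\<eta>s m) = 2 - r"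
      using g m by auto
    have al: "\<And>\<theta>. type10 j \<theta> \<Longrightarrow> alt_form 1 \<theta>" "\<And>\<theta> v. type10 j \<theta> \<Longrightarrow> \<theta> [j v] = \<i> * \<theta> [v]"
      by (auto simp: type10_def)
    consider "r = 0" | "r = 1" | "r = 2" using assms(2) by linarith
    then show ?thesis
    proof cases
      case 1
      then obtain a b where ab: "\<theta>s m = []" "\<eta>s m = [a, b]" using l by (auto simp: length_Suc_conv numeral_2_eq_2)
      then have ta: "type10 j a" and tb: "type10 j b" using t by auto
      then show ?thesis
        using P02_wedge[OF alt_form_cnj[OF al(1)[OF ta]] alt_form_cnj[OF al(1)[OF tb]] type10_cnj[OF ta] type10_cnj[OF tb]] 1
        by (simp add: ab wedge_list_2)
    next
      case 2
      then obtain a b where ab: "\<theta>s m = [a]" "\<eta>s m = [b]" using l by (auto simp: length_Suc_conv)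
      then have ta: "type10 j a" and tb: "type10 j b" using t by auto
      then show ?thesis
        using P02_wedge[OF al(1)[OF ta] alt_form_cnj[OF al(1)[OF tb]] al(2)[OF ta] type10_cnj[OF tb]] 2
        by (simp add: ab wedge_list_2)
    next
      case 3
      then obtain a b where ab: "\<theta>s m = [a, b]" "\<eta>s m = []" using l by (auto simp: length_Suc_conv numeral_2_eq_2)
      then have ta: "type10 j a" and tb: "type10 j b" using t by auto
      then show ?thesis
        using P02_wedge[OF al(1)[OF ta] al(1)[OF tb] al(2)[OF ta] al(2)[OF tb]] 3
        by (simp add: ab wedge_list_2)
    qed
  qed
  then have "(\<Sum>m<n. z m * P02 j (\<lambda>u v. wedge_list (\<theta>s m @ map cnj_form (\<eta>s m)) [u, v]) u v) =
      (\<Sum>m<n. z m * (if r = 0 then wedge_list (\<theta>s m @ map cnj_form (\<eta>s m)) [u, v] else 0))"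
    by (intro sum.cong refl) auto
  then show ?thesis unfolding \<omega> P02_sum P02_scale by simp
qed

lemma degree_forms_pq:
  assumes "\<omega> \<in> forms_pq j r (2 - r)" "r \<le> 2"
  shows "degree_form 2 \<omega>"
proof -
  obtain n and z :: "nat \<Rightarrow> complex" and \<theta>s \<eta>s where g:
    "\<forall>m<n. length (\<theta>s m) = r \<and> length (\<eta>s m) = 2 - r \<and> (\<forall>\<theta>\<in>set (\<theta>s m) \<union> set (\<eta>s m). type10 j \<theta>)"
    and \<omega>: "\<omega> = (\<lambda>vs. \<Sum>m<n. z m * wedge_list (\<theta>s m @ map cnj_form (\<eta>s m)) vs)"
    using assms(1) unfolding forms_pq_def by blast
  have "degree_form 2 (wedge_list (\<theta>s m @ map cnj_form (\<eta>s m)))" if "m < n" for m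
  proof -
    have "length (\<theta>s m @ map cnj_form (\<eta>s m)) = 2" using g that assms(2) by auto
    then obtain a b where ab: "\<theta>s m @ map cnj_form (\<eta>s m) = [a, b]" using length_2E by blast
    have "\<forall>x\<in>set (\<theta>s m @ map cnj_form (\<eta>s m)). degree_form 1 x"
      using g that by (auto simp del: One_nat_def intro: degree_cnj type10_degree)
    then have "degree_form 1 a" "degree_form 1 b" unfolding ab by auto
    then show ?thesis unfolding ab wedge_list_2 using degree_wedge[of 1 a 1 b] by (simp add: numeral_2_eq_2)
  qed
  then show ?thesis unfolding \<omega> degree_form_def by (auto intro!: sum.neutral)
qed

lemma mat_comp_entries: "mat_comp a i 2 3 = a $ i $ 1" "mat_comp a i 3 1 = a $ i $ 2" "mat_comp a i 1 2 = a $ i $ 3"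
  by (simp_all add: mat_comp_def)

lemma sum_cnj2:
  assumes "\<And>i. degree_form 1 (\<theta> i)"
  shows "(\<Sum>m\<in>UNIV. N $ i $ m * cnj2 \<theta> m [u, v]) =
    (\<Sum>k\<in>UNIV. \<Sum>l\<in>UNIV. mat_comp N i k l * cnj (\<theta> k [u]) * cnj (\<theta> l [v]))"
  by (simp add: sum_3 cnj2_eq wedge_1_1[OF degree_cnj[OF assms]] mat_comp_def) (simp add: cnj_form_def algebra_simps)

context coframe
begin

lemma P02_expand:
  assumes "alt_form 2 \<omega>"
  defines "\<beta> \<equiv> P02 j (\<lambda>u v. \<omega> [u, v])"
  shows "\<beta> u v = (\<Sum>k\<in>UNIV. \<Sum>l\<in>UNIV. \<beta> (f k) (f l) * cnj (\<theta> k [u]) * cnj (\<theta> l [v]))" "\<beta> u v = - \<beta> v u"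
proof -
  have l1: "linear (\<lambda>u. \<omega> [u, v])" and l2: "linear (\<lambda>v. \<omega> [u, v])" for u v
    using alt_form_linear[OF assms(1), of "[]" "[v]"] alt_form_linear[OF assms(1), of "[u]" "[]"] by auto
  have skew: "\<omega> [u, v] = - \<omega> [v, u]" for u v
    using alternating_swap[OF alt_form_linear[OF assms(1)] alt_form_repeat[OF assms(1), of _ _ "[]", simplified], of "[]" u v "[]"]
    by simp
  show s: "\<beta> u v = - \<beta> v u" for u v
    unfolding \<beta>_def P02_def using skew[of u v] skew[of "j u" v] skew[of u "j v"] skew[of "j u" "j v"]
    by (simp add: field_simps)
  have lin: "linear (\<lambda>u. \<beta> u v)" for v
    unfolding \<beta>_def P02_def
    by (simp add: linear_iff linear_add[OF linear_j] linear_cmul[OF linear_j] linear_add[OF l1] linear_cmul[OF l1]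
        linear_add[OF l2] linear_cmul[OF l2] algebra_simps scaleR_complex) (simp add: field_simps)
  have j01: "\<beta> (j u) v = - \<i> * \<beta> u v" for u v
    unfolding \<beta>_def P02_def by (simp add: j_j linear_neg[OF l1] algebra_simps)
  have e1: "\<beta> u v = (\<Sum>k\<in>UNIV. cnj (\<theta> k [u]) * \<beta> (f k) v)" for u v
    by (rule expand_01[OF lin j01])
  have e2: "\<beta> u v = (\<Sum>l\<in>UNIV. cnj (\<theta> l [v]) * \<beta> u (f l))" for u v
    unfolding s[of u v] by (subst e1) (simp add: s[of u] sum_negf)
  show "\<beta> u v = (\<Sum>k\<in>UNIV. \<Sum>l\<in>UNIV. \<beta> (f k) (f l) * cnj (\<theta> k [u]) * cnj (\<theta> l [v]))" for u v
    by (subst e1, subst e2) (simp add: sum_distrib_left mult_ac)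
qed

lemma decompose_2_form:
  assumes \<omega>: "alt_form 2 \<omega>"
  shows "\<exists>\<gamma>. (\<forall>r\<le>2. \<gamma> r \<in> forms_pq j r (2 - r)) \<and> \<omega> = (\<lambda>vs. \<Sum>r\<le>2. \<gamma> r vs)"
proof -
  define e where "e k l = (ev (\<lambda>v. ev (\<lambda>u. \<omega> [u, v]) k) l)" for k l
  define m where "m k l = (evc (\<lambda>v. ev (\<lambda>u. \<omega> [u, v]) k) l)" for k l
  define c where "c k l = (evc (\<lambda>v. evc (\<lambda>u. \<omega> [u, v]) k) l)" for k l
  define \<gamma> where "\<gamma> r = (if r = 2 then (\<lambda>vs. \<Sum>k\<in>UNIV. \<Sum>l\<in>UNIV. e k l / 2 * wedge_list ([\<theta> k, \<theta> l] @ map cnj_form []) vs)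
     else if r = 1 then (\<lambda>vs. \<Sum>k\<in>UNIV. \<Sum>l\<in>UNIV. m k l * wedge_list ([\<theta> k] @ map cnj_form [\<theta> l]) vs)
     else (\<lambda>vs. \<Sum>k\<in>UNIV. \<Sum>l\<in>UNIV. c k l / 2 * wedge_list ([] @ map cnj_form [\<theta> k, \<theta> l]) vs))" for r :: nat
  have "\<gamma> r \<in> forms_pq j r (2 - r)" if r: "r \<le> 2" for r
  proof -
    consider "r = 0" | "r = 1" | "r = 2" using r by linarith
    then show ?thesis
    proof cases
      case 1
      have "(\<lambda>vs. z * wedge_list ([] @ map cnj_form [\<theta> k, \<theta> l]) vs) \<in> forms_pq j 0 2" for z k l
        by (rule forms_pq_generator) (auto simp: type10)
      then have "(\<lambda>vs. \<Sum>k\<in>UNIV. \<Sum>l\<in>UNIV. c k l / 2 * wedge_list ([] @ map cnj_form [\<theta> k, \<theta> l]) vs) \<in> forms_pq j 0 2"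
        by (intro forms_pq_sum finite)
      then show ?thesis unfolding 1 \<gamma>_def by simp
    next
      case 2
      have "(\<lambda>vs. z * wedge_list ([\<theta> k] @ map cnj_form [\<theta> l]) vs) \<in> forms_pq j 1 1" for z k l
        by (rule forms_pq_generator) (auto simp: type10)
      then have "(\<lambda>vs. \<Sum>k\<in>UNIV. \<Sum>l\<in>UNIV. m k l * wedge_list ([\<theta> k] @ map cnj_form [\<theta> l]) vs) \<in> forms_pq j 1 1"
        by (intro forms_pq_sum finite)
      then show ?thesis unfolding 2 \<gamma>_def by simp
    next
      case 3
      have "(\<lambda>vs. z * wedge_list ([\<theta> k, \<theta> l] @ map cnj_form []) vs) \<in> forms_pq j 2 0" for z k l
        by (rule forms_pq_generator) (auto simp: type10)
      then have "(\<lambda>vs. \<Sum>k\<in>UNIV. \<Sum>l\<in>UNIV. e k l / 2 * wedge_list ([\<theta> k, \<theta> l] @ map cnj_form []) vs) \<in> forms_pq j 2 0"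
        by (intro forms_pq_sum finite)
      then show ?thesis unfolding 3 \<gamma>_def by simp
    qed
  qed
  moreover have "\<omega> vs = (\<Sum>r\<le>2. \<gamma> r vs)" for vs
  proof (cases "length vs = 2")
    case True
    then obtain u v where vs: "vs = [u, v]" by (auto simp: length_Suc_conv numeral_2_eq_2)
    have l1: "linear (\<lambda>u. \<omega> [u, v])" and l2: "linear (\<lambda>v. \<omega> [u, v])" for u v
      using alt_form_linear[OF assms(1), of "[]" "[v]"] alt_form_linear[OF assms(1), of "[u]" "[]"] by auto
    have skew: "\<omega> [u, v] = - \<omega> [v, u]" for u v
      using alternating_swap[OF alt_form_linear[OF assms(1)] alt_form_repeat[OF assms(1), of _ _ "[]", simplified], of "[]" u v "[]"]
      by simp
    have lin: "linear (\<lambda>v. ev (\<lambda>u. \<omega> [u, v]) k)" "linear (\<lambda>v. evc (\<lambda>u. \<omega> [u, v]) k)" for k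
      unfolding ev_def evc_def
      by (simp_all add: linear_iff linear_add[OF l2] linear_cmul[OF l2] field_simps scaleR_complex)
    have sk: "e k l = - e l k" "c k l = - c l k" "ev (\<lambda>v. evc (\<lambda>u. \<omega> [u, v]) k) l = - m l k" for k l
      unfolding e_def c_def m_def ev_def evc_def
      using skew[of "f k" "f l"] skew[of "j (f k)" "f l"] skew[of "f k" "j (f l)"] skew[of "j (f k)" "j (f l)"]
      by (simp_all add: field_simps)
    have "\<omega> [u, v] = (\<Sum>k\<in>UNIV. \<theta> k [u] * ev (\<lambda>u. \<omega> [u, v]) k + cnj (\<theta> k [u]) * evc (\<lambda>u. \<omega> [u, v]) k)"
      by (rule expand_ev[OF l1])
    also have "\<dots> = (\<Sum>k\<in>UNIV. \<theta> k [u] * (\<Sum>l\<in>UNIV. \<theta> l [v] * e k l + cnj (\<theta> l [v]) * m k l)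
        + cnj (\<theta> k [u]) * (\<Sum>l\<in>UNIV. \<theta> l [v] * (- m l k) + cnj (\<theta> l [v]) * c k l))"
      unfolding expand_ev[OF lin(1), of v] expand_ev[OF lin(2), of v] e_def[symmetric] m_def[symmetric] c_def[symmetric] sk(3) ..
    also have "\<dots> = (\<Sum>r\<le>2. \<gamma> r [u, v])"
    proof -
      note s = sk(1)[of 1 1] sk(1)[of 2 2] sk(1)[of 3 3] sk(1)[of 2 1] sk(1)[of 3 1] sk(1)[of 3 2]
        sk(2)[of 1 1] sk(2)[of 2 2] sk(2)[of 3 3] sk(2)[of 2 1] sk(2)[of 3 1] sk(2)[of 3 2]
      have z: "e 1 1 = 0" "e 2 2 = 0" "e 3 3 = 0" "c 1 1 = 0" "c 2 2 = 0" "c 3 3 = 0"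
        using s by (simp_all add: eq_neg_iff_add_eq_0)
      have "wedge_list [\<theta> k, \<theta> l] [u, v] = \<theta> k [u] * \<theta> l [v] - \<theta> k [v] * \<theta> l [u]"
        "wedge_list [\<theta> k, cnj_form (\<theta> l)] [u, v] = \<theta> k [u] * cnj (\<theta> l [v]) - \<theta> k [v] * cnj (\<theta> l [u])"
        "wedge_list [cnj_form (\<theta> k), cnj_form (\<theta> l)] [u, v] = cnj (\<theta> k [u]) * cnj (\<theta> l [v]) - cnj (\<theta> k [v]) * cnj (\<theta> l [u])" for k l
        by (simp_all add: wedge_list_2 wedge_1_1[OF degree_\<theta>] wedge_1_1[OF degree_cnj[OF degree_\<theta>]]) (simp_all add: cnj_form_def)
      then show ?thesis
        by (simp add: \<gamma>_def numeral_2_eq_2 sum_3 z s(4-6) s(10-12)) (simp add: field_simps)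
    qed
    finally show ?thesis unfolding vs .
  next
    case False
    have "degree_form 2 (\<gamma> r)" if "r \<le> 2" for r
      using degree_forms_pq calculation that by blast
    then show ?thesis using False alt_form_degree[OF \<omega>] by (simp add: degree_form_def)
  qed
  ultimately show ?thesis by blast
qed

lemma part_02:
  assumes \<omega>: "alt_form 2 \<omega>"
  shows "part_pq j 0 2 \<omega> vs = (if length vs = 2 then P02 j (\<lambda>u v. \<omega> [u, v]) (vs ! 0) (vs ! 1) else 0)"
proof -
  define R where "R = (\<lambda>vs. if length vs = 2 then P02 j (\<lambda>u v. \<omega> [u, v]) (vs ! 0) (vs ! 1) else 0)"
  have key: "\<gamma> 0 = R" if "\<forall>r\<le>2. \<gamma> r \<in> forms_pq j r (2 - r)" "\<omega> = (\<lambda>vs. \<Sum>r\<le>2. \<gamma> r vs)" for \<gamma>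
  proof
    fix vs
    show "\<gamma> 0 vs = R vs"
    proof (cases "length vs = 2")
      case True
      then obtain u v where vs: "vs = [u, v]" by (auto simp: length_Suc_conv numeral_2_eq_2)
      have "P02 j (\<lambda>u v. \<omega> [u, v]) u v = (\<Sum>r\<le>2. P02 j (\<lambda>u v. \<gamma> r [u, v]) u v)"
        unfolding that(2) P02_sum ..
      also have "\<dots> = (\<Sum>r\<le>2. if r = 0 then \<gamma> r [u, v] else 0)"
        by (rule sum.cong) (use P02_forms_pq that(1) in auto)
      finally show ?thesis by (simp add: vs R_def numeral_2_eq_2)
    next
      case False
      then show ?thesis using degree_forms_pq[of "\<gamma> 0" j 0] that(1)[rule_format, of 0] by (simp add: degree_form_def R_def)
    qed
  qed
  have "part_pq j 0 2 \<omega> = R"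
    unfolding part_pq_def add_0
  proof (rule the_equality)
    obtain \<gamma> where "\<forall>r\<le>2. \<gamma> r \<in> forms_pq j r (2 - r)" "\<omega> = (\<lambda>vs. \<Sum>r\<le>2. \<gamma> r vs)"
      using decompose_2_form[OF \<omega>] by blast
    then show "\<exists>\<gamma>. (\<forall>r\<le>2. \<gamma> r \<in> forms_pq j r (2 - r)) \<and> \<omega> = (\<lambda>vs. \<Sum>r\<le>2. \<gamma> r vs) \<and> R = \<gamma> 0"
      using key by metis
  qed (use key in blast)
  then show ?thesis by (simp add: R_def)
qed

definition skew_matrix :: "(3 \<Rightarrow> real^6 \<Rightarrow> real^6 \<Rightarrow> complex) \<Rightarrow> complex^3^3" where
  "skew_matrix b = (\<chi> i m. if m = 1 then b i (f 2) (f 3) else if m = 2 then b i (f 3) (f 1) else b i (f 1) (f 2))"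

lemma mat_comp_skew_matrix:
  assumes "\<And>u v. b i u v = - b i v u"
  shows "mat_comp (skew_matrix b) i k l = b i (f k) (f l)"
proof -
  have "b i u u = 0" for u using assms[of u u] by simp
  then show ?thesis
  proof -
    have "\<forall>k l. mat_comp (skew_matrix b) i k l = b i (f k) (f l)"
      using \<open>\<And>u. b i u u = 0\<close> assms[of "f 2" "f 1"] assms[of "f 3" "f 2"] assms[of "f 1" "f 3"]
      by (simp add: forall_3 mat_comp_def skew_matrix_def)
    then show ?thesis by blast
  qed
qed

lemma the_Nmat:
  assumes \<omega>: "\<And>i. alt_form 2 (\<omega> i)"
  defines "N \<equiv> THE N. \<forall>i. part_pq j 0 2 (\<omega> i) = (\<lambda>vs. \<Sum>m\<in>UNIV. N $ i $ m * cnj2 \<theta> m vs)"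
  shows "P02 j (\<lambda>u v. \<omega> i [u, v]) u v = (\<Sum>k\<in>UNIV. \<Sum>l\<in>UNIV. mat_comp N i k l * cnj (\<theta> k [u]) * cnj (\<theta> l [v]))"
proof -
  define M where "M = skew_matrix (\<lambda>i. P02 j (\<lambda>u v. \<omega> i [u, v]))"
  have X: "P02 j (\<lambda>u v. \<omega> i [u, v]) u v = (\<Sum>k\<in>UNIV. \<Sum>l\<in>UNIV. mat_comp M i k l * cnj (\<theta> k [u]) * cnj (\<theta> l [v]))" for i u v
    unfolding M_def mat_comp_skew_matrix[where b = "\<lambda>i. P02 j (\<lambda>u v. \<omega> i [u, v])", OF P02_expand(2)[OF \<omega>]]
    by (rule P02_expand(1)[OF \<omega>])
  have M: "part_pq j 0 2 (\<omega> i) = (\<lambda>vs. \<Sum>m\<in>UNIV. M $ i $ m * cnj2 \<theta> m vs)" for i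
  proof
    fix vs
    show "part_pq j 0 2 (\<omega> i) vs = (\<Sum>m\<in>UNIV. M $ i $ m * cnj2 \<theta> m vs)"
    proof (cases "length vs = 2")
      case True
      then obtain u v where vs: "vs = [u, v]" by (auto simp: length_Suc_conv numeral_2_eq_2)
      show ?thesis
        unfolding vs sum_cnj2[OF degree_\<theta>] part_02[OF \<omega>] X[symmetric] by simp
    next
      case False
      then show ?thesis using alt_form_degree[OF alt_cnj2[OF alt_\<theta>]]
        by (simp add: part_02[OF \<omega>] degree_form_def)
    qed
  qed
  have "M' = M" if "\<forall>i. part_pq j 0 2 (\<omega> i) = (\<lambda>vs. \<Sum>m\<in>UNIV. M' $ i $ m * cnj2 \<theta> m vs)" for M'
  proof -
    have "mat_comp M' i k l = mat_comp M i k l" for i k l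
    proof -
      have *: "(\<Sum>m\<in>UNIV. X $ i $ m * cnj2 \<theta> m [f k, f l]) = mat_comp X i k l" for X
        unfolding sum_cnj2[OF degree_\<theta>]
        by (simp add: \<theta>_f if_distrib[of cnj] if_distrib[of "\<lambda>x. _ * x"] sum.delta cong: if_cong)
      show ?thesis using *[of M] *[of M'] M[of i] that by metis
    qed
    then have "M' $ i $ m = M $ i $ m" for i m
      using exhaust_3[of m] mat_comp_entries[of M i] mat_comp_entries[of M' i] by auto
    then show ?thesis by (simp add: vec_eq_iff)
  qed
  then have "N = M" unfolding N_def using M by (intro the_equality) auto
  then show ?thesis using X by simp
qed

end

section \<open>Change of coframe\<close>

lemma polarization:
  fixes P :: "'m::ab_group_add \<Rightarrow> 'm \<Rightarrow> 'm \<Rightarrow> complex"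
  assumes add: "\<And>a a' b c. P (a + a') b c = P a b c + P a' b c"
    and sym: "\<And>a b c. P a b c = P b a c" "\<And>a b c. P a b c = P a c b"
  shows "6 * P a b c = P (a + b + c) (a + b + c) (a + b + c) - P (a + b) (a + b) (a + b) - P (a + c) (a + c) (a + c)
    - P (b + c) (b + c) (b + c) + P a a a + P b b b + P c c c"
proof -
  have add2: "P b (a + a') c = P b a c + P b a' c" for a a' b c
    using add[of a a' b c] sym(1) by metis
  have add3: "P b c (a + a') = P b c a + P b c a'" for a a' b c
    using add2[of b a a' c] sym(2) by metis
  have s: "P x y x = P x x y" "P y x x = P x x y" for x y
    using sym by metis+
  have t: "P a c b = P a b c" "P b a c = P a b c" "P b c a = P a b c" "P c a b = P a b c" "P c b a = P a b c"
    using sym by metis+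
  show ?thesis
    by (simp only: add add2 add3) (simp add: s t)
qed

lemma polarization_unique:
  fixes P P' :: "'m::ab_group_add \<Rightarrow> 'm \<Rightarrow> 'm \<Rightarrow> complex"
  assumes "\<And>a a' b c. P (a + a') b c = P a b c + P a' b c"
    "\<And>a b c. P a b c = P b a c" "\<And>a b c. P a b c = P a c b"
    "\<And>a a' b c. P' (a + a') b c = P' a b c + P' a' b c"
    "\<And>a b c. P' a b c = P' b a c" "\<And>a b c. P' a b c = P' a c b"
    "\<And>a. P' a a a = z * P a a a"
  shows "P' a b c = z * P a b c"
proof -
  have "6 * P' a b c = 6 * (z * P a b c)"
    unfolding polarization[of P', OF assms(4-6)] mult.left_commute[of 6 z] polarization[of P, OF assms(1-3)]
    by (simp add: assms(7) algebra_simps)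
  then show ?thesis by simp
qed

definition mixed_det :: "complex^3^3 \<Rightarrow> complex^3^3 \<Rightarrow> complex^3^3 \<Rightarrow> complex" where
  "mixed_det a b c = a$1$1 * b$2$2 * c$3$3 + a$1$2 * b$2$3 * c$3$1 + a$1$3 * b$2$1 * c$3$2
    - a$1$1 * b$2$3 * c$3$2 - a$1$2 * b$2$1 * c$3$3 - a$1$3 * b$2$2 * c$3$1"

definition polar_det :: "complex^3^3 \<Rightarrow> complex^3^3 \<Rightarrow> complex^3^3 \<Rightarrow> complex" where
  "polar_det a b c = (mixed_det a b c + mixed_det a c b + mixed_det b a c + mixed_det b c a
    + mixed_det c a b + mixed_det c b a) / 6"

lemma polar_det:
  "polar_det (a + a') b c = polar_det a b c + polar_det a' b c"
  "polar_det (\<chi> i j. z * a $ i $ j) b c = z * polar_det a b c"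
  "polar_det a b c = polar_det b a c" "polar_det a b c = polar_det a c b" "polar_det a a a = det a"
proof -
  have 1: "mixed_det (a + a') b c = mixed_det a b c + mixed_det a' b c"
    "mixed_det b (a + a') c = mixed_det b a c + mixed_det b a' c"
    "mixed_det b c (a + a') = mixed_det b c a + mixed_det b c a'" for b c
    by (simp_all add: mixed_det_def algebra_simps)
  have 2: "mixed_det (\<chi> i j. z * a $ i $ j) b c = z * mixed_det a b c"
    "mixed_det b (\<chi> i j. z * a $ i $ j) c = z * mixed_det b a c"
    "mixed_det b c (\<chi> i j. z * a $ i $ j) = z * mixed_det b c a" for b c
    by (simp_all add: mixed_det_def algebra_simps)
  show "polar_det (a + a') b c = polar_det a b c + polar_det a' b c"
    by (simp add: polar_det_def 1 field_simps)
  show "polar_det (\<chi> i j. z * a $ i $ j) b c = z * polar_det a b c"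
    by (simp add: polar_det_def 2 field_simps)
  show "polar_det a b c = polar_det b a c" "polar_det a b c = polar_det a c b"
    by (simp_all add: polar_det_def add_ac)
  show "polar_det a a a = det a"
    by (simp add: polar_det_def mixed_det_def det_3)
qed

lemma Ptri_eq: "Ptri = polar_det"
  unfolding Ptri_def
proof (rule the_equality)
  show "(\<forall>a a' b c. polar_det (a + a') b c = polar_det a b c + polar_det a' b c) \<and>
     (\<forall>z a b c. polar_det (\<chi> i j. z * a $ i $ j) b c = z * polar_det a b c) \<and>
     (\<forall>a b c. polar_det a b c = polar_det b a c \<and> polar_det a b c = polar_det a c b) \<and>
     (\<forall>a. polar_det a a a = det a)"
    using polar_det by blast
next
  fix P :: "complex^3^3 \<Rightarrow> complex^3^3 \<Rightarrow> complex^3^3 \<Rightarrow> complex" assume P: "(\<forall>a a' b c. P (a + a') b c = P a b c + P a' b c) \<and>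
     (\<forall>z a b c. P (\<chi> i j. z * a $ i $ j) b c = z * P a b c) \<and>
     (\<forall>a b c. P a b c = P b a c \<and> P a b c = P a c b) \<and> (\<forall>a. P a a a = det a)"
  have "P a b c = 1 * polar_det a b c" for a b c
    by (rule polarization_unique[OF polar_det(1,3,4)]) (use P polar_det(5) in auto)
  then show "P = polar_det" by (simp add: fun_eq_iff)
qed

lemma polar_det_mult:
  "polar_det (g ** a ** h) (g ** b ** h) (g ** c ** h) = det g * det h * polar_det a b c"
proof -
  have "polar_det (g ** (a + a') ** h) (g ** b ** h) (g ** c ** h) =
      polar_det (g ** a ** h) (g ** b ** h) (g ** c ** h) + polar_det (g ** a' ** h) (g ** b ** h) (g ** c ** h)" for a a' b c
  proof -
    have "(x + y) ** h = x ** h + y ** h" for x y :: "complex^3^3"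
      by (simp add: matrix_matrix_mult_def vec_eq_iff sum.distrib distrib_right)
    then show ?thesis by (simp add: matrix_add_ldistrib polar_det(1))
  qed
  moreover have "polar_det (g ** a ** h) (g ** a ** h) (g ** a ** h) = det g * det h * polar_det a a a" for a
    by (simp add: polar_det(5) det_mul)
  ultimately show ?thesis
    using polarization_unique[where P = polar_det and P' = "\<lambda>a b c. polar_det (g ** a ** h) (g ** b ** h) (g ** c ** h)" and z = "det g * det h"]
      polar_det(1,3,4) by blast
qed

lemma polar_det_scale:
  "polar_det (\<chi> i j. x * a $ i $ j) (\<chi> i j. y * b $ i $ j) (\<chi> i j. z * c $ i $ j) = x * y * z * polar_det a b c"
proof -
  have 2: "polar_det b (\<chi> i j. y * a $ i $ j) c = y * polar_det b a c" for y a b c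
    using polar_det(2)[of y a b c] polar_det(3) by metis
  have "polar_det b c (\<chi> i j. y * a $ i $ j) = y * polar_det b c a" for y a b c
    using 2[of b y a c] polar_det(4) by metis
  then show ?thesis by (simp add: polar_det(2) 2)
qed

lemma det_cnj_mat: "det (cnj_mat a) = cnj (det a)"
  by (simp add: det_3 cnj_mat_def)

definition change_coframe :: "complex^3^3 \<Rightarrow> (3 \<Rightarrow> cform) \<Rightarrow> 3 \<Rightarrow> cform" where
  "change_coframe g \<theta> i = (\<lambda>vs. \<Sum>k\<in>UNIV. g $ i $ k * \<theta> k vs)"

definition torsion_matrix :: "(3 \<Rightarrow> cform) \<Rightarrow> (real^6 \<Rightarrow> real^6 \<Rightarrow> real^6) \<Rightarrow> complex^3^3 \<Rightarrow> bool" where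
  "torsion_matrix \<theta> Q N \<longleftrightarrow> (\<forall>i u v.
     (\<Sum>k\<in>UNIV. \<Sum>l\<in>UNIV. mat_comp N i k l * cnj (\<theta> k [u]) * cnj (\<theta> l [v])) = - \<theta> i [Q u v] / 4)"

text \<open>\<open>N'\<close> times the cofactor matrix of \<open>h\<close> is \<open>M\<close>; multiply by the transpose of \<open>h\<close>.\<close>

lemma cofactor_solve:
  assumes "\<And>i c d. (\<Sum>k\<in>UNIV. \<Sum>l\<in>UNIV. mat_comp N' i k l * h $ k $ c * h $ l $ d) = mat_comp M i c d"
  shows "det h * N' $ i $ m = (M ** transpose h) $ i $ m"
proof -
  note e = assms[of i 2 3, unfolded mat_comp_entries] assms[of i 3 1, unfolded mat_comp_entries] assms[of i 1 2, unfolded mat_comp_entries]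
  have "(M ** transpose h) $ i $ m = M $ i $ 1 * h $ m $ 1 + M $ i $ 2 * h $ m $ 2 + M $ i $ 3 * h $ m $ 3"
    by (simp add: matrix_matrix_mult_def transpose_def sum_3)
  also have "\<dots> = det h * N' $ i $ m"
    using exhaust_3[of m] unfolding e[symmetric] by (auto simp: sum_3 mat_comp_def det_3 algebra_simps)
  finally show ?thesis ..
qed

context coframe
begin

lemma change_coframe_f: "change_coframe g \<theta> i [f k] = g $ i $ k"
  by (simp add: change_coframe_def \<theta>_f if_distrib[of "\<lambda>x. _ * x"] sum.delta cong: if_cong)

lemma torsion_change:
  assumes "torsion_matrix \<theta> Q N" "torsion_matrix (change_coframe g \<theta>) Q N'"
  shows "cnj (det g) * N' $ i $ m = (g ** N ** transpose (cnj_mat g)) $ i $ m"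
proof -
  have "(\<Sum>k\<in>UNIV. \<Sum>l\<in>UNIV. mat_comp N' i k l * cnj_mat g $ k $ c * cnj_mat g $ l $ d) = mat_comp (g ** N) i c d" for i c d
  proof -
    have "(\<Sum>k\<in>UNIV. \<Sum>l\<in>UNIV. mat_comp N' i k l * cnj_mat g $ k $ c * cnj_mat g $ l $ d)
        = - change_coframe g \<theta> i [Q (f c) (f d)] / 4"
      using assms(2) unfolding torsion_matrix_def by (simp add: change_coframe_f[symmetric] cnj_mat_def)
    also have "\<dots> = (\<Sum>n\<in>UNIV. g $ i $ n * (- \<theta> n [Q (f c) (f d)] / 4))"
      by (simp add: change_coframe_def sum_negf sum_divide_distrib)
    also have "\<dots> = (\<Sum>n\<in>UNIV. g $ i $ n * mat_comp N n c d)"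
    proof -
      have "- \<theta> n [Q (f c) (f d)] / 4 = mat_comp N n c d" for n
        using assms(1)[unfolded torsion_matrix_def, rule_format, of n "f c" "f d", symmetric]
        by (simp add: \<theta>_f if_distrib[of cnj] if_distrib[of "\<lambda>x. _ * x"] sum.delta cong: if_cong)
      then show ?thesis by simp
    qed
    also have "\<dots> = mat_comp (g ** N) i c d"
    proof -
      have "\<forall>c d. (\<Sum>n\<in>UNIV. g $ i $ n * mat_comp N n c d) = mat_comp (g ** N) i c d"
        by (simp add: forall_3 mat_comp_def matrix_matrix_mult_def sum_negf)
      then show ?thesis by blast
    qed
    finally show ?thesis .
  qed
  from cofactor_solve[OF this] show ?thesis by (simp add: det_cnj_mat)
qed

end

lemma vol3_eval:
  assumes "\<And>i. degree_form 1 (\<theta> i)"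
  shows "vol3 \<theta> [u, v, w] = det ((\<chi> i m. \<theta> i [if m = 1 then u else if m = 2 then v else w]) :: complex^3^3)"
proof -
  have "{j::nat. j \<noteq> 0} = {j. \<exists>k. j = Suc k}" using not0_implies_Suc by auto
  then show ?thesis
    by (simp add: vol3_def wedge_1[OF assms] lessThan_Suc numeral_3_eq_3 numeral_2_eq_2 nths_Cons det_3 algebra_simps)
qed

lemma degree_change_coframe:
  "(\<And>i. degree_form k (\<theta> i)) \<Longrightarrow> degree_form k (change_coframe g \<theta> i)"
  by (simp add: degree_form_def change_coframe_def)

lemma vol3_change_coframe:
  assumes "\<And>i. degree_form 1 (\<theta> i)"
  shows "vol3 (change_coframe g \<theta>) = (\<lambda>vs. det g * vol3 \<theta> vs)"
proof
  fix vs
  show "vol3 (change_coframe g \<theta>) vs = det g * vol3 \<theta> vs"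
  proof (cases "length vs = 3")
    case True
    then obtain u v w where vs: "vs = [u, v, w]" by (auto simp: length_Suc_conv numeral_3_eq_3)
    have "((\<chi> i m. change_coframe g \<theta> i [if m = 1 then u else if m = 2 then v else w]) :: complex^3^3) = (g :: complex^3^3) ** (\<chi> i m. \<theta> i [if m = 1 then u else if m = 2 then v else w])"
      by (simp add: change_coframe_def matrix_matrix_mult_def)
    then show ?thesis
      unfolding vs vol3_eval[OF assms] vol3_eval[OF degree_change_coframe[OF assms]] by (simp add: det_mul)
  next
    case False
    then show ?thesis
      using degree_vol3[of \<theta>, OF assms] degree_vol3[of "change_coframe g \<theta>", OF degree_change_coframe[OF assms]]
      by (simp add: degree_form_def)
  qed
qed

lemma Omega_change_coframe:
  assumes "\<And>i. degree_form 1 (\<theta> i)"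
  shows "Omega (change_coframe g \<theta>) vs = complex_of_real ((cmod (det g))\<^sup>2) * Omega \<theta> vs"
proof -
  have "cnj_form (\<lambda>vs. det g * vol3 \<theta> vs) = (\<lambda>vs. cnj (det g) * cnj_form (vol3 \<theta>) vs)"
    by (simp add: cnj_form_def)
  then show ?thesis
    unfolding Omega_def vol3_change_coframe[OF assms] complex_norm_square
    by (simp add: wedge_scale_left wedge_scale_right)
qed

definition psi_coeff :: "complex^3^3 \<Rightarrow> complex" where
  "psi_coeff N = Ptri (cnj_mat N) (cnj_mat N) (transpose N)"

lemma coefficient_change:
  assumes N': "\<And>i m. cnj (det g) * N' $ i $ m = (g ** N ** transpose (cnj_mat g)) $ i $ m" and g: "det g \<noteq> 0"
  shows "(cmod (det g))\<^sup>2 * (cmod (det N'))\<^sup>2 = (cmod (det N))\<^sup>2" "det g * psi_coeff N' = psi_coeff N"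
proof -
  define D where "D = det g"
  have m: "(\<chi> i m. cnj D * N' $ i $ m) = g ** N ** transpose (cnj_mat g)"
    using N' by (simp add: vec_eq_iff D_def)
  have "det (\<chi> i m. cnj D * N' $ i $ m) = cnj D ^ 3 * det N'"
    by (simp add: det_3 algebra_simps power3_eq_cube)
  then have "cnj D ^ 3 * det N' = D * det N * cnj D"
    unfolding m by (simp add: det_mul det_cnj_mat D_def)
  then have "cmod D ^ 3 * cmod (det N') = cmod D ^ 2 * cmod (det N)"
    by (metis (no_types, lifting) complex_mod_cnj mult.commute mult.left_commute norm_mult norm_power power2_eq_square)
  then have "cmod D * cmod (det N') = cmod (det N)"
    using g by (simp add: D_def power3_eq_cube power2_eq_square)
  then show "(cmod (det g))\<^sup>2 * (cmod (det N'))\<^sup>2 = (cmod (det N))\<^sup>2"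
    unfolding D_def by (metis power_mult_distrib)
  have m1: "(\<chi> i m. D * cnj_mat N' $ i $ m) = cnj_mat g ** cnj_mat N ** transpose g"
  proof -
    have "D * cnj_mat N' $ i $ m = cnj ((\<chi> i m. cnj D * N' $ i $ m) $ i $ m)" for i m by (simp add: cnj_mat_def)
    then show ?thesis unfolding m by (simp add: vec_eq_iff matrix_matrix_mult_def cnj_mat_def transpose_def)
  qed
  have m2: "(\<chi> i m. cnj D * transpose N' $ i $ m) = cnj_mat g ** transpose N ** transpose g"
  proof -
    have "(\<chi> i m. cnj D * transpose N' $ i $ m) = transpose (\<chi> i m. cnj D * N' $ i $ m)" by (simp add: transpose_def)
    then show ?thesis unfolding m by (simp add: matrix_transpose_mul matrix_mul_assoc)
  qed
  have "D * D * cnj D * psi_coeff N' = cnj D * D * psi_coeff N"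
    unfolding psi_coeff_def Ptri_eq polar_det_scale[symmetric] m1 m2 polar_det_mult
    by (simp add: det_cnj_mat D_def)
  then show "det g * psi_coeff N' = psi_coeff N" using g by (simp add: D_def)
qed

lemma Lfun_eq: "Lfun c1 c2 N = c1 * (cmod (det N))\<^sup>2 + c2 * (cmod (psi_coeff N))\<^sup>2"
  by (simp add: Lfun_def psi_coeff_def)

lemma Lfun_change:
  assumes "\<And>i m. cnj (det g) * N' $ i $ m = (g ** N ** transpose (cnj_mat g)) $ i $ m" "det g \<noteq> 0"
  shows "(cmod (det g))\<^sup>2 * Lfun c1 c2 N' = Lfun c1 c2 N"
proof -
  have "(cmod (det g))\<^sup>2 * (cmod (psi_coeff N'))\<^sup>2 = (cmod (psi_coeff N))\<^sup>2"
    unfolding coefficient_change(2)[OF assms, symmetric] by (simp add: norm_mult power_mult_distrib)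
  then show ?thesis
    using coefficient_change(1)[OF assms] unfolding Lfun_eq by (simp add: algebra_simps)
qed

lemma coframe_change:
  assumes "coframe j \<theta>" "coframe j \<theta>'"
  obtains g where "\<theta>' = change_coframe g \<theta>" "det g \<noteq> 0"
proof -
  interpret t: coframe j \<theta> by fact
  interpret t': coframe j \<theta>' by fact
  define g where "g = (\<chi> i k. \<theta>' i [t.f k])"
  have "\<theta>' i vs = change_coframe g \<theta> i vs" for i vs
  proof (cases "length vs = 1")
    case True
    then obtain v where vs: "vs = [v]" by (auto simp: length_Suc_conv)
    show ?thesis
      using t.expand_10[OF t'.linear_\<theta>, of i v] t'.\<theta>_j
      by (simp add: vs change_coframe_def g_def mult.commute)
  next
    case False
    then show ?thesis using t.degree_\<theta> t'.degree_\<theta> by (simp add: degree_form_def change_coframe_def)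
  qed
  then have eq: "\<theta>' = change_coframe g \<theta>" by (simp add: fun_eq_iff)
  have "det g \<noteq> 0"
  proof
    assume "det g = 0"
    then have "\<not> invertible (transpose g)" by (simp add: invertible_det_nz)
    then obtain z where z: "z \<noteq> 0" "transpose g *v z = 0"
      using invertible_left_inverse matrix_left_invertible_ker by blast
    have "(\<Sum>i\<in>UNIV. z $ i * \<theta>' i vs) = (\<Sum>k\<in>UNIV. (transpose g *v z) $ k * \<theta> k vs)" for vs
      unfolding eq by (simp add: change_coframe_def matrix_vector_mult_def transpose_def sum_3 algebra_simps)
    then have "z $ i = 0" for i using t'.independent[of "\<lambda>i. z $ i"] z(2) by simp
    then show False using z(1) by (simp add: vec_eq_iff)
  qed
  then show thesis using that eq by blast
qed

lemma density_invariant: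
  assumes "coframe j \<theta>" "coframe j \<theta>'" "torsion_matrix \<theta> Q N" "torsion_matrix \<theta>' Q N'"
  shows "complex_of_real (Lfun c1 c2 N') * Omega \<theta>' vs = complex_of_real (Lfun c1 c2 N) * Omega \<theta> vs"
    "psi_coeff N' * vol3 \<theta>' vs = psi_coeff N * vol3 \<theta> vs"
proof -
  interpret coframe j \<theta> by fact
  obtain g where g: "\<theta>' = change_coframe g \<theta>" "det g \<noteq> 0" using coframe_change[OF assms(1,2)] .
  note t = torsion_change[OF assms(3) assms(4)[unfolded g(1)]]
  show "complex_of_real (Lfun c1 c2 N') * Omega \<theta>' vs = complex_of_real (Lfun c1 c2 N) * Omega \<theta> vs"
    unfolding g(1) Omega_change_coframe[OF degree_\<theta>] Lfun_change[OF t g(2), symmetric] by simp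
  show "psi_coeff N' * vol3 \<theta>' vs = psi_coeff N * vol3 \<theta> vs"
    unfolding g(1) vol3_change_coframe[OF degree_\<theta>] coefficient_change(2)[OF t g(2), symmetric] by simp
qed

section \<open>Coframings and their torsion\<close>

lemma linear_family_has_derivative:
  fixes F :: "'a::real_normed_vector \<Rightarrow> 'b::euclidean_space \<Rightarrow> 'c::real_normed_vector"
  assumes "open S" "x \<in> S" "\<And>y. y \<in> S \<Longrightarrow> linear (F y)" "\<And>v. (\<lambda>y. F y v) differentiable (at x)"
    and g: "g differentiable (at x)"
  shows "((\<lambda>y. F y (g y)) has_derivative
    (\<lambda>w. frechet_derivative (\<lambda>y. F y (g x)) (at x) w + F x (frechet_derivative g (at x) w))) (at x)"
proof -
  have expand: "F y v = (\<Sum>b\<in>Basis. (v \<bullet> b) *\<^sub>R F y b)" if "y \<in> S" for y v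
    using linear_sum[OF assms(3)[OF that], of "\<lambda>b. (v \<bullet> b) *\<^sub>R b" Basis] linear_cmul[OF assms(3)[OF that]]
    by (simp add: euclidean_representation)
  define D where "D v w = frechet_derivative (\<lambda>y. F y v) (at x) w" for v w
  have D: "((\<lambda>y. F y v) has_derivative D v) (at x)" for v
    using assms(4)[of v] unfolding D_def[abs_def] by (simp add: frechet_derivative_works)
  have gd: "(g has_derivative frechet_derivative g (at x)) (at x)" using g by (simp add: frechet_derivative_works)
  have "((\<lambda>y. \<Sum>b\<in>Basis. (v \<bullet> b) *\<^sub>R F y b) has_derivative (\<lambda>w. \<Sum>b\<in>Basis. (v \<bullet> b) *\<^sub>R D b w)) (at x)" for v
    by (intro has_derivative_sum has_derivative_scaleR_right D)
  then have "((\<lambda>y. F y v) has_derivative (\<lambda>w. \<Sum>b\<in>Basis. (v \<bullet> b) *\<^sub>R D b w)) (at x)" for v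
    by (rule has_derivative_transform_within_open[OF _ assms(1,2)]) (simp add: expand[symmetric])
  then have Dexp: "D v = (\<lambda>w. \<Sum>b\<in>Basis. (v \<bullet> b) *\<^sub>R D b w)" for v
    using has_derivative_unique[OF D] by blast
  have gb: "((\<lambda>y. g y \<bullet> b) has_derivative (\<lambda>w. frechet_derivative g (at x) w \<bullet> b)) (at x)" for b
    using has_derivative_inner_left[OF gd] .
  have "((\<lambda>y. \<Sum>b\<in>Basis. (g y \<bullet> b) *\<^sub>R F y b) has_derivative
      (\<lambda>w. \<Sum>b\<in>Basis. (g x \<bullet> b) *\<^sub>R D b w + (frechet_derivative g (at x) w \<bullet> b) *\<^sub>R F x b)) (at x)"
    by (intro has_derivative_sum has_derivative_scaleR gb D)
  then have "((\<lambda>y. F y (g y)) has_derivative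
      (\<lambda>w. \<Sum>b\<in>Basis. (g x \<bullet> b) *\<^sub>R D b w + (frechet_derivative g (at x) w \<bullet> b) *\<^sub>R F x b)) (at x)"
    by (rule has_derivative_transform_within_open[OF _ assms(1,2)]) (simp add: expand[symmetric])
  moreover have "(\<lambda>w. \<Sum>b\<in>Basis. (g x \<bullet> b) *\<^sub>R D b w + (frechet_derivative g (at x) w \<bullet> b) *\<^sub>R F x b) =
      (\<lambda>w. D (g x) w + F x (frechet_derivative g (at x) w))"
    by (simp add: sum.distrib expand[OF assms(2), symmetric] fun_cong[OF Dexp[of "g x"], symmetric])
  ultimately show ?thesis by (simp add: D_def)
qed

lemma frechet_linear_family:
  fixes F :: "'a::real_normed_vector \<Rightarrow> 'b::euclidean_space \<Rightarrow> 'c::real_normed_vector"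
  assumes "open S" "x \<in> S" "\<And>y. y \<in> S \<Longrightarrow> linear (F y)" "\<And>v. (\<lambda>y. F y v) differentiable (at x)"
    "g differentiable (at x)"
  shows "frechet_derivative (\<lambda>y. F y (g y)) (at x) w =
    frechet_derivative (\<lambda>y. F y (g x)) (at x) w + F x (frechet_derivative g (at x) w)"
  using frechet_derivative_at[OF linear_family_has_derivative[OF assms]] by metis

lemma frechet_family_linear:
  fixes F :: "'a::real_normed_vector \<Rightarrow> 'b::real_normed_vector \<Rightarrow> 'c::real_normed_vector"
  assumes "open S" "x \<in> S" "\<And>y. y \<in> S \<Longrightarrow> linear (F y)" "\<And>v. (\<lambda>y. F y v) differentiable (at x)"
  shows "linear (\<lambda>v. frechet_derivative (\<lambda>y. F y v) (at x) w)"
proof (rule linearI)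
  have D: "((\<lambda>y. F y v) has_derivative frechet_derivative (\<lambda>y. F y v) (at x)) (at x)" for v
    using assms(4)[of v] by (simp add: frechet_derivative_works)
  fix u v
  have "((\<lambda>y. F y (u + v)) has_derivative (\<lambda>w. frechet_derivative (\<lambda>y. F y u) (at x) w + frechet_derivative (\<lambda>y. F y v) (at x) w)) (at x)"
    by (rule has_derivative_transform_within_open[OF has_derivative_add[OF D D] assms(1,2)])
      (simp add: linear_add[OF assms(3)])
  from has_derivative_unique[OF D this]
  show "frechet_derivative (\<lambda>y. F y (u + v)) (at x) w = frechet_derivative (\<lambda>y. F y u) (at x) w + frechet_derivative (\<lambda>y. F y v) (at x) w"
    by (rule fun_cong)
next
  have D: "((\<lambda>y. F y v) has_derivative frechet_derivative (\<lambda>y. F y v) (at x)) (at x)" for v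
    using assms(4)[of v] by (simp add: frechet_derivative_works)
  fix r v
  have "((\<lambda>y. F y (r *\<^sub>R v)) has_derivative (\<lambda>w. r *\<^sub>R frechet_derivative (\<lambda>y. F y v) (at x) w)) (at x)"
    by (rule has_derivative_transform_within_open[OF has_derivative_scaleR_right[OF D] assms(1,2)])
      (simp add: linear_cmul[OF assms(3)])
  from has_derivative_unique[OF D this]
  show "frechet_derivative (\<lambda>y. F y (r *\<^sub>R v)) (at x) w = r *\<^sub>R frechet_derivative (\<lambda>y. F y v) (at x) w"
    by (rule fun_cong)
qed

lemma nths_pair: "nths [u, v] (- {0}) = [v]" "nths [u, v] (- {Suc 0}) = [u]"
  by (simp_all add: nths_Cons)

lemma ext_d_pair:
  "ext_d a x [u, v] = frechet_derivative (\<lambda>y. a y [v]) (at x) u - frechet_derivative (\<lambda>y. a y [u]) (at x) v"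
  by (simp add: ext_d_def numeral_2_eq_2 nths_pair)

lemma length_nths_compl: "i < length vs \<Longrightarrow> length (nths vs (- {i})) = length vs - 1"
proof -
  assume "i < length vs"
  moreover have "{k. k < length vs \<and> k \<in> - {i}} = {..<length vs} - {i}" by auto
  ultimately show ?thesis by (simp add: length_nths)
qed

lemma ext_d_degree:
  assumes "open S" "x \<in> S" "\<And>y. y \<in> S \<Longrightarrow> degree_form k (a y)"
  shows "degree_form (Suc k) (ext_d a x)"
  unfolding degree_form_def
proof (intro allI impI)
  fix vs :: "(real^6) list" assume "length vs \<noteq> Suc k"
  have "frechet_derivative (\<lambda>y. a y (nths vs (- {i}))) (at x) v = 0" if i: "i < length vs" for i v
  proof -
    have "length (nths vs (- {i})) \<noteq> k" using \<open>length vs \<noteq> Suc k\<close> i length_nths_compl[OF i] by linarith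
    then have "frechet_derivative (\<lambda>y. a y (nths vs (- {i}))) (at x) = frechet_derivative (\<lambda>y. 0) (at x)"
      using assms(3) by (intro frechet_derivative_cong_open[OF assms(1,2)]) (simp add: degree_form_def)
    then show ?thesis by simp
  qed
  then show "ext_d a x vs = 0" by (simp add: ext_d_def)
qed

lemma ext_d_alt_2:
  assumes S: "open S" "x \<in> S" and a: "\<And>y. y \<in> S \<Longrightarrow> alt_form 1 (a y)" and d: "\<And>v. (\<lambda>y. a y [v]) differentiable (at x)"
  shows "alt_form 2 (ext_d a x)"
proof (rule alt_formI)
  have deg: "degree_form 2 (ext_d a x)"
    using ext_d_degree[OF S alt_form_degree[OF a]] by (simp add: numeral_2_eq_2)
  then show "degree_form 2 (ext_d a x)" .
  have l1: "linear (\<lambda>v. frechet_derivative (\<lambda>y. a y [v]) (at x) w)" for w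
    using frechet_family_linear[of S x "\<lambda>y v. a y [v]"] S alt_form_1_linear[OF a] d by blast
  have l2: "linear (frechet_derivative (\<lambda>y. a y [v]) (at x))" for v
    by (rule frechet_derivative_linear[OF d])
  show "linear (\<lambda>v. ext_d a x (us @ v # ws))" for us ws
  proof (cases "length us + length ws = 1")
    case True
    then consider w where "us = [w]" "ws = []" | w where "us = []" "ws = [w]"
      by (cases us; cases ws) auto
    then show ?thesis
      by cases (simp_all add: ext_d_pair linear_compose_sub l1 l2)
  next
    case False
    then have "(\<lambda>v. ext_d a x (us @ v # ws)) = (\<lambda>v. 0)"
      using deg by (intro ext) (simp add: degree_form_def)
    then show ?thesis by (simp add: linear_iff)
  qed
  show "ext_d a x (us @ v # v # ws) = 0" for us v ws
  proof (cases "us = [] \<and> ws = []")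
    case True
    then show ?thesis by (simp add: ext_d_pair)
  next
    case False
    then have "length (us @ v # v # ws) \<noteq> 2" by auto
    then show ?thesis using deg by (simp add: degree_form_def)
  qed
qed

definition nij :: "(real^6 \<Rightarrow> real^6 \<Rightarrow> real^6) \<Rightarrow> real^6 \<Rightarrow> real^6 \<Rightarrow> real^6 \<Rightarrow> real^6" where
  "nij J x u v = J x (frechet_derivative (\<lambda>y. J y v) (at x) u - frechet_derivative (\<lambda>y. J y u) (at x) v)
     - (frechet_derivative (\<lambda>y. J y v) (at x) (J x u) - frechet_derivative (\<lambda>y. J y u) (at x) (J x v))"

text \<open>Differentiating \<open>a (J v) = \<i> a v\<close> turns the derivatives of the form \<open>a\<close> into derivatives of \<open>J\<close>.
  Hence the torsion at a point depends on the coframing only through its value there.\<close>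

lemma P02_ext_d:
  assumes S: "open S" "x \<in> S" and J: "\<And>y. y \<in> S \<Longrightarrow> linear (J y)" "\<And>v. (\<lambda>y. J y v) differentiable (at x)"
    and a: "\<And>y. y \<in> S \<Longrightarrow> type10 (J y) (a y)" "\<And>v. (\<lambda>y. a y [v]) differentiable (at x)"
  shows "P02 (J x) (\<lambda>u v. ext_d a x [u, v]) u v = - a x [nij J x u v] / 4"
proof -
  define D where "D w v = frechet_derivative (\<lambda>y. a y [v]) (at x) w" for w v
  define E where "E w v = frechet_derivative (\<lambda>y. J y v) (at x) w" for w v
  have alt: "alt_form 1 (a y)" if "y \<in> S" for y using a(1)[OF that] by (simp add: type10_def)
  note lin = alt_form_1_linear[OF alt]
  have key: "D w (J x v) = \<i> * D w v - a x [E w v]" for w v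
  proof -
    have "frechet_derivative (\<lambda>y. a y [J y v]) (at x) w = frechet_derivative (\<lambda>y. \<i> * a y [v]) (at x) w"
      using a(1) by (intro fun_cong[OF frechet_derivative_cong_open[OF S]]) (simp add: type10_def)
    moreover have "frechet_derivative (\<lambda>y. \<i> * a y [v]) (at x) w = \<i> * D w v"
      unfolding D_def by (rule frechet_derivative_bounded_linear_at[OF bounded_linear_mult_right a(2)])
    moreover have "frechet_derivative (\<lambda>y. a y [J y v]) (at x) w = D w (J x v) + a x [E w v]"
      unfolding D_def E_def
      by (rule frechet_linear_family[of S x "\<lambda>y v. a y [v]", OF S lin a(2) J(2)])
    ultimately show ?thesis by (simp add: algebra_simps)
  qed
  note l = lin[OF S(2)]
  have aJ: "a x [J x w] = \<i> * a x [w]" for w using a(1)[OF S(2)] by (simp add: type10_def)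
  have e1: "a x [nij J x u v] = \<i> * (a x [E u v] - a x [E v u]) - (a x [E (J x u) v] - a x [E (J x v) u])"
    unfolding nij_def E_def[symmetric] linear_diff[OF l] aJ ..
  have e2: "P02 (J x) (\<lambda>u v. ext_d a x [u, v]) u v =
     (D u v - D v u + \<i> * (D (J x u) v - D v (J x u)) + \<i> * (D u (J x v) - D (J x v) u)
       - (D (J x u) (J x v) - D (J x v) (J x u))) / 4"
    by (simp add: P02_def ext_d_pair D_def)
  show ?thesis unfolding e1 e2 key by (simp add: field_simps)
qed

lemma wedge_map: "(\<omega> \<and>\<^sub>e \<eta>) (map T vs) = ((\<lambda>us. \<omega> (map T us)) \<and>\<^sub>e (\<lambda>us. \<eta> (map T us))) vs"
  by (simp add: wedge_def nths_map)

lemma vol3_map: "vol3 \<theta> (map T vs) = vol3 (\<lambda>i us. \<theta> i (map T us)) vs"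
  by (simp add: vol3_def wedge_map)

lemma Omega_map: "Omega \<theta> (map T vs) = Omega (\<lambda>i us. \<theta> i (map T us)) vs"
  by (simp add: Omega_def wedge_map vol3_map cnj_form_def)

lemma solve_det:
  fixes G :: "complex^3^3"
  assumes "det G \<noteq> 0" "\<And>k. (\<Sum>i\<in>UNIV. z i * G $ i $ k) = 0"
  shows "z i = 0"
proof -
  have "transpose G *v (\<chi> i. z i) = 0"
    using assms(2) by (simp add: vec_eq_iff matrix_vector_mult_def transpose_def mult.commute)
  moreover have "invertible (transpose G)" using assms(1) by (simp add: invertible_det_nz)
  ultimately have "(\<chi> i. z i) = 0" using invertible_left_inverse matrix_left_invertible_ker by blast
  then show ?thesis by (simp add: vec_eq_iff)
qed

text \<open>Successively choosing \<open>w\<^sub>k\<close> in the kernel of the forms already constructed makes the matrix triangular.\<close>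

lemma exists_covectors:
  assumes j: "linear j"
  shows "\<exists>w :: 3 \<Rightarrow> real^6. det ((\<chi> i k. (complex_of_real (w i \<bullet> w k) - \<i> * complex_of_real (w i \<bullet> j (w k))) / 2) :: complex^3^3) \<noteq> 0"
proof -
  have ex: "\<exists>v::real^6. v \<noteq> 0 \<and> (\<forall>u\<in>set us. u \<bullet> v = 0)" if "length us < 6" for us
  proof -
    have "dim (set us) \<le> card (set us)" by (rule dim_le_card') simp
    then have "dim (set us) < DIM(real^6)" using card_length[of us] that by simp
    then obtain v where "v \<noteq> 0" "\<And>y. y \<in> span (set us) \<Longrightarrow> orthogonal v y"
      using orthogonal_to_subspace_exists by blast
    then show ?thesis by (metis inner_commute orthogonal_def span_base)
  qed
  obtain a :: "real^6" where a: "a \<noteq> 0" using ex[of "[]"] by auto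
  obtain b where b: "b \<noteq> 0" "a \<bullet> b = 0" "a \<bullet> j b = 0"
    using ex[of "[a, adjoint j a]"] adjoint_works[OF j] by (auto simp: inner_commute)
  obtain c where c: "c \<noteq> 0" "a \<bullet> c = 0" "a \<bullet> j c = 0" "b \<bullet> c = 0" "b \<bullet> j c = 0"
    using ex[of "[a, adjoint j a, b, adjoint j b]"] adjoint_works[OF j] by (auto simp: inner_commute)
  have nz: "complex_of_real (v \<bullet> v) - \<i> * complex_of_real (v \<bullet> j v) \<noteq> 0" if "v \<noteq> 0" for v
    using that by (auto simp: complex_eq_iff)
  show ?thesis
    by (rule exI[of _ "\<lambda>i. if i = 1 then a else if i = 2 then b else c"]) (use a b c nz in \<open>simp add: det_3\<close>)
qed

context atlas
begin

lemma almost_complexD: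
  assumes "almost_complex A J" "c \<in> A"
  shows "x \<in> coord_set c UNIV \<Longrightarrow> linear (J c x)" "x \<in> coord_set c UNIV \<Longrightarrow> J c x (J c x v) = - v"
    "smooth_on (coord_set c UNIV) (\<lambda>x. J c x v)"
    "c' \<in> A \<Longrightarrow> x \<in> coord_set c (fst c') \<Longrightarrow>
      J c' (transition c c' x) (transition_deriv c c' x v) = transition_deriv c c' x (J c x v)"
  using assms unfolding almost_complex_def by blast+

lemma form_onD:
  assumes "form_on A U k \<omega>" "c \<in> A"
  shows "x \<in> coord_set c U \<Longrightarrow> alt_form k (\<omega> c x)" "smooth_on (coord_set c U) (\<lambda>x. \<omega> c x vs)"
    "c' \<in> A \<Longrightarrow> x \<in> coord_set c (U \<inter> fst c') \<Longrightarrow>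
      \<omega> c' (transition c c' x) (map (transition_deriv c c' x) vs) = \<omega> c x vs"
  using assms unfolding form_on_def by blast+

lemma coframingD:
  assumes "coframing A J U \<alpha>"
  shows "open U" "form_on A U 1 (\<alpha> i)" "c \<in> A \<Longrightarrow> x \<in> coord_set c U \<Longrightarrow> type10 (J c x) (\<alpha> i c x)"
  using assms unfolding coframing_def by blast+

lemma coframing_coframe:
  assumes "almost_complex A J" "coframing A J U \<alpha>" "c \<in> A" "x \<in> coord_set c U"
  shows "coframe (J c x) (\<lambda>i. \<alpha> i c x)"
proof (rule coframe.intro)
  have x: "x \<in> coord_set c UNIV" using assms(4) by (rule coord_set_UNIV)
  show "linear (J c x)" by (rule almost_complexD(1)[OF assms(1,3) x])
  show "J c x (J c x v) = - v" for v :: "real^6" by (rule almost_complexD(2)[OF assms(1,3) x])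
  show "type10 (J c x) (\<alpha> i c x)" for i :: 3 using coframingD(3)[OF assms(2-4)] .
  show "z i = 0" if "\<And>vs. (\<Sum>i\<in>UNIV. z i * \<alpha> i c x vs) = 0" for z i
    using assms(2-4) that unfolding coframing_def by blast
qed

lemma coframing_differentiable:
  assumes "almost_complex A J" "coframing A J U \<alpha>" "c \<in> A" "x \<in> coord_set c U"
  shows "(\<lambda>y. \<alpha> i c y vs) differentiable (at x)" "(\<lambda>y. J c y v) differentiable (at x)"
  using smooth_on_differentiable[OF form_onD(2)[OF coframingD(2)[OF assms(2)] assms(3)] assms(4)]
    smooth_on_differentiable[OF almost_complexD(3)[OF assms(1,3)] coord_set_UNIV[OF assms(4)]] by auto

lemma coframing_ext_d_alt:
  assumes "coframing A J U \<alpha>" "c \<in> A" "x \<in> coord_set c U"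
  shows "alt_form 2 (ext_d (\<alpha> i c) x)"
  using form_onD(1)[OF coframingD(2)[OF assms(1)] assms(2)]
    smooth_on_differentiable[OF form_onD(2)[OF coframingD(2)[OF assms(1)] assms(2)] assms(3)]
  by (intro ext_d_alt_2[OF open_coord_set[OF assms(2) coframingD(1)[OF assms(1)]] assms(3)]) auto

lemma coframing_P02:
  assumes "almost_complex A J" "coframing A J U \<alpha>" "c \<in> A" "x \<in> coord_set c U"
  shows "P02 (J c x) (\<lambda>u v. ext_d (\<alpha> i c) x [u, v]) u v = - \<alpha> i c x [nij (J c) x u v] / 4"
  using almost_complexD(1)[OF assms(1,3) coord_set_UNIV] coframingD(3)[OF assms(2,3)] coframing_differentiable[OF assms]
  by (intro P02_ext_d[OF open_coord_set[OF assms(3) coframingD(1)[OF assms(2)]] assms(4)]) auto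

lemma Nmat_P02:
  assumes "almost_complex A J" "coframing A J U \<alpha>" "c \<in> A" "x \<in> coord_set c U"
  shows "P02 (J c x) (\<lambda>u v. ext_d (\<alpha> i c) x [u, v]) u v =
    (\<Sum>k\<in>UNIV. \<Sum>l\<in>UNIV. mat_comp (Nmat J \<alpha> c x) i k l * cnj (\<alpha> k c x [u]) * cnj (\<alpha> l c x [v]))"
proof -
  interpret coframe "J c x" "\<lambda>i. \<alpha> i c x" by (rule coframing_coframe[OF assms])
  show ?thesis
    using the_Nmat[of "\<lambda>i. ext_d (\<alpha> i c) x", OF coframing_ext_d_alt[OF assms(2-4)]] unfolding Nmat_def by simp
qed

lemma Nmat_torsion:
  assumes "almost_complex A J" "coframing A J U \<alpha>" "c \<in> A" "x \<in> coord_set c U"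
  shows "torsion_matrix (\<lambda>i. \<alpha> i c x) (nij (J c) x) (Nmat J \<alpha> c x)"
  unfolding torsion_matrix_def Nmat_P02[OF assms, symmetric] coframing_P02[OF assms] by blast

lemma ext_d_transition:
  assumes "form_on A U 1 \<omega>" "open U" "c \<in> A" "c' \<in> A" "x \<in> coord_set c (U \<inter> fst c')"
  shows "ext_d (\<omega> c') (transition c c' x) [transition_deriv c c' x u, transition_deriv c c' x v] = ext_d (\<omega> c) x [u, v]"
proof -
  let ?\<tau> = "transition c c'" and ?T = "transition_deriv c c'" and ?S = "coord_set c (U \<inter> fst c')"
  have S: "open ?S" using open_coord_set[OF assms(3)] assms(2) open_chart[OF assms(4)] by blast
  have sub: "?S \<subseteq> coord_set c (fst c')" by (auto simp: coord_set_def)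
  have \<tau>S: "?\<tau> y \<in> coord_set c' U" if "y \<in> ?S" for y
    using transition_in[OF assms(3,4) that] by (auto simp: coord_set_def)
  have d\<tau>: "?\<tau> differentiable (at x)"
    using smooth_on_differentiable[OF smooth_transition[OF assms(3,4)]] assms(5) sub by blast
  have d\<omega>: "(\<lambda>y. \<omega> c' y [w]) differentiable (at (?\<tau> x))" for w
    using smooth_on_differentiable[OF form_onD(2)[OF assms(1,4)] \<tau>S[OF assms(5)]] .
  have T: "?T x = frechet_derivative ?\<tau> (at x)" by (rule ext) (simp add: transition_deriv_def)
  have dF: "(\<lambda>y. \<omega> c' (?\<tau> y) [w]) differentiable (at x)" for w
    using differentiable_compose[OF d\<omega> d\<tau>] .
  have dT: "(\<lambda>y. ?T y w) differentiable (at x)" for w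
    using smooth_on_differentiable[OF smooth_transition_deriv[OF assms(3,4)]] assms(5) sub by blast
  have lin: "linear (\<lambda>w. \<omega> c' (?\<tau> y) [w])" if "y \<in> ?S" for y
    by (rule alt_form_1_linear[OF form_onD(1)[OF assms(1,4) \<tau>S[OF that]]])
  have eq: "frechet_derivative (\<lambda>y. \<omega> c y [w]) (at x) z =
      frechet_derivative (\<lambda>y. \<omega> c' y [?T x w]) (at (?\<tau> x)) (?T x z)
      + \<omega> c' (?\<tau> x) [frechet_derivative (\<lambda>y. ?T y w) (at x) z]" for w z
  proof -
    have "frechet_derivative (\<lambda>y. \<omega> c y [w]) (at x) z = frechet_derivative (\<lambda>y. \<omega> c' (?\<tau> y) [?T y w]) (at x) z"
      by (rule fun_cong[OF frechet_derivative_cong_open[OF S assms(5)]])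
        (use form_onD(3)[OF assms(1,3,4), of _ "[w]"] in simp)
    also have "\<dots> = frechet_derivative (\<lambda>y. \<omega> c' (?\<tau> y) [?T x w]) (at x) z
        + \<omega> c' (?\<tau> x) [frechet_derivative (\<lambda>y. ?T y w) (at x) z]"
      by (rule frechet_linear_family[of ?S x "\<lambda>y w. \<omega> c' (?\<tau> y) [w]", OF S assms(5) lin dF dT])
    also have "frechet_derivative (\<lambda>y. \<omega> c' (?\<tau> y) [?T x w]) (at x) z =
        frechet_derivative (\<lambda>y. \<omega> c' y [?T x w]) (at (?\<tau> x)) (?T x z)"
      unfolding T by (rule frechet_derivative_compose_at[of "\<lambda>y. \<omega> c' y [_]", OF d\<omega> d\<tau>])
    finally show ?thesis .
  qed
  have sym: "frechet_derivative (\<lambda>y. ?T y v) (at x) u = frechet_derivative (\<lambda>y. ?T y u) (at x) v"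
    unfolding transition_deriv_def
    by (rule second_derivative_symmetric[OF S assms(5) smooth_on_subset[OF smooth_transition[OF assms(3,4)] sub]])
  show ?thesis unfolding ext_d_pair eq sym by simp
qed

lemma exists_coframing:
  assumes J: "almost_complex A J" and c: "c \<in> A" and x: "x \<in> coord_set c UNIV"
  shows "\<exists>U \<alpha>. coframing A J U \<alpha> \<and> x \<in> coord_set c U \<and> U \<subseteq> fst c"
proof -
  obtain w :: "3 \<Rightarrow> real^6" where w:
    "det ((\<chi> i k. (complex_of_real (w i \<bullet> w k) - \<i> * complex_of_real (w i \<bullet> J c x (w k))) / 2) :: complex^3^3) \<noteq> 0"
    using exists_covectors[OF almost_complexD(1)[OF J c x]] by blast
  define G where "G y = (\<chi> i k. (complex_of_real (w i \<bullet> w k) - \<i> * complex_of_real (w i \<bullet> J c y (w k))) / 2 :: complex^3^3)" for y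
  define V where "V = {y \<in> coord_set c UNIV. det (G y) \<noteq> 0}"
  define U where "U = fst c \<inter> snd c -` V"
  define \<alpha> where "\<alpha> i c' y vs = (if length vs = 1 then
     (complex_of_real (w i \<bullet> transition_deriv c' c y (hd vs)) - \<i> * complex_of_real (w i \<bullet> transition_deriv c' c y (J c' y (hd vs)))) / 2
     else 0)" for i c' y vs
  have oc: "open (coord_set c UNIV)" by (rule open_coord_set[OF c open_UNIV])
  have "continuous_on (coord_set c UNIV) (\<lambda>y. J c y v)" for v
    by (rule smooth_on_continuous_on[OF almost_complexD(3)[OF J c]])
  then have "continuous_on (coord_set c UNIV) (\<lambda>y. det (G y))"
    unfolding G_def det_3 by (simp, intro continuous_intros) auto
  then have "open (coord_set c UNIV \<inter> (\<lambda>y. det (G y)) -` (- {0}))"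
    by (rule continuous_open_preimage[OF _ oc]) auto
  moreover have "coord_set c UNIV \<inter> (\<lambda>y. det (G y)) -` (- {0}) = V" by (auto simp: V_def)
  ultimately have oV: "open V" by simp
  have "continuous_on (fst c) (snd c)" using chart_homeomorphism[OF c] by (simp add: homeomorphism_def)
  then have oU: "open U" unfolding U_def by (rule continuous_open_preimage[OF _ open_chart[OF c] oV])
  have inV: "y \<in> V" if "y \<in> coord_set c U" for y using that by (auto simp: coord_set_def U_def)
  have Vin: "y \<in> coord_set c U" if "y \<in> V" for y
    using that by (auto simp: coord_set_def U_def V_def)
  have sub: "coord_set c' U \<subseteq> coord_set c' (fst c)" for c' by (auto simp: coord_set_def U_def)
  have lin: "linear (transition_deriv c' c y)" "linear (J c' y)" if "c' \<in> A" "y \<in> coord_set c' U" for c' y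
    using linear_transition_deriv[OF that(1) c] almost_complexD(1)[OF J that(1)] that sub coord_set_UNIV by blast+
  have alt: "alt_form 1 (\<alpha> i c' y)" if "c' \<in> A" "y \<in> coord_set c' U" for i c' y
  proof (rule alt_form_1I)
    show "linear (\<lambda>v. \<alpha> i c' y [v])"
      using lin[OF that] by (simp add: \<alpha>_def linear_iff inner_add_right scaleR_complex algebra_simps) (simp add: field_simps)
  qed (simp add: \<alpha>_def)
  have form: "form_on A U 1 (\<alpha> i)" for i
    unfolding form_on_def
  proof (intro conjI ballI allI)
    fix c' assume c': "c' \<in> A"
    show "alt_form 1 (\<alpha> i c' y)" if "y \<in> coord_set c' U" for y by (rule alt[OF c' that])
    have o: "open (coord_set c' U)" by (rule open_coord_set[OF c' oU])
    have sT: "smooth_on (coord_set c' U) (\<lambda>y. transition_deriv c' c y v)" for v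
      by (rule smooth_on_subset[OF smooth_transition_deriv[OF c' c] sub])
    have sJ: "smooth_on (coord_set c' U) (\<lambda>y. J c' y v)" for v
      by (rule smooth_on_subset[OF almost_complexD(3)[OF J c'] coord_set_mono]) simp
    have sTJ: "smooth_on (coord_set c' U) (\<lambda>y. transition_deriv c' c y (J c' y v))" for v
      by (rule smooth_on_linear_family[OF o sT sJ lin(1)[OF c']])
    show "smooth_on (coord_set c' U) (\<lambda>y. \<alpha> i c' y vs)" for vs
    proof (cases "length vs = 1")
      case True
      then show ?thesis unfolding \<alpha>_def if_P[OF True]
        by (intro smooth_on_divide smooth_on_diff smooth_on_mult smooth_on_const smooth_on_of_real o
            smooth_on_bounded_linear[OF bounded_linear_inner_right] sT sTJ) auto
    qed (simp add: \<alpha>_def smooth_on_const o)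
  next
    fix c1 c2 y vs assume c12: "c1 \<in> A" "c2 \<in> A" and y: "y \<in> coord_set c1 (U \<inter> fst c2)"
    have y1: "y \<in> coord_set c1 (fst c2 \<inter> fst c)" and y2: "y \<in> coord_set c1 (fst c2)"
      using y by (auto simp: coord_set_def U_def)
    show "\<alpha> i c2 (transition c1 c2 y) (map (transition_deriv c1 c2 y) vs) = \<alpha> i c1 y vs"
      using transition_deriv_compose[OF c12 c y1] almost_complexD(4)[OF J c12 y2]
      by (cases vs) (simp_all add: \<alpha>_def)
  qed
  have "coframing A J U \<alpha>"
    unfolding coframing_def
  proof (intro conjI ballI allI impI)
    show "form_on A U 1 (\<alpha> i)" for i by (rule form)
    fix c' y assume c': "c' \<in> A" and y: "y \<in> coord_set c' U"
    have yU: "y \<in> coord_set c' UNIV" by (rule coord_set_UNIV[OF y])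
    show "type10 (J c' y) (\<alpha> i c' y)" for i
      unfolding type10_def
    proof (intro conjI allI)
      show "alt_form 1 (\<alpha> i c' y)" by (rule alt[OF c' y])
      show "\<alpha> i c' y [J c' y v] = \<i> * \<alpha> i c' y [v]" for v
        by (simp add: \<alpha>_def almost_complexD(2)[OF J c' yU] linear_neg[OF lin(1)[OF c' y]] field_simps)
    qed
    fix z :: "3 \<Rightarrow> complex" and i
    assume z: "\<forall>vs. (\<Sum>i\<in>UNIV. z i * \<alpha> i c' y vs) = 0"
    have yc: "y \<in> coord_set c' (fst c)" and yc': "y \<in> coord_set c' (U \<inter> fst c)" using y by (auto simp: coord_set_def U_def)
    define y0 where "y0 = transition c' c y"
    have y0: "y0 \<in> coord_set c (U \<inter> fst c')" unfolding y0_def by (rule transition_in[OF c' c yc'])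
    then have y0': "y0 \<in> coord_set c (fst c')" "y0 \<in> coord_set c U" by (auto simp: coord_set_def)
    have yback: "transition c c' y0 = y"
      unfolding y0_def using transition_transition[OF c' c, of y c'] transition_self[OF c' yU] y yc
      by (metis Int_commute coord_set_Int_chart)
    define u where "u k = transition_deriv c c' y0 (w k)" for k
    have Tu: "transition_deriv c' c y (u k) = w k" for k
      using transition_deriv_inverse[OF c c' y0'(1), of "w k"] by (simp add: u_def yback)
    have TJ: "transition_deriv c' c y (J c' y (u k)) = J c y0 (w k)" for k
      using almost_complexD(4)[OF J c' c yc, of "u k"] by (simp add: Tu y0_def)
    have zero: "(\<Sum>i\<in>UNIV. z i * G y0 $ i $ k) = 0" for k
      using z[rule_format, of "[u k]"] by (simp add: \<alpha>_def Tu TJ G_def)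
    have "det (G y0) \<noteq> 0" using inV[OF y0'(2)] by (simp add: V_def)
    from solve_det[OF this zero] show "z i = 0" .
  qed (rule oU)
  moreover have "x \<in> V" using w x by (simp add: V_def G_def)
  ultimately show ?thesis using Vin by (auto simp: U_def)
qed

definition density :: "real \<Rightarrow> real \<Rightarrow> 'a endo_field \<Rightarrow> 'a form_field" where
  "density c1 c2 J c x vs = complex_of_real c1 * Phi A J c x vs +
     complex_of_real c2 * (\<i> / 8 * (psi A J c x \<and>\<^sub>e cnj_form (psi A J c x)) vs)"

lemma Phi_eq:
  assumes J: "almost_complex A J" and \<alpha>: "coframing A J U \<alpha>" and c: "c \<in> A" "x \<in> coord_set c U"
  shows "Phi A J c x = (\<lambda>vs. complex_of_real (Lfun 1 0 (Nmat J \<alpha> c x)) * Omega (\<lambda>i. \<alpha> i c x) vs)"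
proof -
  have e: "\<i> / 8 * complex_of_real ((cmod (det N))\<^sup>2) * (\<theta> 1 \<and>\<^sub>e \<theta> 2 \<and>\<^sub>e \<theta> 3 \<and>\<^sub>e cnj_form (\<theta> 1) \<and>\<^sub>e cnj_form (\<theta> 2) \<and>\<^sub>e cnj_form (\<theta> 3)) vs
     = complex_of_real (Lfun 1 0 N) * Omega \<theta> vs" for N \<theta> vs
    by (simp add: Lfun_def Omega_def vol3_def wedge_assoc cnj_form_wedge)
  show ?thesis unfolding Phi_def Let_def e
  proof (rule the_equality)
    show "\<forall>U' \<alpha>'. coframing A J U' \<alpha>' \<and> x \<in> coord_set c U' \<longrightarrow>
      (\<lambda>vs. complex_of_real (Lfun 1 0 (Nmat J \<alpha> c x)) * Omega (\<lambda>i. \<alpha> i c x) vs) =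
      (\<lambda>vs. complex_of_real (Lfun 1 0 (Nmat J \<alpha>' c x)) * Omega (\<lambda>i. \<alpha>' i c x) vs)"
    proof (intro allI impI ext)
      fix U' \<alpha>' vs assume a: "coframing A J U' \<alpha>' \<and> x \<in> coord_set c U'"
      show "complex_of_real (Lfun 1 0 (Nmat J \<alpha> c x)) * Omega (\<lambda>i. \<alpha> i c x) vs =
        complex_of_real (Lfun 1 0 (Nmat J \<alpha>' c x)) * Omega (\<lambda>i. \<alpha>' i c x) vs"
        using a by (intro density_invariant(1)[OF coframing_coframe[OF J _ c(1)] coframing_coframe[OF J \<alpha> c]
            Nmat_torsion[OF J _ c(1)] Nmat_torsion[OF J \<alpha> c]]) auto
    qed
  qed (use \<alpha> c in blast)
qed

lemma psi_eq:
  assumes J: "almost_complex A J" and \<alpha>: "coframing A J U \<alpha>" and c: "c \<in> A" "x \<in> coord_set c U"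
  shows "psi A J c x = (\<lambda>vs. psi_coeff (Nmat J \<alpha> c x) * vol3 (\<lambda>i. \<alpha> i c x) vs)"
  unfolding psi_def Let_def psi_coeff_def[symmetric] vol3_def[of "\<lambda>i. _ i c x", symmetric]
proof (rule the_equality)
  show "\<forall>U' \<alpha>'. coframing A J U' \<alpha>' \<and> x \<in> coord_set c U' \<longrightarrow>
    (\<lambda>vs. psi_coeff (Nmat J \<alpha> c x) * vol3 (\<lambda>i. \<alpha> i c x) vs) =
    (\<lambda>vs. psi_coeff (Nmat J \<alpha>' c x) * vol3 (\<lambda>i. \<alpha>' i c x) vs)"
  proof (intro allI impI ext)
    fix U' \<alpha>' vs assume a: "coframing A J U' \<alpha>' \<and> x \<in> coord_set c U'"
    show "psi_coeff (Nmat J \<alpha> c x) * vol3 (\<lambda>i. \<alpha> i c x) vs = psi_coeff (Nmat J \<alpha>' c x) * vol3 (\<lambda>i. \<alpha>' i c x) vs"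
      using a by (intro density_invariant(2)[OF coframing_coframe[OF J _ c(1)] coframing_coframe[OF J \<alpha> c]
          Nmat_torsion[OF J _ c(1)] Nmat_torsion[OF J \<alpha> c]]) auto
  qed
qed (use \<alpha> c in blast)

lemma density_coframing:
  assumes "almost_complex A J" "coframing A J U \<alpha>" "c \<in> A" "x \<in> coord_set c U"
  shows "density c1 c2 J c x vs = complex_of_real (Lfun c1 c2 (Nmat J \<alpha> c x)) * Omega (\<lambda>i. \<alpha> i c x) vs"
proof -
  let ?V = "vol3 (\<lambda>i. \<alpha> i c x)" and ?p = "psi_coeff (Nmat J \<alpha> c x)"
  have "cnj_form (\<lambda>vs. ?p * ?V vs) = (\<lambda>vs. cnj ?p * cnj_form ?V vs)" by (simp add: cnj_form_def)
  then have "(psi A J c x \<and>\<^sub>e cnj_form (psi A J c x)) vs = ?p * cnj ?p * (?V \<and>\<^sub>e cnj_form ?V) vs"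
    unfolding psi_eq[OF assms] by (simp add: wedge_scale_left wedge_scale_right)
  then show ?thesis
    unfolding density_def Phi_eq[OF assms] Lfun_eq complex_norm_square[symmetric]
    by (simp add: Omega_def algebra_simps)
qed

lemma density_pointwise:
  assumes J: "almost_complex A J" and c: "c \<in> A" "x \<in> coord_set c UNIV"
    and \<theta>: "coframe (J c x) \<theta>" "torsion_matrix \<theta> (nij (J c) x) N"
  shows "density c1 c2 J c x vs = complex_of_real (Lfun c1 c2 N) * Omega \<theta> vs"
proof -
  obtain U \<alpha> where \<alpha>: "coframing A J U \<alpha>" "x \<in> coord_set c U" using exists_coframing[OF J c] by blast
  show ?thesis
    unfolding density_coframing[OF J \<alpha>(1) c(1) \<alpha>(2)]
    by (rule density_invariant(1)[OF \<theta>(1) coframing_coframe[OF J \<alpha>(1) c(1) \<alpha>(2)] \<theta>(2) Nmat_torsion[OF J \<alpha>(1) c(1) \<alpha>(2)]])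
qed

lemma alt_density:
  assumes J: "almost_complex A J" and c: "c \<in> A" "x \<in> coord_set c UNIV"
  shows "alt_form 6 (density c1 c2 J c x)"
proof -
  obtain U \<alpha> where \<alpha>: "coframing A J U \<alpha>" "x \<in> coord_set c U" using exists_coframing[OF J c] by blast
  have "density c1 c2 J c x = (\<lambda>vs. complex_of_real (Lfun c1 c2 (Nmat J \<alpha> c x)) * Omega (\<lambda>i. \<alpha> i c x) vs)"
    by (rule ext) (rule density_coframing[OF J \<alpha>(1) c(1) \<alpha>(2)])
  then show ?thesis
    using alt_form_scale[OF alt_Omega[of "\<lambda>i. \<alpha> i c x", OF form_onD(1)[OF coframingD(2)[OF \<alpha>(1)] c(1) \<alpha>(2)]]] by simp
qed

lemma density_transition:
  assumes J: "almost_complex A J" and c: "c \<in> A" "c' \<in> A" and x: "x \<in> coord_set c (fst c')"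
  shows "density c1 c2 J c' (transition c c' x) (map (transition_deriv c c' x) vs) = density c1 c2 J c x vs"
proof -
  have x': "x \<in> coord_set c UNIV" by (rule coord_set_UNIV[OF x])
  obtain U \<alpha> where \<alpha>: "coframing A J U \<alpha>" "x \<in> coord_set c U" using exists_coframing[OF J c(1) x'] by blast
  have xU: "x \<in> coord_set c (U \<inter> fst c')"
    using \<alpha>(2) x coord_set_iff[OF c(1), of x U] coord_set_iff[OF c(1), of x "fst c'"]
      coord_set_iff[OF c(1), of x "U \<inter> fst c'"] by simp
  define T where "T = transition_deriv c c' x"
  define y where "y = transition c c' x"
  have y: "y \<in> coord_set c' U" using transition_in[OF c xU] by (auto simp: coord_set_def y_def)
  have y1: "y \<in> coord_set c' (fst c)" using transition_in[OF c, of x UNIV] x by (auto simp: coord_set_def y_def)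
  have aT: "\<alpha> i c' y (map T us) = \<alpha> i c x us" for i us
    using form_onD(3)[OF coframingD(2)[OF \<alpha>(1)] c xU] by (simp add: T_def y_def)
  have yback: "transition c' c y = x"
    unfolding y_def using transition_transition[OF c, of x c] transition_self[OF c(1) x'] x
    by (metis Int_commute coord_set_Int_chart)
  have surj: "\<exists>u. v = T u" for v
    using transition_deriv_inverse[OF c(2,1) y1, of v] by (intro exI[of _ "transition_deriv c' c y v"]) (simp add: T_def yback)
  have P: "P02 (J c' y) (\<lambda>u v. ext_d (\<alpha> i c') y [u, v]) (T u) (T v) = P02 (J c x) (\<lambda>u v. ext_d (\<alpha> i c) x [u, v]) u v" for i u v
  proof -
    have "ext_d (\<alpha> i c') y [T u, T v] = ext_d (\<alpha> i c) x [u, v]" for u v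
      unfolding T_def y_def by (rule ext_d_transition[OF coframingD(2,1)[OF \<alpha>(1)] c xU])
    moreover have "J c' y (T u) = T (J c x u)" for u
      unfolding T_def y_def by (rule almost_complexD(4)[OF J c x])
    ultimately show ?thesis by (simp add: P02_def)
  qed
  have "torsion_matrix (\<lambda>i. \<alpha> i c' y) (nij (J c') y) (Nmat J \<alpha> c x)"
    unfolding torsion_matrix_def
  proof (intro allI)
    fix i u v
    obtain p q where "u = T p" "v = T q" using surj by blast
    then show "(\<Sum>k\<in>UNIV. \<Sum>l\<in>UNIV. mat_comp (Nmat J \<alpha> c x) i k l * cnj (\<alpha> k c' y [u]) * cnj (\<alpha> l c' y [v])) = - \<alpha> i c' y [nij (J c') y u v] / 4"
      unfolding coframing_P02[OF J \<alpha>(1) c(2) y, symmetric]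
      using P Nmat_P02[OF J \<alpha>(1) c(1) \<alpha>(2)] aT[of _ "[p]"] aT[of _ "[q]"] by simp
  qed
  then have "density c1 c2 J c' y (map T vs) = complex_of_real (Lfun c1 c2 (Nmat J \<alpha> c x)) * Omega (\<lambda>i. \<alpha> i c' y) (map T vs)"
    by (rule density_pointwise[OF J c(2) coord_set_UNIV[OF y] coframing_coframe[OF J \<alpha>(1) c(2) y]])
  also have "Omega (\<lambda>i. \<alpha> i c' y) (map T vs) = Omega (\<lambda>i. \<alpha> i c x) vs"
    unfolding Omega_map aT ..
  finally show ?thesis unfolding density_coframing[OF J \<alpha>(1) c(1) \<alpha>(2)] by (simp add: T_def y_def)
qed

end

section \<open>Integration\<close>

definition zero_ext :: "'a set \<Rightarrow> ('a \<Rightarrow> 'b::zero) \<Rightarrow> 'a \<Rightarrow> 'b" where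
  "zero_ext W f x = (if x \<in> W then f x else 0)"

lemma continuous_zero_ext:
  fixes f :: "'a::topological_space \<Rightarrow> 'b::{topological_space, zero}"
  assumes "open T" "open W" "continuous_on W f" "W \<subseteq> T" "\<And>x. x \<in> W - C \<Longrightarrow> f x = 0" "closedin (top_of_set T) (C \<inter> T)" "C \<inter> T \<subseteq> W"
  shows "continuous_on T (zero_ext W f)"
proof -
  have eq: "T = W \<union> (T - C)" using assms(4,7) by blast
  have oc: "open (T - C)"
  proof -
    have "openin (top_of_set T) (T - (C \<inter> T))" using assms(6) by (simp add: openin_diff)
    moreover have "T - (C \<inter> T) = T - C" by blast
    ultimately show ?thesis using assms(1) by (simp add: openin_open_eq)
  qed
  have "continuous_on W (zero_ext W f)"
    using assms(3) by (rule continuous_on_cong[THEN iffD1, rotated -1]) (simp_all add: zero_ext_def)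
  moreover have "continuous_on (T - C) (zero_ext W f)"
    by (rule continuous_on_cong[THEN iffD1, OF refl _ continuous_on_const[of _ 0]]) (use assms(5) in \<open>auto simp: zero_ext_def\<close>)
  ultimately show ?thesis using continuous_on_open_Un[OF assms(2) oc] eq by metis
qed

lemma integral_zero_ext:
  fixes f :: "'a::euclidean_space \<Rightarrow> 'b::banach"
  shows "integral UNIV (zero_ext W f) = integral W f"
  unfolding zero_ext_def[abs_def] by (rule integral_restrict_UNIV)

lemma integral_support:
  fixes f :: "'a::euclidean_space \<Rightarrow> 'b::banach"
  assumes "\<And>x. x \<in> S - T \<Longrightarrow> f x = 0" "\<And>x. x \<in> T - S \<Longrightarrow> f x = 0"
  shows "integral S f = integral T f"
proof -
  have "zero_ext S f = zero_ext T f" using assms by (auto simp: zero_ext_def fun_eq_iff)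
  then show ?thesis using integral_zero_ext by metis
qed

lemma absolutely_integrable_compact_support:
  fixes f :: "real^6 \<Rightarrow> complex"
  assumes "open W" "continuous_on W f" "compact C" "C \<subseteq> W" "\<And>x. x \<in> W - C \<Longrightarrow> f x = 0"
  shows "f absolutely_integrable_on W"
proof -
  have c: "continuous_on UNIV (zero_ext W f)"
    by (rule continuous_zero_ext[OF open_UNIV assms(1,2) _ assms(5)]) (use assms compact_imp_closed in auto)
  obtain a b where ab: "C \<subseteq> cbox a b"
    using bounded_subset_cbox_symmetric[OF compact_imp_bounded[OF assms(3)]] by blast
  have "zero_ext W f absolutely_integrable_on cbox a b"
    by (rule absolutely_integrable_continuous[OF continuous_on_subset[OF c]]) simp
  then have "(\<lambda>x. if x \<in> cbox a b then zero_ext W f x else 0) absolutely_integrable_on UNIV"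
    by (simp add: absolutely_integrable_restrict_UNIV)
  moreover have "(\<lambda>x. if x \<in> cbox a b then zero_ext W f x else 0) = (\<lambda>x. if x \<in> W then f x else 0)"
    using ab assms(5) by (auto simp: zero_ext_def fun_eq_iff)
  ultimately show ?thesis by (simp add: absolutely_integrable_restrict_UNIV)
qed

lemma derivative_in_time:
  assumes "((\<lambda>(t, x). G t x) has_derivative D) (at (t, x))"
  shows "((\<lambda>t. G t x) has_vector_derivative D (1, 0)) (at t)"
proof -
  have "((\<lambda>s. (s, x)) has_derivative (\<lambda>s. (s, 0))) (at t)"
    by (auto intro!: derivative_eq_intros)
  from has_derivative_compose[OF this assms]
  have "((\<lambda>s. G s x) has_derivative (\<lambda>s. D (s, 0))) (at t)" by simp
  moreover have "(\<lambda>s. D (s, 0)) = (\<lambda>s. s *\<^sub>R D (1, 0))"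
  proof
    fix s show "D (s, 0) = s *\<^sub>R D (1, 0)"
      using linear_cmul[OF has_derivative_linear[OF assms], of s "(1, 0)"] by simp
  qed
  ultimately show ?thesis unfolding has_vector_derivative_def by metis
qed

lemma derivative_in_space:
  assumes "((\<lambda>(t, x). G t x) has_derivative D) (at (t, x))"
  shows "(G t has_derivative (\<lambda>v. D (0, v))) (at x)"
proof -
  have "((\<lambda>y. (t, y)) has_derivative (\<lambda>v. (0, v))) (at x)"
    by (auto intro!: derivative_eq_intros)
  from has_derivative_compose[OF this assms] show ?thesis by simp
qed

lemma differentiate_integral:
  fixes G :: "real \<Rightarrow> real^6 \<Rightarrow> complex"
  assumes e: "e > 0" and W: "open W" and C: "compact C" "C \<subseteq> W"
    and G: "smooth_on ({-e<..<e} \<times> W) (\<lambda>(t, x). G t x)"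
    and zero: "\<And>t x. t \<in> {-e<..<e} \<Longrightarrow> x \<in> W - C \<Longrightarrow> G t x = 0"
  shows "((\<lambda>t. integral W (G t)) has_vector_derivative integral W (\<lambda>x. vector_derivative (\<lambda>t. G t x) (at 0))) (at 0)"
proof -
  let ?I = "{-e<..<e}" and ?H = "\<lambda>(t, x). G t x"
  have oI: "open (?I \<times> W)" using W by (simp add: open_Times)
  define G' where "G' p = frechet_derivative ?H (at p) (1, 0)" for p
  have dG: "((\<lambda>t. G t x) has_vector_derivative G' (t, x)) (at t)" if "t \<in> ?I" "x \<in> W" for t x
    unfolding G'_def using smooth_on_has_derivative[OF G, of "(t, x)"] that by (intro derivative_in_time) auto
  have contG': "continuous_on (?I \<times> W) G'"
    unfolding G'_def[abs_def] by (rule smooth_on_continuous_on[OF smooth_on_frechet[OF G]])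
  have zero': "G' (t, x) = 0" if "t \<in> ?I" "x \<in> W - C" for t x
  proof -
    have "frechet_derivative ?H (at (t, x)) = frechet_derivative (\<lambda>p. 0) (at (t, x))"
      by (rule frechet_derivative_cong_open[of "?I \<times> (W - C)"])
        (use that W C zero compact_imp_closed in \<open>auto intro!: open_Times open_Diff\<close>)
    then show ?thesis by (simp add: G'_def)
  qed
  obtain a b where ab: "C \<subseteq> cbox a b"
    using bounded_subset_cbox_symmetric[OF compact_imp_bounded[OF C(1)]] by blast
  have toW: "integral (cbox a b) (zero_ext W g) = integral W g" if "\<And>x. x \<in> W - C \<Longrightarrow> g x = 0" for g :: "real^6 \<Rightarrow> complex"
  proof -
    have "integral (cbox a b) (zero_ext W g) = integral UNIV (zero_ext W g)"
      by (rule integral_support) (use ab that in \<open>auto simp: zero_ext_def\<close>)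
    then show ?thesis by (simp add: integral_zero_ext)
  qed
  have "((\<lambda>t. integral (cbox a b) (zero_ext W (G t))) has_vector_derivative
      integral (cbox a b) (zero_ext W (\<lambda>x. G' (0, x)))) (at 0 within ?I)"
  proof (rule leibniz_rule_vector_derivative)
    fix t x assume t: "t \<in> ?I"
    show "((\<lambda>t. zero_ext W (G t) x) has_vector_derivative zero_ext W (\<lambda>x. G' (t, x)) x) (at t within ?I)"
      using dG[OF t] by (cases "x \<in> W") (auto simp: zero_ext_def intro: has_vector_derivative_at_within)
  next
    fix t assume t: "t \<in> ?I"
    have "continuous_on W (\<lambda>x. ?H (t, x))"
      by (rule continuous_on_compose2[OF smooth_on_continuous_on[OF G]]) (use t in \<open>auto intro!: continuous_intros\<close>)
    then have "continuous_on UNIV (zero_ext W (G t))"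
      using C zero[OF t] compact_imp_closed
      by (intro continuous_zero_ext[OF open_UNIV W, where C = C]) auto
    then show "zero_ext W (G t) integrable_on cbox a b"
      using integrable_continuous continuous_on_subset by blast
  next
    have "continuous_on (?I \<times> UNIV) (zero_ext (?I \<times> W) G')"
    proof (rule continuous_zero_ext[OF _ oI contG', where C = "UNIV \<times> C"])
      have "closed (UNIV \<times> C :: (real \<times> _) set)" by (rule closed_Times[OF closed_UNIV compact_imp_closed[OF C(1)]])
      then show "closedin (top_of_set (?I \<times> UNIV)) (UNIV \<times> C \<inter> ?I \<times> UNIV)" by (auto simp: closedin_closed)
      show "G' p = 0" if "p \<in> ?I \<times> W - UNIV \<times> C" for p
        using that zero'[of "fst p" "snd p"] by (cases p) auto
    qed (use C in \<open>auto simp: open_Times\<close>)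
    then have "continuous_on (?I \<times> cbox a b) (zero_ext (?I \<times> W) G')"
      by (rule continuous_on_subset) auto
    then show "continuous_on (?I \<times> cbox a b) (\<lambda>(t, x). zero_ext W (\<lambda>x. G' (t, x)) x)"
      by (rule continuous_on_cong[THEN iffD1, OF refl, rotated]) (auto simp: zero_ext_def split: if_splits)
  qed (use e in auto)
  then have *: "((\<lambda>t. integral (cbox a b) (zero_ext W (G t))) has_vector_derivative integral W (\<lambda>x. G' (0, x))) (at 0)"
    using e zero'[of 0] toW[of "\<lambda>x. G' (0, x)"] by (simp add: at_within_open[of 0 ?I])
  have "((\<lambda>t. integral W (G t)) has_vector_derivative integral W (\<lambda>x. G' (0, x))) (at 0)"
    by (rule has_vector_derivative_transform_within_open[OF *, of ?I]) (use e toW zero in auto)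
  moreover have "integral W (\<lambda>x. G' (0, x)) = integral W (\<lambda>x. vector_derivative (\<lambda>t. G t x) (at 0))"
  proof (rule Henstock_Kurzweil_Integration.integral_cong)
    fix x assume "x \<in> W"
    then show "G' (0, x) = vector_derivative (\<lambda>t. G t x) (at 0)"
      using vector_derivative_at[OF dG[of 0 x]] e by simp
  qed
  ultimately show ?thesis by simp
qed

lemma integral_translate:
  fixes f :: "real^6 \<Rightarrow> complex"
  assumes "bounded C" "\<And>x. x \<notin> C \<Longrightarrow> f x = 0"
  shows "integral UNIV (\<lambda>x. f (c + x)) = integral UNIV f"
proof -
  obtain a b where ab: "C \<subseteq> cbox a b" using bounded_subset_cbox_symmetric[OF assms(1)] by blast
  have "integral UNIV (\<lambda>x. f (c + x)) = integral (cbox (a - c) (b - c)) (f \<circ> (+) c)"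
    unfolding o_def
  proof (rule integral_support)
    fix x assume "x \<in> UNIV - cbox (a - c) (b - c)"
    then have "c + x \<notin> cbox a b" by (auto simp: mem_box algebra_simps)
    then show "f (c + x) = 0" using ab assms(2) by blast
  qed simp
  also have "\<dots> = integral (cbox a b) f" using integral_shift_cbox_plus[of "a - c" "b - c" f c] by simp
  also have "\<dots> = integral UNIV f" by (rule integral_support) (use ab assms(2) in auto)
  finally show ?thesis .
qed

lemma integral_derivative_0:
  fixes f :: "real^6 \<Rightarrow> complex"
  assumes W: "open W" and C: "compact C" "C \<subseteq> W" and f: "smooth_on W f" and zero: "\<And>x. x \<in> W - C \<Longrightarrow> f x = 0"
  shows "integral W (\<lambda>x. frechet_derivative f (at x) v) = 0"
proof -
  define g where "g = zero_ext W f"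
  have g: "smooth_on UNIV g"
  proof (rule smooth_on_local)
    fix x
    show "\<exists>T. open T \<and> x \<in> T \<and> smooth_on T g"
    proof (cases "x \<in> C")
      case True
      have "smooth_on W g" by (rule smooth_on_cong[OF W _ f]) (simp add: g_def zero_ext_def)
      then show ?thesis using True W C by blast
    next
      case False
      have o: "open (- C)" using C compact_imp_closed by blast
      have "smooth_on (- C) g"
        by (rule smooth_on_cong[OF o _ smooth_on_const[OF o, of 0]]) (use zero in \<open>auto simp: g_def zero_ext_def\<close>)
      then show ?thesis using False o by blast
    qed
  qed
  have gzero: "g x = 0" if "x \<notin> C" for x using that zero by (simp add: g_def zero_ext_def)
  define C' where "C' = (\<lambda>(p, t). p - t *\<^sub>R v) ` (C \<times> {-1..1::real})"
  have C': "compact C'"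
    unfolding C'_def by (rule compact_continuous_image) (use C in \<open>auto intro!: compact_Times continuous_intros simp: split_beta\<close>)
  have oI: "open ({-1<..<1::real} \<times> (UNIV :: (real^6) set))" by (simp add: open_Times)
  have sm: "smooth_on ({-1<..<1} \<times> UNIV) (\<lambda>(t, x). g (t *\<^sub>R v + x))"
  proof -
    have bl: "bounded_linear (\<lambda>p :: real \<times> (real^6). fst p *\<^sub>R v + snd p)"
      by (intro bounded_linear_add bounded_linear_scaleR_const bounded_linear_fst bounded_linear_snd)
    show ?thesis unfolding split_beta
      by (rule smooth_on_compose[OF oI open_UNIV smooth_on_linear[OF bl oI] g]) auto
  qed
  have z: "g (t *\<^sub>R v + x) = 0" if "t \<in> {-1<..<1}" "x \<in> UNIV - C'" for t x
  proof (rule gzero)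
    show "t *\<^sub>R v + x \<notin> C"
    proof
      assume "t *\<^sub>R v + x \<in> C"
      then have "(t *\<^sub>R v + x, t) \<in> C \<times> {-1..1}" using that by auto
      then have "(t *\<^sub>R v + x) - t *\<^sub>R v \<in> C'" unfolding C'_def by force
      then show False using that by simp
    qed
  qed
  have "((\<lambda>t. integral UNIV (\<lambda>x. g (t *\<^sub>R v + x))) has_vector_derivative
      integral UNIV (\<lambda>x. vector_derivative (\<lambda>t. g (t *\<^sub>R v + x)) (at 0))) (at 0)"
    by (rule differentiate_integral[where e = 1, OF _ open_UNIV C' _ sm z]) auto
  moreover have "(\<lambda>t. integral UNIV (\<lambda>x. g (t *\<^sub>R v + x))) = (\<lambda>t. integral UNIV g)"
    using integral_translate[of C g] gzero C compact_imp_bounded by blast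
  ultimately have i0: "integral UNIV (\<lambda>x. vector_derivative (\<lambda>t. g (t *\<^sub>R v + x)) (at 0)) = 0"
    using vector_derivative_unique_at[OF _ has_vector_derivative_const] by force
  have "vector_derivative (\<lambda>t. g (t *\<^sub>R v + x)) (at 0) = frechet_derivative g (at x) v" for x
  proof -
    have gd: "(g has_derivative frechet_derivative g (at x)) (at x)" by (rule smooth_on_has_derivative[OF g]) simp
    have "((\<lambda>t. t *\<^sub>R v + x) has_derivative (\<lambda>t. t *\<^sub>R v)) (at 0)" by (auto intro!: derivative_eq_intros)
    from has_derivative_compose[OF this, of g "frechet_derivative g (at x)"]
    have "((\<lambda>t. g (t *\<^sub>R v + x)) has_vector_derivative frechet_derivative g (at x) v) (at 0)"
      using gd linear_cmul[OF has_derivative_linear[OF gd]] by (simp add: has_vector_derivative_def)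
    then show ?thesis by (rule vector_derivative_at)
  qed
  then have "integral UNIV (\<lambda>x. frechet_derivative g (at x) v) = 0" using i0 by simp
  moreover have "integral UNIV (\<lambda>x. frechet_derivative g (at x) v) = integral W (\<lambda>x. frechet_derivative g (at x) v)"
  proof (rule integral_support)
    fix x assume x: "x \<in> UNIV - W"
    have "frechet_derivative g (at x) = frechet_derivative (\<lambda>_. 0) (at x)"
      by (rule frechet_derivative_cong_open[of "- C"]) (use x C compact_imp_closed gzero in auto)
    then show "frechet_derivative g (at x) v = 0" by simp
  qed simp
  moreover have "integral W (\<lambda>x. frechet_derivative g (at x) v) = integral W (\<lambda>x. frechet_derivative f (at x) v)"
  proof (rule Henstock_Kurzweil_Integration.integral_cong)
    fix x assume "x \<in> W"
    then have "frechet_derivative g (at x) = frechet_derivative f (at x)"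
      by (intro frechet_derivative_cong_open[OF W]) (auto simp: g_def zero_ext_def)
    then show "frechet_derivative g (at x) v = frechet_derivative f (at x) v" by simp
  qed
  ultimately show ?thesis by simp
qed

lemma stokes:
  assumes W: "open W" and C: "compact C" "C \<subseteq> W" and \<sigma>: "\<And>ws. smooth_on W (\<lambda>x. \<sigma> x ws)"
    and zero: "\<And>x ws. x \<in> W - C \<Longrightarrow> \<sigma> x ws = 0"
  shows "integral W (\<lambda>x. ext_d \<sigma> x vs) = 0" "(\<lambda>x. ext_d \<sigma> x vs) integrable_on W"
proof -
  let ?f = "\<lambda>i x. (-1) ^ i * frechet_derivative (\<lambda>y. \<sigma> y (nths vs (- {i}))) (at x) (vs ! i)"
  have z: "frechet_derivative (\<lambda>y. \<sigma> y ws) (at x) v = 0" if "x \<in> W - C" for x ws v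
  proof -
    have "frechet_derivative (\<lambda>y. \<sigma> y ws) (at x) = frechet_derivative (\<lambda>_. 0) (at x)"
      by (rule frechet_derivative_cong_open[of "W - C"]) (use that W C compact_imp_closed zero in \<open>auto intro!: open_Diff\<close>)
    then show ?thesis by simp
  qed
  have int: "?f i integrable_on W" for i
  proof -
    have "continuous_on W (\<lambda>x. frechet_derivative (\<lambda>y. \<sigma> y (nths vs (- {i}))) (at x) (vs ! i))"
      by (rule smooth_on_continuous_on[OF smooth_on_frechet[OF \<sigma>]])
    then have "?f i absolutely_integrable_on W"
      by (intro absolutely_integrable_compact_support[OF W _ C] continuous_intros) (simp_all add: z)
    then show ?thesis using set_lebesgue_integral_eq_integral(1) by blast
  qed
  then show "(\<lambda>x. ext_d \<sigma> x vs) integrable_on W" unfolding ext_d_def by (intro integrable_sum) auto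
  have "integral W (\<lambda>x. ext_d \<sigma> x vs) = (\<Sum>i<length vs. integral W (?f i))"
    unfolding ext_d_def by (rule integral_sum) (use int in auto)
  also have "\<dots> = 0"
  proof -
    have "integral W (\<lambda>x. frechet_derivative (\<lambda>y. \<sigma> y ws) (at x) v) = 0" for ws v
      by (rule integral_derivative_0[OF W C \<sigma>]) (use zero in auto)
    then show ?thesis by (intro sum.neutral) simp
  qed
  finally show "integral W (\<lambda>x. ext_d \<sigma> x vs) = 0" .
qed

lemma change_of_variables_complex:
  fixes f :: "real^6 \<Rightarrow> complex"
  assumes S: "open S" and g: "\<And>x. x \<in> S \<Longrightarrow> (g has_derivative g' x) (at x)" "inj_on g S"
    and f: "f absolutely_integrable_on g ` S"
  shows "integral S (\<lambda>x. \<bar>det (matrix (g' x))\<bar> *\<^sub>R f (g x)) = integral (g ` S) f"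
proof -
  define h :: "complex \<Rightarrow> real^2" where "h z = (\<chi> i. if i = 1 then Re z else Im z)" for z
  define k :: "real^2 \<Rightarrow> complex" where "k v = Complex (v $ 1) (v $ 2)" for v
  have h: "bounded_linear h" unfolding linear_conv_bounded_linear[symmetric]
    by (simp add: h_def linear_iff vec_eq_iff)
  have k: "bounded_linear k" unfolding linear_conv_bounded_linear[symmetric]
    by (simp add: k_def linear_iff complex_eq_iff)
  have kh: "k (h z) = z" for z by (simp add: k_def h_def complex_eq_iff)
  have hf: "(h \<circ> f) absolutely_integrable_on g ` S" by (rule absolutely_integrable_linear[OF f h])
  have "(\<lambda>x. \<bar>det (matrix (g' x))\<bar> *\<^sub>R (h \<circ> f) (g x)) absolutely_integrable_on S \<and>
      integral S (\<lambda>x. \<bar>det (matrix (g' x))\<bar> *\<^sub>R (h \<circ> f) (g x)) = integral (g ` S) (h \<circ> f)"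
    using has_absolute_integral_change_of_variables[of S g g' "h \<circ> f" "integral (g ` S) (h \<circ> f)"] hf S g
    by (auto intro: has_derivative_at_withinI)
  then have eq: "k (integral S (\<lambda>x. \<bar>det (matrix (g' x))\<bar> *\<^sub>R (h \<circ> f) (g x))) = k (integral (g ` S) (h \<circ> f))"
    and i: "(\<lambda>x. \<bar>det (matrix (g' x))\<bar> *\<^sub>R (h \<circ> f) (g x)) integrable_on S"
    using set_lebesgue_integral_eq_integral(1) by auto
  have "(h \<circ> f) integrable_on g ` S" using hf set_lebesgue_integral_eq_integral(1) by blast
  from eq[folded integral_linear[OF i k] integral_linear[OF this k]]
  have "integral S (k \<circ> (\<lambda>x. \<bar>det (matrix (g' x))\<bar> *\<^sub>R (h \<circ> f) (g x))) = integral (g ` S) (k \<circ> (h \<circ> f))" .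
  moreover have "k \<circ> (h \<circ> f) = f" "k \<circ> (\<lambda>x. \<bar>det (matrix (g' x))\<bar> *\<^sub>R (h \<circ> f) (g x)) = (\<lambda>x. \<bar>det (matrix (g' x))\<bar> *\<^sub>R f (g x))"
    using linear_cmul[OF bounded_linear.linear[OF k]] by (auto simp: fun_eq_iff kh)
  ultimately show ?thesis by simp
qed

context atlas
begin

definition six_form :: "'a form_field \<Rightarrow> bool" where
  "six_form \<omega> \<longleftrightarrow> (\<forall>c\<in>A. (\<forall>x\<in>coord_set c UNIV. alt_form 6 (\<omega> c x)) \<and>
      continuous_on (coord_set c UNIV) (\<lambda>x. \<omega> c x std_basis)) \<and>
    (\<forall>c\<in>A. \<forall>c'\<in>A. \<forall>x\<in>coord_set c (fst c').
      \<omega> c' (transition c c' x) (map (transition_deriv c c' x) std_basis) = \<omega> c x std_basis)"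

lemma compact_coord_image:
  assumes "compact (UNIV :: 'a set)" "c \<in> A" "closed K" "K \<subseteq> fst c"
  shows "compact (snd c ` K)" "snd c ` K \<subseteq> coord_set c K"
proof -
  have "compact K" using compact_Int_closed[OF assms(1,3)] by simp
  moreover have "continuous_on K (snd c)"
    using chart_homeomorphism[OF assms(2)] assms(4) by (auto simp: homeomorphism_def intro: continuous_on_subset)
  ultimately show "compact (snd c ` K)" by (intro compact_continuous_image)
  show "snd c ` K \<subseteq> coord_set c K" using assms(4) by (auto simp: coord_set_def)
qed

lemma coord_set_image_iff:
  assumes "c \<in> A" "K \<subseteq> fst c" "x \<in> coord_set c UNIV"
  shows "x \<in> snd c ` K \<longleftrightarrow> chart_inv c x \<in> K"
proof -
  have "snd c ` K = coord_set c K" using assms(2) by (auto simp: coord_set_def)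
  then show ?thesis using coord_set_iff[OF assms(1), of x K] assms(3) by simp
qed

lemma transition_image:
  assumes "c \<in> A" "a \<in> A"
  shows "transition c a ` coord_set c (fst a) = coord_set a (fst c)" "inj_on (transition c a) (coord_set c (fst a))"
proof -
  have f: "transition c a x \<in> coord_set a (fst c)" if "c \<in> A" "a \<in> A" "x \<in> coord_set c (fst a)" for c a x
    using transition_in[OF that(1,2), of x UNIV] that(3) by simp
  have g: "transition a c (transition c a x) = x" if "c \<in> A" "a \<in> A" "x \<in> coord_set c (fst a)" for c a x
    using transition_transition[OF that(1,2), of x c] transition_self[OF that(1) coord_set_UNIV[OF that(3)]] that(3)
    by (simp add: coord_set_Int_chart)
  show "inj_on (transition c a) (coord_set c (fst a))" using g[OF assms] by (intro inj_on_inverseI)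
  show "transition c a ` coord_set c (fst a) = coord_set a (fst c)"
  proof
    show "transition c a ` coord_set c (fst a) \<subseteq> coord_set a (fst c)" using f[OF assms] by blast
    show "coord_set a (fst c) \<subseteq> transition c a ` coord_set c (fst a)"
    proof
      fix y assume "y \<in> coord_set a (fst c)"
      then show "y \<in> transition c a ` coord_set c (fst a)"
        using f[OF assms(2,1)] g[OF assms(2,1)] by (metis imageI)
    qed
  qed
qed

lemma continuous_chart_function:
  assumes "smooth_function A \<rho>" "c \<in> A"
  shows "continuous_on (coord_set c UNIV) (\<lambda>x. complex_of_real (\<rho> (chart_inv c x)))"
  using smooth_on_continuous_on[OF smooth_functionD[OF assms]] by (intro continuous_intros)

lemma integral_form_partition:
  assumes "compact (UNIV :: 'a set)"
  obtains F \<rho> where "finite F" "F \<subseteq> A" "\<And>c. c \<in> F \<Longrightarrow> smooth_function A (\<rho> c)"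
    "\<And>c. c \<in> F \<Longrightarrow> closure {p. \<rho> c p \<noteq> 0} \<subseteq> fst c" "\<And>p. (\<Sum>c\<in>F. \<rho> c p) = 1"
    "\<And>\<omega>. integral_form A \<omega> = (\<Sum>c\<in>F. integral (coord_set c UNIV) (\<lambda>x. complex_of_real (\<rho> c (chart_inv c x)) * \<omega> c x std_basis))"
proof -
  define P where "P = (SOME (F, \<rho>). partition_of_unity A F \<rho>)"
  obtain F \<rho> where P: "P = (F, \<rho>)" by (cases P)
  have "\<exists>P. case P of (F, \<rho>) \<Rightarrow> partition_of_unity A F \<rho>" using exists_partition_of_unity[OF assms] by auto
  from someI_ex[OF this] have pu: "partition_of_unity A F \<rho>" unfolding P_def[symmetric] P by simp
  have "integral_form A \<omega> = (\<Sum>c\<in>F. integral (coord_set c UNIV) (\<lambda>x. complex_of_real (\<rho> c (chart_inv c x)) * \<omega> c x std_basis))" for \<omega>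
    unfolding integral_form_def P_def[symmetric] P by simp
  moreover have "finite F" "F \<subseteq> A" "\<And>c. c \<in> F \<Longrightarrow> smooth_function A (\<rho> c)"
    "\<And>c. c \<in> F \<Longrightarrow> closure {p. \<rho> c p \<noteq> 0} \<subseteq> fst c" "\<And>p. (\<Sum>c\<in>F. \<rho> c p) = 1"
    using pu unfolding partition_of_unity_def by auto
  ultimately show thesis by (intro that)
qed

text \<open>The integral of a form supported in one chart can be computed there. Each piece of the
  partition of unity is moved to that chart by the change of variables formula.\<close>

lemma integral_form_chart:
  assumes M: "compact (UNIV :: 'a set)" and \<omega>: "six_form \<omega>" and a: "a \<in> A"
    and K: "closed K" "K \<subseteq> fst a" and supp: "\<And>c x. c \<in> A \<Longrightarrow> x \<in> coord_set c UNIV \<Longrightarrow> chart_inv c x \<notin> K \<Longrightarrow> \<omega> c x std_basis = 0"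
  shows "integral_form A \<omega> = integral (coord_set a UNIV) (\<lambda>x. \<omega> a x std_basis)"
proof -
  obtain F and \<rho> :: "'a chart \<Rightarrow> 'a \<Rightarrow> real" where F: "finite F" "F \<subseteq> A"
    and \<rho>: "\<And>c. c \<in> F \<Longrightarrow> smooth_function A (\<rho> c)" "\<And>c. c \<in> F \<Longrightarrow> closure {p. \<rho> c p \<noteq> 0} \<subseteq> fst c"
    and sum1: "\<And>p. (\<Sum>c\<in>F. \<rho> c p) = 1"
    and intf: "\<And>\<omega>. integral_form A \<omega> = (\<Sum>c\<in>F. integral (coord_set c UNIV) (\<lambda>x. complex_of_real (\<rho> c (chart_inv c x)) * \<omega> c x std_basis))"
    by (rule integral_form_partition[OF M]) (rule that)
  have \<rho>0: "\<rho> c p = 0" if "c \<in> F" "p \<notin> fst c" for c p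
    using \<rho>(2)[OF that(1)] that(2) closure_subset[of "{p. \<rho> c p \<noteq> 0}"] by auto
  define h where "h c b x = complex_of_real (\<rho> c (chart_inv b x)) * \<omega> b x std_basis" for c b x
  have oW: "open (coord_set b V)" if "b \<in> A" "open V" for b V using open_coord_set that by blast
  have contw: "continuous_on (coord_set b UNIV) (\<lambda>x. \<omega> b x std_basis)" if "b \<in> A" for b
    using \<omega> that unfolding six_form_def by blast
  have conth: "continuous_on (coord_set b UNIV) (h c b)" if "c \<in> F" "b \<in> A" for c b
    unfolding h_def using continuous_chart_function[OF \<rho>(1)[OF that(1)] that(2)] contw[OF that(2)]
    by (intro continuous_on_mult)
  have absint: "h c a absolutely_integrable_on coord_set a V" if c: "c \<in> F" and V: "V = UNIV \<or> V = fst c" for c V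
  proof -
    let ?K = "K \<inter> closure {p. \<rho> c p \<noteq> 0}"
    have cA: "c \<in> A" using c F by blast
    have cK: "closed ?K" "?K \<subseteq> fst a" "?K \<subseteq> V" using K V \<rho>(2)[OF c] by auto
    have oV: "open V" using V open_chart[OF cA] by auto
    show ?thesis
    proof (rule absolutely_integrable_compact_support[OF oW[OF a oV], where C = "snd a ` ?K"])
      show "continuous_on (coord_set a V) (h c a)" by (rule continuous_on_subset[OF conth[OF c a] coord_set_mono]) simp
      show "compact (snd a ` ?K)" by (rule compact_coord_image(1)[OF M a cK(1,2)])
      show "snd a ` ?K \<subseteq> coord_set a V" using compact_coord_image(2)[OF M a cK(1,2)] coord_set_mono[OF cK(3)] by blast
      fix x assume x: "x \<in> coord_set a V - snd a ` ?K"
      then have xU: "x \<in> coord_set a UNIV" using coord_set_UNIV by blast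
      then have "chart_inv a x \<notin> ?K" using coord_set_image_iff[OF a cK(2) xU] x by blast
      then have "chart_inv a x \<notin> K \<or> \<rho> c (chart_inv a x) = 0"
        using closure_subset[of "{p. \<rho> c p \<noteq> 0}"] by auto
      then show "h c a x = 0" using supp[OF a xU] by (auto simp: h_def)
    qed
  qed
  have piece: "integral (coord_set c UNIV) (h c c) = integral (coord_set a UNIV) (h c a)" if c: "c \<in> F" for c
  proof -
    have cA: "c \<in> A" using c F by blast
    have "integral (coord_set c UNIV) (h c c) = integral (coord_set c (fst a)) (h c c)"
    proof (rule integral_support)
      fix x assume x: "x \<in> coord_set c UNIV - coord_set c (fst a)"
      then have "chart_inv c x \<notin> K" using coord_set_iff[OF cA, of x "fst a"] K(2) by blast
      then show "h c c x = 0" using supp[OF cA] x by (simp add: h_def)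
    qed (use coord_set_UNIV in blast)
    also have "\<dots> = integral (coord_set c (fst a)) (\<lambda>x. \<bar>det (matrix (transition_deriv c a x))\<bar> *\<^sub>R h c a (transition c a x))"
    proof (rule Henstock_Kurzweil_Integration.integral_cong)
      fix x assume x: "x \<in> coord_set c (fst a)"
      have y: "transition c a x \<in> coord_set a UNIV" using transition_in[OF cA a, of x UNIV] x coord_set_UNIV by simp
      have "\<omega> c x std_basis = \<omega> a (transition c a x) (map (transition_deriv c a x) std_basis)"
        using \<omega> cA a x unfolding six_form_def by simp
      also have "\<dots> = complex_of_real (det (matrix (transition_deriv c a x))) * \<omega> a (transition c a x) std_basis"
        using \<omega> a y linear_transition_deriv[OF cA a x] unfolding six_form_def by (intro alt_form_6_map) auto
      finally show "h c c x = \<bar>det (matrix (transition_deriv c a x))\<bar> *\<^sub>R h c a (transition c a x)"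
        using transition_det_pos[OF cA a x] chart_inv_transition[OF cA a x]
        by (simp add: h_def scaleR_complex)
    qed
    also have "\<dots> = integral (transition c a ` coord_set c (fst a)) (h c a)"
      by (rule change_of_variables_complex[OF oW[OF cA open_chart[OF a]] transition_has_derivative[OF cA a] transition_image(2)[OF cA a]])
        (simp_all add: transition_image(1)[OF cA a] absint[OF c])
    also have "\<dots> = integral (coord_set a UNIV) (h c a)"
      unfolding transition_image(1)[OF cA a]
    proof (rule integral_support)
      fix x assume x: "x \<in> coord_set a UNIV - coord_set a (fst c)"
      then have "chart_inv a x \<notin> fst c" using coord_set_iff[OF a, of x "fst c"] by blast
      then show "h c a x = 0" using \<rho>0[OF c] by (simp add: h_def)
    qed (use coord_set_UNIV in blast)
    finally show ?thesis .
  qed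
  have "integral_form A \<omega> = (\<Sum>c\<in>F. integral (coord_set c UNIV) (h c c))"
    unfolding intf h_def by simp
  also have "\<dots> = (\<Sum>c\<in>F. integral (coord_set a UNIV) (h c a))" using piece by simp
  also have "\<dots> = integral (coord_set a UNIV) (\<lambda>x. \<Sum>c\<in>F. h c a x)"
    by (rule integral_sum[symmetric]) (use F absint set_lebesgue_integral_eq_integral(1) in blast)+
  also have "(\<lambda>x. \<Sum>c\<in>F. h c a x) = (\<lambda>x. \<omega> a x std_basis)"
    unfolding h_def sum_distrib_right[symmetric] of_real_sum[symmetric] sum1 by simp
  finally show ?thesis .
qed

end

section \<open>Smoothness of the Lagrangian along a variation\<close>

lemma smooth_on_det3:
  fixes N :: "'a::real_normed_vector \<Rightarrow> complex^3^3"
  assumes "open S" "\<And>i k. smooth_on S (\<lambda>z. N z $ i $ k)"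
  shows "smooth_on S (\<lambda>z. det (N z))"
  unfolding det_3 by (intro smooth_on_diff smooth_on_add smooth_on_mult assms)

lemma smooth_on_Lfun:
  fixes N :: "'a::real_normed_vector \<Rightarrow> complex^3^3"
  assumes "open S" "\<And>i k. smooth_on S (\<lambda>z. N z $ i $ k)"
  shows "smooth_on S (\<lambda>z. Lfun c1 c2 (N z))"
proof -
  have sq: "(cmod w)\<^sup>2 = Re (w * cnj w)" for w by (simp add: complex_norm_square[symmetric] del: of_real_power)
  have "smooth_on S (\<lambda>z. psi_coeff (N z))"
    unfolding psi_coeff_def Ptri_eq polar_det_def mixed_det_def cnj_mat_def transpose_def vec_lambda_beta
    by (intro smooth_on_divide smooth_on_const smooth_on_diff smooth_on_add smooth_on_mult smooth_on_cnj assms) auto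
  then show ?thesis
    unfolding Lfun_eq sq using smooth_on_det3[OF assms]
    by (intro smooth_on_add smooth_on_mult smooth_on_Re smooth_on_cnj smooth_on_const assms(1))
qed

definition of_comp :: "(3 \<Rightarrow> 3 \<Rightarrow> 3 \<Rightarrow> complex) \<Rightarrow> complex^3^3" where
  "of_comp b = (\<chi> i m. if m = 1 then b i 2 3 else if m = 2 then b i 3 1 else b i 1 2)"

lemma mat_comp_of_comp:
  assumes "\<And>k l. b i k l = - b i l k"
  shows "mat_comp (of_comp b) i k l = b i k l"
proof -
  have "b i k k = 0" for k using assms[of k k] by simp
  then have "\<forall>k l. mat_comp (of_comp b) i k l = b i k l"
    using assms[of 2 1] assms[of 3 2] assms[of 1 3] by (simp add: forall_3 mat_comp_def of_comp_def)
  then show ?thesis by blast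
qed

lemma smooth_on_of_comp:
  assumes "\<And>k l. smooth_on S (\<lambda>z. b z i k l)"
  shows "smooth_on S (\<lambda>z. of_comp (b z) $ i $ m)"
  using assms by (cases "m = 1"; cases "m = 2") (simp_all add: of_comp_def)

lemma nij_skew: "linear (J x) \<Longrightarrow> nij J x u v = - nij J x v u"
  unfolding nij_def by (simp add: linear_diff)

lemma torsion_matrix_solve:
  assumes "torsion_matrix \<theta> Q N" "\<And>u v. Q u v = - Q v u" "\<And>i. linear (\<lambda>v. \<theta> i [v])"
  shows "det (\<chi> k c. cnj (\<theta> k [u c])) * N $ i $ m =
    (of_comp (\<lambda>i c d. - \<theta> i [Q (u c) (u d)] / 4) ** transpose (\<chi> k c. cnj (\<theta> k [u c]))) $ i $ m"
proof (rule cofactor_solve)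
  fix i c d
  have "- \<theta> i [Q (u c) (u d)] / 4 = - (- \<theta> i [Q (u d) (u c)] / 4)" for c d
    unfolding assms(2)[of "u c" "u d"] linear_neg[OF assms(3)] by simp
  then have "mat_comp (of_comp (\<lambda>i c d. - \<theta> i [Q (u c) (u d)] / 4)) i c d = - \<theta> i [Q (u c) (u d)] / 4"
    by (rule mat_comp_of_comp)
  then show "(\<Sum>k\<in>UNIV. \<Sum>l\<in>UNIV. mat_comp N i k l * (\<chi> k c. cnj (\<theta> k [u c])) $ k $ c * (\<chi> k c. cnj (\<theta> k [u c])) $ l $ d) =
      mat_comp (of_comp (\<lambda>i c d. - \<theta> i [Q (u c) (u d)] / 4)) i c d"
    using assms(1) by (simp add: torsion_matrix_def)
qed

definition project10 :: "(real^6 \<Rightarrow> real^6) \<Rightarrow> cform \<Rightarrow> cform" where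
  "project10 j a = (\<lambda>vs. if length vs = 1 then (a [hd vs] - \<i> * a [j (hd vs)]) / 2 else 0)"

lemma type10_project10:
  assumes "linear j" "\<And>v. j (j v) = - v" "linear (\<lambda>v. a [v])"
  shows "type10 j (project10 j a)"
  unfolding type10_def
proof (intro conjI allI)
  show "alt_form 1 (project10 j a)"
  proof (rule alt_form_1I)
    show "linear (\<lambda>v. project10 j a [v])"
      unfolding project10_def
      by (simp add: linear_iff linear_add[OF assms(1)] linear_cmul[OF assms(1)] linear_add[OF assms(3)] linear_cmul[OF assms(3)] scaleR_complex field_simps)
  qed (simp add: project10_def)
  show "project10 j a [j v] = \<i> * project10 j a [v]" for v
    by (simp add: project10_def assms(2) linear_neg[OF assms(3)] field_simps)
qed

lemma coframeI:
  assumes "linear j" "\<And>v. j (j v) = - v" "\<And>i. type10 j (\<theta> i)" "det (\<chi> i k. \<theta> i [u k] :: complex^3^3) \<noteq> 0"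
  shows "coframe j \<theta>"
proof (rule coframe.intro)
  fix z :: "3 \<Rightarrow> complex" and i assume "\<And>vs. (\<Sum>i\<in>UNIV. z i * \<theta> i vs) = 0"
  then show "z i = 0" using solve_det[OF assms(4), of z i] by simp
qed (use assms in auto)

context atlas
begin

lemma exists_torsion_matrix:
  assumes J: "almost_complex A J" and c: "c \<in> A" "x \<in> coord_set c UNIV" and \<theta>: "coframe (J c x) \<theta>"
  shows "\<exists>N. torsion_matrix \<theta> (nij (J c) x) N"
proof -
  obtain U \<alpha> where \<alpha>: "coframing A J U \<alpha>" "x \<in> coord_set c U" using exists_coframing[OF J c] by blast
  interpret t: coframe "J c x" \<theta> by fact
  obtain g where g: "\<theta> = change_coframe g (\<lambda>i. \<alpha> i c x)"
    using coframe_change[OF coframing_coframe[OF J \<alpha>(1) c(1) \<alpha>(2)] \<theta>] by metis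
  define \<omega> where "\<omega> i vs = (\<Sum>k\<in>UNIV. g $ i $ k * ext_d (\<alpha> k c) x vs)" for i vs
  have alt: "alt_form 2 (\<omega> i)" for i
  proof -
    have "alt_form 2 (\<lambda>vs. 1 * (g $ i $ 1 * ext_d (\<alpha> 1 c) x vs + g $ i $ 2 * ext_d (\<alpha> 2 c) x vs) + g $ i $ 3 * ext_d (\<alpha> 3 c) x vs)"
      by (intro alt_form_combination coframing_ext_d_alt[OF \<alpha>(1) c(1) \<alpha>(2)])
    then show ?thesis unfolding \<omega>_def[abs_def] by (simp add: sum_3)
  qed
  have P: "P02 (J c x) (\<lambda>u v. \<omega> i [u, v]) u v = - \<theta> i [nij (J c) x u v] / 4" for i u v
  proof -
    have "P02 (J c x) (\<lambda>u v. \<omega> i [u, v]) u v = (\<Sum>k\<in>UNIV. g $ i $ k * (- \<alpha> k c x [nij (J c) x u v] / 4))"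
      unfolding \<omega>_def P02_sum P02_scale coframing_P02[OF J \<alpha>(1) c(1) \<alpha>(2)] ..
    then show ?thesis by (simp add: g change_coframe_def sum_negf sum_divide_distrib)
  qed
  have "torsion_matrix \<theta> (nij (J c) x) (t.skew_matrix (\<lambda>i. P02 (J c x) (\<lambda>u v. \<omega> i [u, v])))"
    unfolding torsion_matrix_def P[symmetric]
    t.mat_comp_skew_matrix[where b = "\<lambda>i. P02 (J c x) (\<lambda>u v. \<omega> i [u, v])", OF t.P02_expand(2)[OF alt]]
    using t.P02_expand(1)[OF alt, symmetric] by blast
  then show ?thesis by blast
qed

end

locale variation = atlas +
  fixes J :: "'a endo_field" and e :: real and Jt :: "real \<Rightarrow> 'a endo_field"
  assumes variation: "smooth_variation A J e Jt"
begin

abbreviation "I \<equiv> {-e<..<e}"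

lemma e_pos: "e > 0" and Jt_0: "Jt 0 = J" and almost_complex_Jt: "t \<in> I \<Longrightarrow> almost_complex A (Jt t)"
  and smooth_Jt: "c \<in> A \<Longrightarrow> smooth_on (I \<times> coord_set c UNIV) (\<lambda>(t, x). Jt t c x v)"
  using variation by (auto simp: smooth_variation_def)

lemma zero_in: "0 \<in> I"
  using e_pos by simp

lemma open_time_coord: "c \<in> A \<Longrightarrow> open U \<Longrightarrow> open (I \<times> coord_set c U)"
  by (intro open_Times open_coord_set) auto

lemma smooth_Jt': "c \<in> A \<Longrightarrow> smooth_on (I \<times> coord_set c UNIV) (\<lambda>p. Jt (fst p) c (snd p) v)"
  using smooth_Jt[of c v] by (simp add: case_prod_unfold)

lemma linear_Jt: "t \<in> I \<Longrightarrow> c \<in> A \<Longrightarrow> x \<in> coord_set c UNIV \<Longrightarrow> linear (Jt t c x)"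
  using almost_complexD(1)[OF almost_complex_Jt] by blast

lemma space_derivative_Jt:
  assumes "c \<in> A" "t \<in> I" "x \<in> coord_set c UNIV"
  shows "frechet_derivative (\<lambda>y. Jt t c y v) (at x) u = frechet_derivative (\<lambda>p. Jt (fst p) c (snd p) v) (at (t, x)) (0, u)"
proof -
  have "((\<lambda>(t, x). Jt t c x v) has_derivative frechet_derivative (\<lambda>(t, x). Jt t c x v) (at (t, x))) (at (t, x))"
    by (rule smooth_on_has_derivative[OF smooth_Jt]) (use assms in auto)
  from fun_cong[OF frechet_derivative_at[OF derivative_in_space[OF this]], of u]
  show ?thesis unfolding case_prod_unfold by simp
qed

lemma smooth_nij:
  assumes c: "c \<in> A"
  shows "smooth_on (I \<times> coord_set c UNIV) (\<lambda>p. nij (Jt (fst p) c) (snd p) u v)"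
proof -
  let ?S = "I \<times> coord_set c UNIV"
  have o: "open ?S" by (rule open_time_coord[OF c open_UNIV])
  let ?J = "\<lambda>p. Jt (fst p) c (snd p)"
  define E where "E v p u = frechet_derivative (\<lambda>p. ?J p v) (at p) (0, u)" for v p u
  have sE: "smooth_on ?S (\<lambda>p. E v p u)" for u v
    unfolding E_def by (rule smooth_on_frechet[OF smooth_Jt'[OF c]])
  have lE: "linear (E v p)" if "p \<in> ?S" for v p
  proof -
    have "linear (frechet_derivative (\<lambda>p. ?J p v) (at p))"
      by (rule frechet_derivative_linear[OF smooth_on_differentiable[OF smooth_Jt'[OF c] that]])
    from linear_compose[OF _ this, of "\<lambda>u. (0, u)"] show ?thesis
      by (simp add: E_def[abs_def] o_def linear_iff)
  qed
  have lJ: "linear (?J p)" if "p \<in> ?S" for p using linear_Jt[OF _ c] that by auto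
  have "smooth_on ?S (\<lambda>p. ?J p (E v p u - E u p v) - (E v p (?J p u) - E u p (?J p v)))"
    by (intro smooth_on_diff smooth_on_linear_family[OF o smooth_Jt'[OF c] _ lJ]
        smooth_on_linear_family[OF o sE smooth_Jt'[OF c] lE] sE o)
  then show ?thesis
  proof (rule smooth_on_cong[OF o, rotated])
    fix p assume p: "p \<in> ?S"
    have "frechet_derivative (\<lambda>y. Jt (fst p) c y v) (at (snd p)) u = E v p u" for u v
      using space_derivative_Jt[OF c, of "fst p" "snd p" v u] p by (auto simp: E_def)
    then show "?J p (E v p u - E u p v) - (E v p (?J p u) - E u p (?J p v)) = nij (Jt (fst p) c) (snd p) u v"
      by (simp add: nij_def)
  qed
qed

lemma smooth_project10:
  assumes c: "c \<in> A" and a: "linear (\<lambda>v. a [v])"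
  shows "smooth_on (I \<times> coord_set c UNIV) (\<lambda>p. project10 (Jt (fst p) c (snd p)) a ws)"
proof (cases "length ws = 1")
  case True
  have o: "open (I \<times> coord_set c UNIV)" by (rule open_time_coord[OF c open_UNIV])
  have "smooth_on (I \<times> coord_set c UNIV) (\<lambda>p. a [Jt (fst p) c (snd p) (hd ws)])"
    using smooth_on_bounded_linear[OF _ o smooth_Jt'[OF c]] a by (simp add: linear_conv_bounded_linear)
  then show ?thesis unfolding project10_def if_P[OF True]
    by (intro smooth_on_divide smooth_on_diff smooth_on_mult smooth_on_const o) auto
qed (simp add: project10_def smooth_on_const open_time_coord[OF c open_UNIV])

lemma local_torsion:
  fixes u :: "3 \<Rightarrow> real^6" and a :: "3 \<Rightarrow> cform"
  assumes c: "c \<in> A" and a: "\<And>i. linear (\<lambda>v. a i [v])"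
  defines "\<theta> \<equiv> \<lambda>p i. project10 (Jt (fst p) c (snd p)) (a i)"
  defines "S \<equiv> {p \<in> I \<times> coord_set c UNIV. det (\<chi> i k. \<theta> p i [u k] :: complex^3^3) \<noteq> 0}"
  obtains N where "open S" "\<And>i k. smooth_on S (\<lambda>p. N p $ i $ k)"
    "\<And>p. p \<in> S \<Longrightarrow> coframe (Jt (fst p) c (snd p)) (\<theta> p)"
    "\<And>p. p \<in> S \<Longrightarrow> torsion_matrix (\<theta> p) (nij (Jt (fst p) c) (snd p)) (N p)"
    "\<And>p vs. p \<in> S \<Longrightarrow> density c1 c2 (Jt (fst p)) c (snd p) vs = complex_of_real (Lfun c1 c2 (N p)) * Omega (\<theta> p) vs"
proof -
  let ?S = "I \<times> coord_set c UNIV"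
  define G where "G p = (\<chi> i k. \<theta> p i [u k] :: complex^3^3)" for p
  define H where "H p = (\<chi> k m. cnj (\<theta> p k [u m]) :: complex^3^3)" for p
  have o: "open ?S" by (rule open_time_coord[OF c open_UNIV])
  have s\<theta>: "smooth_on ?S (\<lambda>p. \<theta> p i ws)" for i ws unfolding \<theta>_def by (rule smooth_project10[OF c a])
  have "smooth_on ?S (\<lambda>p. det (G p))" by (rule smooth_on_det3[OF o]) (simp add: G_def s\<theta>)
  then have "open (?S \<inter> (\<lambda>p. det (G p)) -` (- {0}))"
    by (intro continuous_open_preimage[OF smooth_on_continuous_on o]) auto
  moreover have "?S \<inter> (\<lambda>p. det (G p)) -` (- {0}) = S" by (auto simp: S_def G_def)
  ultimately have oS: "open S" by simp
  have sub: "S \<subseteq> ?S" by (auto simp: S_def)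
  have JS: "linear (Jt (fst p) c (snd p))" "Jt (fst p) c (snd p) (Jt (fst p) c (snd p) v) = - v" if "p \<in> S" for p v
    using that sub linear_Jt[OF _ c] almost_complexD(2)[OF almost_complex_Jt c] by auto
  have t10: "type10 (Jt (fst p) c (snd p)) (\<theta> p i)" if "p \<in> S" for p i
    unfolding \<theta>_def by (rule type10_project10[OF JS[OF that] a])
  have cf: "coframe (Jt (fst p) c (snd p)) (\<theta> p)" if "p \<in> S" for p
    by (rule coframeI[OF JS[OF that] t10[OF that], where u = u]) (use that in \<open>simp add: S_def\<close>)
  have ac: "almost_complex A (Jt (fst p))" "snd p \<in> coord_set c UNIV" if "p \<in> S" for p
    using that sub almost_complex_Jt by auto
  define N where "N p = (SOME N. torsion_matrix (\<theta> p) (nij (Jt (fst p) c) (snd p)) N)" for p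
  have N: "torsion_matrix (\<theta> p) (nij (Jt (fst p) c) (snd p)) (N p)" if "p \<in> S" for p
    unfolding N_def by (rule someI_ex[OF exists_torsion_matrix[OF ac(1)[OF that] c ac(2)[OF that] cf[OF that]]])
  define M where "M p = of_comp (\<lambda>i m d. - \<theta> p i [nij (Jt (fst p) c) (snd p) (u m) (u d)] / 4)" for p
  have detH: "det (H p) = cnj (det (G p))" for p by (simp add: H_def G_def det_3)
  have sM: "smooth_on S (\<lambda>p. M p $ i $ k)" for i k
    unfolding M_def
  proof (rule smooth_on_of_comp)
    fix m d
    have "smooth_on ?S (\<lambda>p. \<theta> p i [nij (Jt (fst p) c) (snd p) (u m) (u d)])"
    proof (rule smooth_on_linear_family[OF o s\<theta> smooth_nij[OF c]])
      fix p assume p: "p \<in> ?S"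
      then have J': "linear (Jt (fst p) c (snd p))" "Jt (fst p) c (snd p) (Jt (fst p) c (snd p) v) = - v" for v
        using linear_Jt[OF _ c] almost_complexD(2)[OF almost_complex_Jt c] by auto
      show "linear (\<lambda>v. \<theta> p i [v])"
        unfolding \<theta>_def using type10_project10[OF J' a] by (intro alt_form_1_linear) (simp add: type10_def)
    qed
    then show "smooth_on S (\<lambda>p. - \<theta> p i [nij (Jt (fst p) c) (snd p) (u m) (u d)] / 4)"
      by (intro smooth_on_divide smooth_on_minus smooth_on_const oS smooth_on_subset[OF _ sub]) auto
  qed
  have Neq: "N p $ i $ k = (M p ** transpose (H p)) $ i $ k / det (H p)" if p: "p \<in> S" for p i k
  proof -
    interpret t: coframe "Jt (fst p) c (snd p)" "\<theta> p" by (rule cf[OF p])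
    have "det (H p) * N p $ i $ k = (M p ** transpose (H p)) $ i $ k"
      unfolding H_def M_def
      by (rule torsion_matrix_solve[OF N[OF p] nij_skew[where J = "Jt (fst p) c" and x = "snd p", OF JS(1)[OF p]] t.linear_\<theta>])
    moreover have "det (H p) \<noteq> 0" using p by (simp add: detH S_def G_def)
    ultimately show ?thesis by (simp add: field_simps)
  qed
  have "smooth_on S (\<lambda>p. N p $ i $ k)" for i k
  proof -
    have sH: "smooth_on S (\<lambda>p. H p $ i $ k)" for i k
      unfolding H_def by (simp, intro smooth_on_cnj oS smooth_on_subset[OF s\<theta> sub])
    have "smooth_on S (\<lambda>p. (M p ** transpose (H p)) $ i $ k / det (H p))"
      unfolding matrix_matrix_mult_def transpose_def
      by (simp, intro smooth_on_divide smooth_on_sum smooth_on_mult smooth_on_det3 sH sM oS) (simp add: detH S_def G_def)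
    then show ?thesis by (rule smooth_on_cong[OF oS, rotated]) (simp add: Neq)
  qed
  moreover have "density c1 c2 (Jt (fst p)) c (snd p) vs = complex_of_real (Lfun c1 c2 (N p)) * Omega (\<theta> p) vs" if "p \<in> S" for p vs
    by (rule density_pointwise[OF ac(1)[OF that] c ac(2)[OF that] cf[OF that] N[OF that]])
  ultimately show thesis using that oS cf N by blast
qed

lemma smooth_on_Omega:
  assumes "open S" "\<And>i ws. smooth_on S (\<lambda>p. \<theta> p i ws)"
  shows "smooth_on S (\<lambda>p. Omega (\<theta> p) vs)"
  unfolding Omega_def vol3_def
  by (intro smooth_on_mult smooth_on_const smooth_on_wedge smooth_on_cnj_form assms)

lemma smooth_density:
  assumes c: "c \<in> A"
  shows "smooth_on (I \<times> coord_set c UNIV) (\<lambda>(t, x). density c1 c2 (Jt t) c x vs)"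
proof (rule smooth_on_local)
  fix p0 assume p0: "p0 \<in> I \<times> coord_set c UNIV"
  obtain t0 x0 where tx: "p0 = (t0, x0)" "t0 \<in> I" "x0 \<in> coord_set c UNIV" using p0 by auto
  note ac = almost_complex_Jt[OF tx(2)]
  obtain U \<alpha> where \<alpha>: "coframing A (Jt t0) U \<alpha>" "x0 \<in> coord_set c U" using exists_coframing[OF ac c tx(3)] by blast
  interpret t: coframe "Jt t0 c x0" "\<lambda>i. \<alpha> i c x0" by (rule coframing_coframe[OF ac \<alpha>(1) c \<alpha>(2)])
  let ?\<theta> = "\<lambda>p i. project10 (Jt (fst p) c (snd p)) (\<alpha> i c x0)"
  define S where "S = {p \<in> I \<times> coord_set c UNIV. det (\<chi> i k. ?\<theta> p i [t.f k] :: complex^3^3) \<noteq> 0}"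
  obtain N where N: "open S" "\<And>i k. smooth_on S (\<lambda>p. N p $ i $ k)"
    "\<And>p vs. p \<in> S \<Longrightarrow> density c1 c2 (Jt (fst p)) c (snd p) vs = complex_of_real (Lfun c1 c2 (N p)) * Omega (?\<theta> p) vs"
    unfolding S_def by (rule local_torsion[where u = t.f and a = "\<lambda>i. \<alpha> i c x0" and ?c1.0 = c1 and ?c2.0 = c2, OF c t.linear_\<theta>]) blast
  have "smooth_on S (\<lambda>p. complex_of_real (Lfun c1 c2 (N p)) * Omega (?\<theta> p) vs)"
  proof (intro smooth_on_mult smooth_on_of_real smooth_on_Lfun N(1,2) smooth_on_Omega)
    show "smooth_on S (\<lambda>p. ?\<theta> p i ws)" for i ws
      by (rule smooth_on_subset[OF smooth_project10[OF c t.linear_\<theta>]]) (auto simp: S_def)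
  qed
  then have "smooth_on S (\<lambda>(t, x). density c1 c2 (Jt t) c x vs)"
    by (rule smooth_on_cong[OF N(1), rotated]) (simp add: N(3) case_prod_unfold)
  moreover have "p0 \<in> S"
  proof -
    have "(\<chi> i k. ?\<theta> p0 i [t.f k] :: complex^3^3) = mat 1"
      by (simp add: project10_def tx(1) t.\<theta>_j t.\<theta>_f mat_def vec_eq_iff)
    then show ?thesis using p0 by (simp add: S_def)
  qed
  ultimately show "\<exists>T. open T \<and> p0 \<in> T \<and> smooth_on T (\<lambda>(t, x). density c1 c2 (Jt t) c x vs)"
    using N(1) by blast
qed

definition density_var :: "real \<Rightarrow> real \<Rightarrow> 'a form_field" where
  "density_var c1 c2 c x vs = vector_derivative (\<lambda>t. density c1 c2 (Jt t) c x vs) (at 0)"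

lemma density_has_derivative:
  assumes "c \<in> A" "x \<in> coord_set c UNIV"
  shows "((\<lambda>t. density c1 c2 (Jt t) c x vs) has_vector_derivative density_var c1 c2 c x vs) (at 0)"
    "density_var c1 c2 c x vs = frechet_derivative (\<lambda>(t, x). density c1 c2 (Jt t) c x vs) (at (0, x)) (1, 0)"
proof -
  have "((\<lambda>(t, x). density c1 c2 (Jt t) c x vs) has_derivative
      frechet_derivative (\<lambda>(t, x). density c1 c2 (Jt t) c x vs) (at (0, x))) (at (0, x))"
    by (rule smooth_on_has_derivative[OF smooth_density[OF assms(1)]]) (use assms(2) zero_in in auto)
  from derivative_in_time[OF this]
  show "((\<lambda>t. density c1 c2 (Jt t) c x vs) has_vector_derivative density_var c1 c2 c x vs) (at 0)"
    "density_var c1 c2 c x vs = frechet_derivative (\<lambda>(t, x). density c1 c2 (Jt t) c x vs) (at (0, x)) (1, 0)"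
    unfolding density_var_def by (auto simp: vector_derivative_at)
qed

lemma continuous_density_var:
  assumes c: "c \<in> A"
  shows "continuous_on (coord_set c UNIV) (\<lambda>x. density_var c1 c2 c x vs)"
proof -
  have "continuous_on (coord_set c UNIV) (\<lambda>x. frechet_derivative (\<lambda>(t, x). density c1 c2 (Jt t) c x vs) (at (0, x)) (1, 0))"
    by (rule continuous_on_compose2[OF smooth_on_continuous_on[OF smooth_on_frechet[OF smooth_density[OF c]]]])
      (use zero_in in \<open>auto intro!: continuous_intros\<close>)
  then show ?thesis
    by (rule continuous_on_cong[THEN iffD1, OF refl, rotated]) (simp add: density_has_derivative(2)[OF c])
qed

lemma density_var_det:
  assumes "c \<in> A" "x \<in> coord_set c UNIV"
  shows "density_var c1 c2 c x vs = det_form vs * density_var c1 c2 c x std_basis"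
proof -
  have "((\<lambda>t. det_form vs * density c1 c2 (Jt t) c x std_basis) has_vector_derivative
      det_form vs * density_var c1 c2 c x std_basis) (at 0)"
    by (rule has_vector_derivative_mult_right[OF density_has_derivative(1)[OF assms]])
  then have "((\<lambda>t. density c1 c2 (Jt t) c x vs) has_vector_derivative
      det_form vs * density_var c1 c2 c x std_basis) (at 0)"
  proof (rule has_vector_derivative_transform_within_open[of _ _ _ I])
    show "det_form vs * density c1 c2 (Jt t) c x std_basis = density c1 c2 (Jt t) c x vs" if "t \<in> I" for t
      by (rule alt_form_6_det[OF alt_density[OF almost_complex_Jt[OF that] assms], symmetric])
  qed (use zero_in in auto)
  then show ?thesis using vector_derivative_at by (simp add: density_var_def)
qed

lemma six_form_density_var: "six_form (density_var c1 c2)"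
  unfolding six_form_def
proof (intro conjI ballI)
  fix c assume c: "c \<in> A"
  show "continuous_on (coord_set c UNIV) (\<lambda>x. density_var c1 c2 c x std_basis)"
    by (rule continuous_density_var[OF c])
  fix x assume x: "x \<in> coord_set c UNIV"
  have "density_var c1 c2 c x = (\<lambda>vs. density_var c1 c2 c x std_basis * det_form vs)"
    by (rule ext) (rule trans[OF density_var_det[OF c x] mult.commute])
  then show "alt_form 6 (density_var c1 c2 c x)"
    using alt_form_scale[OF alt_form_det] by metis
next
  fix c c' x assume c: "c \<in> A" "c' \<in> A" and x: "x \<in> coord_set c (fst c')"
  have y: "transition c c' x \<in> coord_set c' UNIV" using transition_in[OF c, of x UNIV] x coord_set_UNIV by simp
  have "((\<lambda>t. density c1 c2 (Jt t) c' (transition c c' x) (map (transition_deriv c c' x) std_basis)) has_vector_derivative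
      density_var c1 c2 c x std_basis) (at 0)"
  proof (rule has_vector_derivative_transform_within_open[OF density_has_derivative(1)[OF c(1) coord_set_UNIV[OF x]], of I])
    show "density c1 c2 (Jt t) c x std_basis =
        density c1 c2 (Jt t) c' (transition c c' x) (map (transition_deriv c c' x) std_basis)" if "t \<in> I" for t
      by (rule density_transition[OF almost_complex_Jt[OF that] c x, symmetric])
  qed (use zero_in in auto)
  then show "density_var c1 c2 c' (transition c c' x) (map (transition_deriv c c' x) std_basis) = density_var c1 c2 c x std_basis"
    using vector_derivative_at by (simp add: density_var_def)
qed

lemma Ffun_has_derivative:
  assumes M: "compact (UNIV :: 'a set)"
  shows "((\<lambda>t. Ffun A c1 c2 (Jt t)) has_vector_derivative integral_form A (density_var c1 c2)) (at 0)"
proof -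
  obtain F and \<rho> :: "'a chart \<Rightarrow> 'a \<Rightarrow> real" where F: "finite F" "F \<subseteq> A"
    and \<rho>: "\<And>c. c \<in> F \<Longrightarrow> smooth_function A (\<rho> c)" "\<And>c. c \<in> F \<Longrightarrow> closure {p. \<rho> c p \<noteq> 0} \<subseteq> fst c"
    and "\<And>p. (\<Sum>c\<in>F. \<rho> c p) = 1"
    and intf: "\<And>\<omega>. integral_form A \<omega> = (\<Sum>c\<in>F. integral (coord_set c UNIV) (\<lambda>x. complex_of_real (\<rho> c (chart_inv c x)) * \<omega> c x std_basis))"
    by (rule integral_form_partition[OF M]) (rule that)
  define h where "h t c x = complex_of_real (\<rho> c (chart_inv c x)) * density c1 c2 (Jt t) c x std_basis" for t c x
  have "((\<lambda>t. integral (coord_set c UNIV) (h t c)) has_vector_derivative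
      integral (coord_set c UNIV) (\<lambda>x. complex_of_real (\<rho> c (chart_inv c x)) * density_var c1 c2 c x std_basis)) (at 0)" if c: "c \<in> F" for c
  proof -
    have cA: "c \<in> A" using c F by blast
    let ?K = "closure {p. \<rho> c p \<noteq> 0}" and ?W = "coord_set c UNIV"
    have oW: "open ?W" by (rule open_coord_set[OF cA open_UNIV])
    have K: "compact (snd c ` ?K)" "snd c ` ?K \<subseteq> ?W"
      using compact_coord_image[OF M cA closed_closure \<rho>(2)[OF c]] coord_set_UNIV by blast+
    have s: "smooth_on (I \<times> ?W) (\<lambda>(t, x). h t c x)"
    proof -
      have "smooth_on (I \<times> ?W) (\<lambda>p. \<rho> c (chart_inv c (snd p)))"
        by (rule smooth_on_compose[OF open_time_coord[OF cA open_UNIV] oW smooth_on_linear[OF bounded_linear_snd open_time_coord[OF cA open_UNIV]]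
              smooth_functionD[OF \<rho>(1)[OF c] cA]]) auto
      then show ?thesis
        unfolding h_def case_prod_unfold using smooth_density[OF cA, unfolded case_prod_unfold]
        by (intro smooth_on_mult smooth_on_of_real open_time_coord[OF cA open_UNIV])
    qed
    have z: "h t c x = 0" if "x \<in> ?W - snd c ` ?K" for t x
    proof -
      have "chart_inv c x \<notin> ?K" using coord_set_image_iff[OF cA \<rho>(2)[OF c], of x] that by blast
      then show ?thesis using closure_subset[of "{p. \<rho> c p \<noteq> 0}"] by (auto simp: h_def)
    qed
    have v: "vector_derivative (\<lambda>t. h t c x) (at 0) = complex_of_real (\<rho> c (chart_inv c x)) * density_var c1 c2 c x std_basis" if "x \<in> ?W" for x
      unfolding h_def by (rule vector_derivative_at[OF has_vector_derivative_mult_right[OF density_has_derivative(1)[OF cA that]]])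
    have "integral ?W (\<lambda>x. vector_derivative (\<lambda>t. h t c x) (at 0)) =
        integral ?W (\<lambda>x. complex_of_real (\<rho> c (chart_inv c x)) * density_var c1 c2 c x std_basis)"
      by (rule Henstock_Kurzweil_Integration.integral_cong) (rule v)
    then show ?thesis
      using differentiate_integral[OF e_pos oW K s z] by simp
  qed
  then have "((\<lambda>t. \<Sum>c\<in>F. integral (coord_set c UNIV) (h t c)) has_vector_derivative
     (\<Sum>c\<in>F. integral (coord_set c UNIV) (\<lambda>x. complex_of_real (\<rho> c (chart_inv c x)) * density_var c1 c2 c x std_basis))) (at 0)"
    by (intro has_vector_derivative_sum)
  moreover have "integral_form A (density_var c1 c2) =
      (\<Sum>c\<in>F. integral (coord_set c UNIV) (\<lambda>x. complex_of_real (\<rho> c (chart_inv c x)) * density_var c1 c2 c x std_basis))"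
    unfolding intf by simp
  moreover have "Ffun A c1 c2 (Jt t) = (\<Sum>c\<in>F. integral (coord_set c UNIV) (h t c))" for t
    unfolding Ffun_def density_def[symmetric] intf by (simp add: h_def[abs_def])
  ultimately show ?thesis by simp
qed

end

section \<open>The Euler-Lagrange form\<close>

lemma smooth_on_vec:
  fixes f :: "'a::real_normed_vector \<Rightarrow> 'b::euclidean_space^'n"
  assumes "open S" "\<And>i. smooth_on S (\<lambda>z. f z $ i)"
  shows "smooth_on S f"
proof -
  have ax: "bounded_linear (axis i :: 'b \<Rightarrow> 'b^'n)" for i
    unfolding linear_conv_bounded_linear[symmetric] by (auto simp: linear_iff vec_eq_iff axis_def)
  have "smooth_on S (\<lambda>z. \<Sum>i\<in>UNIV. axis i (f z $ i))"
    by (intro smooth_on_sum smooth_on_bounded_linear[OF ax] assms)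
  moreover have "(\<Sum>i\<in>UNIV. axis i (f z $ i)) = f z" for z
    by (simp add: vec_eq_iff axis_def if_distrib[of "\<lambda>v. v $ _"] cong: if_cong)
  ultimately show ?thesis by simp
qed

lemma L_partials_diagonal: "L_partials c1 c2 L' \<Longrightarrow> L' a i k k = 0"
proof -
  assume "L_partials c1 c2 L'"
  then have "L' a i k k = - L' a i k k" unfolding L_partials_def by blast
  then show ?thesis by simp
qed

text \<open>The partial derivatives are recovered by evaluating the differential of the Lagrangian on the
  matrices with a single skew pair of nonzero components.\<close>

lemma smooth_L_partials:
  assumes L: "L_partials c1 c2 L'"
  shows "smooth_on UNIV (\<lambda>a. L' a i j k)"
proof (cases "j = k")
  case True
  then show ?thesis using L_partials_diagonal[OF L] by (simp add: smooth_on_const)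
next
  case False
  have sL: "smooth_on UNIV (Lfun c1 c2)"
  proof (rule smooth_on_Lfun[where N = "\<lambda>a. a"])
    fix i k
    show "smooth_on UNIV (\<lambda>a :: complex^3^3. a $ i $ k)"
      by (rule smooth_on_linear[OF bounded_linear_compose[OF bounded_linear_vec_nth bounded_linear_vec_nth]]) simp
  qed simp
  define b where "b z i' j' k' = (if i' = i then if j' = j \<and> k' = k then z else if j' = k \<and> k' = j then - z else 0 else 0)"
    for z :: complex and i' j' k'
  have bs: "b z i' j' k' = - b z i' k' j'" for z i' j' k' using False by (auto simp: b_def)
  define D where "D z a = frechet_derivative (Lfun c1 c2) (at a) (of_comp (b z))" for z a
  have D: "D z a = Re (2 * L' a i j k * z)" for z a
  proof -
    have "(Lfun c1 c2 has_derivative (\<lambda>h. Re (\<Sum>i\<in>UNIV. \<Sum>j\<in>UNIV. \<Sum>k\<in>UNIV. L' a i j k * mat_comp h i j k))) (at a)"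
      using L unfolding L_partials_def by blast
    from fun_cong[OF frechet_derivative_at[OF this], of "of_comp (b z)"]
    have "D z a = Re (\<Sum>i'\<in>UNIV. \<Sum>j'\<in>UNIV. \<Sum>k'\<in>UNIV. L' a i' j' k' * mat_comp (of_comp (b z)) i' j' k')"
      unfolding D_def by (rule sym)
    also have "(\<Sum>i'\<in>UNIV. \<Sum>j'\<in>UNIV. \<Sum>k'\<in>UNIV. L' a i' j' k' * mat_comp (of_comp (b z)) i' j' k') =
        (\<Sum>j'\<in>UNIV. \<Sum>k'\<in>UNIV. L' a i j' k' * b z i j' k')"
    proof -
      have eq: "(\<Sum>j'\<in>UNIV. \<Sum>k'\<in>UNIV. L' a i' j' k' * b z i' j' k') = (if i' = i then (\<Sum>j'\<in>UNIV. \<Sum>k'\<in>UNIV. L' a i j' k' * b z i j' k') else 0)" for i'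
        by (simp add: b_def)
      show ?thesis
        unfolding mat_comp_of_comp[of "b z", OF bs] by (rule trans[OF sum.cong[OF refl eq]]) simp
    qed
    also have "\<dots> = 2 * L' a i j k * z"
    proof -
      have "(\<Sum>j'\<in>UNIV. \<Sum>k'\<in>UNIV. L' a i j' k' * b z i j' k') = L' a i j k * z - L' a i k j * z"
      proof -
        have "L' a i j' k' * b z i j' k' = (if j' = j then (if k' = k then L' a i j k * z else 0) else 0)
            - (if j' = k then (if k' = j then L' a i k j * z else 0) else 0)" for j' k'
          using False by (simp add: b_def)
        then have "(\<Sum>k'\<in>UNIV. L' a i j' k' * b z i j' k') =
            (if j' = j then L' a i j k * z else 0) - (if j' = k then L' a i k j * z else 0)" for j'
          by (cases "j' = j"; cases "j' = k") (simp_all add: sum_subtractf sum_negf)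
        then show ?thesis by (simp add: sum_subtractf)
      qed
      moreover have "L' a i k j = - L' a i j k" using L unfolding L_partials_def by blast
      ultimately show ?thesis by simp
    qed
    finally show ?thesis .
  qed
  have eq: "(\<lambda>a. L' a i j k) = (\<lambda>a. (complex_of_real (D 1 a) + \<i> * complex_of_real (D (- \<i>) a)) / 2)"
    unfolding D by (simp add: complex_eq_iff fun_eq_iff)
  have "smooth_on UNIV (\<lambda>a. (complex_of_real (D 1 a) + \<i> * complex_of_real (D (- \<i>) a)) / 2)"
    unfolding D_def
    by (intro smooth_on_divide smooth_on_add smooth_on_mult smooth_on_const smooth_on_of_real smooth_on_frechet[OF sL]) auto
  then show ?thesis unfolding eq .
qed

lemma (in coframe) torsion_matrix_unique:
  assumes "torsion_matrix \<theta> Q N" "torsion_matrix \<theta> Q N'"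
  shows "N = N'"
proof -
  have e: "mat_comp N i c d = - \<theta> i [Q (f c) (f d)] / 4" if "torsion_matrix \<theta> Q N" for N i c d
    using that[unfolded torsion_matrix_def, rule_format, of i "f c" "f d"]
    by (simp add: \<theta>_f if_distrib[of cnj] if_distrib[of "\<lambda>x. _ * x"] sum.delta cong: if_cong)
  have "N $ i $ m = N' $ i $ m" for i m
    using exhaust_3[of m] mat_comp_entries[of N i] mat_comp_entries[of N' i] e[OF assms(1)] e[OF assms(2)] by auto
  then show ?thesis by (simp add: vec_eq_iff)
qed

context atlas
begin

lemma smooth_coframing: "coframing A J U \<alpha> \<Longrightarrow> c \<in> A \<Longrightarrow> smooth_on (coord_set c U) (\<lambda>x. \<alpha> i c x ws)"
  by (rule form_onD(2)[OF coframingD(2)])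

lemma linear_coframing: "coframing A J U \<alpha> \<Longrightarrow> c \<in> A \<Longrightarrow> x \<in> coord_set c U \<Longrightarrow> linear (\<lambda>v. \<alpha> i c x [v])"
  by (rule alt_form_1_linear[OF form_onD(1)[OF coframingD(2)]])

lemma smooth_nij_fixed:
  assumes J: "almost_complex A J" and c: "c \<in> A"
  shows "smooth_on (coord_set c UNIV) (\<lambda>x. nij (J c) x u v)"
proof -
  let ?W = "coord_set c UNIV"
  have o: "open ?W" by (rule open_coord_set[OF c open_UNIV])
  note sJ = almost_complexD(3)[OF J c]
  define E where "E v x u = frechet_derivative (\<lambda>y. J c y v) (at x) u" for v x u
  have sE: "smooth_on ?W (\<lambda>x. E v x u)" for u v unfolding E_def by (rule smooth_on_frechet[OF sJ])
  have lE: "linear (E v x)" if "x \<in> ?W" for v x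
    using frechet_derivative_linear[OF smooth_on_differentiable[OF sJ that]] by (simp add: E_def[abs_def])
  have lJ: "linear (J c x)" if "x \<in> ?W" for x by (rule almost_complexD(1)[OF J c that])
  have "smooth_on ?W (\<lambda>x. J c x (E v x u - E u x v) - (E v x (J c x u) - E u x (J c x v)))"
    by (intro smooth_on_diff smooth_on_linear_family[OF o sJ _ lJ] smooth_on_linear_family[OF o sE sJ lE] sE o)
  then show ?thesis by (simp add: nij_def E_def)
qed

lemma coframe_nonvanishing:
  assumes J: "almost_complex A J" and \<alpha>: "coframing A J U \<alpha>" and c: "c \<in> A" and x0: "x0 \<in> coord_set c U"
  obtains u :: "3 \<Rightarrow> real^6" and T where "open T" "x0 \<in> T" "T \<subseteq> coord_set c U"
    "\<And>x. x \<in> T \<Longrightarrow> det (\<chi> k m. cnj (\<alpha> k c x [u m]) :: complex^3^3) \<noteq> 0"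
proof -
  interpret t: coframe "J c x0" "\<lambda>i. \<alpha> i c x0" by (rule coframing_coframe[OF J \<alpha> c x0])
  let ?H = "\<lambda>x. det (\<chi> k m. cnj (\<alpha> k c x [t.f m]) :: complex^3^3)"
  let ?T = "coord_set c U \<inter> ?H -` (- {0})"
  have o: "open (coord_set c U)" by (rule open_coord_set[OF c coframingD(1)[OF \<alpha>]])
  have "smooth_on (coord_set c U) ?H"
    by (rule smooth_on_det3[OF o]) (simp, intro smooth_on_cnj o smooth_coframing[OF \<alpha> c])
  then have "open ?T" by (intro continuous_open_preimage[OF smooth_on_continuous_on o]) auto
  moreover have "(\<chi> k m. cnj (\<alpha> k c x0 [t.f m]) :: complex^3^3) = mat 1"
    by (simp add: vec_eq_iff mat_def t.\<theta>_f)
  then have "x0 \<in> ?T" using x0 by simp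
  ultimately show thesis using that[of ?T t.f] by auto
qed

lemma smooth_Nmat:
  assumes J: "almost_complex A J" and \<alpha>: "coframing A J U \<alpha>" and c: "c \<in> A"
  shows "smooth_on (coord_set c U) (\<lambda>x. Nmat J \<alpha> c x $ i $ m)"
proof (rule smooth_on_local)
  fix x0 assume x0: "x0 \<in> coord_set c U"
  obtain u :: "3 \<Rightarrow> real^6" and T where T: "open T" "x0 \<in> T" "T \<subseteq> coord_set c U"
    and nz: "\<And>x. x \<in> T \<Longrightarrow> det (\<chi> k m. cnj (\<alpha> k c x [u m]) :: complex^3^3) \<noteq> 0"
    by (rule coframe_nonvanishing[OF J \<alpha> c x0]) blast
  define H where "H x = (\<chi> k m. cnj (\<alpha> k c x [u m]) :: complex^3^3)" for x
  define M where "M x = of_comp (\<lambda>i m d. - \<alpha> i c x [nij (J c) x (u m) (u d)] / 4)" for x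
  have TU: "T \<subseteq> coord_set c UNIV" using T(3) coord_set_UNIV by blast
  have s\<alpha>: "smooth_on T (\<lambda>x. \<alpha> i c x ws)" for i ws by (rule smooth_on_subset[OF smooth_coframing[OF \<alpha> c] T(3)])
  have sH: "smooth_on T (\<lambda>x. H x $ i $ k)" for i k
    unfolding H_def by (simp, intro smooth_on_cnj T s\<alpha>)
  have sM: "smooth_on T (\<lambda>x. M x $ i $ k)" for i k
    unfolding M_def
  proof (rule smooth_on_of_comp)
    fix m d
    have "smooth_on T (\<lambda>x. \<alpha> i c x [nij (J c) x (u m) (u d)])"
      by (rule smooth_on_linear_family[OF T(1) s\<alpha> smooth_on_subset[OF smooth_nij_fixed[OF J c] TU]])
        (use linear_coframing[OF \<alpha> c] T(3) in blast)
    then show "smooth_on T (\<lambda>x. - \<alpha> i c x [nij (J c) x (u m) (u d)] / 4)"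
      by (intro smooth_on_divide smooth_on_minus smooth_on_const T(1)) auto
  qed
  have Neq: "(M x ** transpose (H x)) $ i $ m / det (H x) = Nmat J \<alpha> c x $ i $ m" if x: "x \<in> T" for x
  proof -
    have xU: "x \<in> coord_set c U" using x T(3) by blast
    interpret t: coframe "J c x" "\<lambda>i. \<alpha> i c x" by (rule coframing_coframe[OF J \<alpha> c xU])
    have "det (H x) * Nmat J \<alpha> c x $ i $ m = (M x ** transpose (H x)) $ i $ m"
      unfolding H_def M_def
      by (rule torsion_matrix_solve[OF Nmat_torsion[OF J \<alpha> c xU] nij_skew[where J = "J c" and x = x, OF t.linear_j] t.linear_\<theta>])
    then show ?thesis using nz[OF x] by (simp add: H_def[symmetric] field_simps)
  qed
  have "smooth_on T (\<lambda>x. (M x ** transpose (H x)) $ i $ m / det (H x))"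
    unfolding matrix_matrix_mult_def transpose_def
    by (simp, intro smooth_on_divide smooth_on_sum smooth_on_mult smooth_on_det3 sH sM T(1)) (simp add: H_def nz)
  then have "smooth_on T (\<lambda>x. Nmat J \<alpha> c x $ i $ m)"
    by (rule smooth_on_cong[OF T(1), rotated]) (rule Neq)
  then show "\<exists>T. open T \<and> x0 \<in> T \<and> smooth_on T (\<lambda>x. Nmat J \<alpha> c x $ i $ m)" using T by blast
qed

lemma smooth_dual5:
  assumes J: "almost_complex A J" and \<alpha>: "coframing A J U \<alpha>" and c: "c \<in> A"
  shows "smooth_on (coord_set c U) (\<lambda>x. dual5 (\<lambda>m. \<alpha> m c x) k ws)"
proof -
  have o: "open (coord_set c U)" by (rule open_coord_set[OF c coframingD(1)[OF \<alpha>]])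
  have s2: "smooth_on (coord_set c U) (\<lambda>x. cnj2 (\<lambda>m. \<alpha> m c x) k us)" for us
    using exhaust_3[of k] by (auto simp: cnj2_eq intro!: smooth_on_wedge smooth_on_cnj_form o smooth_coframing[OF \<alpha> c])
  have "smooth_on (coord_set c U) (\<lambda>x. - \<i> / 8 * (vol3 (\<lambda>m. \<alpha> m c x) \<and>\<^sub>e cnj2 (\<lambda>m. \<alpha> m c x) k) ws)"
    unfolding vol3_def
    by (intro smooth_on_mult smooth_on_const smooth_on_wedge o s2 smooth_coframing[OF \<alpha> c])
  then show ?thesis
    by (rule smooth_on_cong[OF o, rotated])
      (simp add: coframe.dual5_eq[OF coframing_coframe[OF J \<alpha> c]] coframe.dual_def[OF coframing_coframe[OF J \<alpha> c]])
qed

definition el_form :: "(complex^3^3 \<Rightarrow> 3 \<Rightarrow> 3 \<Rightarrow> 3 \<Rightarrow> complex) \<Rightarrow> 'a endo_field \<Rightarrow> (3 \<Rightarrow> 'a form_field) \<Rightarrow>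
    'a chart \<Rightarrow> 3 \<Rightarrow> 3 \<Rightarrow> real^6 \<Rightarrow> cform" where
  "el_form L' J \<alpha> c i j y ws = (\<Sum>k\<in>UNIV. L' (Nmat J \<alpha> c y) i j k * dual5 (\<lambda>m. \<alpha> m c y) k ws)"

definition el_expr :: "(complex^3^3 \<Rightarrow> 3 \<Rightarrow> 3 \<Rightarrow> 3 \<Rightarrow> complex) \<Rightarrow> 'a endo_field \<Rightarrow> (3 \<Rightarrow> 'a form_field) \<Rightarrow>
    (3 \<Rightarrow> 3 \<Rightarrow> 'a form_field) \<Rightarrow> 'a chart \<Rightarrow> 3 \<Rightarrow> 3 \<Rightarrow> real^6 \<Rightarrow> cform" where
  "el_expr L' J \<alpha> \<kappa> c i j x vs = ext_d (el_form L' J \<alpha> c i j) x vs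
     - (\<Sum>l\<in>UNIV. \<Sum>k\<in>UNIV. L' (Nmat J \<alpha> c x) l j k * (\<kappa> l i c x \<and>\<^sub>e dual5 (\<lambda>m. \<alpha> m c x) k) vs)
     + (\<Sum>l\<in>UNIV. \<Sum>k\<in>UNIV. L' (Nmat J \<alpha> c x) i l k * (cnj_form (\<kappa> j l c x) \<and>\<^sub>e dual5 (\<lambda>m. \<alpha> m c x) k) vs)"

lemma smooth_L_Nmat:
  assumes "almost_complex A J" "coframing A J U \<alpha>" "c \<in> A" "L_partials c1 c2 L'"
  shows "smooth_on (coord_set c U) (\<lambda>x. L' (Nmat J \<alpha> c x) i j k)"
proof -
  have o: "open (coord_set c U)" by (rule open_coord_set[OF assms(3) coframingD(1)[OF assms(2)]])
  have "smooth_on (coord_set c U) (Nmat J \<alpha> c)"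
    by (intro smooth_on_vec o smooth_Nmat[OF assms(1-3)])
  from smooth_on_compose[where g = "\<lambda>a. L' a i j k", OF o open_UNIV this smooth_L_partials[OF assms(4)] subset_UNIV]
  show ?thesis .
qed

lemma smooth_el_form:
  assumes "almost_complex A J" "coframing A J U \<alpha>" "c \<in> A" "L_partials c1 c2 L'"
  shows "smooth_on (coord_set c U) (\<lambda>y. el_form L' J \<alpha> c i j y ws)"
proof -
  have o: "open (coord_set c U)" by (rule open_coord_set[OF assms(3) coframingD(1)[OF assms(2)]])
  show ?thesis
    unfolding el_form_def
    by (rule smooth_on_sum[OF o smooth_on_mult[OF o smooth_L_Nmat[OF assms] smooth_dual5[OF assms(1-3)]]])
qed

lemma smooth_ext_d:
  assumes "open W" "\<And>ws. smooth_on W (\<lambda>y. \<omega> y ws)"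
  shows "smooth_on W (\<lambda>y. ext_d \<omega> y vs)"
  unfolding ext_d_def by (intro smooth_on_sum smooth_on_mult smooth_on_const smooth_on_frechet assms)

lemma connection02D:
  assumes "connection02 A J U \<alpha> \<kappa>"
  shows "form_on A U 1 (\<kappa> i j)" "c \<in> A \<Longrightarrow> x \<in> coord_set c U \<Longrightarrow> ext_d (\<alpha> i c) x vs =
        - (\<Sum>j\<in>UNIV. (\<kappa> i j c x \<and>\<^sub>e \<alpha> j c x) vs) + (\<Sum>m\<in>UNIV. Nmat J \<alpha> c x $ i $ m * cnj2 (\<lambda>i. \<alpha> i c x) m vs)"
  using assms unfolding connection02_def by blast+

lemma smooth_el_expr:
  assumes "almost_complex A J" "coframing A J U \<alpha>" "c \<in> A" "L_partials c1 c2 L'" "connection02 A J U \<alpha> \<kappa>"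
  shows "smooth_on (coord_set c U) (\<lambda>y. el_expr L' J \<alpha> \<kappa> c i j y vs)"
proof -
  have o: "open (coord_set c U)" by (rule open_coord_set[OF assms(3) coframingD(1)[OF assms(2)]])
  have k: "smooth_on (coord_set c U) (\<lambda>y. \<kappa> i j c y ws)" for i j ws
    by (rule form_onD(2)[OF connection02D(1)[OF assms(5)] assms(3)])
  have w: "smooth_on (coord_set c U) (\<lambda>y. (\<kappa> l i c y \<and>\<^sub>e dual5 (\<lambda>m. \<alpha> m c y) k) vs)" for l i k
    by (rule smooth_on_wedge[OF o k smooth_dual5[OF assms(1-3)]])
  have w': "smooth_on (coord_set c U) (\<lambda>y. (cnj_form (\<kappa> l i c y) \<and>\<^sub>e dual5 (\<lambda>m. \<alpha> m c y) k) vs)" for l i k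
    by (rule smooth_on_wedge[OF o smooth_on_cnj_form[OF o k] smooth_dual5[OF assms(1-3)]])
  have n: "smooth_on (coord_set c U) (\<lambda>y. L' (Nmat J \<alpha> c y) i j k)" for i j k
    by (rule smooth_L_Nmat[OF assms(1-4)])
  have d: "smooth_on (coord_set c U) (\<lambda>y. ext_d (el_form L' J \<alpha> c i j) y vs)"
    by (rule smooth_ext_d[OF o smooth_el_form[OF assms(1-4)]])
  have s1: "smooth_on (coord_set c U) (\<lambda>y. \<Sum>l\<in>UNIV. \<Sum>k\<in>UNIV. L' (Nmat J \<alpha> c y) l j k * (\<kappa> l i c y \<and>\<^sub>e dual5 (\<lambda>m. \<alpha> m c y) k) vs)"
    by (intro smooth_on_sum smooth_on_mult o n w)
  have s2: "smooth_on (coord_set c U) (\<lambda>y. \<Sum>l\<in>UNIV. \<Sum>k\<in>UNIV. L' (Nmat J \<alpha> c y) i l k * (cnj_form (\<kappa> j l c y) \<and>\<^sub>e dual5 (\<lambda>m. \<alpha> m c y) k) vs)"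
    by (intro smooth_on_sum smooth_on_mult o n w')
  note s3 = smooth_on_add[OF o smooth_on_diff[OF o d s1] s2]
  have "smooth_on (coord_set c U) (\<lambda>y. el_expr L' J \<alpha> \<kappa> c i j y vs)"
    unfolding el_expr_def using s3 .
  then show ?thesis .
qed

end

section \<open>The first variation\<close>

lemma has_vector_derivative_linear_family:
  fixes F :: "real \<Rightarrow> 'b::euclidean_space \<Rightarrow> 'c::real_normed_vector"
  assumes "open S" "t \<in> S" "\<And>s. s \<in> S \<Longrightarrow> linear (F s)"
    and F: "\<And>v. ((\<lambda>s. F s v) has_vector_derivative F' v) (at t)" and g: "(g has_vector_derivative g') (at t)"
  shows "((\<lambda>s. F s (g s)) has_vector_derivative F' (g t) + F t g') (at t)"
proof -
  have dF: "(\<lambda>s. F s v) differentiable (at t)" and fF: "frechet_derivative (\<lambda>s. F s v) (at t) = (\<lambda>h. h *\<^sub>R F' v)" for v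
    using F[of v] frechet_derivative_at[of "\<lambda>s. F s v" "\<lambda>h. h *\<^sub>R F' v" t]
    by (auto simp: has_vector_derivative_def intro: differentiableI)
  have dg: "g differentiable (at t)" and fg: "frechet_derivative g (at t) = (\<lambda>h. h *\<^sub>R g')"
    using g frechet_derivative_at[of g "\<lambda>h. h *\<^sub>R g'" t]
    by (auto simp: has_vector_derivative_def intro: differentiableI)
  have "((\<lambda>s. F s (g s)) has_derivative (\<lambda>w. w *\<^sub>R F' (g t) + F t (w *\<^sub>R g'))) (at t)"
    using linear_family_has_derivative[OF assms(1-3) dF dg] unfolding fF fg .
  moreover have "(\<lambda>w. w *\<^sub>R F' (g t) + F t (w *\<^sub>R g')) = (\<lambda>w. w *\<^sub>R (F' (g t) + F t g'))"
    by (rule ext) (simp add: linear_cmul[OF assms(3)[OF assms(2)]] scaleR_add_right)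
  ultimately show ?thesis by (simp add: has_vector_derivative_def)
qed

lemma has_vector_derivative_wedge:
  assumes "\<And>ws. ((\<lambda>t. \<omega> t ws) has_vector_derivative \<omega>' ws) (at s)" "\<And>ws. ((\<lambda>t. \<eta> t ws) has_vector_derivative \<eta>' ws) (at s)"
  shows "((\<lambda>t. (\<omega> t \<and>\<^sub>e \<eta> t) vs) has_vector_derivative (\<omega>' \<and>\<^sub>e \<eta> s) vs + (\<omega> s \<and>\<^sub>e \<eta>') vs) (at s)"
proof -
  let ?e = "\<lambda>I. (-1) ^ card {(i, j). i \<in> I \<and> j \<in> {..<length vs} - I \<and> j < i} :: complex"
  have "((\<lambda>t. (\<omega> t \<and>\<^sub>e \<eta> t) vs) has_vector_derivative
     (\<Sum>I\<in>Pow {..<length vs}. ?e I * (\<omega> s (nths vs I) * \<eta>' (nths vs (- I)) + \<omega>' (nths vs I) * \<eta> s (nths vs (- I))))) (at s)"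
    unfolding wedge_def mult.assoc
    by (intro has_vector_derivative_sum has_vector_derivative_mult_right has_vector_derivative_mult assms)
  moreover have "(\<Sum>I\<in>Pow {..<length vs}. ?e I * (\<omega> s (nths vs I) * \<eta>' (nths vs (- I)) + \<omega>' (nths vs I) * \<eta> s (nths vs (- I))))
     = (\<omega>' \<and>\<^sub>e \<eta> s) vs + (\<omega> s \<and>\<^sub>e \<eta>') vs"
    unfolding wedge_def by (simp add: sum.distrib[symmetric] algebra_simps)
  ultimately show ?thesis by simp
qed

lemma has_vector_derivative_cnj': "(f has_vector_derivative f') F \<Longrightarrow> ((\<lambda>t. cnj (f t)) has_vector_derivative cnj f') F"
  by (rule bounded_linear.has_vector_derivative[OF bounded_linear_cnj])

lemma mat_comp_has_vector_derivative:
  assumes "\<And>i m. ((\<lambda>t. N t $ i $ m) has_vector_derivative D $ i $ m) F"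
  shows "((\<lambda>t. mat_comp (N t) i k l) has_vector_derivative mat_comp D i k l) F"
proof -
  have "\<forall>k l. ((\<lambda>t. mat_comp (N t) i k l) has_vector_derivative mat_comp D i k l) F"
    by (simp add: forall_3 mat_comp_def assms has_vector_derivative_minus)
  then show ?thesis by blast
qed

context coframe
begin

lemma project10_id: "project10 j (\<theta> i) = \<theta> i"
proof
  fix vs show "project10 j (\<theta> i) vs = \<theta> i vs"
  proof (cases "length vs = 1")
    case True
    then obtain v where "vs = [v]" by (auto simp: length_Suc_conv)
    then show ?thesis by (simp add: project10_def \<theta>_j)
  next
    case False
    then show ?thesis using degree_\<theta>[of i] by (simp add: project10_def degree_form_def)
  qed
qed

text \<open>The wedge product of a (0,1)-form and the conjugate volume form vanishes.\<close>

lemma Omega_derivative_0: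
  assumes d: "\<And>i ws. ((\<lambda>t. \<theta>t t i ws) has_vector_derivative (\<Sum>k\<in>UNIV. \<phi> i k * cnj_form (\<theta> k) ws)) (at s)"
    and s: "\<theta>t s = \<theta>"
  shows "((\<lambda>t. Omega (\<theta>t t) vs) has_vector_derivative 0) (at s)"
proof -
  define \<beta> where "\<beta> i = (\<lambda>ws. \<Sum>k\<in>UNIV. \<phi> i k * cnj_form (\<theta> k) ws)" for i
  have d\<beta>: "degree_form 1 (\<beta> i)" for i
    using degree_cnj[OF degree_\<theta>] by (simp add: \<beta>_def degree_form_def)
  define V where "V = vol3 \<theta>"
  define V' where "V' ws = (\<beta> 1 \<and>\<^sub>e \<theta> 2 \<and>\<^sub>e \<theta> 3) ws + ((\<theta> 1 \<and>\<^sub>e \<beta> 2 \<and>\<^sub>e \<theta> 3) ws + (\<theta> 1 \<and>\<^sub>e \<theta> 2 \<and>\<^sub>e \<beta> 3) ws)" for ws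
  have "cnj_form V = vol3 (\<lambda>i. cnj_form (\<theta> i))" by (simp add: V_def vol3_def cnj_form_wedge)
  then have "(cnj_form (\<theta> k) \<and>\<^sub>e cnj_form V) = (\<lambda>_. 0)" for k
    using vol3_swap[of "\<lambda>i. cnj_form (\<theta> i)" k] degree_cnj[OF degree_\<theta>] by simp
  then have \<beta>V: "(\<beta> i \<and>\<^sub>e cnj_form V) = (\<lambda>_. 0)" for i
    unfolding \<beta>_def by (intro ext) (simp add: wedge_sum_left wedge_scale_left)
  have z: "(\<beta> i \<and>\<^sub>e \<theta> k \<and>\<^sub>e cnj_form V) = (\<lambda>_. 0)" for i k
    using wedge_swap_1[OF d\<beta> degree_\<theta>, of i k "cnj_form V"] by (simp add: \<beta>V wedge_zero_right) (simp add: neg_def)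
  then have z2: "(\<beta> i \<and>\<^sub>e \<theta> k \<and>\<^sub>e \<theta> l \<and>\<^sub>e cnj_form V) = (\<lambda>_. 0)" for i k l
    using wedge_swap_1[OF d\<beta> degree_\<theta>, of i k "\<theta> l \<and>\<^sub>e cnj_form V"] by (simp add: wedge_zero_right) (simp add: neg_def)
  have V'V: "(V' \<and>\<^sub>e cnj_form V) ws = 0" for ws
    unfolding V'_def wedge_add_left wedge_assoc z z2 \<beta>V by (simp add: wedge_zero_right)
  have dV': "degree_form 3 V'"
  proof -
    have "degree_form (1 + (1 + 1)) (a \<and>\<^sub>e b \<and>\<^sub>e c)" if "degree_form 1 a" "degree_form 1 b" "degree_form 1 c" for a b c
      using that by (intro degree_wedge)
    then have "degree_form 3 (a \<and>\<^sub>e b \<and>\<^sub>e c)" if "degree_form 1 a" "degree_form 1 b" "degree_form 1 c" for a b c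
      using that by (simp add: numeral_3_eq_3)
    from this[OF d\<beta> degree_\<theta> degree_\<theta>] this[OF degree_\<theta> d\<beta> degree_\<theta>] this[OF degree_\<theta> degree_\<theta> d\<beta>]
    show ?thesis unfolding degree_form_def V'_def by simp
  qed
  have VV': "(V \<and>\<^sub>e cnj_form V') ws = 0" for ws
  proof -
    have "(cnj_form V \<and>\<^sub>e V') ws = 0"
      using wedge_commute_degree[OF dV' degree_cnj[OF degree_vol3[of \<theta>, OF degree_\<theta>]], of ws] V'V by (simp add: V_def)
    then have "cnj_form (cnj_form V \<and>\<^sub>e V') ws = 0" by (simp add: cnj_form_def)
    then show ?thesis by (simp add: cnj_form_wedge)
  qed
  have dV: "((\<lambda>t. vol3 (\<theta>t t) ws) has_vector_derivative V' ws) (at s)" for ws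
  proof -
    have d': "((\<lambda>t. \<theta>t t i ws) has_vector_derivative \<beta> i ws) (at s)" for i ws using d by (simp add: \<beta>_def)
    have "((\<lambda>t. (\<theta>t t 2 \<and>\<^sub>e \<theta>t t 3) ws) has_vector_derivative (\<beta> 2 \<and>\<^sub>e \<theta> 3) ws + (\<theta> 2 \<and>\<^sub>e \<beta> 3) ws) (at s)" for ws
      using has_vector_derivative_wedge[where \<omega> = "\<lambda>t. \<theta>t t 2" and \<eta> = "\<lambda>t. \<theta>t t 3" and \<omega>' = "\<beta> 2" and \<eta>' = "\<beta> 3" and vs = ws, OF d' d']
      by (simp add: s)
    from has_vector_derivative_wedge[where \<omega> = "\<lambda>t. \<theta>t t 1" and \<eta> = "\<lambda>t. \<theta>t t 2 \<and>\<^sub>e \<theta>t t 3" and \<omega>' = "\<beta> 1" and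
      \<eta>' = "\<lambda>ws. (\<beta> 2 \<and>\<^sub>e \<theta> 3) ws + (\<theta> 2 \<and>\<^sub>e \<beta> 3) ws" and vs = ws, OF d' this]
    show ?thesis by (simp add: vol3_def s V'_def wedge_add_right)
  qed
  have "((\<lambda>t. cnj_form (vol3 (\<theta>t t)) ws) has_vector_derivative cnj_form V' ws) (at s)" for ws
    unfolding cnj_form_def by (rule has_vector_derivative_cnj'[OF dV])
  from has_vector_derivative_wedge[where \<omega> = "\<lambda>t. vol3 (\<theta>t t)" and \<eta> = "\<lambda>t. cnj_form (vol3 (\<theta>t t))" and \<omega>' = V' and \<eta>' = "cnj_form V'" and vs = vs, OF dV this]
  have "((\<lambda>t. (vol3 (\<theta>t t) \<and>\<^sub>e cnj_form (vol3 (\<theta>t t))) vs) has_vector_derivative 0) (at s)"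
    using V'V[of vs] VV'[of vs] by (simp add: s V_def)
  from has_vector_derivative_mult_right[OF this, of "\<i> / 8"] show ?thesis by (simp add: Omega_def)
qed

text \<open>For an infinitesimal change \<open>K\<close> of the complex structure, \<open>Q\<close> is the resulting change of the
  (0,2)-part of a fixed bilinear form.\<close>

definition dv :: "(real^6 \<Rightarrow> real^6) \<Rightarrow> (real^6 \<Rightarrow> complex) \<Rightarrow> 3 \<Rightarrow> complex" where
  "dv K g k = \<i> * g (K (f k)) / 2"

definition Q :: "(real^6 \<Rightarrow> real^6) \<Rightarrow> (real^6 \<Rightarrow> real^6 \<Rightarrow> complex) \<Rightarrow> 3 \<Rightarrow> 3 \<Rightarrow> complex" where
  "Q K b k l = (\<i> * b (K (f k)) (f l) + \<i> * b (f k) (K (f l)) - b (K (f k)) (j (f l)) - b (j (f k)) (K (f l))) / 4"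

lemma P02_product: "P02 j (\<lambda>u v. g u * h v) (f k) (f l) = evc g k * evc h l"
  by (simp add: P02_def evc_def field_simps)

lemma Q_product: "Q K (\<lambda>u v. g u * h v) k l = dv K g k * evc h l + evc g k * dv K h l"
  by (simp add: Q_def evc_def dv_def field_simps)

lemma P02_lin: "P02 j (\<lambda>u v. b u v + b' u v) u v = P02 j b u v + P02 j b' u v"
  "P02 j (\<lambda>u v. b u v - b' u v) u v = P02 j b u v - P02 j b' u v"
  "P02 j (\<lambda>u v. - b u v) u v = - P02 j b u v"
  by (simp_all add: P02_def field_simps)

lemma Q_lin: "Q K (\<lambda>u v. b u v + b' u v) k l = Q K b k l + Q K b' k l"
  "Q K (\<lambda>u v. b u v - b' u v) k l = Q K b k l - Q K b' k l"
  "Q K (\<lambda>u v. - b u v) k l = - Q K b k l"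
  "Q K (\<lambda>u v. z * b u v) k l = z * Q K b k l"
  by (simp_all add: Q_def field_simps)

lemma Q_sum: "Q K (\<lambda>u v. \<Sum>r\<in>S. B r u v) k l = (\<Sum>r\<in>S. Q K (B r) k l)"
  by (simp add: Q_def sum_distrib_left sum.distrib sum_subtractf flip: sum_divide_distrib)

lemma evc_\<theta>: "evc (\<lambda>v. \<theta> i [v]) k = 0" "evc (\<lambda>v. cnj (\<theta> i [v])) k = (if i = k then 1 else 0)"
  by (simp_all add: evc_def \<theta>_j \<theta>_f)

end

locale first_variation = variation A J e Jt
  for A :: "'a::{t2_space,second_countable_topology} chart set" and J e Jt +
  fixes U :: "'a set" and \<alpha> :: "3 \<Rightarrow> 'a form_field" and \<kappa> :: "3 \<Rightarrow> 3 \<Rightarrow> 'a form_field" and c :: "'a chart"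
    and c1 c2 :: real and L' :: "complex^3^3 \<Rightarrow> 3 \<Rightarrow> 3 \<Rightarrow> 3 \<Rightarrow> complex"
  assumes coframing: "coframing A J U \<alpha>" and connection: "connection02 A J U \<alpha> \<kappa>" and c: "c \<in> A"
    and L: "L_partials c1 c2 L'"
begin

abbreviation "W \<equiv> coord_set c U"

lemma ac_J: "almost_complex A J"
  using almost_complex_Jt[OF zero_in] by (simp add: Jt_0)

lemma W_UNIV: "x \<in> W \<Longrightarrow> x \<in> coord_set c UNIV"
  by (rule coord_set_UNIV)

lemma open_W: "open W"
  by (rule open_coord_set[OF c coframingD(1)[OF coframing]])

lemma cf: "x \<in> W \<Longrightarrow> coframe (J c x) (\<lambda>i. \<alpha> i c x)"
  by (rule coframing_coframe[OF ac_J coframing c])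

definition Jdot :: "real^6 \<Rightarrow> real^6 \<Rightarrow> real^6" where
  "Jdot x v = vector_derivative (\<lambda>t. Jt t c x v) (at 0)"

lemma Jdot:
  assumes "x \<in> coord_set c UNIV"
  shows "((\<lambda>t. Jt t c x v) has_vector_derivative Jdot x v) (at 0)"
    "Jdot x v = frechet_derivative (\<lambda>p. Jt (fst p) c (snd p) v) (at (0, x)) (1, 0)"
proof -
  have "((\<lambda>(t, x). Jt t c x v) has_derivative frechet_derivative (\<lambda>(t, x). Jt t c x v) (at (0, x))) (at (0, x))"
    by (rule smooth_on_has_derivative[OF smooth_Jt[OF c]]) (use assms zero_in in auto)
  from derivative_in_time[OF this]
  show "((\<lambda>t. Jt t c x v) has_vector_derivative Jdot x v) (at 0)"
    "Jdot x v = frechet_derivative (\<lambda>p. Jt (fst p) c (snd p) v) (at (0, x)) (1, 0)"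
    unfolding Jdot_def by (auto simp: vector_derivative_at case_prod_unfold)
qed

lemma smooth_at_time_0:
  fixes V :: "'v::euclidean_space set" and g :: "real \<times> 'v \<Rightarrow> 'w::euclidean_space"
  assumes "open V" "smooth_on (I \<times> V) g"
  shows "smooth_on V (\<lambda>x. g (0, x))"
proof -
  have bl: "bounded_linear (\<lambda>x :: 'v. (0 :: real, x))" by (intro bounded_linear_Pair bounded_linear_zero bounded_linear_ident)
  show ?thesis
    by (rule smooth_on_compose[where f = "\<lambda>x. (0, x)", OF assms(1) _ smooth_on_linear[OF bl assms(1)] assms(2)])
      (use assms(1) zero_in in \<open>auto intro: open_Times\<close>)
qed

lemma smooth_Jdot: "smooth_on (coord_set c UNIV) (\<lambda>x. Jdot x v)"
proof -
  have o: "open (coord_set c UNIV)" by (rule open_coord_set[OF c open_UNIV])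
  show ?thesis
    by (rule smooth_on_cong[OF o _ smooth_at_time_0[OF o smooth_on_frechet[OF smooth_Jt'[OF c]]]])
      (simp add: Jdot(2))
qed

lemma linear_Jdot:
  assumes x: "x \<in> coord_set c UNIV"
  shows "linear (Jdot x)"
proof (rule linearI)
  fix u v
  have "((\<lambda>t. Jt t c x (u + v)) has_vector_derivative Jdot x u + Jdot x v) (at 0)"
    by (rule has_vector_derivative_transform_within_open[OF has_vector_derivative_add[OF Jdot(1)[OF x] Jdot(1)[OF x]], of I])
      (use zero_in linear_add[OF linear_Jt[OF _ c x]] in auto)
  then show "Jdot x (u + v) = Jdot x u + Jdot x v"
    by (rule vector_derivative_unique_at[OF Jdot(1)[OF x]])
next
  fix r v
  have "((\<lambda>t. Jt t c x (r *\<^sub>R v)) has_vector_derivative r *\<^sub>R Jdot x v) (at 0)"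
    by (rule has_vector_derivative_transform_within_open[OF bounded_linear.has_vector_derivative[OF bounded_linear_scaleR_right Jdot(1)[OF x]], of I])
      (use zero_in linear_cmul[OF linear_Jt[OF _ c x]] in auto)
  then show "Jdot x (r *\<^sub>R v) = r *\<^sub>R Jdot x v"
    by (rule vector_derivative_unique_at[OF Jdot(1)[OF x]])
qed

lemma Jdot_J:
  assumes x: "x \<in> coord_set c UNIV"
  shows "Jdot x (J c x v) = - J c x (Jdot x v)"
proof -
  have "((\<lambda>t. Jt t c x (Jt t c x v)) has_vector_derivative Jdot x (Jt 0 c x v) + Jt 0 c x (Jdot x v)) (at 0)"
    by (rule has_vector_derivative_linear_family[of I]) (use zero_in linear_Jt[OF _ c x] Jdot(1)[OF x] in auto)
  moreover have "((\<lambda>t. Jt t c x (Jt t c x v)) has_vector_derivative 0) (at 0)"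
    by (rule has_vector_derivative_transform_within_open[OF has_vector_derivative_const[of "- v"], of I])
      (use zero_in almost_complexD(2)[OF almost_complex_Jt c x] in auto)
  ultimately have "Jdot x (Jt 0 c x v) + Jt 0 c x (Jdot x v) = 0"
    by (rule vector_derivative_unique_at)
  then show ?thesis by (simp add: Jt_0 eq_neg_iff_add_eq_0)
qed

definition frame :: "real^6 \<Rightarrow> 3 \<Rightarrow> real^6" where
  "frame x = coframe.f (\<lambda>i. \<alpha> i c x)"

definition phi :: "3 \<Rightarrow> 3 \<Rightarrow> real^6 \<Rightarrow> complex" where
  "phi i k x = - \<i> / 2 * \<alpha> i c x [Jdot x (frame x k)]"

lemma phi_expand:
  assumes x: "x \<in> W"
  shows "- \<i> / 2 * \<alpha> i c x [Jdot x v] = (\<Sum>k\<in>UNIV. phi i k x * cnj (\<alpha> k c x [v]))"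
proof -
  interpret t: coframe "J c x" "\<lambda>i. \<alpha> i c x" by (rule cf[OF x])
  note xU = W_UNIV[OF x]
  have lin: "linear (\<lambda>v. - \<i> / 2 * \<alpha> i c x [Jdot x v])"
    using linear_compose[OF linear_Jdot[OF xU] t.linear_\<theta>, of i] by (intro linear_complex_scale) (simp add: o_def)
  have "- \<i> / 2 * \<alpha> i c x [Jdot x v] = (\<Sum>k\<in>UNIV. cnj (\<alpha> k c x [v]) * (- \<i> / 2 * \<alpha> i c x [Jdot x (t.f k)]))"
    by (rule t.expand_01[OF lin]) (simp add: Jdot_J[OF xU] linear_neg[OF t.linear_\<theta>] t.\<theta>_j)
  then show ?thesis by (simp add: phi_def frame_def mult.commute)
qed

lemma smooth_phi: "smooth_on W (phi i k)"
proof (rule smooth_on_local)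
  fix x0 assume x0: "x0 \<in> W"
  obtain u :: "3 \<Rightarrow> real^6" and T where T: "open T" "x0 \<in> T" "T \<subseteq> W"
    and nz: "\<And>x. x \<in> T \<Longrightarrow> det (\<chi> k m. cnj (\<alpha> k c x [u m]) :: complex^3^3) \<noteq> 0"
    by (rule coframe_nonvanishing[OF ac_J coframing c x0]) blast
  define H where "H x = (\<chi> m k. cnj (\<alpha> k c x [u m]) :: complex^3^3)" for x
  define B where "B x = (\<chi> m. - \<i> / 2 * \<alpha> i c x [Jdot x (u m)] :: complex^3)" for x
  define D where "D x = (\<chi> r s. if s = k then B x $ r else H x $ r $ s :: complex^3^3)" for x
  have s\<alpha>: "smooth_on T (\<lambda>x. \<alpha> i c x ws)" for i ws by (rule smooth_on_subset[OF smooth_coframing[OF coframing c] T(3)])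
  have sH: "smooth_on T (\<lambda>x. H x $ r $ s)" for r s unfolding H_def by (simp, intro smooth_on_cnj T s\<alpha>)
  have TU: "T \<subseteq> coord_set c UNIV" using T(3) W_UNIV by blast
  have sB: "smooth_on T (\<lambda>x. B x $ r)" for r
  proof -
    have "smooth_on T (\<lambda>x. \<alpha> i c x [Jdot x (u r)])"
      by (rule smooth_on_linear_family[OF T(1) s\<alpha> smooth_on_subset[OF smooth_Jdot TU]])
        (use linear_coframing[OF coframing c] T(3) in blast)
    then show ?thesis unfolding B_def vec_lambda_beta by (intro smooth_on_mult smooth_on_const T(1))
  qed
  have sD: "smooth_on T (\<lambda>x. D x $ r $ s)" for r s
    using sB sH by (cases "s = k") (simp_all add: D_def)
  have eq: "det (D x) / det (H x) = phi i k x" if x: "x \<in> T" for x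
  proof -
    have HB: "H x *v (\<chi> k. phi i k x) = B x"
      using phi_expand[of x i] x T(3) by (auto simp: vec_eq_iff H_def B_def matrix_vector_mult_def mult.commute)
    have "det (D x) = phi i k x * det (H x)"
      using cramer_lemma[where k = k and A = "H x" and x = "\<chi> k. phi i k x", unfolded HB] by (simp add: D_def)
    moreover have "H x = transpose (\<chi> k m. cnj (\<alpha> k c x [u m]))" by (simp add: H_def transpose_def)
    then have "det (H x) \<noteq> 0" using nz[OF x] by simp
    ultimately show ?thesis by simp
  qed
  have nz': "det (H x) \<noteq> 0" if "x \<in> T" for x
  proof -
    have "H x = transpose (\<chi> k m. cnj (\<alpha> k c x [u m]))" by (simp add: H_def transpose_def)
    then show ?thesis using nz[OF that] by simp
  qed
  have "smooth_on T (\<lambda>x. det (D x) / det (H x))"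
    by (intro smooth_on_divide smooth_on_det3 T(1) sD sH nz')
  then have "smooth_on T (phi i k)" by (rule smooth_on_cong[OF T(1), rotated]) (rule eq)
  then show "\<exists>T. open T \<and> x0 \<in> T \<and> smooth_on T (phi i k)" using T by blast
qed

definition proj :: "real \<Rightarrow> 3 \<Rightarrow> real^6 \<Rightarrow> cform" where
  "proj t i y = project10 (Jt t c y) (\<alpha> i c y)"

lemma proj_type10: "t \<in> I \<Longrightarrow> y \<in> W \<Longrightarrow> type10 (Jt t c y) (proj t i y)"
  unfolding proj_def
  by (intro type10_project10 linear_Jt[OF _ c W_UNIV] almost_complexD(2)[OF almost_complex_Jt c W_UNIV] linear_coframing[OF coframing c])

lemma smooth_proj: "smooth_on (I \<times> W) (\<lambda>p. proj (fst p) i (snd p) [v])"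
proof -
  have o: "open (I \<times> W)" using open_W by (intro open_Times) auto
  have sub: "I \<times> W \<subseteq> I \<times> coord_set c UNIV" using W_UNIV by auto
  have s\<alpha>: "smooth_on (I \<times> W) (\<lambda>p. \<alpha> i c (snd p) ws)" for ws
    by (rule smooth_on_compose[OF o open_W smooth_on_linear[OF bounded_linear_snd o] smooth_coframing[OF coframing c]]) auto
  have "smooth_on (I \<times> W) (\<lambda>p. \<alpha> i c (snd p) [Jt (fst p) c (snd p) v])"
    by (rule smooth_on_linear_family[OF o s\<alpha> smooth_on_subset[OF smooth_Jt'[OF c] sub]])
      (use linear_coframing[OF coframing c] in auto)
  then show ?thesis
    unfolding proj_def project10_def
    by (simp, intro smooth_on_divide smooth_on_diff smooth_on_mult smooth_on_const o s\<alpha>) auto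
qed

lemma proj_time_derivative:
  assumes y: "y \<in> W"
  shows "((\<lambda>t. proj t i y [v]) has_vector_derivative - \<i> / 2 * \<alpha> i c y [Jdot y v]) (at 0)"
proof -
  have "((\<lambda>t. \<alpha> i c y [Jt t c y v]) has_vector_derivative \<alpha> i c y [Jdot y v]) (at 0)"
    using bounded_linear.has_vector_derivative[OF _ Jdot(1)[OF W_UNIV[OF y]], of "\<lambda>v. \<alpha> i c y [v]"]
      linear_coframing[OF coframing c y] by (simp add: linear_conv_bounded_linear)
  from has_vector_derivative_mult_right[OF has_vector_derivative_diff[OF has_vector_derivative_const
      has_vector_derivative_mult_right[OF this, of \<i>]], of "1 / 2" "\<alpha> i c y [v]"]
  show ?thesis by (simp add: proj_def project10_def)
qed

text \<open>The derivatives in time and in space are interchanged here.\<close>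

lemma ext_d_proj_derivative:
  assumes x: "x \<in> W"
  shows "((\<lambda>t. ext_d (proj t i) x [u, v]) has_vector_derivative
    (\<Sum>k\<in>UNIV. frechet_derivative (phi i k) (at x) u * cnj (\<alpha> k c x [v]) - frechet_derivative (phi i k) (at x) v * cnj (\<alpha> k c x [u])
       + phi i k x * cnj (ext_d (\<alpha> k c) x [u, v]))) (at 0)"
proof -
  have o: "open (I \<times> W)" using open_W by (intro open_Times) auto
  define \<Psi> where "\<Psi> v p = proj (fst p) i (snd p) [v]" for v p
  have s\<Psi>: "smooth_on (I \<times> W) (\<Psi> v)" for v unfolding \<Psi>_def[abs_def] by (rule smooth_proj)
  define g where "g v y = - \<i> / 2 * \<alpha> i c y [Jdot y v]" for v y
  have time: "frechet_derivative (\<Psi> v) (at (0, y)) (1, 0) = g v y" if y: "y \<in> W" for v y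
  proof -
    have "((\<lambda>(t, y). \<Psi> v (t, y)) has_derivative frechet_derivative (\<Psi> v) (at (0, y))) (at (0, y))"
      using smooth_on_has_derivative[OF s\<Psi>, of "(0, y)"] y zero_in by simp
    from derivative_in_time[OF this]
    have "((\<lambda>t. proj t i y [v]) has_vector_derivative frechet_derivative (\<Psi> v) (at (0, y)) (1, 0)) (at 0)" by (simp add: \<Psi>_def)
    from vector_derivative_unique_at[OF this proj_time_derivative[OF y]] show ?thesis by (simp add: g_def)
  qed
  have space: "frechet_derivative (\<lambda>y. proj t i y [v]) (at x) u = frechet_derivative (\<Psi> v) (at (t, x)) (0, u)" if t: "t \<in> I" for t u v
  proof -
    have "((\<lambda>(t, y). \<Psi> v (t, y)) has_derivative frechet_derivative (\<Psi> v) (at (t, x))) (at (t, x))"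
      using smooth_on_has_derivative[OF s\<Psi>, of "(t, x)"] x t by simp
    from fun_cong[OF frechet_derivative_at[OF derivative_in_space[OF this]], of u] show ?thesis by (simp add: \<Psi>_def)
  qed
  have part: "((\<lambda>t. frechet_derivative (\<lambda>y. proj t i y [v]) (at x) u) has_vector_derivative frechet_derivative (g v) (at x) u) (at 0)" for u v
  proof -
    have sD: "smooth_on (I \<times> W) (\<lambda>p. frechet_derivative (\<Psi> v) (at p) (0, u))" by (rule smooth_on_frechet[OF s\<Psi>])
    have p0: "(0, x) \<in> I \<times> W" using x zero_in by simp
    have "((\<lambda>(t, y). frechet_derivative (\<Psi> v) (at (t, y)) (0, u)) has_derivative
        frechet_derivative (\<lambda>p. frechet_derivative (\<Psi> v) (at p) (0, u)) (at (0, x))) (at (0, x))"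
      using smooth_on_has_derivative[OF sD p0] by (simp add: case_prod_unfold)
    from derivative_in_time[OF this]
    have "((\<lambda>t. frechet_derivative (\<Psi> v) (at (t, x)) (0, u)) has_vector_derivative
        frechet_derivative (\<lambda>p. frechet_derivative (\<Psi> v) (at p) (0, u)) (at (0, x)) (1, 0)) (at 0)" .
    moreover have "frechet_derivative (\<lambda>p. frechet_derivative (\<Psi> v) (at p) (0, u)) (at (0, x)) (1, 0) =
        frechet_derivative (\<lambda>p. frechet_derivative (\<Psi> v) (at p) (1, 0)) (at (0, x)) (0, u)"
      by (rule second_derivative_symmetric[OF o p0 s\<Psi>])
    moreover have "frechet_derivative (\<lambda>p. frechet_derivative (\<Psi> v) (at p) (1, 0)) (at (0, x)) (0, u) = frechet_derivative (g v) (at x) u"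
    proof -
      have "((\<lambda>(t, y). frechet_derivative (\<Psi> v) (at (t, y)) (1, 0)) has_derivative
          frechet_derivative (\<lambda>p. frechet_derivative (\<Psi> v) (at p) (1, 0)) (at (0, x))) (at (0, x))"
        using smooth_on_has_derivative[OF smooth_on_frechet[OF s\<Psi>] p0, of v "(1, 0)"] by (simp add: case_prod_unfold)
      from derivative_in_space[OF this]
      have "(g v has_derivative (\<lambda>u. frechet_derivative (\<lambda>p. frechet_derivative (\<Psi> v) (at p) (1, 0)) (at (0, x)) (0, u))) (at x)"
        by (rule has_derivative_transform_within_open[OF _ open_W x]) (simp add: time)
      from fun_cong[OF frechet_derivative_at[OF this], of u] show ?thesis .
    qed
    ultimately have d: "((\<lambda>t. frechet_derivative (\<Psi> v) (at (t, x)) (0, u)) has_vector_derivative frechet_derivative (g v) (at x) u) (at 0)"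
      by simp
    show ?thesis
      by (rule has_vector_derivative_transform_within_open[OF d, of I]) (use zero_in space in auto)
  qed
  have dphi: "(phi i k has_derivative frechet_derivative (phi i k) (at x)) (at x)" for k
    by (rule smooth_on_has_derivative[OF smooth_phi x])
  have d\<alpha>: "((\<lambda>y. cnj (\<alpha> k c y [v])) has_derivative (\<lambda>u. cnj (frechet_derivative (\<lambda>y. \<alpha> k c y [v]) (at x) u))) (at x)" for k v
    by (rule bounded_linear.has_derivative[OF bounded_linear_cnj smooth_on_has_derivative[OF smooth_coframing[OF coframing c] x]])
  have gD: "frechet_derivative (g v) (at x) u = (\<Sum>k\<in>UNIV. phi i k x * cnj (frechet_derivative (\<lambda>y. \<alpha> k c y [v]) (at x) u)
      + frechet_derivative (phi i k) (at x) u * cnj (\<alpha> k c x [v]))" for u v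
  proof -
    have "((\<lambda>y. \<Sum>k\<in>UNIV. phi i k y * cnj (\<alpha> k c y [v])) has_derivative (\<lambda>u. \<Sum>k\<in>UNIV. phi i k x * cnj (frechet_derivative (\<lambda>y. \<alpha> k c y [v]) (at x) u)
      + frechet_derivative (phi i k) (at x) u * cnj (\<alpha> k c x [v]))) (at x)"
      by (intro has_derivative_sum has_derivative_mult dphi d\<alpha>)
    then have "(g v has_derivative (\<lambda>u. \<Sum>k\<in>UNIV. phi i k x * cnj (frechet_derivative (\<lambda>y. \<alpha> k c y [v]) (at x) u)
      + frechet_derivative (phi i k) (at x) u * cnj (\<alpha> k c x [v]))) (at x)"
      by (rule has_derivative_transform_within_open[OF _ open_W x]) (simp add: g_def phi_expand[symmetric] del: times_divide_eq_left)
    from fun_cong[OF frechet_derivative_at[OF this], of u] show ?thesis by simp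
  qed
  have "((\<lambda>t. ext_d (proj t i) x [u, v]) has_vector_derivative frechet_derivative (g v) (at x) u - frechet_derivative (g u) (at x) v) (at 0)"
    unfolding ext_d_pair by (intro has_vector_derivative_diff part)
  moreover have "frechet_derivative (g v) (at x) u - frechet_derivative (g u) (at x) v =
    (\<Sum>k\<in>UNIV. frechet_derivative (phi i k) (at x) u * cnj (\<alpha> k c x [v]) - frechet_derivative (phi i k) (at x) v * cnj (\<alpha> k c x [u])
       + phi i k x * cnj (ext_d (\<alpha> k c) x [u, v]))"
    unfolding gD ext_d_pair sum_subtractf[symmetric] by (intro sum.cong refl) (simp add: algebra_simps)
  ultimately show ?thesis by simp
qed

end

lemma P02_has_vector_derivative:
  fixes K :: "real \<Rightarrow> real^6 \<Rightarrow> real^6" and b :: "real \<Rightarrow> real^6 \<Rightarrow> real^6 \<Rightarrow> complex"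
  assumes S: "open S" "t \<in> S" and l: "\<And>s v. s \<in> S \<Longrightarrow> linear (\<lambda>u. b s u v)" "\<And>s u. s \<in> S \<Longrightarrow> linear (\<lambda>v. b s u v)"
    and b: "\<And>u v. ((\<lambda>s. b s u v) has_vector_derivative b' u v) (at t)"
    and K: "\<And>v. ((\<lambda>s. K s v) has_vector_derivative K' v) (at t)"
  shows "((\<lambda>s. P02 (K s) (b s) u v) has_vector_derivative P02 (K t) b' u v +
    (\<i> * b t (K' u) v + \<i> * b t u (K' v) - b t (K' u) (K t v) - b t (K t u) (K' v)) / 4) (at t)"
proof -
  have 1: "((\<lambda>s. b s (K s u) v) has_vector_derivative b' (K t u) v + b t (K' u) v) (at t)" for v
    by (rule has_vector_derivative_linear_family[where F = "\<lambda>s u. b s u v" and F' = "\<lambda>u. b' u v", OF S l(1) b K])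
  have 2: "((\<lambda>s. b s u (K s v)) has_vector_derivative b' u (K t v) + b t u (K' v)) (at t)"
    by (rule has_vector_derivative_linear_family[where F = "\<lambda>s v. b s u v" and F' = "\<lambda>v. b' u v", OF S l(2) b K])
  have 3: "((\<lambda>s. b s (K s u) (K s v)) has_vector_derivative (b' (K t u) (K t v) + b t (K' u) (K t v)) + b t (K t u) (K' v)) (at t)"
    by (rule has_vector_derivative_linear_family[where F = "\<lambda>s v. b s (K s u) v" and F' = "\<lambda>v. b' (K t u) v + b t (K' u) v", OF S l(2) 1 K])
  have D: "((\<lambda>s. (b s u v + \<i> * b s (K s u) v + \<i> * b s u (K s v) - b s (K s u) (K s v)) / 4) has_vector_derivative
     (b' u v + \<i> * (b' (K t u) v + b t (K' u) v) + \<i> * (b' u (K t v) + b t u (K' v)) - ((b' (K t u) (K t v) + b t (K' u) (K t v)) + b t (K t u) (K' v))) / 4) (at t)"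
    by (intro has_vector_derivative_divide has_vector_derivative_diff has_vector_derivative_add has_vector_derivative_mult_right b 1 2 3)
  show ?thesis unfolding P02_def by (rule has_vector_derivative_eq_rhs[OF D]) (simp add: field_simps)
qed

lemma alt_form_2_bilinear:
  assumes "alt_form 2 \<omega>"
  shows "linear (\<lambda>u. \<omega> [u, v])" "linear (\<lambda>v. \<omega> [u, v])"
proof -
  have "linear (\<lambda>u. \<omega> ([0, v][0 := u]))" "linear (\<lambda>v. \<omega> ([u, 0][1 := v]))"
    using assms unfolding alt_form_def by (metis length_Cons list.size(3) Suc_1 One_nat_def zero_less_Suc lessI)+
  then show "linear (\<lambda>u. \<omega> [u, v])" "linear (\<lambda>v. \<omega> [u, v])" by simp_all
qed

lemma alt_form_2_swap:
  assumes "alt_form 2 \<omega>"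
  shows "\<omega> [v, u] = - \<omega> [u, v]"
  using alternating_swap[of \<omega> "[]" v u "[]", OF alt_form_linear[OF assms]] alt_form_repeat[OF assms, of _ _ "[]"] by simp

lemma sum_sum_delta: "(\<Sum>k\<in>UNIV. \<Sum>l\<in>UNIV. if k = a then g k l else 0) = (\<Sum>l\<in>UNIV. g a l)"
  for g :: "'n::finite \<Rightarrow> 'm::finite \<Rightarrow> complex"
  by (subst sum.swap) simp

context first_variation
begin

definition covariant :: "3 \<Rightarrow> 3 \<Rightarrow> real^6 \<Rightarrow> real^6 \<Rightarrow> complex" where
  "covariant i j x v = frechet_derivative (phi i j) (at x) v + (\<Sum>m\<in>UNIV. phi m j x * \<kappa> i m c x [v])
    - (\<Sum>l\<in>UNIV. phi i l x * cnj (\<kappa> l j c x [v]))"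

lemma proj_0: "x \<in> W \<Longrightarrow> proj 0 i x = \<alpha> i c x"
  unfolding proj_def Jt_0 by (rule coframe.project10_id[OF cf])

lemma proj_derivative_f:
  assumes x: "x \<in> W"
  shows "((\<lambda>t. proj t i x [frame x k]) has_vector_derivative phi i k x) (at 0)"
  using proj_time_derivative[OF x, of i "frame x k"] by (simp add: phi_def)

lemma alt_\<kappa>: "x \<in> W \<Longrightarrow> alt_form 1 (\<kappa> i j c x)"
  by (rule form_onD(1)[OF connection02D(1)[OF connection] c])

lemma smooth_proj_space: "t \<in> I \<Longrightarrow> smooth_on W (\<lambda>y. proj t i y [v])"
proof -
  assume t: "t \<in> I"
  have "smooth_on W (\<lambda>y. (t, y))"
  proof -
    have "smooth_on W (\<lambda>y. (t, 0) + (0, y))"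
      by (intro smooth_on_add smooth_on_const smooth_on_linear bounded_linear_Pair bounded_linear_zero bounded_linear_ident open_W)
    then show ?thesis by simp
  qed
  moreover have "open (I \<times> W)" using open_W by (intro open_Times) auto
  moreover have "(\<lambda>y. (t, y)) ` W \<subseteq> I \<times> W" using t by auto
  ultimately have "smooth_on W (\<lambda>y. proj (fst (t, y)) i (snd (t, y)) [v])"
    using smooth_on_compose[where g = "\<lambda>p. proj (fst p) i (snd p) [v]", OF open_W _ _ smooth_proj] by blast
  then show ?thesis by simp
qed

lemma P02_proj:
  assumes t: "t \<in> I" and x: "x \<in> W"
  shows "P02 (Jt t c x) (\<lambda>u v. ext_d (proj t i) x [u, v]) u v = - proj t i x [nij (Jt t c) x u v] / 4"
  by (rule P02_ext_d[OF open_W x])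
    (use t x linear_Jt[OF t c] W_UNIV proj_type10[OF t] smooth_on_differentiable[OF smooth_proj_space[OF t]]
      smooth_on_differentiable[OF almost_complexD(3)[OF almost_complex_Jt[OF t] c]] in auto)

lemma ext_d_\<alpha>:
  assumes x: "x \<in> W"
  shows "ext_d (\<alpha> i c) x [u, v] = (\<Sum>m\<in>UNIV. \<alpha> m c x [u] * \<kappa> i m c x [v] - \<kappa> i m c x [u] * \<alpha> m c x [v]) +
    (\<Sum>k\<in>UNIV. \<Sum>l\<in>UNIV. mat_comp (Nmat J \<alpha> c x) i k l * (cnj (\<alpha> k c x [u]) * cnj (\<alpha> l c x [v])))"
proof -
  interpret t: coframe "J c x" "\<lambda>i. \<alpha> i c x" by (rule cf[OF x])
  show ?thesis
    unfolding connection02D(2)[OF connection c x] sum_cnj2[OF t.degree_\<theta>]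
      wedge_1_1[OF alt_form_degree[OF alt_\<kappa>[OF x]]]
    by (simp add: sum_negf[symmetric] mult.commute mult.left_commute)
qed

lemma alt_ext_d_proj:
  assumes t: "t \<in> I" and x: "x \<in> W"
  shows "alt_form 2 (ext_d (proj t i) x)"
  by (rule ext_d_alt_2[OF open_W x])
    (use proj_type10[OF t] smooth_on_differentiable[OF smooth_proj_space[OF t] x] in \<open>auto simp: type10_def\<close>)

lemma torsion_derivative:
  assumes x: "x \<in> W"
    and S: "open S" "0 \<in> S" "S \<subseteq> I"
    and cf': "\<And>t. t \<in> S \<Longrightarrow> coframe (Jt t c x) (\<lambda>i. proj t i x)"
    and N: "\<And>t. t \<in> S \<Longrightarrow> torsion_matrix (\<lambda>i. proj t i x) (nij (Jt t c) x) (N t)"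
    and D: "\<And>i m. ((\<lambda>t. N t $ i $ m) has_vector_derivative D $ i $ m) (at 0)"
  shows "N 0 = Nmat J \<alpha> c x"
    "mat_comp D i a b = coframe.evc (J c x) (\<lambda>i. \<alpha> i c x) (covariant i b x) a - coframe.evc (J c x) (\<lambda>i. \<alpha> i c x) (covariant i a x) b"
proof -
  interpret t: coframe "J c x" "\<lambda>i. \<alpha> i c x" by (rule cf[OF x])
  show N0: "N 0 = Nmat J \<alpha> c x"
    using N[OF S(2)] proj_0[OF x] Nmat_torsion[OF ac_J coframing c x] by (intro t.torsion_matrix_unique) (auto simp: Jt_0)
  define P where "P = mat_comp (Nmat J \<alpha> c x)"
  define h where "h = t.f"
  have h: "frame x k = h k" for k by (simp add: frame_def h_def)
  have \<theta>h: "\<alpha> k c x [h m] = (if k = m then 1 else 0)" for k m unfolding h_def by (rule t.\<theta>_f)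
  define \<beta> where "\<beta> s u v = ext_d (proj s i) x [u, v]" for s u v
  define \<beta>' where "\<beta>' u v = (\<Sum>k\<in>UNIV. frechet_derivative (phi i k) (at x) u * cnj (\<alpha> k c x [v]) - frechet_derivative (phi i k) (at x) v * cnj (\<alpha> k c x [u])
       + phi i k x * cnj (ext_d (\<alpha> k c) x [u, v]))" for u v
  have left: "((\<lambda>s. \<Sum>k\<in>UNIV. \<Sum>l\<in>UNIV. mat_comp (N s) i k l * (cnj (proj s k x [h a]) * cnj (proj s l x [h b]))) has_vector_derivative
     (\<Sum>k\<in>UNIV. \<Sum>l\<in>UNIV. P i k l * (cnj (\<alpha> k c x [h a]) * cnj (phi l b x) + cnj (phi k a x) * cnj (\<alpha> l c x [h b])) +
        mat_comp D i k l * (cnj (\<alpha> k c x [h a]) * cnj (\<alpha> l c x [h b])))) (at 0)"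
  proof -
    have p: "((\<lambda>s. cnj (proj s k x [h m])) has_vector_derivative cnj (phi k m x)) (at 0)" for k m
      using has_vector_derivative_cnj'[OF proj_derivative_f[OF x, of k m]] by (simp add: h)
    have "((\<lambda>s. mat_comp (N s) i k l * (cnj (proj s k x [h a]) * cnj (proj s l x [h b]))) has_vector_derivative
        mat_comp (N 0) i k l * (cnj (proj 0 k x [h a]) * cnj (phi l b x) + cnj (phi k a x) * cnj (proj 0 l x [h b])) +
        mat_comp D i k l * (cnj (proj 0 k x [h a]) * cnj (proj 0 l x [h b]))) (at 0)" for k l
      by (intro has_vector_derivative_mult mat_comp_has_vector_derivative D p)
    then show ?thesis unfolding N0 proj_0[OF x] P_def[symmetric] by (intro has_vector_derivative_sum)
  qed
  have left_val: "(\<Sum>k\<in>UNIV. \<Sum>l\<in>UNIV. P i k l * (cnj (\<alpha> k c x [h a]) * cnj (phi l b x) + cnj (phi k a x) * cnj (\<alpha> l c x [h b])) +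
        mat_comp D i k l * (cnj (\<alpha> k c x [h a]) * cnj (\<alpha> l c x [h b]))) =
     (\<Sum>l\<in>UNIV. P i a l * cnj (phi l b x)) + (\<Sum>k\<in>UNIV. P i k b * cnj (phi k a x)) + mat_comp D i a b"
    by (simp add: \<theta>h sum.distrib distrib_left if_distrib[of cnj] if_distrib[of "\<lambda>x. _ * x"] if_distrib[of "\<lambda>x. x * _"] sum_sum_delta cong: if_cong)
  have right: "((\<lambda>s. P02 (Jt s c x) (\<beta> s) (h a) (h b)) has_vector_derivative
     P02 (Jt 0 c x) \<beta>' (h a) (h b) + (\<i> * \<beta> 0 (Jdot x (h a)) (h b) + \<i> * \<beta> 0 (h a) (Jdot x (h b)) - \<beta> 0 (Jdot x (h a)) (Jt 0 c x (h b)) - \<beta> 0 (Jt 0 c x (h a)) (Jdot x (h b))) / 4) (at 0)"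
  proof (rule P02_has_vector_derivative[OF S(1,2)])
    fix s v assume "s \<in> S"
    then have "alt_form 2 (ext_d (proj s i) x)" using alt_ext_d_proj[OF _ x] S(3) by blast
    then show "linear (\<lambda>u. \<beta> s u v)" "linear (\<lambda>u. \<beta> s v u)" unfolding \<beta>_def by (rule alt_form_2_bilinear)+
  next
    show "((\<lambda>s. \<beta> s u v) has_vector_derivative \<beta>' u v) (at 0)" for u v
      unfolding \<beta>_def \<beta>'_def by (rule ext_d_proj_derivative[OF x])
    show "((\<lambda>t. Jt t c x v) has_vector_derivative Jdot x v) (at 0)" for v by (rule Jdot(1)[OF W_UNIV[OF x]])
  qed
  have "P02 (Jt s c x) (\<beta> s) (h a) (h b) = (\<Sum>k\<in>UNIV. \<Sum>l\<in>UNIV. mat_comp (N s) i k l * (cnj (proj s k x [h a]) * cnj (proj s l x [h b])))" if "s \<in> S" for s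
    using P02_proj[OF _ x, of s i "h a" "h b"] N[OF that, unfolded torsion_matrix_def, rule_format, of i "h a" "h b"] that S(3)
    by (auto simp: \<beta>_def[abs_def] mult.assoc)
  from has_vector_derivative_transform_within_open[OF right S(1,2) this]
  have "P02 (Jt 0 c x) \<beta>' (h a) (h b) + t.Q (Jdot x) (\<beta> 0) a b =
     (\<Sum>l\<in>UNIV. P i a l * cnj (phi l b x)) + (\<Sum>k\<in>UNIV. P i k b * cnj (phi k a x)) + mat_comp D i a b"
    using left unfolding left_val by (simp add: t.Q_def h_def Jt_0 vector_derivative_unique_at)
  moreover have "P02 (Jt 0 c x) \<beta>' (h a) (h b) = t.evc (frechet_derivative (phi i b) (at x)) a - t.evc (frechet_derivative (phi i a) (at x)) b
     + (\<Sum>k\<in>UNIV. phi i k x * (t.evc (\<lambda>v. cnj (\<kappa> k a c x [v])) b - t.evc (\<lambda>v. cnj (\<kappa> k b c x [v])) a))"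
  proof -
    have e: "P02 (J c x) (\<lambda>u v. cnj (ext_d (\<alpha> k c) x [u, v])) (h a) (h b) = t.evc (\<lambda>v. cnj (\<kappa> k a c x [v])) b - t.evc (\<lambda>v. cnj (\<kappa> k b c x [v])) a" for k
    proof -
      have n: "t.evc (\<lambda>v. \<alpha> k c x [v]) l = 0" for k l by (rule t.evc_\<theta>(1))
      have "P02 (J c x) (\<lambda>u v. cnj (ext_d (\<alpha> k c) x [u, v])) (h a) (h b) =
        (\<Sum>m\<in>UNIV. P02 (J c x) (\<lambda>u v. cnj (\<alpha> m c x [u]) * cnj (\<kappa> k m c x [v])) (h a) (h b)
           - P02 (J c x) (\<lambda>u v. cnj (\<kappa> k m c x [u]) * cnj (\<alpha> m c x [v])) (h a) (h b))
        + (\<Sum>r\<in>UNIV. \<Sum>l\<in>UNIV. cnj (P k r l) * P02 (J c x) (\<lambda>u v. \<alpha> r c x [u] * \<alpha> l c x [v]) (h a) (h b))"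
        unfolding ext_d_\<alpha>[OF x] complex_cnj_add complex_cnj_mult complex_cnj_diff cnj_sum complex_cnj_cnj t.P02_lin P02_sum P02_scale P_def ..
      then show ?thesis
        unfolding h_def t.P02_product n t.evc_\<theta>(2)
        by (simp add: sum_subtractf if_distrib[of "\<lambda>x. _ * x"] if_distrib[of "\<lambda>x. x * _"] sum_sum_delta cong: if_cong)
    qed
    have "P02 (J c x) \<beta>' (h a) (h b) = (\<Sum>k\<in>UNIV. P02 (J c x) (\<lambda>u v. frechet_derivative (phi i k) (at x) u * cnj (\<alpha> k c x [v])) (h a) (h b)
       - P02 (J c x) (\<lambda>u v. cnj (\<alpha> k c x [u]) * frechet_derivative (phi i k) (at x) v) (h a) (h b)
       + phi i k x * P02 (J c x) (\<lambda>u v. cnj (ext_d (\<alpha> k c) x [u, v])) (h a) (h b))"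
      unfolding \<beta>'_def P02_sum t.P02_lin P02_scale by (simp add: mult.commute)
    then show ?thesis
      unfolding e Jt_0 unfolding h_def t.P02_product t.evc_\<theta>(2)
      by (simp add: sum_subtractf sum.distrib if_distrib[of "\<lambda>x. _ * x"] if_distrib[of "\<lambda>x. x * _"] sum_sum_delta cong: if_cong)
  qed
  moreover have "t.Q (Jdot x) (\<beta> 0) a b = (\<Sum>m\<in>UNIV. phi m b x * t.evc (\<lambda>v. \<kappa> i m c x [v]) a - phi m a x * t.evc (\<lambda>v. \<kappa> i m c x [v]) b)
     + ((\<Sum>l\<in>UNIV. P i a l * cnj (phi l b x)) + (\<Sum>k\<in>UNIV. P i k b * cnj (phi k a x)))"
  proof -
    have d1: "t.dv (Jdot x) (\<lambda>v. \<alpha> m c x [v]) k = - phi m k x" for m k by (simp add: t.dv_def phi_def frame_def)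
    have d2: "t.dv (Jdot x) (\<lambda>v. cnj (\<alpha> m c x [v])) k = cnj (phi m k x)" for m k by (simp add: t.dv_def phi_def frame_def)
    have \<beta>0: "\<beta> 0 = (\<lambda>u v. (\<Sum>m\<in>UNIV. \<alpha> m c x [u] * \<kappa> i m c x [v] - \<kappa> i m c x [u] * \<alpha> m c x [v]) +
      (\<Sum>k\<in>UNIV. \<Sum>l\<in>UNIV. P i k l * (cnj (\<alpha> k c x [u]) * cnj (\<alpha> l c x [v]))))"
    proof -
      have "ext_d (proj 0 i) x [u, v] = ext_d (\<alpha> i c) x [u, v]" for u v
      proof -
        have "frechet_derivative (\<lambda>y. proj 0 i y [v]) (at x) = frechet_derivative (\<lambda>y. \<alpha> i c y [v]) (at x)" for v
          by (rule frechet_derivative_cong_open[OF open_W x]) (simp add: proj_0)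
        then show ?thesis unfolding ext_d_pair by simp
      qed
      then show ?thesis unfolding \<beta>_def P_def by (simp only: ext_d_\<alpha>[OF x])
    qed
    show ?thesis
      unfolding \<beta>0 t.Q_lin t.Q_sum t.Q_product d1 d2 t.evc_\<theta>
      by (simp add: sum.distrib distrib_left if_distrib[of "\<lambda>x. _ * x"] if_distrib[of "\<lambda>x. x * _"] sum_sum_delta cong: if_cong) (simp add: mult.commute)
  qed
  moreover have E: "t.evc (covariant i r x) s = t.evc (frechet_derivative (phi i r) (at x)) s + (\<Sum>m\<in>UNIV. phi m r x * t.evc (\<lambda>v. \<kappa> i m c x [v]) s)
      - (\<Sum>l\<in>UNIV. phi i l x * t.evc (\<lambda>v. cnj (\<kappa> l r c x [v])) s)" for r s
    by (simp add: t.evc_def covariant_def[abs_def] sum_distrib_left sum.distrib sum_subtractf add_divide_distrib diff_divide_distrib sum_divide_distrib algebra_simps)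
  ultimately show "mat_comp D i a b = t.evc (covariant i b x) a - t.evc (covariant i a x) b"
    unfolding E[of a b] E[of b a] by (simp add: sum_subtractf right_diff_distrib algebra_simps)
qed

end

definition covector :: "(real^6 \<Rightarrow> complex) \<Rightarrow> cform" where
  "covector g ws = (if length ws = 1 then g (hd ws) else 0)"

lemma covector_1 [simp]: "covector g [v] = g v"
  by (simp add: covector_def)

lemma alt_covector: "linear g \<Longrightarrow> alt_form 1 (covector g)"
  by (rule alt_form_1I) (simp_all add: covector_def)

lemma ext_d_scale:
  assumes g: "(g has_derivative g') (at x)" and \<eta>: "\<And>ws. (\<lambda>y. \<eta> y ws) differentiable (at x)"
  shows "ext_d (\<lambda>y ws. g y * \<eta> y ws) x vs = (covector g' \<and>\<^sub>e \<eta> x) vs + g x * ext_d \<eta> x vs"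
proof -
  have "frechet_derivative (\<lambda>y. g y * \<eta> y ws) (at x) = (\<lambda>h. g x * frechet_derivative (\<lambda>y. \<eta> y ws) (at x) h + g' h * \<eta> x ws)" for ws
    by (rule frechet_derivative_at[symmetric]) (intro has_derivative_mult g frechet_derivative_works[THEN iffD1, OF \<eta>])
  moreover have "(covector g' \<and>\<^sub>e \<eta> x) vs = (\<Sum>i<length vs. (-1) ^ i * g' (vs ! i) * \<eta> x (nths vs (- {i})))"
    by (subst wedge_1) (simp_all add: degree_form_def covector_def)
  ultimately show ?thesis
    by (simp add: ext_d_def sum_distrib_left sum.distrib[symmetric] algebra_simps)
qed

lemma ext_d_sum:
  assumes "finite I" "\<And>i ws. i \<in> I \<Longrightarrow> (\<lambda>y. \<eta> i y ws) differentiable (at x)"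
  shows "ext_d (\<lambda>y ws. \<Sum>i\<in>I. \<eta> i y ws) x vs = (\<Sum>i\<in>I. ext_d (\<eta> i) x vs)"
proof -
  have "frechet_derivative (\<lambda>y. \<Sum>i\<in>I. \<eta> i y ws) (at x) = (\<lambda>h. \<Sum>i\<in>I. frechet_derivative (\<lambda>y. \<eta> i y ws) (at x) h)" for ws
    by (rule frechet_derivative_at[symmetric]) (intro has_derivative_sum frechet_derivative_works[THEN iffD1] assms)
  then show ?thesis by (simp add: ext_d_def sum_distrib_left sum.swap[of _ I])
qed

context first_variation
begin

definition chi :: "real^6 \<Rightarrow> cform" where
  "chi y ws = (\<Sum>i\<in>UNIV. \<Sum>j\<in>UNIV. phi i j y * el_form L' J \<alpha> c i j y ws)"

lemma proj_derivative:
  assumes x: "x \<in> W"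
  shows "((\<lambda>t. proj t i x ws) has_vector_derivative (\<Sum>k\<in>UNIV. phi i k x * cnj_form (\<alpha> k c x) ws)) (at 0)"
proof (cases "length ws = 1")
  case True
  then obtain v where "ws = [v]" by (auto simp: length_Suc_conv)
  then show ?thesis using proj_time_derivative[OF x, of i v] unfolding phi_expand[OF x] by (simp add: cnj_form_def)
next
  case False
  interpret t: coframe "J c x" "\<lambda>i. \<alpha> i c x" by (rule cf[OF x])
  have "(\<lambda>t. proj t i x ws) = (\<lambda>t. 0)" using False by (simp add: proj_def project10_def fun_eq_iff)
  moreover have "\<alpha> k c x ws = 0" for k using t.degree_\<theta>[of k] False unfolding degree_form_def by blast
  ultimately show ?thesis by (simp add: cnj_form_def)
qed

lemma density_var_covariant:
  assumes x: "x \<in> W"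
  shows "density_var c1 c2 c x vs = complex_of_real (- 2 * Re (\<Sum>i\<in>UNIV. \<Sum>j\<in>UNIV. \<Sum>k\<in>UNIV.
    L' (Nmat J \<alpha> c x) i j k * coframe.evc (J c x) (\<lambda>i. \<alpha> i c x) (covariant i j x) k)) * Omega (\<lambda>i. \<alpha> i c x) vs"
proof -
  interpret t: coframe "J c x" "\<lambda>i. \<alpha> i c x" by (rule cf[OF x])
  have lin: "linear (\<lambda>v. \<alpha> i c x [v])" for i by (rule t.linear_\<theta>)
  define T where "T p = (\<lambda>i. project10 (Jt (fst p) c (snd p)) (\<alpha> i c x))" for p
  define S where "S = {p \<in> I \<times> coord_set c UNIV. det (\<chi> i k. T p i [t.f k] :: complex^3^3) \<noteq> 0}"
  obtain N where S: "open S" and sN: "\<And>i k. smooth_on S (\<lambda>p. N p $ i $ k)"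
    and Nc: "\<And>p. p \<in> S \<Longrightarrow> coframe (Jt (fst p) c (snd p)) (T p)"
    and Nt: "\<And>p. p \<in> S \<Longrightarrow> torsion_matrix (T p) (nij (Jt (fst p) c) (snd p)) (N p)"
    and Nd: "\<And>p vs. p \<in> S \<Longrightarrow> density c1 c2 (Jt (fst p)) c (snd p) vs = complex_of_real (Lfun c1 c2 (N p)) * Omega (T p) vs"
    using local_torsion[OF c, of "\<lambda>i. \<alpha> i c x" t.f c1 c2, OF lin] unfolding T_def S_def by blast
  have T: "T (t, x) = (\<lambda>i. proj t i x)" for t by (simp add: T_def proj_def)
  have "(\<chi> i k. T (0, x) i [t.f k] :: complex^3^3) = mat 1"
    by (simp add: T proj_0[OF x] vec_eq_iff mat_def t.\<theta>_f)
  then have p0: "(0, x) \<in> S" using zero_in W_UNIV[OF x] by (simp add: S_def)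
  define R where "R = {t. (t, x) \<in> S}"
  have R: "open R" "0 \<in> R" "R \<subseteq> I"
  proof -
    have "open ((\<lambda>t. (t, x)) -` S)" by (intro continuous_open_vimage S continuous_intros)
    then show "open R" by (simp add: R_def vimage_def)
    show "0 \<in> R" "R \<subseteq> I" using p0 by (auto simp: R_def S_def)
  qed
  have sN': "smooth_on S N" by (intro smooth_on_vec S sN)
  define D where "D = frechet_derivative N (at (0, x)) (1, 0)"
  have D: "((\<lambda>t. N (t, x)) has_vector_derivative D) (at 0)"
    unfolding D_def by (rule derivative_in_time) (simp add: case_prod_unfold smooth_on_has_derivative[OF sN' p0])
  have Dc: "((\<lambda>t. N (t, x) $ i $ m) has_vector_derivative D $ i $ m) (at 0)" for i m
    by (intro bounded_linear.has_vector_derivative[OF bounded_linear_vec_nth] D)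
  have cf': "coframe (Jt t c x) (\<lambda>i. proj t i x)" "torsion_matrix (\<lambda>i. proj t i x) (nij (Jt t c) x) (N (t, x))" if "t \<in> R" for t
    using Nc[of "(t, x)"] Nt[of "(t, x)"] that by (simp_all add: T R_def)
  have td: "N (0, x) = Nmat J \<alpha> c x" "mat_comp D i a b = t.evc (covariant i b x) a - t.evc (covariant i a x) b" for i a b
    by (rule torsion_derivative[where S = R and N = "\<lambda>t. N (t, x)" and D = D, OF x R _ _ Dc]; erule cf')+
  let ?N = "Nmat J \<alpha> c x"
  let ?E = "\<lambda>i j k. t.evc (covariant i j x) k"
  have skew: "L' a i k m = - L' a i m k" for a i k m using L unfolding L_partials_def by blast
  have "(Lfun c1 c2 has_derivative (\<lambda>h. Re (\<Sum>i\<in>UNIV. \<Sum>j\<in>UNIV. \<Sum>k\<in>UNIV. L' ?N i j k * mat_comp h i j k))) (at (N (0, x)))"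
    using L unfolding L_partials_def td(1) by blast
  then have dL: "((\<lambda>t. Lfun c1 c2 (N (t, x))) has_vector_derivative Re (\<Sum>i\<in>UNIV. \<Sum>j\<in>UNIV. \<Sum>k\<in>UNIV. L' ?N i j k * mat_comp D i j k)) (at 0)"
    by (rule vector_derivative_diff_chain_within[OF D, of "Lfun c1 c2", OF has_derivative_at_withinI, unfolded o_def])
  have val: "(\<Sum>i\<in>UNIV. \<Sum>j\<in>UNIV. \<Sum>k\<in>UNIV. L' ?N i j k * mat_comp D i j k) = - 2 * (\<Sum>i\<in>UNIV. \<Sum>j\<in>UNIV. \<Sum>k\<in>UNIV. L' ?N i j k * ?E i j k)"
  proof -
    have "(\<Sum>j\<in>UNIV. \<Sum>k\<in>UNIV. L' ?N i j k * ?E i k j) = - (\<Sum>j\<in>UNIV. \<Sum>k\<in>UNIV. L' ?N i j k * ?E i j k)" for i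
    proof -
      have "(\<Sum>j\<in>UNIV. \<Sum>k\<in>UNIV. L' ?N i j k * ?E i k j) = (\<Sum>k\<in>UNIV. \<Sum>j\<in>UNIV. L' ?N i j k * ?E i k j)" by (rule sum.swap)
      also have "\<dots> = (\<Sum>k\<in>UNIV. \<Sum>j\<in>UNIV. - (L' ?N i k j * ?E i k j))"
        by (intro sum.cong refl) (subst skew, simp)
      finally show ?thesis by (simp add: sum_negf)
    qed
    then show ?thesis
      unfolding td(2) by (simp add: right_diff_distrib sum_subtractf sum_negf flip: sum_distrib_left)
  qed
  have "((\<lambda>t. Omega (\<lambda>i. proj t i x) vs) has_vector_derivative 0) (at 0)"
    by (rule t.Omega_derivative_0[where \<theta>t = "\<lambda>t i. proj t i x" and \<phi> = "\<lambda>i k. phi i k x", OF proj_derivative[OF x]])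
      (simp add: proj_0[OF x])
  from has_vector_derivative_mult[OF bounded_linear.has_vector_derivative[OF bounded_linear_of_real[where 'a = complex] dL] this]
  have "((\<lambda>t. complex_of_real (Lfun c1 c2 (N (t, x))) * Omega (\<lambda>i. proj t i x) vs) has_vector_derivative
     complex_of_real (Re (\<Sum>i\<in>UNIV. \<Sum>j\<in>UNIV. \<Sum>k\<in>UNIV. L' ?N i j k * mat_comp D i j k)) * Omega (\<lambda>i. \<alpha> i c x) vs) (at 0)"
    by (simp add: proj_0[OF x])
  then have "((\<lambda>t. density c1 c2 (Jt t) c x vs) has_vector_derivative
     complex_of_real (Re (\<Sum>i\<in>UNIV. \<Sum>j\<in>UNIV. \<Sum>k\<in>UNIV. L' ?N i j k * mat_comp D i j k)) * Omega (\<lambda>i. \<alpha> i c x) vs) (at 0)"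
    by (rule has_vector_derivative_transform_within_open[OF _ R(1,2)])
      (use Nd[of "(_, x)"] in \<open>simp add: R_def T\<close>)
  from vector_derivative_unique_at[OF density_has_derivative(1)[OF c W_UNIV[OF x]] this] show ?thesis unfolding val by simp
qed

lemma evc_covariant:
  assumes x: "x \<in> W"
  shows "coframe.evc (J c x) (\<lambda>i. \<alpha> i c x) (covariant i j x) k * Omega (\<lambda>i. \<alpha> i c x) vs =
    (covector (frechet_derivative (phi i j) (at x)) \<and>\<^sub>e dual5 (\<lambda>m. \<alpha> m c x) k) vs
    + (\<Sum>m\<in>UNIV. phi m j x * (\<kappa> i m c x \<and>\<^sub>e dual5 (\<lambda>m. \<alpha> m c x) k) vs)
    - (\<Sum>l\<in>UNIV. phi i l x * (cnj_form (\<kappa> l j c x) \<and>\<^sub>e dual5 (\<lambda>m. \<alpha> m c x) k) vs)"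
proof -
  interpret t: coframe "J c x" "\<lambda>i. \<alpha> i c x" by (rule cf[OF x])
  have lp: "linear (frechet_derivative (phi i j) (at x))"
    by (rule frechet_derivative_linear[OF smooth_on_differentiable[OF smooth_phi x]])
  have "t.evc (covariant i j x) k = t.evc (frechet_derivative (phi i j) (at x)) k + (\<Sum>m\<in>UNIV. phi m j x * t.evc (\<lambda>v. \<kappa> i m c x [v]) k)
      - (\<Sum>l\<in>UNIV. phi i l x * t.evc (\<lambda>v. cnj (\<kappa> l j c x [v])) k)"
    by (simp add: t.evc_def covariant_def[abs_def] sum_distrib_left sum.distrib sum_subtractf add_divide_distrib diff_divide_distrib sum_divide_distrib algebra_simps)
  then show ?thesis
    unfolding t.dual5_eq t.one_form_wedge_dual[OF alt_\<kappa>[OF x]] t.one_form_wedge_dual[OF alt_form_cnj[OF alt_\<kappa>[OF x]]]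
      t.one_form_wedge_dual[OF alt_covector[OF lp]]
    by (simp add: cnj_form_def sum_distrib_right ring_distribs mult.assoc)
qed

lemma ext_d_chi:
  assumes x: "x \<in> W"
  shows "ext_d chi x vs - (\<Sum>i\<in>UNIV. \<Sum>j\<in>UNIV. phi i j x * el_expr L' J \<alpha> \<kappa> c i j x vs) =
    (\<Sum>i\<in>UNIV. \<Sum>j\<in>UNIV. \<Sum>k\<in>UNIV. L' (Nmat J \<alpha> c x) i j k * coframe.evc (J c x) (\<lambda>i. \<alpha> i c x) (covariant i j x) k) * Omega (\<lambda>i. \<alpha> i c x) vs"
proof -
  let ?L = "L' (Nmat J \<alpha> c x)" and ?d = "dual5 (\<lambda>m. \<alpha> m c x)"
  have d: "(\<lambda>y. el_form L' J \<alpha> c i j y ws) differentiable (at x)" for i j ws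
    by (rule smooth_on_differentiable[OF smooth_el_form[OF ac_J coframing c L] x])
  have dphi: "(phi i j has_derivative frechet_derivative (phi i j) (at x)) (at x)" for i j
    by (rule smooth_on_has_derivative[OF smooth_phi x])
  have m: "(\<lambda>y. phi i j y * el_form L' J \<alpha> c i j y ws) differentiable (at x)" for i j ws
    by (intro differentiable_mult d differentiableI[OF dphi])
  have "ext_d chi x vs = ext_d (\<lambda>y ws. \<Sum>i\<in>UNIV. \<Sum>j\<in>UNIV. phi i j y * el_form L' J \<alpha> c i j y ws) x vs"
    by (simp add: chi_def[abs_def])
  also have "\<dots> = (\<Sum>i\<in>UNIV. ext_d (\<lambda>y ws. \<Sum>j\<in>UNIV. phi i j y * el_form L' J \<alpha> c i j y ws) x vs)"
    by (rule ext_d_sum) (auto intro!: differentiable_sum m)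
  also have "\<dots> = (\<Sum>i\<in>UNIV. \<Sum>j\<in>UNIV. ext_d (\<lambda>y ws. phi i j y * el_form L' J \<alpha> c i j y ws) x vs)"
    by (intro sum.cong refl ext_d_sum) (auto intro: m)
  also have "\<dots> = (\<Sum>i\<in>UNIV. \<Sum>j\<in>UNIV. (\<Sum>k\<in>UNIV. ?L i j k * (covector (frechet_derivative (phi i j) (at x)) \<and>\<^sub>e ?d k) vs)
      + phi i j x * ext_d (el_form L' J \<alpha> c i j) x vs)"
    unfolding ext_d_scale[OF dphi d] by (simp add: el_form_def[abs_def] wedge_sum_right wedge_scale_right)
  finally have e: "ext_d chi x vs = \<dots>" .
  have a: "(\<Sum>i\<in>UNIV. \<Sum>j\<in>UNIV. \<Sum>l\<in>UNIV. \<Sum>k\<in>UNIV. phi i j x * (?L l j k * (\<kappa> l i c x \<and>\<^sub>e ?d k) vs)) =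
     (\<Sum>i\<in>UNIV. \<Sum>j\<in>UNIV. \<Sum>k\<in>UNIV. \<Sum>m\<in>UNIV. ?L i j k * (phi m j x * (\<kappa> i m c x \<and>\<^sub>e ?d k) vs))"
    by (simp only: sum_3 algebra_simps)
  have b: "(\<Sum>i\<in>UNIV. \<Sum>j\<in>UNIV. \<Sum>l\<in>UNIV. \<Sum>k\<in>UNIV. phi i j x * (?L i l k * (cnj_form (\<kappa> j l c x) \<and>\<^sub>e ?d k) vs)) =
     (\<Sum>i\<in>UNIV. \<Sum>j\<in>UNIV. \<Sum>k\<in>UNIV. \<Sum>m\<in>UNIV. ?L i j k * (phi i m x * (cnj_form (\<kappa> m j c x) \<and>\<^sub>e ?d k) vs))"
    by (simp only: sum_3 algebra_simps)
  show ?thesis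
    unfolding sum_distrib_right mult.assoc evc_covariant[OF x] e el_expr_def
    using a b by (simp add: ring_distribs sum.distrib sum_subtractf sum_distrib_left)
qed

lemma density_var_eq:
  assumes x: "x \<in> W"
  shows "density_var c1 c2 c x vs = complex_of_real (- 2 * Re (ext_d chi x vs - (\<Sum>i\<in>UNIV. \<Sum>j\<in>UNIV. phi i j x * el_expr L' J \<alpha> \<kappa> c i j x vs)))"
proof -
  interpret t: coframe "J c x" "\<lambda>i. \<alpha> i c x" by (rule cf[OF x])
  have "Im (Omega (\<lambda>i. \<alpha> i c x) vs) = 0" using cnj_Omega[of "\<lambda>i. \<alpha> i c x" vs, OF t.degree_\<theta>] by (simp add: complex_eq_iff)
  then show ?thesis unfolding density_var_covariant[OF x] ext_d_chi[OF x] by (simp add: complex_eq_iff)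
qed

end

lemma alt_form_sum:
  assumes "finite I" "\<And>i. i \<in> I \<Longrightarrow> alt_form k (\<omega> i)"
  shows "alt_form k (\<lambda>vs. \<Sum>i\<in>I. \<omega> i vs)"
  using assms
proof (induction I rule: finite_induct)
  case empty
  then show ?case by (auto simp: alt_form_def linear_iff)
next
  case (insert a I)
  then show ?case using alt_form_combination[of k "\<omega> a" "\<lambda>vs. \<Sum>i\<in>I. \<omega> i vs" 1 1] by simp
qed

lemma ext_d_alt:
  assumes S: "open S" "x \<in> S" and \<omega>: "\<And>y. y \<in> S \<Longrightarrow> alt_form k (\<omega> y)" and d: "\<And>ws. (\<lambda>y. \<omega> y ws) differentiable (at x)"
  shows "alt_form (Suc k) (ext_d \<omega> x)"
proof -
  define D where "D b ws = frechet_derivative (\<lambda>y. \<omega> y ws) (at x) b" for b ws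
  have zero: "D b ws = 0" if "\<And>y. y \<in> S \<Longrightarrow> \<omega> y ws = 0" for b ws
    using frechet_derivative_cong_open[OF S, of "\<lambda>y. \<omega> y ws" "\<lambda>_. 0"] that by (simp add: D_def)
  have alt: "alt_form k (D b)" for b
    unfolding alt_form_def
  proof (intro conjI allI impI)
    fix vs :: "(real^6) list" assume l: "length vs \<noteq> k"
    show "D b vs = 0" by (rule zero) (use \<omega> l in \<open>auto simp: alt_form_def\<close>)
  next
    fix vs :: "(real^6) list" and i m assume h: "length vs = k \<and> i < m \<and> m < k \<and> vs ! i = vs ! m"
    show "D b vs = 0" by (rule zero) (use \<omega> h in \<open>unfold alt_form_def, blast\<close>)
  next
    fix vs :: "(real^6) list" and i assume h: "length vs = k \<and> i < k"
    have lin: "linear (\<lambda>v. \<omega> y (vs[i := v]))" if "y \<in> S" for y using \<omega>[OF that] h unfolding alt_form_def by blast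
    show "linear (\<lambda>v. D b (vs[i := v]))"
    proof (rule linearI)
      fix u v
      have "((\<lambda>y. \<omega> y (vs[i := u]) + \<omega> y (vs[i := v])) has_derivative (\<lambda>h. D h (vs[i := u]) + D h (vs[i := v]))) (at x)"
        unfolding D_def by (intro has_derivative_add frechet_derivative_works[THEN iffD1] d)
      then have "((\<lambda>y. \<omega> y (vs[i := u + v])) has_derivative (\<lambda>h. D h (vs[i := u]) + D h (vs[i := v]))) (at x)"
        by (rule has_derivative_transform_within_open[OF _ S]) (simp add: linear_add[OF lin])
      from fun_cong[OF frechet_derivative_at[OF this], of b] show "D b (vs[i := u + v]) = D b (vs[i := u]) + D b (vs[i := v])"
        by (simp add: D_def)
    next
      fix r v
      have "((\<lambda>y. r *\<^sub>R \<omega> y (vs[i := v])) has_derivative (\<lambda>h. r *\<^sub>R D h (vs[i := v]))) (at x)"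
        unfolding D_def by (intro has_derivative_scaleR_right frechet_derivative_works[THEN iffD1] d)
      then have "((\<lambda>y. \<omega> y (vs[i := r *\<^sub>R v])) has_derivative (\<lambda>h. r *\<^sub>R D h (vs[i := v]))) (at x)"
        by (rule has_derivative_transform_within_open[OF _ S]) (simp add: linear_cmul[OF lin])
      from fun_cong[OF frechet_derivative_at[OF this], of b] show "D b (vs[i := r *\<^sub>R v]) = r *\<^sub>R D b (vs[i := v])"
        by (simp add: D_def)
    qed
  qed
  have "ext_d \<omega> x vs = (\<Sum>b\<in>Basis. (covector (\<lambda>v. complex_of_real (v \<bullet> b)) \<and>\<^sub>e D b) vs)" for vs
  proof -
    have e: "D v ws = (\<Sum>b\<in>Basis. complex_of_real (v \<bullet> b) * D b ws)" for v ws
    proof -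
      have l: "linear (\<lambda>h. D h ws)" unfolding D_def by (rule frechet_derivative_linear[OF d])
      have "D (\<Sum>b\<in>Basis. (v \<bullet> b) *\<^sub>R b) ws = (\<Sum>b\<in>Basis. complex_of_real (v \<bullet> b) * D b ws)"
        by (simp add: linear_sum[OF l] linear_cmul[OF l] scaleR_complex)
      then show ?thesis by (simp add: euclidean_representation)
    qed
    have "(covector (\<lambda>v. complex_of_real (v \<bullet> b)) \<and>\<^sub>e D b) vs =
       (\<Sum>i<length vs. (-1) ^ i * complex_of_real (vs ! i \<bullet> b) * D b (nths vs (- {i})))" for b
      by (subst wedge_1) (simp_all add: degree_form_def covector_def)
    then have "(\<Sum>b\<in>Basis. (covector (\<lambda>v. complex_of_real (v \<bullet> b)) \<and>\<^sub>e D b) vs) =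
       (\<Sum>i<length vs. (-1) ^ i * D (vs ! i) (nths vs (- {i})))"
      unfolding e[of "vs ! _"] by (simp add: sum_distrib_left mult.assoc sum.swap[of _ Basis])
    then show ?thesis by (simp add: ext_d_def D_def)
  qed
  then have "ext_d \<omega> x = (\<lambda>vs. \<Sum>b\<in>Basis. (covector (\<lambda>v. complex_of_real (v \<bullet> b)) \<and>\<^sub>e D b) vs)" by (rule ext)
  moreover have "alt_form (Suc k) (\<lambda>vs. \<Sum>b\<in>Basis. (covector (\<lambda>v. complex_of_real (v \<bullet> b)) \<and>\<^sub>e D b) vs)"
  proof (rule alt_form_sum)
    fix b :: "real^6"
    have "linear (\<lambda>v. complex_of_real (v \<bullet> b))" by (simp add: linear_iff inner_add_left scaleR_complex)
    from alt_form_wedge[OF alt_covector[OF this] alt, of b]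
    show "alt_form (Suc k) (covector (\<lambda>v. complex_of_real (v \<bullet> b)) \<and>\<^sub>e D b)" by simp
  qed simp
  ultimately show ?thesis by simp
qed

context atlas
begin

lemma el_expr_alt:
  assumes "almost_complex A J" "coframing A J U \<alpha>" "c \<in> A" "L_partials c1 c2 L'" "connection02 A J U \<alpha> \<kappa>" "x \<in> coord_set c U"
  shows "alt_form 6 (el_expr L' J \<alpha> \<kappa> c i j x)"
proof -
  have o: "open (coord_set c U)" by (rule open_coord_set[OF assms(3) coframingD(1)[OF assms(2)]])
  have d5: "alt_form 5 (dual5 (\<lambda>m. \<alpha> m c y) k)" if "y \<in> coord_set c U" for y k
  proof -
    interpret t: coframe "J c y" "\<lambda>i. \<alpha> i c y" by (rule coframing_coframe[OF assms(1-3) that])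
    show ?thesis using t.alt_dual by (simp add: t.dual5_eq)
  qed
  have "alt_form (Suc 5) (ext_d (el_form L' J \<alpha> c i j) x)"
  proof (rule ext_d_alt[OF o assms(6)])
    show "alt_form 5 (el_form L' J \<alpha> c i j y)" if "y \<in> coord_set c U" for y
      unfolding el_form_def[abs_def] by (intro alt_form_sum alt_form_scale d5 that) simp
    show "(\<lambda>y. el_form L' J \<alpha> c i j y ws) differentiable (at x)" for ws
      by (rule smooth_on_differentiable[OF smooth_el_form[OF assms(1-4)] assms(6)])
  qed
  then have 1: "alt_form 6 (ext_d (el_form L' J \<alpha> c i j) x)" by simp
  have k: "alt_form 1 (\<kappa> a b c x)" for a b
    by (rule form_onD(1)[OF connection02D(1)[OF assms(5)] assms(3,6)])
  have w: "alt_form 6 (\<kappa> a b c x \<and>\<^sub>e dual5 (\<lambda>m. \<alpha> m c x) k)" "alt_form 6 (cnj_form (\<kappa> a b c x) \<and>\<^sub>e dual5 (\<lambda>m. \<alpha> m c x) k)" for a b k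
    using alt_form_wedge[OF k d5[OF assms(6)], of a b k] alt_form_wedge[OF alt_form_cnj[OF k] d5[OF assms(6)], of a b k] by simp_all
  have 2: "alt_form 6 (\<lambda>vs. \<Sum>l\<in>UNIV. \<Sum>k\<in>UNIV. L' (Nmat J \<alpha> c x) l j k * (\<kappa> l i c x \<and>\<^sub>e dual5 (\<lambda>m. \<alpha> m c x) k) vs)"
    by (intro alt_form_sum alt_form_scale w) simp_all
  have 3: "alt_form 6 (\<lambda>vs. \<Sum>l\<in>UNIV. \<Sum>k\<in>UNIV. L' (Nmat J \<alpha> c x) i l k * (cnj_form (\<kappa> j l c x) \<and>\<^sub>e dual5 (\<lambda>m. \<alpha> m c x) k) vs)"
    by (intro alt_form_sum alt_form_scale w) simp_all
  from alt_form_combination[OF alt_form_combination[OF 1 2, of 1 "-1"] 3, of 1 1]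
  show ?thesis unfolding el_expr_def[abs_def] by simp
qed

lemma density_local:
  assumes J: "almost_complex A J" "almost_complex A J'" and c: "c \<in> A" and T: "open T" "x \<in> T" "T \<subseteq> coord_set c UNIV"
    and eq: "\<And>y v. y \<in> T \<Longrightarrow> J' c y v = J c y v"
  shows "density c1 c2 J' c x vs = density c1 c2 J c x vs"
proof -
  have x: "x \<in> coord_set c UNIV" using T by blast
  obtain U \<alpha> where \<alpha>: "coframing A J U \<alpha>" "x \<in> coord_set c U" using exists_coframing[OF J(1) c x] by blast
  let ?\<theta> = "\<lambda>i. \<alpha> i c x"
  have cf: "coframe (J c x) ?\<theta>" by (rule coframing_coframe[OF J(1) \<alpha>(1) c \<alpha>(2)])
  have Jx: "J' c x = J c x" using eq[OF T(2)] by blast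
  have "frechet_derivative (\<lambda>y. J' c y v) (at x) = frechet_derivative (\<lambda>y. J c y v) (at x)" for v
    by (rule frechet_derivative_cong_open[OF T(1,2) eq])
  then have "nij (J' c) x = nij (J c) x" by (simp add: nij_def fun_eq_iff Jx)
  then have tm: "torsion_matrix ?\<theta> (nij (J' c) x) (Nmat J \<alpha> c x)" using Nmat_torsion[OF J(1) \<alpha>(1) c \<alpha>(2)] by simp
  show ?thesis
    unfolding density_pointwise[OF J(2) c x cf[folded Jx] tm] density_coframing[OF J(1) \<alpha>(1) c \<alpha>(2)] ..
qed

end

lemma (in variation) density_var_outside:
  assumes c: "c \<in> A" and T: "open T" "x \<in> T" "T \<subseteq> coord_set c UNIV" and eq: "\<And>t y v. t \<in> I \<Longrightarrow> y \<in> T \<Longrightarrow> Jt t c y v = J c y v"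
  shows "density_var c1 c2 c x vs = 0"
proof -
  have "((\<lambda>t. density c1 c2 (Jt t) c x vs) has_vector_derivative 0) (at 0)"
  proof (rule has_vector_derivative_transform_within_open[OF has_vector_derivative_const, of I])
    have ac: "almost_complex A J" using almost_complex_Jt[OF zero_in] by (simp add: Jt_0)
    show "density c1 c2 J c x vs = density c1 c2 (Jt t) c x vs" if "t \<in> I" for t
      by (rule density_local[OF ac almost_complex_Jt[OF that] c T eq[OF that], symmetric])
  qed (use zero_in in auto)
  moreover have "x \<in> coord_set c UNIV" using T by blast
  ultimately show ?thesis using vector_derivative_unique_at density_has_derivative(1)[OF c] by blast
qed

lemma (in first_variation) integral_density_var:
  assumes M: "compact (UNIV :: 'a set)" and K: "closed K" "K \<subseteq> U \<inter> fst c"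
    and eq: "\<And>t d y v. t \<in> I \<Longrightarrow> d \<in> A \<Longrightarrow> y \<in> coord_set d (- K) \<Longrightarrow> Jt t d y v = J d y v"
  shows "integral_form A (density_var c1 c2) = complex_of_real (2 * Re (integral W (\<lambda>x. \<Sum>i\<in>UNIV. \<Sum>j\<in>UNIV. phi i j x * el_expr L' J \<alpha> \<kappa> c i j x std_basis)))"
proof -
  let ?E = "\<lambda>x. \<Sum>i\<in>UNIV. \<Sum>j\<in>UNIV. phi i j x * el_expr L' J \<alpha> \<kappa> c i j x std_basis"
  let ?d = "\<lambda>x. ext_d chi x std_basis"
  define C where "C = snd c ` K"
  have KU: "K \<subseteq> fst c" "K \<subseteq> U" using K(2) by auto
  have C: "compact C" "C \<subseteq> W"
    using compact_coord_image[OF M c K(1) KU(1)] coord_set_mono[OF KU(2), of c] by (auto simp: C_def)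
  have outC: "x \<in> coord_set c (- K)" if "x \<in> W - C" for x
  proof -
    have "x \<in> coord_set c UNIV" "x \<notin> snd c ` K" using that W_UNIV by (auto simp: C_def)
    then show ?thesis using coord_set_iff[OF c, of x "- K"] coord_set_image_iff[OF c KU(1), of x] by blast
  qed
  have out: "density_var c1 c2 d x vs = 0" if "d \<in> A" "x \<in> coord_set d (- K)" for d x vs
    by (rule density_var_outside[OF that(1) open_coord_set[OF that(1)] that(2)])
      (use K(1) eq that coord_set_mono[of "- K" UNIV d] in \<open>auto simp: open_Compl\<close>)
  have phi0: "phi i k x = 0" if "x \<in> W - C" for i k x
  proof -
    have "((\<lambda>t. Jt t c x v) has_vector_derivative 0) (at 0)" for v
      by (rule has_vector_derivative_transform_within_open[OF has_vector_derivative_const[of "J c x v"], of I])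
        (use zero_in eq[OF _ c outC[OF that]] in auto)
    then have "Jdot x v = 0" for v
      using vector_derivative_unique_at[OF Jdot(1)] W_UNIV that by blast
    moreover have "\<alpha> i c x [0] = 0" using linear_0[OF linear_coframing[OF coframing c]] that by blast
    ultimately show ?thesis by (simp add: phi_def)
  qed
  have schi: "smooth_on W (\<lambda>x. chi x ws)" for ws
    unfolding chi_def by (intro smooth_on_sum smooth_on_mult open_W smooth_phi smooth_el_form[OF ac_J coframing c L])
  have sE: "smooth_on W ?E"
    by (intro smooth_on_sum smooth_on_mult open_W smooth_phi smooth_el_expr[OF ac_J coframing c L connection])
  have stokes: "integral W ?d = 0" "?d integrable_on W"
    by (rule stokes[OF open_W C schi]; simp add: chi_def phi0)+
  have intE: "?E integrable_on W"
    by (rule set_lebesgue_integral_eq_integral(1)[OF absolutely_integrable_compact_support[OF open_W smooth_on_continuous_on[OF sE] C]])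
      (simp add: phi0)
  define h where "h z = complex_of_real (- 2 * Re z)" for z
  have bl: "bounded_linear h"
    unfolding h_def[abs_def] linear_conv_bounded_linear[symmetric] by (simp add: linear_iff scaleR_complex algebra_simps)
  have "integral_form A (density_var c1 c2) = integral (coord_set c UNIV) (\<lambda>x. density_var c1 c2 c x std_basis)"
  proof (rule integral_form_chart[OF M six_form_density_var c K(1) KU(1)])
    fix d x assume "d \<in> A" "x \<in> coord_set d UNIV" "chart_inv d x \<notin> K"
    then show "density_var c1 c2 d x std_basis = 0" using coord_set_iff[of d x "- K"] out[of d x] by blast
  qed
  also have "\<dots> = integral W (\<lambda>x. density_var c1 c2 c x std_basis)"
  proof (rule integral_support)
    fix x assume "x \<in> coord_set c UNIV - W"
    then have "x \<in> coord_set c (- K)" using coord_set_iff[OF c, of x U] coord_set_iff[OF c, of x "- K"] KU(2) by blast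
    then show "density_var c1 c2 c x std_basis = 0" by (rule out[OF c])
  qed (use W_UNIV in blast)
  also have "\<dots> = integral W (\<lambda>x. h (?d x - ?E x))"
    by (rule integral_cong) (simp add: density_var_eq h_def)
  also have "\<dots> = h (integral W (\<lambda>x. ?d x - ?E x))"
    using integral_linear[OF integrable_diff[OF stokes(2) intE] bl] by (simp add: o_def)
  also have "integral W (\<lambda>x. ?d x - ?E x) = - integral W ?E"
    using integral_diff[OF stokes(2) intE] stokes(1) by simp
  finally show ?thesis by (simp add: h_def)
qed

section \<open>Local connections\<close>

context coframe
begin

lemma \<theta>_eqI: "(\<And>i. \<theta> i [u] = \<theta> i [v]) \<Longrightarrow> u = v"
  using inj_coords by (auto simp: coords_def inj_def)

definition vector_of :: "(3 \<Rightarrow> complex) \<Rightarrow> real^6" where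
  "vector_of z = (\<Sum>k\<in>UNIV. Re (z k) *\<^sub>R f k + Im (z k) *\<^sub>R j (f k))"

lemma \<theta>_vector_of: "\<theta> i [vector_of z] = z i"
proof -
  have "\<theta> i [vector_of z] = (\<Sum>k\<in>UNIV. complex_of_real (Re (z k)) * \<theta> i [f k] + complex_of_real (Im (z k)) * (\<i> * \<theta> i [f k]))"
    by (simp add: vector_of_def linear_sum[OF linear_\<theta>] linear_add[OF linear_\<theta>] linear_cmul[OF linear_\<theta>] \<theta>_j scaleR_complex)
  also have "\<dots> = (\<Sum>k\<in>UNIV. if k = i then z k else 0)"
    by (intro sum.cong refl) (simp add: \<theta>_f complex_eq_iff)
  finally show ?thesis by simp
qed

lemma sum_\<theta>_ev:
  assumes "linear g"
  shows "(\<Sum>k\<in>UNIV. \<theta> k [u] * ev g k) = (g u - \<i> * g (j u)) / 2"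
  unfolding expand_ev[OF assms, of u] expand_ev[OF assms, of "j u"]
  by (simp add: \<theta>_j sum.distrib sum_subtractf sum_negf sum_distrib_left ring_distribs mult.assoc[symmetric]) (simp add: sum_distrib_left mult.commute mult.left_commute)

definition conn :: "cform \<Rightarrow> 3 \<Rightarrow> real^6 \<Rightarrow> complex" where
  "conn \<omega> k v = (3 * ev (\<lambda>u. \<omega> [u, v]) k + \<i> * ev (\<lambda>u. \<omega> [u, j v]) k) / 4"

text \<open>With \<open>e\<^sub>k\<close> the complex frame, \<open>conn \<omega> k v\<close> is \<open>\<omega>(e\<^sub>k, v - v\<^sup>1\<^sup>0/2)\<close>, so that antisymmetrizing counts
  the (2,0)-part of \<open>\<omega>\<close> once.\<close>

lemma conn_eq:
  assumes \<omega>: "alt_form 2 \<omega>"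
  shows "\<omega> [u, v] = - (\<Sum>k\<in>UNIV. conn \<omega> k u * \<theta> k [v] - conn \<omega> k v * \<theta> k [u]) + P02 j (\<lambda>u v. \<omega> [u, v]) u v"
proof -
  note lin = alt_form_2_bilinear(1)[OF \<omega>]
  have s: "(\<Sum>k\<in>UNIV. conn \<omega> k v * \<theta> k [u]) = (3 * (\<omega> [u, v] - \<i> * \<omega> [j u, v]) / 2 + \<i> * (\<omega> [u, j v] - \<i> * \<omega> [j u, j v]) / 2) / 4" for u v
  proof -
    have "(\<Sum>k\<in>UNIV. conn \<omega> k v * \<theta> k [u]) = (3 * (\<Sum>k\<in>UNIV. \<theta> k [u] * ev (\<lambda>u. \<omega> [u, v]) k) + \<i> * (\<Sum>k\<in>UNIV. \<theta> k [u] * ev (\<lambda>u. \<omega> [u, j v]) k)) / 4"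
      by (simp add: conn_def sum_distrib_left sum.distrib sum_divide_distrib algebra_simps add_divide_distrib)
    then show ?thesis unfolding sum_\<theta>_ev[OF lin] by simp
  qed
  have skew: "\<omega> [v, u] = - \<omega> [u, v]" "\<omega> [j v, u] = - \<omega> [u, j v]" "\<omega> [v, j u] = - \<omega> [j u, v]" "\<omega> [j v, j u] = - \<omega> [j u, j v]"
    using alt_form_2_swap[OF \<omega>] by blast+
  show ?thesis
    unfolding sum_subtractf s skew P02_def by (simp add: field_simps)
qed

lemma linear_conn:
  assumes \<omega>: "alt_form 2 \<omega>"
  shows "linear (conn \<omega> k)"
proof -
  note l = alt_form_2_bilinear(2)[OF \<omega>]
  have l': "linear (\<lambda>v. \<omega> [u, j v])" for u using linear_compose[OF linear_j l] by (simp add: o_def)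
  show ?thesis
    unfolding conn_def[abs_def] ev_def
    by (rule linearI)
      (simp_all add: linear_add[OF l] linear_add[OF l'] linear_cmul[OF l] linear_cmul[OF l'] scaleR_complex field_simps)
qed

end

context atlas
begin

lemma frame_transition:
  assumes J: "almost_complex A J" and \<alpha>: "coframing A J U \<alpha>" and c: "c \<in> A" "c' \<in> A" "x \<in> coord_set c (U \<inter> fst c')"
  shows "coframe.f (\<lambda>i. \<alpha> i c' (transition c c' x)) k = transition_deriv c c' x (coframe.f (\<lambda>i. \<alpha> i c x) k)"
proof -
  have x: "x \<in> coord_set c U" using c(3) by (auto simp: coord_set_def)
  have y: "transition c c' x \<in> coord_set c' U" using transition_in[OF c] by (auto simp: coord_set_def)
  interpret t: coframe "J c x" "\<lambda>i. \<alpha> i c x" by (rule coframing_coframe[OF J \<alpha> c(1) x])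
  interpret t': coframe "J c' (transition c c' x)" "\<lambda>i. \<alpha> i c' (transition c c' x)" by (rule coframing_coframe[OF J \<alpha> c(2) y])
  show ?thesis
    by (rule t'.\<theta>_eqI) (use form_onD(3)[OF coframingD(2)[OF \<alpha>] c, of _ "[t.f k]"] in \<open>simp add: t.\<theta>_f t'.\<theta>_f\<close>)
qed

lemma smooth_frame:
  assumes J: "almost_complex A J" and \<alpha>: "coframing A J U \<alpha>" and c: "c \<in> A"
  shows "smooth_on (coord_set c U) (\<lambda>x. coframe.f (\<lambda>i. \<alpha> i c x) k)"
proof (rule smooth_on_local)
  fix x0 assume x0: "x0 \<in> coord_set c U"
  obtain u :: "3 \<Rightarrow> real^6" and T where T: "open T" "x0 \<in> T" "T \<subseteq> coord_set c U"
    and nz: "\<And>x. x \<in> T \<Longrightarrow> det (\<chi> k m. cnj (\<alpha> k c x [u m]) :: complex^3^3) \<noteq> 0"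
    by (rule coframe_nonvanishing[OF J \<alpha> c x0]) blast
  define H where "H x = (\<chi> i m. \<alpha> i c x [u m] :: complex^3^3)" for x
  define D where "D m x = (\<chi> r s. if s = m then axis k 1 $ r else H x $ r $ s :: complex^3^3)" for m x
  define G where "G m x = det (D m x) / det (H x)" for m x
  have s\<alpha>: "smooth_on T (\<lambda>x. \<alpha> i c x ws)" for i ws by (rule smooth_on_subset[OF smooth_coframing[OF \<alpha> c] T(3)])
  have nz': "det (H x) \<noteq> 0" if "x \<in> T" for x
  proof -
    have "det (\<chi> k m. cnj (\<alpha> k c x [u m]) :: complex^3^3) = cnj (det (H x))" by (simp add: H_def det_3)
    then show ?thesis using nz[OF that] by auto
  qed
  have sH: "smooth_on T (\<lambda>x. H x $ r $ s)" for r s unfolding H_def by (simp add: s\<alpha>)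
  have sD: "smooth_on T (\<lambda>x. D m x $ r $ s)" for m r s
    using sH by (cases "s = m") (simp_all add: D_def smooth_on_const T(1))
  have sG: "smooth_on T (G m)" for m
    unfolding G_def[abs_def] by (intro smooth_on_divide smooth_on_det3 T(1) sD sH nz')
  have sJ: "smooth_on T (\<lambda>x. J c x v)" for v
    by (rule smooth_on_subset[OF almost_complexD(3)[OF J c]]) (use T(3) coord_set_UNIV in blast)
  define F where "F x = (\<Sum>m\<in>UNIV. Re (G m x) *\<^sub>R u m + Im (G m x) *\<^sub>R J c x (u m))" for x
  have sF: "smooth_on T F"
    unfolding F_def[abs_def]
    by (intro smooth_on_sum smooth_on_add smooth_on_scaleR smooth_on_Re smooth_on_Im smooth_on_const sG sJ T(1))
  have "F x = coframe.f (\<lambda>i. \<alpha> i c x) k" if x: "x \<in> T" for x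
  proof -
    interpret t: coframe "J c x" "\<lambda>i. \<alpha> i c x" by (rule coframing_coframe[OF J \<alpha> c]) (use x T(3) in blast)
    have "H x *v (\<chi> m. G m x) = axis k 1"
      using cramer[OF nz'[OF x], of "\<chi> m. G m x" "axis k 1"] by (simp add: G_def D_def)
    then have "(H x *v (\<chi> m. G m x)) $ i = axis k 1 $ i" for i by simp
    then have g: "(\<Sum>m\<in>UNIV. G m x * \<alpha> i c x [u m]) = (if i = k then 1 else 0)" for i
      by (simp add: matrix_vector_mult_def H_def axis_def mult.commute)
    have "\<alpha> i c x [F x] = (\<Sum>m\<in>UNIV. G m x * \<alpha> i c x [u m])" for i
      unfolding F_def linear_sum[OF t.linear_\<theta>]
      by (intro sum.cong refl) (simp add: linear_add[OF t.linear_\<theta>] linear_cmul[OF t.linear_\<theta>] t.\<theta>_j scaleR_complex complex_eq_iff)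
    then show ?thesis by (intro t.\<theta>_eqI) (simp add: g t.\<theta>_f)
  qed
  then have "smooth_on T (\<lambda>x. coframe.f (\<lambda>i. \<alpha> i c x) k)" by (rule smooth_on_cong[OF T(1) _ sF])
  then show "\<exists>T. open T \<and> x0 \<in> T \<and> smooth_on T (\<lambda>x. coframe.f (\<lambda>i. \<alpha> i c x) k)" using T by blast
qed

lemma exists_connection:
  assumes J: "almost_complex A J" and \<alpha>: "coframing A J U \<alpha>"
  shows "\<exists>\<kappa>. connection02 A J U \<alpha> \<kappa>"
proof -
  define \<kappa> where "\<kappa> i k c x = covector (coframe.conn (J c x) (\<lambda>i. \<alpha> i c x) (ext_d (\<alpha> i c) x) k)" for i k c x
  have alt: "alt_form 1 (\<kappa> i k c x)" if "c \<in> A" "x \<in> coord_set c U" for i k c x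
  proof -
    interpret t: coframe "J c x" "\<lambda>i. \<alpha> i c x" by (rule coframing_coframe[OF J \<alpha> that])
    show ?thesis unfolding \<kappa>_def by (intro alt_covector t.linear_conn coframing_ext_d_alt[OF \<alpha> that])
  qed
  have smooth: "smooth_on (coord_set c U) (\<lambda>x. \<kappa> i k c x vs)" if c: "c \<in> A" for i k c vs
  proof (cases "length vs = 1")
    case True
    then obtain v where v: "vs = [v]" by (auto simp: length_Suc_conv)
    let ?W = "coord_set c U" and ?f = "\<lambda>x. coframe.f (\<lambda>i. \<alpha> i c x) k" and ?\<omega> = "\<lambda>x. ext_d (\<alpha> i c) x"
    have o: "open ?W" by (rule open_coord_set[OF c coframingD(1)[OF \<alpha>]])
    have s\<omega>: "smooth_on ?W (\<lambda>x. ?\<omega> x ws)" for ws by (rule smooth_ext_d[OF o smooth_coframing[OF \<alpha> c]])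
    have alt\<omega>: "alt_form 2 (?\<omega> x)" if "x \<in> ?W" for x by (rule coframing_ext_d_alt[OF \<alpha> c that])
    have sJ: "smooth_on ?W (\<lambda>x. J c x v)" for v
      by (rule smooth_on_subset[OF almost_complexD(3)[OF J c] coord_set_mono[OF subset_UNIV]])
    have lJ: "linear (J c x)" if "x \<in> ?W" for x by (rule almost_complexD(1)[OF J c coord_set_UNIV[OF that]])
    have sf: "smooth_on ?W ?f" by (rule smooth_frame[OF J \<alpha> c])
    have sJf: "smooth_on ?W (\<lambda>x. J c x (?f x))" by (rule smooth_on_linear_family[OF o sJ sf lJ])
    have 1: "smooth_on ?W (\<lambda>x. ?\<omega> x [g x, v])" if g: "smooth_on ?W g" for g v
      by (rule smooth_on_linear_family[where F = "\<lambda>x u. ?\<omega> x [u, v]", OF o s\<omega> g alt_form_2_bilinear(1)[OF alt\<omega>]])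
    have 2: "smooth_on ?W (\<lambda>x. ?\<omega> x [g x, J c x v])" if g: "smooth_on ?W g" for g
      by (rule smooth_on_linear_family[where F = "\<lambda>x u. ?\<omega> x [g x, u]", OF o 1[OF g] sJ alt_form_2_bilinear(2)[OF alt\<omega>]])
    have "smooth_on ?W (\<lambda>x. (3 * ((?\<omega> x [?f x, v] - \<i> * ?\<omega> x [J c x (?f x), v]) / 2) + \<i> * ((?\<omega> x [?f x, J c x v] - \<i> * ?\<omega> x [J c x (?f x), J c x v]) / 2)) / 4)"
      by (intro smooth_on_divide smooth_on_add smooth_on_diff smooth_on_mult smooth_on_const o 1 2 sf sJf) auto
    then show ?thesis
      by (rule smooth_on_cong[OF o, rotated])
        (simp add: v \<kappa>_def coframe.conn_def[OF coframing_coframe[OF J \<alpha> c]] coframe.ev_def[OF coframing_coframe[OF J \<alpha> c]])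
  next
    case False
    then show ?thesis by (simp add: \<kappa>_def covector_def smooth_on_const open_coord_set[OF c coframingD(1)[OF \<alpha>]])
  qed
  have trans: "\<kappa> i k c' (transition c c' x) (map (transition_deriv c c' x) vs) = \<kappa> i k c x vs"
    if c: "c \<in> A" "c' \<in> A" "x \<in> coord_set c (U \<inter> fst c')" for c c' x vs i k
  proof -
    have x: "x \<in> coord_set c U" "x \<in> coord_set c (fst c')" using c(3) by (auto simp: coord_set_def)
    have y: "transition c c' x \<in> coord_set c' U" using transition_in[OF c] by (auto simp: coord_set_def)
    interpret t: coframe "J c x" "\<lambda>i. \<alpha> i c x" by (rule coframing_coframe[OF J \<alpha> c(1) x(1)])
    interpret t': coframe "J c' (transition c c' x)" "\<lambda>i. \<alpha> i c' (transition c c' x)" by (rule coframing_coframe[OF J \<alpha> c(2) y])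
    have "t'.conn (ext_d (\<alpha> i c') (transition c c' x)) k (transition_deriv c c' x v) = t.conn (ext_d (\<alpha> i c) x) k v" for v
      by (simp add: t'.conn_def t.conn_def t'.ev_def t.ev_def frame_transition[OF J \<alpha> c]
        almost_complexD(4)[OF J c(1,2) x(2)] ext_d_transition[OF coframingD(2)[OF \<alpha>] coframingD(1)[OF \<alpha>] c])
    then show ?thesis by (cases vs) (simp_all add: \<kappa>_def covector_def)
  qed
  have "ext_d (\<alpha> i c) x vs = - (\<Sum>k\<in>UNIV. (\<kappa> i k c x \<and>\<^sub>e \<alpha> k c x) vs) + (\<Sum>m\<in>UNIV. Nmat J \<alpha> c x $ i $ m * cnj2 (\<lambda>i. \<alpha> i c x) m vs)"
    if c: "c \<in> A" "x \<in> coord_set c U" for c x i vs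
  proof -
    interpret t: coframe "J c x" "\<lambda>i. \<alpha> i c x" by (rule coframing_coframe[OF J \<alpha> c])
    have alt2: "alt_form 2 (ext_d (\<alpha> i c) x)" by (rule coframing_ext_d_alt[OF \<alpha> c])
    show ?thesis
    proof (cases "length vs = 2")
      case True
      then obtain u v where vs: "vs = [u, v]" using length_2E by blast
      have "(\<kappa> i k c x \<and>\<^sub>e \<alpha> k c x) vs = t.conn (ext_d (\<alpha> i c) x) k u * \<alpha> k c x [v] - t.conn (ext_d (\<alpha> i c) x) k v * \<alpha> k c x [u]" for k
        unfolding vs wedge_1_1[OF alt_form_degree[OF alt[OF c]]] by (simp add: \<kappa>_def)
      then show ?thesis
        unfolding vs using t.conn_eq[OF alt2, of u v] Nmat_P02[OF J \<alpha> c, of i u v] by (simp add: sum_cnj2[OF t.degree_\<theta>])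
    next
      case False
      have "degree_form 2 (\<kappa> i k c x \<and>\<^sub>e \<alpha> k c x)" for k
        using degree_wedge[OF alt_form_degree[OF alt[OF c]] t.degree_\<theta>, of i k k] by (simp add: numeral_2_eq_2)
      moreover have "degree_form 2 (cnj2 (\<lambda>i. \<alpha> i c x) m)" for m by (intro alt_form_degree alt_cnj2 t.alt_\<theta>)
      ultimately show ?thesis using False alt_form_degree[OF alt2] by (simp add: degree_form_def)
    qed
  qed
  then have "connection02 A J U \<alpha> \<kappa>"
    unfolding connection02_def form_on_def using alt smooth trans by blast
  then show ?thesis by blast
qed

end

section \<open>Test variations\<close>

lemma det_rows_linear:
  fixes g :: "real^6 \<Rightarrow> real^6"
  assumes g: "linear g"
  shows "det (vector [g a1, g a2, g a3, g a4, g a5, g a6] :: real^6^6) = det (matrix g) * det (vector [a1, a2, a3, a4, a5, a6] :: real^6^6)"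
proof -
  define M :: "real^6^6" where "M = vector [a1, a2, a3, a4, a5, a6]"
  have "(vector [g a1, g a2, g a3, g a4, g a5, g a6] :: real^6^6) = (\<chi> i. g (M $ i))"
    unfolding vec_eq_iff[of "vector _"]
  proof
    fix i :: 6
    show "(vector [g a1, g a2, g a3, g a4, g a5, g a6] :: real^6^6) $ i = (\<chi> i. g (M $ i)) $ i"
      using exhaust_6[of i] by (auto simp: M_def vector_def)
  qed
  also have "\<dots> = M ** transpose (matrix g)"
  proof -
    have "g v $ k = (\<Sum>l\<in>UNIV. v $ l * matrix g $ k $ l)" for v k
    proof -
      have "g v $ k = (matrix g *v v) $ k" by (simp add: fun_cong[OF matrix_vector_mul(2)[OF g]])
      then show ?thesis by (simp add: matrix_vector_mult_def mult.commute)
    qed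
    then show ?thesis by (simp add: vec_eq_iff matrix_matrix_mult_def transpose_def)
  qed
  finally show ?thesis by (simp add: M_def det_mul mult.commute)
qed

lemma det_one_plus_nilpotent:
  fixes s :: "real^6 \<Rightarrow> real^6"
  assumes s: "linear s" "\<And>v. s (s v) = 0"
  shows "det (matrix (\<lambda>v. v + s v)) > 0"
proof -
  have lin: "linear (\<lambda>v. v + r *\<^sub>R s v)" for r
    by (intro linear_compose_add linear_ident linear_compose_scale_right s)
  have comp: "matrix (\<lambda>v. v + (p + q) *\<^sub>R s v) = matrix (\<lambda>v. v + p *\<^sub>R s v) ** matrix (\<lambda>v. v + q *\<^sub>R s v)" for p q
    using matrix_compose[OF lin[of q] lin[of p]]
    by (simp add: o_def linear_add[OF s(1)] linear_cmul[OF s(1)] s(2) algebra_simps)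
  have "matrix (\<lambda>v. v + (1 + (- 1)) *\<^sub>R s v) = (mat 1 :: real^6^6)" using matrix_id_mat_1 by (simp add: id_def)
  then have "det (matrix (\<lambda>v. v + 1 *\<^sub>R s v) ** matrix (\<lambda>v. v + (-1) *\<^sub>R s v)) = 1" unfolding comp by simp
  then have "det (matrix (\<lambda>v. v + 1 *\<^sub>R s v)) * det (matrix (\<lambda>v. v + (-1) *\<^sub>R s v)) = 1"
    unfolding det_mul .
  then have "det (matrix (\<lambda>v. v + s v)) \<noteq> 0" by auto
  moreover have "det (matrix (\<lambda>v. v + s v)) = (det (matrix (\<lambda>v. v + (1 / 2) *\<^sub>R s v)))\<^sup>2"
    using comp[of "1 / 2" "1 / 2"] by (simp add: det_mul power2_eq_square)
  ultimately show ?thesis by (simp add: less_le)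
qed

text \<open>Such a perturbation of \<open>j\<close> is conjugate to \<open>j\<close> by \<open>1 - r T j / 2\<close>, a map of positive determinant.\<close>

lemma orientation_perturbed:
  fixes j T :: "real^6 \<Rightarrow> real^6" and r :: real
  assumes j: "linear j" "\<And>v. j (j v) = - v" and T: "linear T" "\<And>v. T (T v) = 0" "\<And>v. T (j v) = - j (T v)"
    and orient: "\<And>v1 v2 v3. det (vector [v1, j v1, v2, j v2, v3, j v3] :: real^6^6) \<noteq> 0 \<Longrightarrow>
      det (vector [v1, j v1, v2, j v2, v3, j v3] :: real^6^6) > 0"
  defines "j' \<equiv> \<lambda>v. j v + r *\<^sub>R T v"
  assumes nz: "det (vector [v1, j' v1, v2, j' v2, v3, j' v3] :: real^6^6) \<noteq> 0"
  shows "det (vector [v1, j' v1, v2, j' v2, v3, j' v3] :: real^6^6) > 0"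
proof -
  define s where "s v = (- r / 2) *\<^sub>R T (j v)" for v
  have ls: "linear s" unfolding s_def[abs_def]
    using linear_compose[OF j(1) T(1)] by (intro linear_compose_scale_right) (simp add: o_def)
  have jT0: "j 0 = 0" "T 0 = 0" by (rule linear_0[OF j(1)] linear_0[OF T(1)])+
  have ss: "s (s v) = 0" for v
    by (simp add: s_def linear_cmul[OF T(1)] linear_cmul[OF j(1)] linear_neg[OF T(1)] linear_neg[OF j(1)] T(2,3) j(2) jT0)
  define g where "g v = v + s v" for v
  have lg: "linear g" unfolding g_def[abs_def] by (intro linear_compose_add linear_ident ls)
  have 1: "g (v - s v) = v" for v by (simp add: g_def linear_diff[OF ls] ss)
  have 2: "g (j (v - s v)) = j' v" for v
    by (simp add: g_def j'_def s_def linear_add[OF T(1)] linear_diff[OF j(1)] linear_diff[OF T(1)] linear_cmul[OF T(1)] linear_cmul[OF j(1)]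
      linear_neg[OF T(1)] linear_neg[OF j(1)] T(2,3) j(2) jT0 flip: scaleR_add_left) (simp add: vec_eq_iff)
  have e: "det (vector [v1, j' v1, v2, j' v2, v3, j' v3] :: real^6^6) = det (matrix g) *
    det (vector [v1 - s v1, j (v1 - s v1), v2 - s v2, j (v2 - s v2), v3 - s v3, j (v3 - s v3)] :: real^6^6)"
    using det_rows_linear[OF lg, of "v1 - s v1" "j (v1 - s v1)" "v2 - s v2" "j (v2 - s v2)" "v3 - s v3" "j (v3 - s v3)"]
    unfolding 1 2 .
  have "det (matrix g) > 0" unfolding g_def[abs_def] by (rule det_one_plus_nilpotent[OF ls ss])
  then show ?thesis using nz orient unfolding e by (simp add: zero_less_mult_iff)
qed

context atlas
begin

definition tangent :: "'a endo_field \<Rightarrow> 'a set \<Rightarrow> (3 \<Rightarrow> 'a form_field) \<Rightarrow> ('a \<Rightarrow> real) \<Rightarrow> (3 \<Rightarrow> 3 \<Rightarrow> complex) \<Rightarrow> 'a endo_field" where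
  "tangent J U \<alpha> b \<Phi> c x v = (if chart_inv c x \<in> U then coframe.vector_of (J c x) (\<lambda>i. \<alpha> i c x)
     (\<lambda>i. complex_of_real (b (chart_inv c x)) * (2 * \<i> * (\<Sum>k\<in>UNIV. \<Phi> i k * cnj (\<alpha> k c x [v])))) else 0)"

lemma test_variation:
  assumes J: "almost_complex A J" "induces_orientation A J" and \<alpha>: "coframing A J U \<alpha>"
    and b: "smooth_function A b" "closure {p. b p \<noteq> 0} \<subseteq> U"
    and \<Phi>: "\<And>i l. (\<Sum>k\<in>UNIV. \<Phi> i k * cnj (\<Phi> k l)) = 0"
  shows "smooth_variation A J 1 (\<lambda>t c x v. J c x v + t *\<^sub>R tangent J U \<alpha> b \<Phi> c x v)"
proof -
  let ?T = "tangent J U \<alpha> b \<Phi>"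
  define z where "z c x v i = complex_of_real (b (chart_inv c x)) * (2 * \<i> * (\<Sum>k\<in>UNIV. \<Phi> i k * cnj (\<alpha> k c x [v])))" for c x v i
  have T_out: "?T c x v = 0" if "chart_inv c x \<notin> U" for c x v using that by (simp add: tangent_def)
  have xU: "x \<in> coord_set c U" if "c \<in> A" "x \<in> coord_set c UNIV" "chart_inv c x \<in> U" for c x
    using coord_set_iff[OF that(1), of x U] that by blast
  have cf: "coframe (J c x) (\<lambda>i. \<alpha> i c x)" if "c \<in> A" "x \<in> coord_set c U" for c x
    by (rule coframing_coframe[OF J(1) \<alpha> that])
  have T_in: "?T c x v = coframe.vector_of (J c x) (\<lambda>i. \<alpha> i c x) (z c x v)" if "c \<in> A" "x \<in> coord_set c U" for c x v
    using chart_inv_in[OF that] by (simp add: tangent_def z_def[abs_def])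
  have \<alpha>T: "\<alpha> i c x [?T c x v] = z c x v i" if "c \<in> A" "x \<in> coord_set c U" for c x v i
    unfolding T_in[OF that] by (rule coframe.\<theta>_vector_of[OF cf[OF that]])
  have lin: "linear (?T c x)" and TJ: "?T c x (J c x v) = - J c x (?T c x v)" and TT: "?T c x (?T c x v) = 0"
    if c: "c \<in> A" "x \<in> coord_set c UNIV" for c x v
  proof -
    have "linear (?T c x) \<and> ?T c x (J c x v) = - J c x (?T c x v) \<and> ?T c x (?T c x v) = 0"
    proof (cases "chart_inv c x \<in> U")
      case False
      have "J c x 0 = 0" by (rule linear_0[OF almost_complexD(1)[OF J(1) c]])
      then show ?thesis using T_out[OF False] by (simp add: linear_iff)
    next
      case True
      note xu = xU[OF c True]
      interpret t: coframe "J c x" "\<lambda>i. \<alpha> i c x" by (rule cf[OF c(1) xu])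
      note \<alpha>T = \<alpha>T[OF c(1) xu]
      have "?T c x (u + w) = ?T c x u + ?T c x w" for u w
        by (rule t.\<theta>_eqI) (simp add: \<alpha>T linear_add[OF t.linear_\<theta>] z_def sum.distrib ring_distribs)
      moreover have "?T c x (r *\<^sub>R u) = r *\<^sub>R ?T c x u" for r u
        by (rule t.\<theta>_eqI) (simp add: \<alpha>T linear_cmul[OF t.linear_\<theta>] z_def sum_distrib_left scaleR_complex mult_ac)
      moreover have "?T c x (J c x v) = - J c x (?T c x v)"
        by (rule t.\<theta>_eqI) (simp add: \<alpha>T linear_neg[OF t.linear_\<theta>] t.\<theta>_j z_def sum_distrib_left sum_negf[symmetric] mult_ac)
      moreover have "?T c x (?T c x v) = 0"
      proof (rule t.\<theta>_eqI)
        fix i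
        have "(\<Sum>k\<in>UNIV. \<Phi> i k * cnj (z c x v k)) = complex_of_real (b (chart_inv c x)) * (- 2 * \<i> * (\<Sum>k\<in>UNIV. \<Sum>l\<in>UNIV. \<Phi> i k * cnj (\<Phi> k l) * \<alpha> l c x [v]))"
          by (simp add: z_def sum_distrib_left mult_ac)
        also have "(\<Sum>k\<in>UNIV. \<Sum>l\<in>UNIV. \<Phi> i k * cnj (\<Phi> k l) * \<alpha> l c x [v]) = (\<Sum>l\<in>UNIV. (\<Sum>k\<in>UNIV. \<Phi> i k * cnj (\<Phi> k l)) * \<alpha> l c x [v])"
          unfolding sum_distrib_right by (rule sum.swap)
        finally have "(\<Sum>k\<in>UNIV. \<Phi> i k * cnj (z c x v k)) = 0" by (simp add: \<Phi>)
        then show "\<alpha> i c x [?T c x (?T c x v)] = \<alpha> i c x [0]"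
          unfolding \<alpha>T z_def[of c x "?T c x v"] by (simp add: linear_0[OF t.linear_\<theta>])
      qed
      ultimately show ?thesis by (simp add: linear_iff)
    qed
    then show "linear (?T c x)" "?T c x (J c x v) = - J c x (?T c x v)" "?T c x (?T c x v) = 0" by blast+
  qed
  have smooth: "smooth_on (coord_set c UNIV) (\<lambda>x. ?T c x v)" if c: "c \<in> A" for c v
  proof (rule smooth_on_local)
    fix x assume x: "x \<in> coord_set c UNIV"
    show "\<exists>V. open V \<and> x \<in> V \<and> smooth_on V (\<lambda>x. ?T c x v)"
    proof (cases "chart_inv c x \<in> U")
      case True
      let ?W = "coord_set c U"
      have o: "open ?W" by (rule open_coord_set[OF c coframingD(1)[OF \<alpha>]])
      have sb: "smooth_on ?W (\<lambda>x. b (chart_inv c x))"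
        by (rule smooth_on_subset[OF smooth_functionD[OF b(1) c] coord_set_mono[OF subset_UNIV]])
      have sz: "smooth_on ?W (\<lambda>x. z c x v i)" for i
        unfolding z_def by (intro smooth_on_mult smooth_on_of_real smooth_on_const smooth_on_sum smooth_on_cnj smooth_coframing[OF \<alpha> c] sb o)
      have sf: "smooth_on ?W (\<lambda>x. coframe.f (\<lambda>i. \<alpha> i c x) k)" for k by (rule smooth_frame[OF J(1) \<alpha> c])
      have sJ: "smooth_on ?W (\<lambda>x. J c x v)" for v
        by (rule smooth_on_subset[OF almost_complexD(3)[OF J(1) c] coord_set_mono[OF subset_UNIV]])
      have sJf: "smooth_on ?W (\<lambda>x. J c x (coframe.f (\<lambda>i. \<alpha> i c x) k))" for k
        by (rule smooth_on_linear_family[OF o sJ sf almost_complexD(1)[OF J(1) c coord_set_UNIV]])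
      have "smooth_on ?W (\<lambda>x. \<Sum>k\<in>UNIV. Re (z c x v k) *\<^sub>R coframe.f (\<lambda>i. \<alpha> i c x) k + Im (z c x v k) *\<^sub>R J c x (coframe.f (\<lambda>i. \<alpha> i c x) k))"
        by (intro smooth_on_sum smooth_on_add smooth_on_scaleR smooth_on_Re smooth_on_Im sz sf sJf o)
      then have "smooth_on ?W (\<lambda>x. ?T c x v)"
        by (rule smooth_on_cong[OF o, rotated]) (simp add: T_in[OF c] coframe.vector_of_def[OF cf[OF c]])
      then show ?thesis using o xU[OF c x True] by blast
    next
      case False
      let ?V = "coord_set c (- closure {p. b p \<noteq> 0})"
      have o: "open ?V" by (rule open_coord_set[OF c]) (simp add: open_Compl)
      have "x \<in> ?V" using False b(2) x coord_set_iff[OF c, of x "- closure {p. b p \<noteq> 0}"] by blast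
      moreover have "?T c y v = 0" if "y \<in> ?V" for y
      proof -
        have "b (chart_inv c y) = 0" using chart_inv_in[OF c that] closure_subset[of "{p. b p \<noteq> 0}"] by blast
        moreover have "coframe.vector_of (J c y) (\<lambda>i. \<alpha> i c y) (\<lambda>i. 0) = 0" if "chart_inv c y \<in> U"
          using coframe.vector_of_def[OF cf[OF c xU[OF c coord_set_UNIV[OF \<open>y \<in> ?V\<close>] that]]] by simp
        ultimately show ?thesis by (simp add: tangent_def)
      qed
      then have "smooth_on ?V (\<lambda>x. ?T c x v)" by (intro smooth_on_cong[OF o _ smooth_on_const[OF o, of 0]]) simp
      ultimately show ?thesis using o by blast
    qed
  qed
  have trans: "?T c' (transition c c' x) (transition_deriv c c' x v) = transition_deriv c c' x (?T c x v)"
    if c: "c \<in> A" "c' \<in> A" "x \<in> coord_set c (fst c')" for c c' x v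
  proof (cases "chart_inv c x \<in> U")
    case False
    then show ?thesis
      using T_out chart_inv_transition[OF c] linear_0[OF linear_transition_deriv[OF c]] by simp
  next
    case True
    have x: "x \<in> coord_set c (U \<inter> fst c')" "x \<in> coord_set c U"
      using True c(3) coord_set_iff[OF c(1), of x U] coord_set_iff[OF c(1), of x "fst c'"] coord_set_iff[OF c(1), of x "U \<inter> fst c'"] by blast+
    have y: "transition c c' x \<in> coord_set c' U" using transition_in[OF c(1,2) x(1)] by (auto simp: coord_set_def)
    interpret t: coframe "J c' (transition c c' x)" "\<lambda>i. \<alpha> i c' (transition c c' x)" by (rule cf[OF c(2) y])
    have tr: "\<alpha> i c' (transition c c' x) [transition_deriv c c' x u] = \<alpha> i c x [u]" for i u
      using form_onD(3)[OF coframingD(2)[OF \<alpha>] c(1,2) x(1), of i "[u]"] by simp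
    show ?thesis
      by (rule t.\<theta>_eqI) (simp add: \<alpha>T[OF c(2) y] tr \<alpha>T[OF c(1) x(2)] z_def chart_inv_transition[OF c])
  qed
  let ?Jt = "\<lambda>t c x v. J c x v + t *\<^sub>R ?T c x v"
  have ac: "almost_complex A (?Jt t)" for t
    unfolding almost_complex_def
  proof (intro conjI ballI allI)
    fix c x assume c: "c \<in> A" "x \<in> coord_set c UNIV"
    note lJ = almost_complexD(1)[OF J(1) c]
    show "linear (?Jt t c x)" by (intro linear_compose_add linear_compose_scale_right lJ lin[OF c])
    show "?Jt t c x (?Jt t c x v) = - v" for v
      by (simp add: linear_add[OF lJ] linear_cmul[OF lJ] linear_add[OF lin[OF c]] linear_cmul[OF lin[OF c]] TJ[OF c] TT[OF c] almost_complexD(2)[OF J(1) c])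
  next
    fix c v assume c: "c \<in> A"
    show "smooth_on (coord_set c UNIV) (\<lambda>x. ?Jt t c x v)"
      by (intro smooth_on_add smooth_on_scaleR smooth_on_const smooth c almost_complexD(3)[OF J(1)] open_coord_set open_UNIV)
  next
    fix c c' x v assume c: "c \<in> A" "c' \<in> A" "x \<in> coord_set c (fst c')"
    note l = linear_transition_deriv[OF c]
    show "?Jt t c' (transition c c' x) (transition_deriv c c' x v) = transition_deriv c c' x (?Jt t c x v)"
      by (simp add: trans[OF c] almost_complexD(4)[OF J(1) c] linear_add[OF l] linear_cmul[OF l])
  qed
  have or: "induces_orientation A (?Jt t)" for t
    unfolding induces_orientation_def Let_def
  proof (intro ballI allI impI)
    fix c x v1 v2 v3 assume c: "c \<in> A" "x \<in> coord_set c UNIV"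
      and nz: "det (vector [v1, ?Jt t c x v1, v2, ?Jt t c x v2, v3, ?Jt t c x v3] :: real^6^6) \<noteq> 0"
    show "det (vector [v1, ?Jt t c x v1, v2, ?Jt t c x v2, v3, ?Jt t c x v3] :: real^6^6) > 0"
      by (rule orientation_perturbed[OF almost_complexD(1,2)[OF J(1) c] lin[OF c] TT[OF c] TJ[OF c] _ nz])
        (use J(2) c in \<open>auto simp: induces_orientation_def Let_def\<close>)
  qed
  have sm: "smooth_on ({-1<..<1} \<times> coord_set c UNIV) (\<lambda>(t, x). ?Jt t c x v)" if c: "c \<in> A" for c v
  proof -
    let ?W = "coord_set c UNIV" and ?S = "{-1<..<1::real} \<times> coord_set c UNIV"
    have oW: "open ?W" by (rule open_coord_set[OF c open_UNIV])
    have o: "open ?S" by (intro open_Times oW) auto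
    have 1: "smooth_on ?S (\<lambda>p. g (snd p))" if "smooth_on ?W g" for g :: "real^6 \<Rightarrow> real^6"
      by (rule smooth_on_compose[OF o oW smooth_on_linear[OF bounded_linear_snd o] that]) auto
    have "smooth_on ?S (\<lambda>p. J c (snd p) v + fst p *\<^sub>R ?T c (snd p) v)"
      by (rule smooth_on_add[OF o 1[OF almost_complexD(3)[OF J(1) c]] smooth_on_scaleR[OF o smooth_on_linear[OF bounded_linear_fst o] 1[OF smooth[OF c]]]])
    then show ?thesis by (simp add: case_prod_unfold)
  qed
  have "?Jt 0 = J" by (intro ext) simp
  then show ?thesis unfolding smooth_variation_def using ac or sm by (intro conjI ballI allI) simp_all
qed

end

section \<open>The Euler-Lagrange equation\<close>

lemma null_matrices_pairing:
  fixes E :: "3 \<Rightarrow> 3 \<Rightarrow> complex"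
  assumes *: "\<And>\<Phi>. (\<And>i l. (\<Sum>k\<in>UNIV. \<Phi> i k * cnj (\<Phi> k l)) = 0) \<Longrightarrow> Re (\<Sum>i\<in>UNIV. \<Sum>j\<in>UNIV. \<Phi> i j * E i j) = 0"
  shows "E i j = 0"
proof -
  have rank1: "(\<Sum>i\<in>UNIV. \<Sum>j\<in>UNIV. v i * w j * E i j) = 0" if vw: "(\<Sum>k\<in>UNIV. w k * cnj (v k)) = 0" for v w :: "3 \<Rightarrow> complex"
  proof -
    have "(\<Sum>k\<in>UNIV. (a * v i * w k) * cnj (a * v k * w l)) = (a * cnj a * v i * cnj (w l)) * (\<Sum>k\<in>UNIV. w k * cnj (v k))" for a i l
      by (simp add: sum_distrib_left mult_ac)
    then have n: "(\<Sum>k\<in>UNIV. (a * v i * w k) * cnj (a * v k * w l)) = 0" for a i l using vw by simp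
    have "Re (\<Sum>i\<in>UNIV. \<Sum>j\<in>UNIV. (a * v i * w j) * E i j) = 0" for a
      by (rule *[of "\<lambda>i j. a * v i * w j", OF n])
    then have "Re (a * (\<Sum>i\<in>UNIV. \<Sum>j\<in>UNIV. v i * w j * E i j)) = 0" for a by (simp add: sum_distrib_left mult.assoc)
    from this[of 1] this[of "- \<i>"] show ?thesis by (simp add: complex_eq_iff)
  qed
  let ?e = "\<lambda>p k :: 3. if k = p then 1 else 0 :: complex"
  have pair: "(\<Sum>i\<in>UNIV. \<Sum>j\<in>UNIV. (?e p i + a * ?e q i) * (b * ?e r j + d * ?e s j) * E i j) =
      b * E p r + d * E p s + a * b * E q r + a * d * E q s" for p q r s a b d
  proof -
    have d: "(\<Sum>j\<in>UNIV. \<Sum>i\<in>UNIV. (?e p i * ?e r j) * E i j) = E p r" for p r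
    proof -
      have "(\<Sum>i\<in>UNIV. (?e p i * ?e r j) * E i j) = (if j = r then E p r else 0)" for j
        by (simp add: if_distrib[of "\<lambda>x. x * _"] if_distrib[of "\<lambda>x. _ * x"] cong: if_cong)
      then show ?thesis by simp
    qed
    have "(\<Sum>i\<in>UNIV. \<Sum>j\<in>UNIV. (?e p i + a * ?e q i) * (b * ?e r j + d * ?e s j) * E i j) =
      (\<Sum>j\<in>UNIV. \<Sum>i\<in>UNIV. b * ((?e p i * ?e r j) * E i j) + d * ((?e p i * ?e s j) * E i j) + a * b * ((?e q i * ?e r j) * E i j) + a * d * ((?e q i * ?e s j) * E i j))"
      by (subst sum.swap) (intro sum.cong refl, simp add: algebra_simps)
    then show ?thesis unfolding sum.distrib sum_distrib_left[symmetric] d .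
  qed
  have off: "E p q = 0" if "p \<noteq> q" for p q
    using rank1[of "\<lambda>j. 1 * ?e q j + 0 * ?e q j" "\<lambda>i. ?e p i + 0 * ?e p i"] pair[of p 0 p 1 q 0 q] that
    by (simp add: if_distrib[of "\<lambda>x. x * _"] cong: if_cong)
  have diag: "E p p = 0" if pq: "p \<noteq> q" for p q
  proof -
    have "(\<Sum>k\<in>UNIV. (1 * ?e p k + (- 1) * ?e q k) * cnj (?e p k + 1 * ?e q k)) = (\<Sum>k\<in>UNIV. ?e p k - ?e q k)"
      by (intro sum.cong refl) (use pq in auto)
    then have "E p p - E q q = 0"
      using rank1[of "\<lambda>j. 1 * ?e p j + (- 1) * ?e q j" "\<lambda>i. ?e p i + 1 * ?e q i"] pair[of p 1 q 1 p "- 1" q] off[OF pq] off[of q p] pq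
      by (simp add: sum_subtractf)
    moreover have "(\<Sum>k\<in>UNIV. (1 * ?e p k + (- \<i>) * ?e q k) * cnj (?e p k + \<i> * ?e q k)) = (\<Sum>k\<in>UNIV. ?e p k - ?e q k)"
      by (intro sum.cong refl) (use pq in auto)
    then have "E p p + E q q = 0"
      using rank1[of "\<lambda>j. 1 * ?e p j + (- \<i>) * ?e q j" "\<lambda>i. ?e p i + \<i> * ?e q i"] pair[of p \<i> q 1 p "- \<i>" q] off[OF pq] off[of q p] pq
      by (simp add: sum_subtractf)
    ultimately have "E p p + E p p = 0" by algebra
    then show ?thesis by simp
  qed
  show ?thesis
  proof (cases "i = j")
    case True
    have "\<exists>q. j \<noteq> q" using exhaust_3[of j] by (metis zero_neq_one one_neq_zero num1_eq1 exhaust_3)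
    then show ?thesis using diag True by blast
  qed (rule off)
qed

context atlas
begin

lemma critical_pairing:
  assumes M: "compact (UNIV :: 'a set)" and J: "almost_complex A J" "induces_orientation A J"
    and crit: "critical_point A c1 c2 J" and L: "L_partials c1 c2 L'"
    and \<alpha>: "coframing A J U \<alpha>" and \<kappa>: "connection02 A J U \<alpha> \<kappa>" and c: "c \<in> A" "x0 \<in> coord_set c U"
    and \<Phi>: "\<And>i l. (\<Sum>k\<in>UNIV. \<Phi> i k * cnj (\<Phi> k l)) = 0"
  shows "Re (\<Sum>i\<in>UNIV. \<Sum>j\<in>UNIV. \<Phi> i j * el_expr L' J \<alpha> \<kappa> c i j x0 std_basis) \<le> 0"
proof (rule ccontr)
  let ?W = "coord_set c U" and ?S = "\<lambda>x. \<Sum>i\<in>UNIV. \<Sum>j\<in>UNIV. \<Phi> i j * el_expr L' J \<alpha> \<kappa> c i j x std_basis"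
  let ?h = "\<lambda>x. Re (?S x)"
  assume "\<not> ?h x0 \<le> 0"
  then have pos: "?h x0 > 0" by simp
  have oW: "open ?W" by (rule open_coord_set[OF c(1) coframingD(1)[OF \<alpha>]])
  have sS: "smooth_on ?W ?S"
    by (intro smooth_on_sum smooth_on_mult smooth_on_const oW smooth_el_expr[OF J(1) \<alpha> c(1) L \<kappa>])
  have ch: "continuous_on ?W ?h" by (rule smooth_on_continuous_on[OF smooth_on_Re[OF oW sS]])
  define V where "V = ?W \<inter> ?h -` {0<..}"
  have oV: "open V" unfolding V_def by (rule continuous_open_preimage[OF ch oW open_greaterThan])
  define P where "P = fst c \<inter> snd c -` V"
  have "continuous_on (fst c) (snd c)" using chart_homeomorphism[OF c(1)] by (simp add: homeomorphism_def)
  then have oP: "open P" unfolding P_def by (rule continuous_open_preimage[OF _ open_chart[OF c(1)] oV])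
  have PV: "coord_set c P = V"
  proof
    show "coord_set c P \<subseteq> V" by (auto simp: coord_set_def P_def)
    show "V \<subseteq> coord_set c P"
    proof
      fix x assume x: "x \<in> V"
      then have "x \<in> ?W" by (simp add: V_def)
      then obtain p where "p \<in> U \<inter> fst c" "x = snd c p" by (auto simp: coord_set_def)
      then show "x \<in> coord_set c P" using x by (auto simp: coord_set_def P_def)
    qed
  qed
  have PU: "P \<subseteq> U"
  proof
    fix p assume p: "p \<in> P"
    then have "snd c p \<in> ?W" by (auto simp: P_def V_def)
    then show "p \<in> U" using chart_inv_in[OF c(1), of "snd c p" U] chart_inv_left[OF c(1), of p] p by (simp add: P_def)
  qed
  have x0P: "x0 \<in> coord_set c P" unfolding PV using c(2) pos by (simp add: V_def)
  obtain b r where b: "smooth_function A b" "\<And>q. 0 \<le> b q" "closure {q. b q \<noteq> 0} \<subseteq> P \<inter> fst c" and r: "r > 0"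
    and bump: "\<And>q. q \<in> fst c \<Longrightarrow> b q = bump x0 r (snd c q)"
    using exists_bump[OF c(1) x0P oP] by metis
  let ?K = "closure {q. b q \<noteq> 0}"
  have K: "?K \<subseteq> U" "?K \<subseteq> U \<inter> fst c" using b(3) PU by auto
  define Jt where "Jt t c x v = J c x v + t *\<^sub>R tangent J U \<alpha> b \<Phi> c x v" for t c x v
  have var: "smooth_variation A J 1 Jt"
    using test_variation[OF J \<alpha> b(1) K(1) \<Phi>] unfolding Jt_def[abs_def] .
  interpret fv: first_variation A J 1 Jt U \<alpha> \<kappa> c c1 c2 L'
    by unfold_locales (fact var \<alpha> \<kappa> c(1) L)+
  have "((\<lambda>t. Ffun A c1 c2 (Jt t)) has_vector_derivative 0) (at 0)"
    using crit var unfolding critical_point_def by blast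
  then have "integral_form A (fv.density_var c1 c2) = 0"
    by (rule vector_derivative_unique_at[OF fv.Ffun_has_derivative[OF M]])
  moreover have "Jt t d y v = J d y v" if "d \<in> A" "y \<in> coord_set d (- ?K)" for t d y v
  proof -
    have z: "b (chart_inv d y) = 0" using chart_inv_in[OF that] closure_subset[of "{q. b q \<noteq> 0}"] by blast
    have "tangent J U \<alpha> b \<Phi> d y v = 0"
    proof (cases "chart_inv d y \<in> U")
      case True
      then have y: "y \<in> coord_set d U" using coord_set_iff[OF that(1), of y U] coord_set_UNIV[OF that(2)] by blast
      show ?thesis using True z by (simp add: tangent_def coframe.vector_of_def[OF coframing_coframe[OF J(1) \<alpha> that(1) y]])
    qed (simp add: tangent_def)
    then show ?thesis by (simp add: Jt_def)
  qed
  ultimately have I0: "Re (integral ?W (\<lambda>x. \<Sum>i\<in>UNIV. \<Sum>j\<in>UNIV. fv.phi i j x * el_expr L' J \<alpha> \<kappa> c i j x std_basis)) = 0"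
    using fv.integral_density_var[OF M closed_closure K(2)] by simp
  have phi: "fv.phi i k x = complex_of_real (b (chart_inv c x)) * \<Phi> i k" if x: "x \<in> ?W" for i k x
  proof -
    interpret t: coframe "J c x" "\<lambda>i. \<alpha> i c x" by (rule coframing_coframe[OF J(1) \<alpha> c(1) x])
    have xU: "chart_inv c x \<in> U" using chart_inv_in[OF c(1) x] by blast
    have "((\<lambda>t. Jt t c x v) has_vector_derivative tangent J U \<alpha> b \<Phi> c x v) (at 0)" for v
      unfolding Jt_def by (auto intro!: derivative_eq_intros simp: has_vector_derivative_def)
    then have "fv.Jdot x v = tangent J U \<alpha> b \<Phi> c x v" for v
      using vector_derivative_unique_at[OF fv.Jdot(1)[OF coord_set_UNIV[OF x]]] by blast
    then have "fv.phi i k x = - \<i> / 2 * (complex_of_real (b (chart_inv c x)) * (2 * \<i> * (\<Sum>m\<in>UNIV. \<Phi> i m * cnj (\<alpha> m c x [t.f k]))))"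
      using xU by (simp add: fv.phi_def fv.frame_def tangent_def t.\<theta>_vector_of)
    also have "(\<Sum>m\<in>UNIV. \<Phi> i m * cnj (\<alpha> m c x [t.f k])) = \<Phi> i k"
      by (simp add: t.\<theta>_f if_distrib[of cnj] if_distrib[of "\<lambda>x. _ * x"] sum.delta cong: if_cong)
    finally show ?thesis by (simp add: complex_eq_iff)
  qed
  have bx: "b (chart_inv c x) = bump x0 r x" if "x \<in> ?W" for x
    using bump[of "chart_inv c x"] chart_inv_in[OF c(1) that] chart_inv_right[OF c(1) that] by simp
  have cb: "continuous_on ?W (bump x0 r)"
    using smooth_on_continuous_on[OF smooth_bump] continuous_on_subset by blast
  let ?G = "\<lambda>x. complex_of_real (bump x0 r x) * ?S x" and ?g = "\<lambda>x. bump x0 r x * ?h x"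
  have Gint: "?G integrable_on ?W"
  proof (rule set_lebesgue_integral_eq_integral(1)[OF absolutely_integrable_compact_support[OF oW]])
    show "continuous_on ?W ?G" by (intro continuous_intros cb smooth_on_continuous_on[OF sS])
    show "compact (snd c ` ?K)" using compact_coord_image(1)[OF M c(1) closed_closure] b(3) by blast
    show "snd c ` ?K \<subseteq> ?W" using K(2) by (auto simp: coord_set_def)
    show "?G x = 0" if "x \<in> ?W - snd c ` ?K" for x
    proof -
      have "chart_inv c x \<notin> ?K" using coord_set_image_iff[OF c(1), of ?K x] b(3) that coord_set_UNIV by blast
      then have "b (chart_inv c x) = 0" using closure_subset[of "{q. b q \<noteq> 0}"] by blast
      then show ?thesis using bx[of x] that by simp
    qed
  qed
  have gint: "?g integrable_on ?W" and "integral ?W ?g = 0"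
  proof -
    have "integral ?W (\<lambda>x. \<Sum>i\<in>UNIV. \<Sum>j\<in>UNIV. fv.phi i j x * el_expr L' J \<alpha> \<kappa> c i j x std_basis) = integral ?W ?G"
      by (rule integral_cong) (simp add: phi bx sum_distrib_left mult.assoc)
    then have "Re (integral ?W ?G) = 0" using I0 by simp
    moreover have Re: "Re (?G x) = ?g x" for x by simp
    ultimately show "integral ?W ?g = 0" "?g integrable_on ?W"
      using integral_linear[OF Gint bounded_linear_Re] integrable_linear[OF Gint bounded_linear_Re] unfolding o_def Re by simp_all
  qed
  have g0: "?g x \<ge> 0" if "x \<in> ?W" for x
  proof (cases "bump x0 r x = 0")
    case False
    then have "chart_inv c x \<in> ?K" using bx[OF that] closure_subset[of "{q. b q \<noteq> 0}"] by auto
    then have "chart_inv c x \<in> P" using b(3) by blast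
    then have "x \<in> V" using chart_inv_right[OF c(1) that] by (simp add: P_def)
    then show ?thesis using bump_nonneg[of x0 r x] by (simp add: V_def)
  qed simp
  obtain a d where ad: "cbox a d \<subseteq> ?W" "x0 \<in> box a d" using oW c(2) open_contains_cbox by metis
  have gc: "continuous_on (cbox a d) ?g"
    by (rule continuous_on_subset[OF _ ad(1)]) (intro continuous_intros cb ch)
  have gi: "?g integrable_on cbox a d" by (rule integrable_continuous[OF gc])
  have "integral (cbox a d) ?g \<le> integral ?W ?g"
    by (rule integral_subset_le[OF ad(1) gi gint]) (use g0 in blast)
  moreover have "integral (cbox a d) ?g \<ge> 0" by (rule integral_nonneg[OF gi]) (use g0 ad(1) in blast)
  ultimately have "integral (cbox a d) ?g = 0" using \<open>integral ?W ?g = 0\<close> by simp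
  then have hi: "(?g has_integral 0) (cbox a d)" using integrable_integral[OF gi] by simp
  have "?g x0 = 0"
    by (rule has_integral_0_cbox_imp_0[OF gc _ hi]) (use g0 ad box_subset_cbox[of a d] in blast)+
  moreover have "bump x0 r x0 > 0" using bump_pos_iff[OF r, of x0 x0] r by simp
  ultimately show False using pos by simp
qed

lemma critical_imp_EL:
  assumes M: "compact (UNIV :: 'a set)" and J: "almost_complex A J" "induces_orientation A J"
    and crit: "critical_point A c1 c2 J" and L: "L_partials c1 c2 L'"
    and \<alpha>: "coframing A J U \<alpha>" and \<kappa>: "connection02 A J U \<alpha> \<kappa>" and c: "c \<in> A" "x \<in> coord_set c U"
  shows "el_expr L' J \<alpha> \<kappa> c i j x vs = 0"
proof -
  have "el_expr L' J \<alpha> \<kappa> c i j x std_basis = 0"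
  proof (rule null_matrices_pairing)
    fix \<Phi> :: "3 \<Rightarrow> 3 \<Rightarrow> complex"
    assume \<Phi>: "\<And>i l. (\<Sum>k\<in>UNIV. \<Phi> i k * cnj (\<Phi> k l)) = 0"
    let ?E = "\<lambda>i j. el_expr L' J \<alpha> \<kappa> c i j x std_basis"
    have "Re (\<Sum>i\<in>UNIV. \<Sum>j\<in>UNIV. \<Phi> i j * ?E i j) \<le> 0" by (rule critical_pairing[OF M J crit L \<alpha> \<kappa> c \<Phi>])
    moreover have "Re (\<Sum>i\<in>UNIV. \<Sum>j\<in>UNIV. - \<Phi> i j * ?E i j) \<le> 0"
      by (rule critical_pairing[OF M J crit L \<alpha> \<kappa> c]) (simp add: \<Phi>)
    ultimately show "Re (\<Sum>i\<in>UNIV. \<Sum>j\<in>UNIV. \<Phi> i j * ?E i j) = 0" by (simp add: sum_negf)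
  qed
  then show ?thesis using alt_form_6_det[OF el_expr_alt[OF J(1) \<alpha> c(1) L \<kappa> c(2)], of i j vs] by simp
qed

lemma integral_form_sum:
  assumes M: "compact (UNIV :: 'a set)" and I: "finite I" and \<omega>: "\<And>a. a \<in> I \<Longrightarrow> six_form (\<omega> a)"
    and eq: "\<And>c x. c \<in> A \<Longrightarrow> x \<in> coord_set c UNIV \<Longrightarrow> \<eta> c x std_basis = (\<Sum>a\<in>I. \<omega> a c x std_basis)"
  shows "integral_form A \<eta> = (\<Sum>a\<in>I. integral_form A (\<omega> a))"
proof -
  obtain F and \<rho> :: "'a chart \<Rightarrow> 'a \<Rightarrow> real" where F: "finite F" "F \<subseteq> A"
    and \<rho>: "\<And>c. c \<in> F \<Longrightarrow> smooth_function A (\<rho> c)" "\<And>c. c \<in> F \<Longrightarrow> closure {p. \<rho> c p \<noteq> 0} \<subseteq> fst c"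
    and "\<And>p. (\<Sum>c\<in>F. \<rho> c p) = 1"
    and intf: "\<And>\<omega>. integral_form A \<omega> = (\<Sum>c\<in>F. integral (coord_set c UNIV) (\<lambda>x. complex_of_real (\<rho> c (chart_inv c x)) * \<omega> c x std_basis))"
    by (rule integral_form_partition[OF M]) (rule that)
  let ?h = "\<lambda>\<omega> c x. complex_of_real (\<rho> c (chart_inv c x)) * \<omega> c x std_basis"
  have int: "?h (\<omega> a) c integrable_on coord_set c UNIV" if a: "a \<in> I" and c: "c \<in> F" for a c
  proof -
    have cA: "c \<in> A" using c F by blast
    let ?K = "closure {p. \<rho> c p \<noteq> 0}" and ?W = "coord_set c UNIV"
    show ?thesis
    proof (rule set_lebesgue_integral_eq_integral(1)[OF absolutely_integrable_compact_support])
      show "open ?W" by (rule open_coord_set[OF cA open_UNIV])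
      show "continuous_on ?W (?h (\<omega> a) c)"
        using \<omega>[OF a] cA unfolding six_form_def by (intro continuous_on_mult continuous_chart_function \<rho>(1) c) auto
      show "compact (snd c ` ?K)" "snd c ` ?K \<subseteq> ?W"
        using compact_coord_image[OF M cA closed_closure \<rho>(2)[OF c]] coord_set_UNIV by blast+
      show "?h (\<omega> a) c x = 0" if "x \<in> ?W - snd c ` ?K" for x
      proof -
        have "chart_inv c x \<notin> ?K" using coord_set_image_iff[OF cA \<rho>(2)[OF c], of x] that by blast
        then have "\<rho> c (chart_inv c x) = 0" using closure_subset[of "{p. \<rho> c p \<noteq> 0}"] by blast
        then show ?thesis by simp
      qed
    qed
  qed
  have "integral (coord_set c UNIV) (?h \<eta> c) = (\<Sum>a\<in>I. integral (coord_set c UNIV) (?h (\<omega> a) c))" if c: "c \<in> F" for c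
  proof -
    have "integral (coord_set c UNIV) (?h \<eta> c) = integral (coord_set c UNIV) (\<lambda>x. \<Sum>a\<in>I. ?h (\<omega> a) c x)"
      by (rule integral_cong) (simp add: eq[OF subsetD[OF F(2) c]] sum_distrib_left)
    also have "\<dots> = (\<Sum>a\<in>I. integral (coord_set c UNIV) (?h (\<omega> a) c))" by (rule integral_sum[OF I int[OF _ c]])
    finally show ?thesis .
  qed
  then show ?thesis unfolding intf by (simp add: sum.swap[of _ I])
qed

end

context variation
begin

definition damped :: "('a \<Rightarrow> real) \<Rightarrow> real \<Rightarrow> 'a endo_field" where
  "damped \<rho> t c x = Jt (t * \<rho> (chart_inv c x)) c x"

lemma damped_in:
  assumes "t \<in> I" "0 \<le> r" "r \<le> 1"
  shows "t * r \<in> I"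
proof -
  have "\<bar>t\<bar> * r \<le> \<bar>t\<bar> * 1" using assms by (intro mult_left_mono) auto
  then have "\<bar>t * r\<bar> < e" using assms by (auto simp: abs_mult)
  then show ?thesis by auto
qed

lemma damped_variation:
  assumes \<rho>: "smooth_function A \<rho>" "\<And>p. 0 \<le> \<rho> p" "\<And>p. \<rho> p \<le> 1"
  shows "smooth_variation A J e (damped \<rho>)"
proof -
  have s: "t * \<rho> p \<in> I" if "t \<in> I" for t p by (rule damped_in[OF that \<rho>(2,3)])
  have joint: "smooth_on (I \<times> coord_set c UNIV) (\<lambda>p. damped \<rho> (fst p) c (snd p) v)" if c: "c \<in> A" for c v
  proof -
    let ?S = "I \<times> coord_set c UNIV"
    have oW: "open (coord_set c UNIV)" by (rule open_coord_set[OF c open_UNIV])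
    have o: "open ?S" by (rule open_time_coord[OF c open_UNIV])
    have sr: "smooth_on ?S (\<lambda>p. \<rho> (chart_inv c (snd p)))"
      by (rule smooth_on_compose[OF o oW smooth_on_linear[OF bounded_linear_snd o] smooth_functionD[OF \<rho>(1) c]]) auto
    have i1: "bounded_linear (\<lambda>r :: real. (r, 0 :: real^6))" by (intro bounded_linear_Pair bounded_linear_ident bounded_linear_zero)
    have i2: "bounded_linear (\<lambda>x. (0 :: real, x :: real^6))" by (intro bounded_linear_Pair bounded_linear_ident bounded_linear_zero)
    have "smooth_on ?S (\<lambda>p. (fst p * \<rho> (chart_inv c (snd p)), 0) + (0, snd p))"
      by (rule smooth_on_add[OF o smooth_on_bounded_linear[OF i1 o smooth_on_mult[OF o smooth_on_linear[OF bounded_linear_fst o] sr]]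
        smooth_on_bounded_linear[OF i2 o smooth_on_linear[OF bounded_linear_snd o]]])
    then have m: "smooth_on ?S (\<lambda>p. (fst p * \<rho> (chart_inv c (snd p)), snd p))" by simp
    have "(\<lambda>p. (fst p * \<rho> (chart_inv c (snd p)), snd p)) ` ?S \<subseteq> ?S"
    proof (rule image_subsetI)
      fix p assume "p \<in> ?S"
      then have "fst p \<in> I" "snd p \<in> coord_set c UNIV" by auto
      then show "(fst p * \<rho> (chart_inv c (snd p)), snd p) \<in> ?S" by (intro SigmaI s)
    qed
    from smooth_on_compose[OF o o m smooth_Jt'[OF c] this]
    show ?thesis by (simp add: damped_def)
  qed
  have ac: "almost_complex A (damped \<rho> t)" if t: "t \<in> I" for t
    unfolding almost_complex_def
  proof (intro conjI ballI allI)
    fix c x assume c: "c \<in> A" "x \<in> coord_set c UNIV"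
    show "linear (damped \<rho> t c x)" unfolding damped_def by (rule linear_Jt[OF s[OF t] c])
    show "damped \<rho> t c x (damped \<rho> t c x v) = - v" for v
      unfolding damped_def by (rule almost_complexD(2)[OF almost_complex_Jt[OF s[OF t]] c])
  next
    fix c v assume c: "c \<in> A"
    let ?W = "coord_set c UNIV"
    have oW: "open ?W" by (rule open_coord_set[OF c open_UNIV])
    have i2: "bounded_linear (\<lambda>x. (0 :: real, x :: real^6))" by (intro bounded_linear_Pair bounded_linear_ident bounded_linear_zero)
    have "smooth_on ?W (\<lambda>x. (t, 0) + (0, x))"
      by (rule smooth_on_add[OF oW smooth_on_const[OF oW] smooth_on_linear[OF i2 oW]])
    then have m: "smooth_on ?W (\<lambda>x. (t, x))" by simp
    have "smooth_on ?W (\<lambda>x. damped \<rho> (fst (t, x)) c (snd (t, x)) v)"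
      by (rule smooth_on_compose[where g = "\<lambda>p. damped \<rho> (fst p) c (snd p) v", OF oW open_time_coord[OF c open_UNIV] m joint[OF c]])
        (use t in auto)
    then show "smooth_on ?W (\<lambda>x. damped \<rho> t c x v)" by simp
  next
    fix c c' x v assume c: "c \<in> A" "c' \<in> A" "x \<in> coord_set c (fst c')"
    show "damped \<rho> t c' (transition c c' x) (transition_deriv c c' x v) = transition_deriv c c' x (damped \<rho> t c x v)"
      unfolding damped_def chart_inv_transition[OF c] by (rule almost_complexD(4)[OF almost_complex_Jt[OF s[OF t]] c])
  qed
  moreover have "induces_orientation A (damped \<rho> t)" if t: "t \<in> I" for t
    unfolding induces_orientation_def damped_def
  proof (intro ballI allI)
    fix c x v1 v2 v3 assume c: "c \<in> A" "x \<in> coord_set c UNIV"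
    have "induces_orientation A (Jt (t * \<rho> (chart_inv c x)))"
      using variation s[OF t] unfolding smooth_variation_def by blast
    then show "let D = det (vector [v1, Jt (t * \<rho> (chart_inv c x)) c x v1, v2, Jt (t * \<rho> (chart_inv c x)) c x v2, v3, Jt (t * \<rho> (chart_inv c x)) c x v3] :: real^6^6)
       in D \<noteq> 0 \<longrightarrow> D > 0"
      using c unfolding induces_orientation_def by blast
  qed
  moreover have "damped \<rho> 0 = J" by (intro ext) (simp add: damped_def Jt_0)
  moreover have "smooth_on (I \<times> coord_set c UNIV) (\<lambda>(t, x). damped \<rho> t c x v)" if "c \<in> A" for c v
    using joint[OF that] by (simp add: case_prod_unfold)
  ultimately show ?thesis unfolding smooth_variation_def using e_pos by blast
qed

end

context atlas
begin

lemma EL_imp_critical: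
  assumes M: "compact (UNIV :: 'a set)" and J: "almost_complex A J" and L: "L_partials c1 c2 L'"
    and EL: "\<And>U \<alpha> \<kappa> c x i j vs. coframing A J U \<alpha> \<Longrightarrow> connection02 A J U \<alpha> \<kappa> \<Longrightarrow> c \<in> A \<Longrightarrow> x \<in> coord_set c U \<Longrightarrow>
      el_expr L' J \<alpha> \<kappa> c i j x vs = 0"
  shows "critical_point A c1 c2 J"
  unfolding critical_point_def
proof (intro allI impI)
  fix e Jt assume var: "smooth_variation A J e Jt"
  interpret variation A J e Jt by unfold_locales (rule var)
  have "\<exists>c U \<alpha>. c \<in> A \<and> coframing A J U \<alpha> \<and> p \<in> U \<and> U \<subseteq> fst c" for p
  proof -
    obtain c where c: "c \<in> A" "p \<in> fst c" using chart_cover by blast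
    have "snd c p \<in> coord_set c UNIV" using c(2) by (intro snd_in_coord_set) auto
    from exists_coframing[OF J c(1) this] obtain U \<alpha> where \<alpha>: "coframing A J U \<alpha>" "snd c p \<in> coord_set c U" "U \<subseteq> fst c" by blast
    have "p \<in> U" using chart_inv_in[OF c(1) \<alpha>(2)] chart_inv_left[OF c] by simp
    then show ?thesis using c \<alpha> by blast
  qed
  then obtain ch and U :: "'a \<Rightarrow> 'a set" and \<alpha> where ch: "\<And>p. ch p \<in> A" and \<alpha>: "\<And>p. coframing A J (U p) (\<alpha> p)"
    and U: "\<And>p. p \<in> U p" "\<And>p. U p \<subseteq> fst (ch p)" by metis
  have oU: "open (U p)" for p by (rule coframingD(1)[OF \<alpha>])
  obtain F and \<rho> :: "'a \<Rightarrow> 'a \<Rightarrow> real" where F: "finite F" and \<rho>: "\<And>a. a \<in> F \<Longrightarrow> smooth_function A (\<rho> a)" "\<And>a p. a \<in> F \<Longrightarrow> 0 \<le> \<rho> a p"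
    and supp: "\<And>a. a \<in> F \<Longrightarrow> closure {p. \<rho> a p \<noteq> 0} \<subseteq> U a \<inter> fst (ch a)" and sum1: "\<And>p. (\<Sum>a\<in>F. \<rho> a p) = 1"
    using exists_partition[OF M ch U(1) oU subsetD[OF U(2) U(1)]] by blast
  have \<rho>1: "\<rho> a p \<le> 1" if "a \<in> F" for a p
    using member_le_sum[of a F "\<lambda>a. \<rho> a p"] that F \<rho>(2) sum1[of p] by simp
  have dv: "smooth_variation A J e (damped (\<rho> a))" if "a \<in> F" for a
    by (rule damped_variation[OF \<rho>(1)[OF that] \<rho>(2)[OF that] \<rho>1[OF that]])
  define V where "V a = variation.density_var A (damped (\<rho> a)) c1 c2" for a
  have va: "variation A J e (damped (\<rho> a))" if "a \<in> F" for a
    by unfold_locales (rule dv[OF that])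
  have six: "six_form (V a)" if "a \<in> F" for a
    unfolding V_def by (rule variation.six_form_density_var[OF va[OF that]])
  have zero: "integral_form A (V a) = 0" if a: "a \<in> F" for a
  proof -
    obtain \<kappa> where \<kappa>: "connection02 A J (U a) (\<alpha> a) \<kappa>" using exists_connection[OF J \<alpha>] by blast
    interpret d: first_variation A J e "damped (\<rho> a)" "U a" "\<alpha> a" \<kappa> "ch a" c1 c2 L'
      by unfold_locales (fact dv[OF a] \<alpha> \<kappa> ch L)+
    have out: "damped (\<rho> a) t d y v = J d y v" if "d \<in> A" "y \<in> coord_set d (- closure {p. \<rho> a p \<noteq> 0})" for t d y v
    proof -
      have "\<rho> a (chart_inv d y) = 0" using chart_inv_in[OF that] closure_subset[of "{p. \<rho> a p \<noteq> 0}"] by blast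
      then show ?thesis by (simp add: damped_def Jt_0)
    qed
    have "integral d.W (\<lambda>x. \<Sum>i\<in>UNIV. \<Sum>j\<in>UNIV. d.phi i j x * el_expr L' J (\<alpha> a) \<kappa> (ch a) i j x std_basis) = integral d.W (\<lambda>x. 0)"
      by (rule integral_cong) (simp add: EL[OF \<alpha> \<kappa> ch])
    then show ?thesis
      unfolding V_def using d.integral_density_var[OF M closed_closure supp[OF a] out] by simp
  qed
  have sum: "density_var c1 c2 c x std_basis = (\<Sum>a\<in>F. V a c x std_basis)" if c: "c \<in> A" and x: "x \<in> coord_set c UNIV" for c x
  proof -
    obtain U0 \<beta> where \<beta>: "coframing A J U0 \<beta>" "x \<in> coord_set c U0" using exists_coframing[OF J c x] by blast
    obtain \<kappa> where \<kappa>: "connection02 A J U0 \<beta> \<kappa>" using exists_connection[OF J \<beta>(1)] by blast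
    interpret f: first_variation A J e Jt U0 \<beta> \<kappa> c c1 c2 L'
      by unfold_locales (fact \<beta>(1) \<kappa> c L)+
    have fa: "first_variation A J e (damped (\<rho> a)) U0 \<beta> \<kappa> c c1 c2 L'" if "a \<in> F" for a
      by unfold_locales (fact dv[OF that] \<beta>(1) \<kappa> c L)+
    let ?chi = "\<lambda>a y ws. complex_of_real (\<rho> a (chart_inv c y)) * f.chi y ws"
    have part: "V a c x std_basis = complex_of_real (- 2 * Re (ext_d (?chi a) x std_basis))" if a: "a \<in> F" for a
    proof -
      interpret d: first_variation A J e "damped (\<rho> a)" U0 \<beta> \<kappa> c c1 c2 L' by (rule fa[OF a])
      have J': "d.Jdot y v = \<rho> a (chart_inv c y) *\<^sub>R f.Jdot y v" if y: "y \<in> coord_set c UNIV" for y v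
      proof -
        have "((\<lambda>t. Jt t c y v) has_vector_derivative f.Jdot y v) (at (0 * \<rho> a (chart_inv c y)))" using f.Jdot(1)[OF y] by simp
        moreover have "((\<lambda>t. t * \<rho> a (chart_inv c y)) has_vector_derivative \<rho> a (chart_inv c y)) (at 0)"
          by (auto intro!: derivative_eq_intros simp: has_real_derivative_iff_has_vector_derivative[symmetric])
        ultimately have "((\<lambda>t. damped (\<rho> a) t c y v) has_vector_derivative \<rho> a (chart_inv c y) *\<^sub>R f.Jdot y v) (at 0)"
          using vector_diff_chain_at[of "\<lambda>t. t * \<rho> a (chart_inv c y)" _ 0 "\<lambda>t. Jt t c y v"] by (simp add: o_def damped_def)
        then show ?thesis by (rule vector_derivative_unique_at[OF d.Jdot(1)[OF y]])
      qed
      have "d.phi i k y = complex_of_real (\<rho> a (chart_inv c y)) * f.phi i k y" if y: "y \<in> f.W" for i k y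
        using linear_cmul[OF linear_coframing[OF \<beta>(1) c y]]
        by (simp add: d.phi_def f.phi_def d.frame_def f.frame_def J'[OF coord_set_UNIV[OF y]] scaleR_complex)
      then have chi: "d.chi y ws = ?chi a y ws" if "y \<in> f.W" for y ws
        using that by (simp add: d.chi_def f.chi_def sum_distrib_left mult.assoc)
      have "frechet_derivative (\<lambda>y. d.chi y ws) (at x) = frechet_derivative (\<lambda>y. ?chi a y ws) (at x)" for ws
        by (rule frechet_derivative_cong_open[OF f.open_W \<beta>(2)]) (rule chi)
      then have "ext_d d.chi x std_basis = ext_d (?chi a) x std_basis" by (simp add: ext_d_def)
      then show ?thesis using d.density_var_eq[OF \<beta>(2), of std_basis] by (simp add: V_def EL[OF \<beta>(1) \<kappa> c \<beta>(2)])
    qed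
    have "smooth_on f.W (\<lambda>y. f.chi y ws)" for ws
      unfolding f.chi_def by (intro smooth_on_sum smooth_on_mult f.open_W f.smooth_phi smooth_el_form[OF J \<beta>(1) c L])
    moreover have "smooth_on f.W (\<lambda>y. complex_of_real (\<rho> a (chart_inv c y)))" if "a \<in> F" for a
      by (rule smooth_on_of_real[OF f.open_W smooth_on_subset[OF smooth_functionD[OF \<rho>(1)[OF that] c] coord_set_mono[OF subset_UNIV]]])
    ultimately have "(\<lambda>y. ?chi a y ws) differentiable (at x)" if "a \<in> F" for a ws
      using that by (intro smooth_on_differentiable[OF smooth_on_mult[OF f.open_W] \<beta>(2)])
    then have "(\<Sum>a\<in>F. ext_d (?chi a) x std_basis) = ext_d (\<lambda>y ws. \<Sum>a\<in>F. ?chi a y ws) x std_basis"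
      by (intro ext_d_sum[OF F, symmetric])
    also have "(\<lambda>y ws. \<Sum>a\<in>F. ?chi a y ws) = f.chi"
      by (simp add: sum_distrib_right[symmetric] of_real_sum[symmetric] sum1 fun_eq_iff del: of_real_sum)
    finally have "ext_d f.chi x std_basis = (\<Sum>a\<in>F. ext_d (?chi a) x std_basis)" by simp
    then show ?thesis
      using f.density_var_eq[OF \<beta>(2), of std_basis]
      by (simp add: part EL[OF \<beta>(1) \<kappa> c \<beta>(2)] sum_distrib_left)
  qed
  have "integral_form A (density_var c1 c2) = (\<Sum>a\<in>F. integral_form A (V a))"
    by (rule integral_form_sum[where \<omega> = V and \<eta> = "density_var c1 c2" and I = F, OF M F six sum])
  then have "integral_form A (density_var c1 c2) = 0" by (simp add: zero)
  then show "((\<lambda>t. Ffun A c1 c2 (Jt t)) has_vector_derivative 0) (at 0)"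
    using Ffun_has_derivative[OF M, of c1 c2] by simp
qed

end

theorem theorem2:
  fixes A :: "'a::{t2_space,second_countable_topology} chart set"
    and J :: "'a endo_field"
    and c1 c2 :: real
    and L' :: "complex^3^3 \<Rightarrow> 3 \<Rightarrow> 3 \<Rightarrow> 3 \<Rightarrow> complex"
  assumes "oriented_atlas A"
    and "compact (UNIV :: 'a set)"
    and "almost_complex A J"
    and "induces_orientation A J"
    and "L_partials c1 c2 L'"
  shows "critical_point A c1 c2 J \<longleftrightarrow>
    (\<forall>U \<alpha> \<kappa>. coframing A J U \<alpha> \<and> connection02 A J U \<alpha> \<kappa> \<longrightarrow>
      (\<forall>i j. \<forall>c\<in>A. \<forall>x\<in>coord_set c U. \<forall>vs.
         ext_d (\<lambda>y ws. \<Sum>k\<in>UNIV. L' (Nmat J \<alpha> c y) i j k * dual5 (\<lambda>m. \<alpha> m c y) k ws) x vs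
         - (\<Sum>l\<in>UNIV. \<Sum>k\<in>UNIV. L' (Nmat J \<alpha> c x) l j k *
              (\<kappa> l i c x \<and>\<^sub>e dual5 (\<lambda>m. \<alpha> m c x) k) vs)
         + (\<Sum>l\<in>UNIV. \<Sum>k\<in>UNIV. L' (Nmat J \<alpha> c x) i l k *
              (cnj_form (\<kappa> j l c x) \<and>\<^sub>e dual5 (\<lambda>m. \<alpha> m c x) k) vs) = 0))"
proof -
  interpret atlas A by unfold_locales (rule assms(1))
  have e: "ext_d (\<lambda>y ws. \<Sum>k\<in>UNIV. L' (Nmat J \<alpha> c y) i j k * dual5 (\<lambda>m. \<alpha> m c y) k ws) x vs
         - (\<Sum>l\<in>UNIV. \<Sum>k\<in>UNIV. L' (Nmat J \<alpha> c x) l j k *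
              (\<kappa> l i c x \<and>\<^sub>e dual5 (\<lambda>m. \<alpha> m c x) k) vs)
         + (\<Sum>l\<in>UNIV. \<Sum>k\<in>UNIV. L' (Nmat J \<alpha> c x) i l k *
              (cnj_form (\<kappa> j l c x) \<and>\<^sub>e dual5 (\<lambda>m. \<alpha> m c x) k) vs) = el_expr L' J \<alpha> \<kappa> c i j x vs" for \<alpha> \<kappa> i j c x vs
    by (simp only: el_expr_def el_form_def[abs_def])
  show ?thesis
    unfolding e
  proof
    assume "critical_point A c1 c2 J"
    then show "\<forall>U \<alpha> \<kappa>. coframing A J U \<alpha> \<and> connection02 A J U \<alpha> \<kappa> \<longrightarrow>
      (\<forall>i j. \<forall>c\<in>A. \<forall>x\<in>coord_set c U. \<forall>vs. el_expr L' J \<alpha> \<kappa> c i j x vs = 0)"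
      using critical_imp_EL[OF assms(2-4) _ assms(5)] by blast
  next
    assume EL: "\<forall>U \<alpha> \<kappa>. coframing A J U \<alpha> \<and> connection02 A J U \<alpha> \<kappa> \<longrightarrow>
      (\<forall>i j. \<forall>c\<in>A. \<forall>x\<in>coord_set c U. \<forall>vs. el_expr L' J \<alpha> \<kappa> c i j x vs = 0)"
    show "critical_point A c1 c2 J"
      by (rule EL_imp_critical[OF assms(2,3,5)]) (use EL in blast)
  qed
qed

end
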